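(* Let $\beta\in\mathbb{R}$, $d\in\{1,2,3\}$, $s>d/2$, $R_1>0$, $\varphi_{\mathrm{in}}\in H^{s+4}(\mathbb{R}^d)$ and $0<T<T^*$ satisfy the Hypotheses listed in the context (with some $\delta t_0>0$ and $R_2>0$). Then there exist $\mathscr{C}>0$ and $\delta t_1\in(0,\delta t_0]$ such that for every real-valued $\Upsilon_{-1/2}\in H^{s+4}(\mathbb{R}^d)$ with $\|\Upsilon_{-1/2}\|_{H^{s+4}(\mathbb{R}^d)}\le R_1$, every $\delta t\in(0,\delta t_1)$ and every $n\in\mathbb{N}$ with $n\,\delta t\le T$, $$\|X_n-X(t_n)\|_{(H^s(\mathbb{R}^d))^7}\le \mathscr{C}\left(\big\|\Upsilon_{-1/2}-|\varphi(-\delta t/2,\cdot)|^2\big\|_{H^{s+4}(\mathbb{R}^d)}+\delta t^2\right),$$ where $t_n=n\,\delta t$, $X_n$ is the numerical solution of the (augmented) relaxation scheme and $X(t)$ is the vector built from the exact solution $\varphi$ of the cubic nonlinear Schrödinger equation, both defined in the context.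
   Context: **Equation.** $\varphi$ is the solution of the cubic nonlinear Schrödinger equation $i\partial_t\varphi=-\tfrac12\Delta\varphi+\beta|\varphi|^2\varphi$, $\varphi(0,\cdot)=\varphi_{\mathrm{in}}=:\varphi_0$, on $\mathbb{R}^d$. **Relaxation scheme.** Given $\varphi_0$ and a real-valued $\Upsilon_{-1/2}$, the scheme is, for $n\ge0$, $$\frac{\Upsilon_{n+1/2}+\Upsilon_{n-1/2}}{2}=|\varphi_n|^2,\qquad i\frac{\varphi_{n+1}-\varphi_n}{\delta t}=\Big(-\tfrac12\Delta+\beta\Upsilon_{n+1/2}\Big)\frac{\varphi_{n+1}+\varphi_n}{2}.$$ **Augmented form.** Put $X_n=(\Upsilon_{n-1/2},\Upsilon_{n+1/2},\varphi_{n-1},\varphi_n,\varphi_{n+1},v_{n-1/2},v_{n+1/2})$. The initial vector $X_0$ is computed from $\varphi_0$ and $\Upsilon_{-1/2}$ by $\Upsilon_{1/2}=2|\varphi_0|^2-\Upsilon_{-1/2}$, $\varphi_{-1}=\big(2-i\delta t(-\tfrac12\Delta+\beta\Upsilon_{-1/2})\big)^{-1}\big(2+i\delta t(-\tfrac12\Delta+\beta\Upsilon_{-1/2})\big)\varphi_0$, $\varphi_{1}=\big(2+i\delta t(-\tfrac12\Delta+\beta\Upsilon_{1/2})\big)^{-1}\big(2-i\delta t(-\tfrac12\Delta+\beta\Upsilon_{1/2})\big)\varphi_0$, $v_{-1/2}=(\varphi_0-\varphi_{-1})/\delta t$, $v_{1/2}=(\varphi_1-\varphi_0)/\delta t$.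 The recursion $X_n\mapsto X_{n+1}$ (which shifts the indices and determines $\varphi_{n+2},\Upsilon_{n+3/2},v_{n+3/2}$) is $$X_{n+1}=\mathcal{B}X_n+\delta t\,\mathcal{C}\,\mathcal{M}(X_n,X_{n+1}).$$ Here, with $A=(i+\delta t\Delta/4)^{-1}(i-\delta t\Delta/4)$ and $B=(i+\delta t\Delta/4)^{-1}$ (Fourier multipliers), $\mathcal{B}$ is block diagonal with blocks $$\begin{pmatrix} 0 & I \\ I & 0 \end{pmatrix},\quad\begin{pmatrix} 0 & I & 0 \\ 0 & 0 & I \\ 0 & 0 & A \end{pmatrix},\quad\begin{pmatrix} 0 & I \\ A & A-I \end{pmatrix},$$ $\mathcal{C}=\mathrm{diag}(I,I,B,B,B,B,B)$, and for $X=(x_1,\dots,x_7)$, $Y=(y_1,\dots,y_7)$, $\mathcal{M}(X,Y)=(0,\,2\Xi,\,0,\,0,\,\beta\Phi,\,0,\,2\beta W)$ with $\Xi=2\,\mathrm{Re}\big(x_7\,\overline{\tfrac{x_5+x_4}{2}}\big)$, $\Phi=y_2\,\tfrac{y_5+y_4}{2}$, $W=\tfrac{y_2+x_1}{2}\cdot\tfrac{y_7+2x_7+x_6}{4}+\Xi\cdot\tfrac{y_5+x_5+x_4+x_3}{4}$. (The components of $X_n$ so defined satisfy the relaxation scheme, with $v_{n+1/2}=(\varphi_{n+1}-\varphi_n)/\delta t$.) **Exact vector.** $X(t)=\big(|\varphi(t-\tfrac{\delta t}{2})|^2,\ |\varphi(t+\tfrac{\delta t}{2})|^2,\ \varphi(t-\delta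 t),\ \varphi(t),\ \varphi(t+\delta t),\ \partial_t\varphi(t-\tfrac{\delta t}{2}),\ \partial_t\varphi(t+\tfrac{\delta t}{2})\big)$, each entry being a function of $x\in\mathbb{R}^d$. **Hypotheses.** $d\in\{1,2,3\}$, $s>d/2$, $\varphi_0=\varphi_{\mathrm{in}}\in H^{s+4}(\mathbb{R}^d)$; $T^*>0$ is the (forward) existence time of the maximal $H^{s+4}(\mathbb{R}^d)$-solution $\varphi$ of the Cauchy problem; $0<T<T^*$. There is $\delta t_0>0$ such that $\varphi$ extends to a solution on $(-\delta t_0,T^* )$ with $\tau\mapsto\varphi(\tau,\cdot)$ a smooth map from $(-\delta t_0,T^* )$ to $H^{s+4}(\mathbb{R}^d)$. Moreover there are $R_1,R_2>0$ such that for all real-valued $\Upsilon_{-1/2}\in H^{s+4}(\mathbb{R}^d)$ with $\|\Upsilon_{-1/2}\|_{H^{s+4}}\le R_1$, all $\delta t\in(0,\delta t_0)$ and all $n\in\mathbb{N}$ with $n\,\delta t\le T$, the numerical solution $X_n$ with initial vector $X_0=(\Upsilon_{-1/2},\Upsilon_{1/2},\varphi_{-1},\varphi_0,\varphi_1,v_{-1/2},v_{1/2})$ computed from $\varphi_0$ and $\Upsilon_{-1/2}$ is uniquely determined by the recursion $X_{n+1}=\mathcal{B}X_n+\delta t\,\mathcal{C}\,\mathcal{M}(X_n,X_{n+1})$ and satisfies $\|X_n\|_{(H^{s+2}(\mathbb{R}^d))^7}\le R_2$. *)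

theory Defs
  imports "HOL-Analysis.Analysis" "HOL-Library.Function_Algebras"
begin

text \<open>
  Elements of Lebesgue and Sobolev spaces are represented by Borel functions; the
  mathematical objects are their classes modulo equality almost everywhere, so equations
  between such objects are stated with the relation \<open>ae_eq\<close>.
\<close>

definition ae_eq :: "('a::euclidean_space \<Rightarrow> complex) \<Rightarrow> ('a \<Rightarrow> complex) \<Rightarrow> bool" where
  "ae_eq u v \<longleftrightarrow> (AE x in lborel. u x = v x)"

definition real_valued :: "('a::euclidean_space \<Rightarrow> complex) \<Rightarrow> bool" where
  "real_valued u \<longleftrightarrow> (AE x in lborel. u x \<in> \<real>)"

definition square_integrable :: "('a::euclidean_space \<Rightarrow> complex) \<Rightarrow> bool" where
  "square_integrable u \<longleftrightarrow>
     u \<in> borel_measurable borel \<and> integrable lborel (\<lambda>x. (cmod (u x))\<^sup>2)"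


subsection \<open>Fourier transform and Sobolev spaces\<close>

definition fourier_integral :: "('a::euclidean_space \<Rightarrow> complex) \<Rightarrow> 'a \<Rightarrow> complex" where
  "fourier_integral u \<xi> =
     of_real ((2 * pi) powr (- real DIM('a) / 2)) *
     (LINT x|lborel. exp (- \<i> * of_real (x \<bullet> \<xi>)) * u x)"

text \<open>
  Plancherel extension: \<open>g\<close> is the limit in \<open>L\<^sup>2\<close> of the Fourier integrals of the
  truncations of \<open>u\<close> to balls (which are integrable).
\<close>

definition has_fourier_L2 ::
    "('a::euclidean_space \<Rightarrow> complex) \<Rightarrow> ('a \<Rightarrow> complex) \<Rightarrow> bool" where
  "has_fourier_L2 u g \<longleftrightarrow>
     square_integrable u \<and> square_integrable g \<and>
     (\<lambda>k::nat. \<integral>\<^sup>+ \<xi>. ennreal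
        ((cmod (fourier_integral (\<lambda>x. indicator (cball 0 (real k)) x * u x) \<xi> - g \<xi>))\<^sup>2)
        \<partial>lborel) \<longlonglongrightarrow> 0"

definition fourier_L2 :: "('a::euclidean_space \<Rightarrow> complex) \<Rightarrow> 'a \<Rightarrow> complex" where
  "fourier_L2 u = (SOME g. has_fourier_L2 u g)"

text \<open>
  Only orders \<open>s \<ge> 0\<close> are used, so that the Sobolev spaces are contained in \<open>L\<^sup>2\<close>.
  The value of \<open>sobolev_norm\<close> is meaningful only for elements of \<open>sobolev s\<close>.
\<close>

definition sobolev :: "real \<Rightarrow> ('a::euclidean_space \<Rightarrow> complex) set" where
  "sobolev s = {u. square_integrable u \<and>
     integrable lborel (\<lambda>\<xi>. (1 + (norm \<xi>)\<^sup>2) powr s * (cmod (fourier_L2 u \<xi>))\<^sup>2)}"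

definition sobolev_norm :: "real \<Rightarrow> ('a::euclidean_space \<Rightarrow> complex) \<Rightarrow> real" where
  "sobolev_norm s u =
     sqrt (LINT \<xi>|lborel. (1 + (norm \<xi>)\<^sup>2) powr s * (cmod (fourier_L2 u \<xi>))\<^sup>2)"

definition fourier_multiplier ::
    "('a::euclidean_space \<Rightarrow> complex) \<Rightarrow> ('a \<Rightarrow> complex) \<Rightarrow> 'a \<Rightarrow> complex" where
  "fourier_multiplier m u = (SOME w. has_fourier_L2 w (\<lambda>\<xi>. m \<xi> * fourier_L2 u \<xi>))"

definition laplacian_symbol :: "'a::euclidean_space \<Rightarrow> complex" where
  "laplacian_symbol \<xi> = - of_real ((norm \<xi>)\<^sup>2)"

definition laplacian :: "('a::euclidean_space \<Rightarrow> complex) \<Rightarrow> 'a \<Rightarrow> complex" where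
  "laplacian = fourier_multiplier laplacian_symbol"


subsection \<open>Curves with values in a Sobolev space\<close>

definition sobolev_continuous_on ::
    "real \<Rightarrow> real set \<Rightarrow> (real \<Rightarrow> 'a::euclidean_space \<Rightarrow> complex) \<Rightarrow> bool" where
  "sobolev_continuous_on \<sigma> I u \<longleftrightarrow>
     (\<forall>t\<in>I. u t \<in> sobolev \<sigma> \<and>
        ((\<lambda>\<tau>. sobolev_norm \<sigma> (\<lambda>x. u \<tau> x - u t x)) \<longlongrightarrow> 0) (at t within I))"

definition has_sobolev_derivative ::
    "real \<Rightarrow> (real \<Rightarrow> 'a::euclidean_space \<Rightarrow> complex) \<Rightarrow> ('a \<Rightarrow> complex) \<Rightarrow> real \<Rightarrow> real set \<Rightarrow> bool"
where
  "has_sobolev_derivative \<sigma> u v t I \<longleftrightarrow>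
     u t \<in> sobolev \<sigma> \<and> v \<in> sobolev \<sigma> \<and> (\<forall>\<^sub>F \<tau> in at t within I. u \<tau> \<in> sobolev \<sigma>) \<and>
     ((\<lambda>\<tau>. sobolev_norm \<sigma> (\<lambda>x. (u \<tau> x - u t x) / of_real (\<tau> - t) - v x)) \<longlongrightarrow> 0)
       (at t within I)"

definition sobolev_deriv ::
    "real \<Rightarrow> (real \<Rightarrow> 'a::euclidean_space \<Rightarrow> complex) \<Rightarrow> real \<Rightarrow> 'a \<Rightarrow> complex" where
  "sobolev_deriv \<sigma> u t = (SOME v. has_sobolev_derivative \<sigma> u v t UNIV)"

definition sobolev_smooth_on ::
    "real \<Rightarrow> real set \<Rightarrow> (real \<Rightarrow> 'a::euclidean_space \<Rightarrow> complex) \<Rightarrow> bool" where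
  "sobolev_smooth_on \<sigma> I u \<longleftrightarrow>
     (\<exists>D :: nat \<Rightarrow> real \<Rightarrow> 'a \<Rightarrow> complex. D 0 = u \<and>
        (\<forall>k. \<forall>t\<in>I. has_sobolev_derivative \<sigma> (D k) (D (Suc k) t) t I))"


subsection \<open>The cubic nonlinear Schroedinger equation\<close>

text \<open>
  \<open>H\<^sup>\<sigma>\<close>-solutions on an interval \<open>I\<close>: \<open>C(I; H\<^sup>\<sigma>) \<inter> C\<^sup>1(I; H\<^sup>\<sigma>\<^sup>-\<^sup>2)\<close>; for \<open>\<sigma> > d/2\<close>,
  \<open>\<sigma> \<ge> 2\<close>, continuity of the time derivative follows from the equation.
\<close>

definition nls_solution_on ::
    "real \<Rightarrow> real \<Rightarrow> real set \<Rightarrow> (real \<Rightarrow> 'a::euclidean_space \<Rightarrow> complex) \<Rightarrow> bool" where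
  "nls_solution_on \<beta> \<sigma> I \<phi> \<longleftrightarrow>
     sobolev_continuous_on \<sigma> I \<phi> \<and>
     (\<forall>t\<in>I. \<exists>\<psi>. has_sobolev_derivative (\<sigma> - 2) \<phi> \<psi> t I \<and>
        ae_eq (\<lambda>x. \<i> * \<psi> x)
              (\<lambda>x. - laplacian (\<phi> t) x / 2 + of_real \<beta> * of_real ((cmod (\<phi> t x))\<^sup>2) * \<phi> t x))"

definition maximal_nls_solution ::
    "real \<Rightarrow> real \<Rightarrow> ('a::euclidean_space \<Rightarrow> complex) \<Rightarrow> ereal \<Rightarrow> (real \<Rightarrow> 'a \<Rightarrow> complex) \<Rightarrow> bool" where
  "maximal_nls_solution \<beta> \<sigma> \<phi>\<^sub>0 Tmax \<phi> \<longleftrightarrow>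
     0 < Tmax \<and> ae_eq (\<phi> 0) \<phi>\<^sub>0 \<and>
     nls_solution_on \<beta> \<sigma> {t. 0 \<le> t \<and> ereal t < Tmax} \<phi> \<and>
     \<not> (\<exists>T' \<psi>. Tmax < T' \<and> nls_solution_on \<beta> \<sigma> {t. 0 \<le> t \<and> ereal t < T'} \<psi> \<and>
          (\<forall>t. 0 \<le> t \<and> ereal t < Tmax \<longrightarrow> ae_eq (\<psi> t) (\<phi> t)))"


subsection \<open>Vectors of seven functions\<close>

type_synonym 'a field = "'a \<Rightarrow> complex"
type_synonym 'a state =
  "'a field \<times> 'a field \<times> 'a field \<times> 'a field \<times> 'a field \<times> 'a field \<times> 'a field"

definition components :: "'a state \<Rightarrow> 'a field list" where
  "components = (\<lambda>(x1, x2, x3, x4, x5, x6, x7). [x1, x2, x3, x4, x5, x6, x7])"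

definition state_ae_eq :: "'a::euclidean_space state \<Rightarrow> 'a state \<Rightarrow> bool" where
  "state_ae_eq X Y \<longleftrightarrow> list_all2 ae_eq (components X) (components Y)"

definition state_sobolev :: "real \<Rightarrow> 'a::euclidean_space state set" where
  "state_sobolev s = {X. \<forall>u\<in>set (components X). u \<in> sobolev s}"

definition state_norm :: "real \<Rightarrow> 'a::euclidean_space state \<Rightarrow> real" where
  "state_norm s X = sqrt (\<Sum>u\<leftarrow>components X. (sobolev_norm s u)\<^sup>2)"

definition scale_state :: "real \<Rightarrow> 'a state \<Rightarrow> 'a state" where
  "scale_state c = (\<lambda>(x1, x2, x3, x4, x5, x6, x7).
     ((\<lambda>x. of_real c * x1 x), (\<lambda>x. of_real c * x2 x), (\<lambda>x. of_real c * x3 x),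
      (\<lambda>x. of_real c * x4 x), (\<lambda>x. of_real c * x5 x), (\<lambda>x. of_real c * x6 x),
      (\<lambda>x. of_real c * x7 x)))"


subsection \<open>The augmented relaxation scheme\<close>

definition opA :: "real \<Rightarrow> 'a::euclidean_space field \<Rightarrow> 'a field" where
  "opA dt = fourier_multiplier
     (\<lambda>\<xi>. (\<i> - of_real dt * laplacian_symbol \<xi> / 4) / (\<i> + of_real dt * laplacian_symbol \<xi> / 4))"

definition opB :: "real \<Rightarrow> 'a::euclidean_space field \<Rightarrow> 'a field" where
  "opB dt = fourier_multiplier (\<lambda>\<xi>. 1 / (\<i> + of_real dt * laplacian_symbol \<xi> / 4))"

definition calB :: "real \<Rightarrow> 'a::euclidean_space state \<Rightarrow> 'a state" where
  "calB dt = (\<lambda>(x1, x2, x3, x4, x5, x6, x7).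
     (x2, x1,
      x4, x5, opA dt x5,
      x7, (\<lambda>x. opA dt x6 x + (opA dt x7 x - x7 x))))"

definition calC :: "real \<Rightarrow> 'a::euclidean_space state \<Rightarrow> 'a state" where
  "calC dt = (\<lambda>(x1, x2, x3, x4, x5, x6, x7).
     (x1, x2, opB dt x3, opB dt x4, opB dt x5, opB dt x6, opB dt x7))"

definition calM :: "real \<Rightarrow> 'a state \<Rightarrow> 'a state \<Rightarrow> 'a state" where
  "calM \<beta> = (\<lambda>(x1, x2, x3, x4, x5, x6, x7) (y1, y2, y3, y4, y5, y6, y7).
     let \<Xi> = (\<lambda>x. of_real (2 * Re (x7 x * cnj ((x5 x + x4 x) / 2))));
         \<Phi> = (\<lambda>x. y2 x * ((y5 x + y4 x) / 2));
         W = (\<lambda>x. (y2 x + x1 x) / 2 * ((y7 x + 2 * x7 x + x6 x) / 4)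
                  + \<Xi> x * ((y5 x + x5 x + x4 x + x3 x) / 4))
     in ((\<lambda>x. 0), (\<lambda>x. 2 * \<Xi> x), (\<lambda>x. 0), (\<lambda>x. 0), (\<lambda>x. of_real \<beta> * \<Phi> x),
         (\<lambda>x. 0), (\<lambda>x. 2 * of_real \<beta> * W x)))"

text \<open>
  \<open>cayley \<beta> V c \<phi>\<close> is \<open>(2 + \<i> c (- \<Delta>/2 + \<beta> V))\<^sup>-\<^sup>1 (2 - \<i> c (- \<Delta>/2 + \<beta> V)) \<phi>\<close>, the operator
  \<open>- \<Delta>/2 + \<beta> V\<close> having domain \<open>H\<^sup>2\<close> in \<open>L\<^sup>2\<close>; the inverse exists for real bounded \<open>V\<close>.
\<close>

definition hamiltonian ::
    "real \<Rightarrow> 'a::euclidean_space field \<Rightarrow> 'a field \<Rightarrow> 'a field" where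
  "hamiltonian \<beta> V u = (\<lambda>x. - laplacian u x / 2 + of_real \<beta> * V x * u x)"

definition cayley ::
    "real \<Rightarrow> 'a::euclidean_space field \<Rightarrow> real \<Rightarrow> 'a field \<Rightarrow> 'a field" where
  "cayley \<beta> V c \<phi> = (SOME w. w \<in> sobolev 2 \<and>
     ae_eq (\<lambda>x. 2 * w x + \<i> * of_real c * hamiltonian \<beta> V w x)
           (\<lambda>x. 2 * \<phi> x - \<i> * of_real c * hamiltonian \<beta> V \<phi> x))"

definition initial_state ::
    "real \<Rightarrow> real \<Rightarrow> 'a::euclidean_space field \<Rightarrow> 'a field \<Rightarrow> 'a state" where
  "initial_state \<beta> dt \<phi>\<^sub>0 Y =
     (let Y' = (\<lambda>x. 2 * of_real ((cmod (\<phi>\<^sub>0 x))\<^sup>2) - Y x);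
          \<phi>m = cayley \<beta> Y (- dt) \<phi>\<^sub>0;
          \<phi>p = cayley \<beta> Y' dt \<phi>\<^sub>0
      in (Y, Y', \<phi>m, \<phi>\<^sub>0, \<phi>p,
          (\<lambda>x. (\<phi>\<^sub>0 x - \<phi>m x) / of_real dt), (\<lambda>x. (\<phi>p x - \<phi>\<^sub>0 x) / of_real dt)))"

text \<open>
  \<open>numerical_solution s \<beta> dt \<phi>\<^sub>0 Y N X\<close>: the states \<open>X 0, \<dots>, X N\<close> lie in the seventh power
  of \<open>H\<^sup>s\<close> and solve the (implicit) recursion started at the initial state.
\<close>

definition numerical_solution ::
    "real \<Rightarrow> real \<Rightarrow> real \<Rightarrow> 'a::euclidean_space field \<Rightarrow> 'a field \<Rightarrow> nat \<Rightarrow> (nat \<Rightarrow> 'a state) \<Rightarrow> bool"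
where
  "numerical_solution s \<beta> dt \<phi>\<^sub>0 Y N X \<longleftrightarrow>
     (\<forall>n\<le>N. X n \<in> state_sobolev s) \<and>
     state_ae_eq (X 0) (initial_state \<beta> dt \<phi>\<^sub>0 Y) \<and>
     (\<forall>n<N. state_ae_eq (X (Suc n))
        (calB dt (X n) + scale_state dt (calC dt (calM \<beta> (X n) (X (Suc n))))))"

definition exact_state ::
    "real \<Rightarrow> real \<Rightarrow> (real \<Rightarrow> 'a::euclidean_space field) \<Rightarrow> real \<Rightarrow> 'a state" where
  "exact_state \<sigma> dt \<phi> t =
     ((\<lambda>x. of_real ((cmod (\<phi> (t - dt / 2) x))\<^sup>2)),
      (\<lambda>x. of_real ((cmod (\<phi> (t + dt / 2) x))\<^sup>2)),
      \<phi> (t - dt), \<phi> t, \<phi> (t + dt),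
      sobolev_deriv \<sigma> \<phi> (t - dt / 2), sobolev_deriv \<sigma> \<phi> (t + dt / 2))"

end

theory Submission
  imports Defs "HOL-Probability.Characteristic_Functions"
begin

text \<open>
  The scheme and the exact flow satisfy the same recursion up to a residual of size
  \<open>O(dt\<^sup>2)\<close> per unit of time: all exact values are evaluated at points symmetric about a
  midpoint, and for the increments one subtracts the equation at two times, so that neither
  the scheme nor the equation has to be differentiated. Multiplying a step by
  \<open>\<i> + dt \<Delta> / 4\<close> turns it into \<open>(\<i> + dt \<Delta> / 4) y = (\<i> - dt \<Delta> / 4) x + dt r\<close>, which is an isometry
  perturbed by \<open>dt r\<close>. The block of the increments is not power bounded, but in the variables
  \<open>\<alpha> = (\<i> + dt \<Delta> / 4)(x\<^sub>6 + x\<^sub>7)\<close> and \<open>\<gamma> = (\<i> + dt \<Delta> / 4) x\<^sub>7 - (\<i> - dt \<Delta> / 4) x\<^sub>6\<close> it becomes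
  \<open>\<alpha> \<mapsto> A \<alpha> + dt r\<close>, \<open>\<gamma> \<mapsto> - \<gamma> + dt r\<close>; this costs two derivatives, at the initial time only.
  As \<open>H\<^sup>s\<close> is an algebra, the nonlinear terms are Lipschitz on bounded sets, and a discrete
  Gronwall argument concludes. The Sobolev calculus rests on Plancherel's theorem, obtained
  from the Gaussian and the continuity of translations in \<open>L\<^sup>2\<close>.
\<close>

subsection \<open>Square-integrable functions\<close>

text \<open>Four derivatives are spent in two pairs. Comparing \<open>err\<close> with plain norms
  at time zero takes one pair, so the initial error has to be small in H^(s+2). The Crank-Nicolson
  residual estimated in that space contains the Laplacian of a Taylor remainder of the solution,
  which takes the other pair and leads to H^(s+4). The obstacle at time zero is the division by
  \<open>dt\<close> in the increments: the errors of \<phi>_1 and \<phi>_(-1) must carry a factor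
  \<open>dt\<close> of their own. They do, because the difference between a Cayley step and the
  exact flow solves an equation whose right side is \<open>dt\<close> times small terms. The scheme
  is implicit, so the Lipschitz bounds involve the error at both ends of a step; absorbing the newer
  one, solving the two Cayley equations and staying in the time interval of the exact solution are
  the reasons for restricting \<open>dt\<close>. Multipliers, Cayley transforms and derivatives are
  selected by \<open>SOME\<close> among functions, not classes. Identities between them hold almost
  everywhere only, and measurability has to be carried along.\<close>

definition l2norm :: "('a::euclidean_space \<Rightarrow> complex) \<Rightarrow> real" where
  "l2norm f = sqrt (LINT x|lborel. (cmod (f x))\<^sup>2)"

text \<open>Bilinear, without conjugation: Fubini makes the Fourier transform symmetric for this
  pairing. The Hermitian inner product is recovered by conjugating the second function.\<close>

definition l2pair :: "('a::euclidean_space \<Rightarrow> complex) \<Rightarrow> ('a \<Rightarrow> complex) \<Rightarrow> complex" where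
  "l2pair f g = (LINT x|lborel. f x * g x)"

lemma square_integrable_measurable: "square_integrable f \<Longrightarrow> f \<in> borel_measurable borel"
  by (simp add: square_integrable_def)

lemma square_integrable_iff_nn:
  "square_integrable f \<longleftrightarrow> f \<in> borel_measurable borel \<and> (\<integral>\<^sup>+x. ennreal ((cmod (f x))\<^sup>2) \<partial>lborel) < \<infinity>"
  by (auto simp: square_integrable_def integrable_iff_bounded)

lemma l2norm_nonneg [simp]: "0 \<le> l2norm f"
  by (simp add: l2norm_def)

lemma l2norm_sq: "(l2norm f)\<^sup>2 = (LINT x|lborel. (cmod (f x))\<^sup>2)"
  by (simp add: l2norm_def)

lemma nn_integral_cmod_sq:
  assumes "square_integrable f"
  shows "(\<integral>\<^sup>+x. ennreal ((cmod (f x))\<^sup>2) \<partial>lborel) = ennreal ((l2norm f)\<^sup>2)"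
  unfolding l2norm_sq using assms
  by (subst nn_integral_eq_integral) (auto simp: square_integrable_def)

lemma l2norm_le_nn:
  assumes "f \<in> borel_measurable borel" "(\<integral>\<^sup>+x. ennreal ((cmod (f x))\<^sup>2) \<partial>lborel) \<le> ennreal (c\<^sup>2)" "0 \<le> c"
  shows "square_integrable f" "l2norm f \<le> c"
proof -
  show s: "square_integrable f"
    using assms by (auto simp: square_integrable_iff_nn intro: le_less_trans)
  show "l2norm f \<le> c"
    using assms nn_integral_cmod_sq[OF s] by (simp add: power2_le_iff_abs_le)
qed

text \<open>Domination by a constant multiple; in this form pointwise bounds on Fourier symbols
  become operator bounds.\<close>

lemma square_integrable_bound:
  assumes "square_integrable f" "g \<in> borel_measurable borel" "AE x in lborel. cmod (g x) \<le> C * cmod (f x)"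
    "0 \<le> C"
  shows "square_integrable g" "l2norm g \<le> C * l2norm f"
proof -
  have "(\<integral>\<^sup>+x. ennreal ((cmod (g x))\<^sup>2) \<partial>lborel) \<le> (\<integral>\<^sup>+x. ennreal (C\<^sup>2) * ennreal ((cmod (f x))\<^sup>2) \<partial>lborel)"
  proof (rule nn_integral_mono_AE)
    show "AE x in lborel. ennreal ((cmod (g x))\<^sup>2) \<le> ennreal (C\<^sup>2) * ennreal ((cmod (f x))\<^sup>2)"
      using assms(3)
    proof eventually_elim
      case (elim x)
      have "(cmod (g x))\<^sup>2 \<le> C\<^sup>2 * (cmod (f x))\<^sup>2"
        using power_mono[OF elim norm_ge_zero, of 2] by (simp add: power_mult_distrib)
      then show ?case
        by (simp add: ennreal_mult[symmetric] ennreal_leI)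
    qed
  qed
  also have "\<dots> = ennreal (C\<^sup>2) * (\<integral>\<^sup>+x. ennreal ((cmod (f x))\<^sup>2) \<partial>lborel)"
    using square_integrable_measurable[OF assms(1)] by (intro nn_integral_cmult) auto
  also have "\<dots> = ennreal ((C * l2norm f)\<^sup>2)"
    by (simp add: nn_integral_cmod_sq[OF assms(1)] ennreal_mult[symmetric] power_mult_distrib)
  finally have *: "(\<integral>\<^sup>+x. ennreal ((cmod (g x))\<^sup>2) \<partial>lborel) \<le> ennreal ((C * l2norm f)\<^sup>2)" .
  show "square_integrable g" "l2norm g \<le> C * l2norm f"
    using l2norm_le_nn[OF assms(2) *] assms(4) by auto
qed

lemma l2norm_cong:
  assumes "AE x in lborel. cmod (f x) = cmod (g x)" "f \<in> borel_measurable borel" "g \<in> borel_measurable borel"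
  shows "l2norm f = l2norm g"
proof -
  have "(LINT x|lborel. (cmod (f x))\<^sup>2) = (LINT x|lborel. (cmod (g x))\<^sup>2)"
    by (rule integral_cong_AE) (use assms in auto)
  then show ?thesis by (simp add: l2norm_def)
qed

lemma square_integrable_cmult:
  assumes "square_integrable f" shows "square_integrable (\<lambda>x. c * f x)"
  by (rule square_integrable_bound(1)[OF assms, of _ "cmod c"])
     (use square_integrable_measurable[OF assms] in \<open>auto simp: norm_mult\<close>)

lemma l2norm_cmult: "l2norm (\<lambda>x. c * f x) = cmod c * l2norm f"
  by (simp add: l2norm_def norm_mult power_mult_distrib real_sqrt_mult)

lemma l2norm_uminus: "l2norm (\<lambda>x. - f x) = l2norm f"
  by (simp add: l2norm_def)

lemma l2norm_minus_commute: "l2norm (\<lambda>x. f x - g x) = l2norm (\<lambda>x. g x - f x)"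
  by (simp add: l2norm_def norm_minus_commute)

lemma square_integrable_zero [simp]: "square_integrable (\<lambda>x. 0)"
  by (simp add: square_integrable_def)

lemma measurable_cnj [measurable]:
  "f \<in> borel_measurable M \<Longrightarrow> (\<lambda>x. cnj (f x)) \<in> borel_measurable M"
  by (rule borel_measurable_continuous_on[OF continuous_on_cnj[OF continuous_on_id], of f M, simplified])

lemma square_integrable_cnj [simp]: "square_integrable f \<Longrightarrow> square_integrable (\<lambda>x. cnj (f x))"
  unfolding square_integrable_def using measurable_cnj[of f borel] by simp

lemma l2norm_cnj [simp]: "l2norm (\<lambda>x. cnj (f x)) = l2norm f"
  by (simp add: l2norm_def)

lemma square_integrable_mult_integrable:
  assumes "square_integrable f" "square_integrable g"
  shows "integrable lborel (\<lambda>x. f x * g x)"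
proof (rule Bochner_Integration.integrable_bound)
  show "integrable lborel (\<lambda>x. (cmod (f x))\<^sup>2 + (cmod (g x))\<^sup>2)"
    using assms by (auto simp: square_integrable_def)
  show "(\<lambda>x. f x * g x) \<in> borel_measurable lborel"
    using assms[THEN square_integrable_measurable] by simp
  have "cmod (f x * g x) \<le> (cmod (f x))\<^sup>2 + (cmod (g x))\<^sup>2" for x
    using sum_squares_bound[of "cmod (f x)" "cmod (g x)"]
      mult_nonneg_nonneg[OF norm_ge_zero norm_ge_zero, of "f x" "g x"]
    unfolding norm_mult by linarith
  then show "AE x in lborel. norm (f x * g x) \<le> norm ((cmod (f x))\<^sup>2 + (cmod (g x))\<^sup>2)"
    by (simp add: order_trans[OF _ abs_ge_self])
qed

text \<open>Cauchy-Schwarz for the product of moduli, without assuming integrability beforehand. It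
  bounds \<open>l2pair\<close>, and later the L1 norm of a Fourier transform by a Sobolev
  norm.\<close>

lemma nn_integral_mult_le_l2norm:
  assumes "square_integrable f" "square_integrable g"
  shows "(\<integral>\<^sup>+x. ennreal (cmod (f x) * cmod (g x)) \<partial>lborel) \<le> ennreal (l2norm f * l2norm g)"
proof -
  have [measurable]: "f \<in> borel_measurable borel" "g \<in> borel_measurable borel"
    using assms[THEN square_integrable_measurable] by simp_all
  let ?I = "\<integral>\<^sup>+x. ennreal (cmod (f x) * cmod (g x)) \<partial>lborel"
  have "?I\<^sup>2 \<le> ennreal ((l2norm f)\<^sup>2) * ennreal ((l2norm g)\<^sup>2)"
    using Cauchy_Schwarz_nn_integral[of "\<lambda>x. ennreal (cmod (f x))" lborel "\<lambda>x. ennreal (cmod (g x))"]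
    by (simp add: ennreal_mult[symmetric] ennreal_power nn_integral_cmod_sq[OF assms(1)] nn_integral_cmod_sq[OF assms(2)])
  also have "\<dots> = (ennreal (l2norm f * l2norm g))\<^sup>2"
    by (simp add: ennreal_mult[symmetric] ennreal_power power_mult_distrib)
  finally have *: "?I\<^sup>2 \<le> (ennreal (l2norm f * l2norm g))\<^sup>2" .
  show ?thesis
  proof (cases ?I)
    case (real a)
    then have "a\<^sup>2 \<le> (l2norm f * l2norm g)\<^sup>2"
      using * by (simp add: ennreal_power)
    then have "a \<le> l2norm f * l2norm g" by (rule power2_le_imp_le) simp
    then show ?thesis using real by (simp add: ennreal_leI)
  next
    \<comment> \<open>An infinite integral is excluded, since its square is bounded by a finite
      number.\<close>
    case top
    then show ?thesis using * by (simp add: ennreal_power top_unique)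
  qed
qed

lemma l2pair_le:
  assumes "square_integrable f" "square_integrable g"
  shows "cmod (l2pair f g) \<le> l2norm f * l2norm g"
proof -
  have "ennreal (cmod (l2pair f g)) \<le> (\<integral>\<^sup>+x. ennreal (norm (f x * g x)) \<partial>lborel)"
    unfolding l2pair_def
    using integral_norm_bound_ennreal[OF square_integrable_mult_integrable[OF assms]] by simp
  also have "\<dots> \<le> ennreal (l2norm f * l2norm g)"
    using nn_integral_mult_le_l2norm[OF assms] by (simp add: norm_mult)
  finally show ?thesis by (simp add: ennreal_le_iff)
qed

lemma square_integrable_add:
  assumes "square_integrable f" "square_integrable g"
  shows "square_integrable (\<lambda>x. f x + g x)"
proof -
  have [measurable]: "f \<in> borel_measurable borel" "g \<in> borel_measurable borel"
    using assms[THEN square_integrable_measurable] by simp_all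
  have "integrable lborel (\<lambda>x. (cmod (f x + g x))\<^sup>2)"
  proof (rule Bochner_Integration.integrable_bound)
    show "integrable lborel (\<lambda>x. 2 * (cmod (f x))\<^sup>2 + 2 * (cmod (g x))\<^sup>2)"
      using assms by (auto simp: square_integrable_def)
    have "(cmod (f x + g x))\<^sup>2 \<le> 2 * (cmod (f x))\<^sup>2 + 2 * (cmod (g x))\<^sup>2" for x
      using power_mono[OF norm_triangle_ineq norm_ge_zero, of "f x" "g x" 2]
        sum_squares_bound[of "cmod (f x)" "cmod (g x)"]
      by (simp add: power2_sum)
    then show "AE x in lborel. norm ((cmod (f x + g x))\<^sup>2) \<le> norm (2 * (cmod (f x))\<^sup>2 + 2 * (cmod (g x))\<^sup>2)"
      by simp
  qed simp
  then show ?thesis by (simp add: square_integrable_def)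
qed

lemma square_integrable_diff:
  assumes "square_integrable f" "square_integrable g"
  shows "square_integrable (\<lambda>x. f x - g x)"
  using square_integrable_add[OF assms(1) square_integrable_cmult[OF assms(2), of "-1"]] by simp

section \<open>The inner product of L2 and the triangle inequality\<close>

lemma l2norm_sq_pair: "complex_of_real ((l2norm f)\<^sup>2) = l2pair f (\<lambda>x. cnj (f x))"
  unfolding l2norm_sq l2pair_def integral_complex_of_real[symmetric]
  by (simp only: complex_norm_square)

lemma l2pair_commute: "l2pair f g = l2pair g f"
  by (simp add: l2pair_def mult.commute)

lemma l2pair_cnj: "l2pair (\<lambda>x. cnj (f x)) (\<lambda>x. cnj (g x)) = cnj (l2pair f g)"
  unfolding l2pair_def by (simp flip: complex_cnj_mult)

lemma l2pair_add_left:
  assumes "square_integrable f" "square_integrable g" "square_integrable h"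
  shows "l2pair (\<lambda>x. f x + g x) h = l2pair f h + l2pair g h"
  unfolding l2pair_def
  by (simp add: distrib_right square_integrable_mult_integrable assms)

lemma l2pair_diff_left:
  assumes "square_integrable f" "square_integrable g" "square_integrable h"
  shows "l2pair (\<lambda>x. f x - g x) h = l2pair f h - l2pair g h"
  unfolding l2pair_def
  by (simp add: left_diff_distrib square_integrable_mult_integrable assms)

lemma l2pair_diff_right:
  assumes "square_integrable f" "square_integrable g" "square_integrable h"
  shows "l2pair h (\<lambda>x. f x - g x) = l2pair h f - l2pair h g"
  using l2pair_diff_left[OF assms] by (simp add: l2pair_commute)

text \<open>Expansion of the square through the pairing. Besides the triangle inequality it serves
  Fourier inversion, where the cross term equals the square of the common norm and the difference
  vanishes.\<close>

lemma l2norm_diff_sq: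
  assumes "square_integrable f" "square_integrable g"
  shows "(l2norm (\<lambda>x. f x - g x))\<^sup>2 = (l2norm f)\<^sup>2 + (l2norm g)\<^sup>2 - 2 * Re (l2pair f (\<lambda>x. cnj (g x)))"
proof -
  have "complex_of_real ((l2norm (\<lambda>x. f x - g x))\<^sup>2)
      = l2pair f (\<lambda>x. cnj (f x)) - l2pair f (\<lambda>x. cnj (g x))
        - (l2pair g (\<lambda>x. cnj (f x)) - l2pair g (\<lambda>x. cnj (g x)))"
    unfolding l2norm_sq_pair complex_cnj_diff using assms
    by (simp add: l2pair_diff_left l2pair_diff_right square_integrable_diff)
  also have "l2pair g (\<lambda>x. cnj (f x)) = cnj (l2pair f (\<lambda>x. cnj (g x)))"
    using l2pair_cnj[of f "\<lambda>x. cnj (g x)"] by (simp add: l2pair_commute)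
  finally have "complex_of_real ((l2norm (\<lambda>x. f x - g x))\<^sup>2)
     = complex_of_real ((l2norm f)\<^sup>2) + complex_of_real ((l2norm g)\<^sup>2)
        - (l2pair f (\<lambda>x. cnj (g x)) + cnj (l2pair f (\<lambda>x. cnj (g x))))"
    unfolding l2norm_sq_pair by simp
  then have "Re (complex_of_real ((l2norm (\<lambda>x. f x - g x))\<^sup>2)) = Re (complex_of_real ((l2norm f)\<^sup>2) + complex_of_real ((l2norm g)\<^sup>2)
        - (l2pair f (\<lambda>x. cnj (g x)) + cnj (l2pair f (\<lambda>x. cnj (g x)))))" by (rule arg_cong)
  then show ?thesis
    unfolding plus_complex.sel minus_complex.sel Re_complex_of_real complex_cnj(1) by simp
qed

lemma l2norm_triangle:
  assumes "square_integrable f" "square_integrable g"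
  shows "l2norm (\<lambda>x. f x + g x) \<le> l2norm f + l2norm g"
proof -
  have sg: "square_integrable (\<lambda>x. - g x)"
    using square_integrable_cmult[OF assms(2), of "-1"] by simp
  have "(l2norm (\<lambda>x. f x + g x))\<^sup>2 = (l2norm f)\<^sup>2 + (l2norm g)\<^sup>2 - 2 * Re (l2pair f (\<lambda>x. cnj (- g x)))"
    using l2norm_diff_sq[OF assms(1) sg] by (simp add: l2norm_uminus)
  moreover have "- Re (l2pair f (\<lambda>x. cnj (- g x))) \<le> l2norm f * l2norm g"
    using l2pair_le[OF assms(1) square_integrable_cnj[OF sg]]
      abs_Re_le_cmod[of "l2pair f (\<lambda>x. cnj (- g x))"] by (simp add: l2norm_uminus)
  ultimately have "(l2norm (\<lambda>x. f x + g x))\<^sup>2 \<le> (l2norm f + l2norm g)\<^sup>2"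
    by (simp add: power2_sum)
  then show ?thesis by (rule power2_le_imp_le) simp
qed

lemma l2norm_triangle_diff:
  assumes "square_integrable f" "square_integrable g" "square_integrable h"
  shows "l2norm (\<lambda>x. f x - h x) \<le> l2norm (\<lambda>x. f x - g x) + l2norm (\<lambda>x. g x - h x)"
  using l2norm_triangle[OF square_integrable_diff[OF assms(1,2)] square_integrable_diff[OF assms(2,3)]]
  by simp

lemma l2norm_abs_diff_le:
  assumes "square_integrable f" "square_integrable g"
  shows "\<bar>l2norm f - l2norm g\<bar> \<le> l2norm (\<lambda>x. f x - g x)"
  using l2norm_triangle_diff[OF assms(1,2) square_integrable_zero]
    l2norm_triangle_diff[OF assms(2,1) square_integrable_zero] l2norm_minus_commute[of f g]
  by simp

lemma l2norm_eq_0_iff: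
  assumes "square_integrable f"
  shows "l2norm f = 0 \<longleftrightarrow> (AE x in lborel. f x = 0)"
proof -
  have "l2norm f = 0 \<longleftrightarrow> (LINT x|lborel. (cmod (f x))\<^sup>2) = 0"
    by (simp add: l2norm_def)
  also have "\<dots> \<longleftrightarrow> (AE x in lborel. (cmod (f x))\<^sup>2 = 0)"
    using assms by (intro integral_nonneg_eq_0_iff_AE) (auto simp: square_integrable_def)
  finally show ?thesis by simp
qed

lemma l2norm_limit_unique:
  assumes "\<And>k. square_integrable (f k)" "square_integrable g" "square_integrable h"
    and "(\<lambda>k. l2norm (\<lambda>x. f k x - g x)) \<longlonglongrightarrow> 0" "(\<lambda>k. l2norm (\<lambda>x. f k x - h x)) \<longlonglongrightarrow> 0"
  shows "ae_eq g h"
proof -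
  have "(\<lambda>k::nat. l2norm (\<lambda>x. g x - h x)) \<longlonglongrightarrow> 0"
  proof (rule tendsto_sandwich[OF _ _ tendsto_const])
    show "(\<lambda>k. l2norm (\<lambda>x. f k x - g x) + l2norm (\<lambda>x. f k x - h x)) \<longlonglongrightarrow> 0"
      using tendsto_add[OF assms(4,5)] by simp
    show "\<forall>\<^sub>F k in sequentially. l2norm (\<lambda>x. g x - h x) \<le> l2norm (\<lambda>x. f k x - g x) + l2norm (\<lambda>x. f k x - h x)"
      using l2norm_triangle_diff[OF assms(2,1,3)] by (simp add: l2norm_minus_commute[of g])
  qed simp
  then have "l2norm (\<lambda>x. g x - h x) = 0"
    by (simp add: LIMSEQ_const_iff)
  then show ?thesis
    using l2norm_eq_0_iff[OF square_integrable_diff[OF assms(2,3)]] by (simp add: ae_eq_def)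
qed

lemma l2norm_tendsto:
  assumes "\<And>k. square_integrable (f k)" "square_integrable g" "(\<lambda>k. l2norm (\<lambda>x. f k x - g x)) \<longlonglongrightarrow> 0"
  shows "(\<lambda>k. l2norm (f k)) \<longlonglongrightarrow> l2norm g"
proof -
  have "(\<lambda>k. l2norm (f k) - l2norm g) \<longlonglongrightarrow> 0"
    by (rule Lim_null_comparison[OF _ assms(3)]) (simp add: l2norm_abs_diff_le assms)
  then show ?thesis by (rule LIM_zero_cancel)
qed

lemma l2pair_tendsto:
  assumes f: "\<And>k. square_integrable (f k)" "square_integrable f'" "(\<lambda>k. l2norm (\<lambda>x. f k x - f' x)) \<longlonglongrightarrow> 0"
    and g: "\<And>k. square_integrable (g k)" "square_integrable g'" "(\<lambda>k. l2norm (\<lambda>x. g k x - g' x)) \<longlonglongrightarrow> 0"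
  shows "(\<lambda>k. l2pair (f k) (g k)) \<longlonglongrightarrow> l2pair f' g'"
proof -
  have "(\<lambda>k. l2pair (f k) (g k) - l2pair f' g') \<longlonglongrightarrow> 0"
  proof (rule Lim_null_comparison)
    show "\<forall>\<^sub>F k in sequentially. norm (l2pair (f k) (g k) - l2pair f' g')
        \<le> l2norm (\<lambda>x. f k x - f' x) * l2norm (g k) + l2norm f' * l2norm (\<lambda>x. g k x - g' x)"
    proof (intro always_eventually allI)
      fix k
      have eq: "l2pair (f k) (g k) - l2pair f' g' = l2pair (\<lambda>x. f k x - f' x) (g k) + l2pair f' (\<lambda>x. g k x - g' x)"
        using f g by (simp add: l2pair_diff_left l2pair_diff_right)
      show "norm (l2pair (f k) (g k) - l2pair f' g')
        \<le> l2norm (\<lambda>x. f k x - f' x) * l2norm (g k) + l2norm f' * l2norm (\<lambda>x. g k x - g' x)"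
        unfolding eq
        by (intro order_trans[OF norm_triangle_ineq] add_mono l2pair_le square_integrable_diff f g)
    qed
    show "(\<lambda>k. l2norm (\<lambda>x. f k x - f' x) * l2norm (g k) + l2norm f' * l2norm (\<lambda>x. g k x - g' x)) \<longlonglongrightarrow> 0"
      using tendsto_add[OF tendsto_mult[OF f(3) l2norm_tendsto[OF g]] tendsto_mult[OF tendsto_const g(3)]]
      by simp
  qed
  then show ?thesis by (rule LIM_zero_cancel)
qed

text \<open>Riesz-Fischer. A rapidly converging subsequence has square-summable increments even
  after weighting with 4^k, so almost everywhere the increments decay like 2^(-k) and the
  subsequence converges. Fatou's lemma then controls the distance of the whole sequence from the
  limit.\<close>

theorem l2_complete:
  fixes f :: "nat \<Rightarrow> 'a::euclidean_space \<Rightarrow> complex"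
  assumes f: "\<And>k. square_integrable (f k)"
    and cauchy: "\<And>e. e > 0 \<Longrightarrow> \<exists>N. \<forall>m\<ge>N. \<forall>n\<ge>N. l2norm (\<lambda>x. f m x - f n x) < e"
  shows "\<exists>g. square_integrable g \<and> (\<lambda>k. l2norm (\<lambda>x. f k x - g x)) \<longlonglongrightarrow> 0"
proof -
  have [measurable]: "f k \<in> borel_measurable borel" for k
    using square_integrable_measurable[OF f] .
  \<comment> \<open>The tolerance (1/4)^k leaves room for the weight 4^k: the k-th weighted square
    has integral at most 4^k times 16^(-k), that is 4^(-k).\<close>
  define ok where "ok k N \<longleftrightarrow> (\<forall>m\<ge>N. \<forall>n\<ge>N. l2norm (\<lambda>x. f m x - f n x) < (1/4) ^ k)" for k :: nat and N
  have ex: "\<exists>N. ok k N" for k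
    unfolding ok_def by (rule cauchy) simp
  have "\<exists>r. \<forall>k. ok k (r k) \<and> r k < r (Suc k)"
  proof (rule dependent_nat_choice)
    show "\<exists>N. ok 0 N" using ex .
    show "\<exists>N'. ok (Suc k) N' \<and> N < N'" for N k
    proof -
      obtain M where "ok (Suc k) M" using ex by blast
      then have "ok (Suc k) (max M (Suc N))" by (auto simp: ok_def)
      then show ?thesis by (intro exI[of _ "max M (Suc N)"]) auto
    qed
  qed
  then obtain r :: "nat \<Rightarrow> nat" where r: "\<And>k. ok k (r k)" "\<And>k. r k < r (Suc k)" by blast
  define d where "d k x = cmod (f (r (Suc k)) x - f (r k) x)" for k x
  have [measurable]: "d k \<in> borel_measurable borel" for k
    unfolding d_def by measurable
  have d_int: "(\<integral>\<^sup>+x. ennreal (4 ^ k * (d k x)\<^sup>2) \<partial>lborel) \<le> ennreal ((1/4)^k)" for k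
  proof -
    have "l2norm (\<lambda>x. f (r (Suc k)) x - f (r k) x) < (1/4)^k"
      using r(1)[of k] r(2)[of k] by (auto simp: ok_def)
    then have "(l2norm (\<lambda>x. f (r (Suc k)) x - f (r k) x))\<^sup>2 \<le> ((1/4)^k)\<^sup>2"
      by (intro power_mono) auto
    then have "ennreal (4^k) * (\<integral>\<^sup>+x. ennreal ((d k x)\<^sup>2) \<partial>lborel) \<le> ennreal (4^k) * ennreal (((1/4)^k)\<^sup>2)"
      unfolding d_def nn_integral_cmod_sq[OF square_integrable_diff[OF f f]]
      by (intro mult_left_mono ennreal_leI) auto
    also have "\<dots> = ennreal ((1/4)^k)"
      by (simp add: ennreal_mult[symmetric] power2_eq_square power_mult_distrib[symmetric] flip: mult.assoc)
    also have "ennreal (4^k) * (\<integral>\<^sup>+x. ennreal ((d k x)\<^sup>2) \<partial>lborel) = (\<integral>\<^sup>+x. ennreal (4 ^ k * (d k x)\<^sup>2) \<partial>lborel)"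
      by (subst nn_integral_cmult[symmetric]) (auto simp: ennreal_mult)
    finally show ?thesis .
  qed
  have "(\<integral>\<^sup>+x. (\<Sum>k. ennreal (4 ^ k * (d k x)\<^sup>2)) \<partial>lborel) = (\<Sum>k. \<integral>\<^sup>+x. ennreal (4 ^ k * (d k x)\<^sup>2) \<partial>lborel)"
    by (rule nn_integral_suminf) simp
  also have "\<dots> \<le> (\<Sum>k. ennreal ((1/4)^k))"
    using d_int by (intro suminf_le) auto
  also have "\<dots> < \<infinity>"
    by (subst suminf_ennreal2) (auto intro!: summable_geometric)
  finally have "(\<integral>\<^sup>+x. (\<Sum>k. ennreal (4 ^ k * (d k x)\<^sup>2)) \<partial>lborel) \<noteq> \<infinity>" by simp
  \<comment> \<open>A finite integral forces the weighted series to be finite almost everywhere. Its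
    terms are then bounded, which gives geometric decay of the increments.\<close>
  then have "AE x in lborel. (\<Sum>k. ennreal (4 ^ k * (d k x)\<^sup>2)) \<noteq> \<infinity>"
    by (rule nn_integral_noteq_infinite[rotated]) measurable
  then have conv: "AE x in lborel. convergent (\<lambda>k. f (r k) x)"
  proof eventually_elim
    case (elim x)
    then have "(\<Sum>k. ennreal (4 ^ k * (d k x)\<^sup>2)) < top"
      by (simp only: less_top infinity_ennreal_def not_False_eq_True)
    then obtain c where c: "(\<Sum>k. ennreal (4 ^ k * (d k x)\<^sup>2)) = ennreal c" "0 \<le> c"
      using ennreal_enn2real enn2real_nonneg by metis
    have "ennreal (4 ^ k * (d k x)\<^sup>2) \<le> ennreal c" for k
      using sum_le_suminf[of "\<lambda>k. ennreal (4 ^ k * (d k x)\<^sup>2)" "{k}"] unfolding c(1) by simp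
    then have "4 ^ k * (d k x)\<^sup>2 \<le> c" for k
      using c(2) by (simp only: ennreal_le_iff)
    moreover have "(4::real) ^ k = (2 ^ k)\<^sup>2" for k :: nat
      by (simp add: power2_eq_square flip: power_mult_distrib)
    ultimately have "(2 ^ k * d k x)\<^sup>2 \<le> c" for k
      by (simp add: power_mult_distrib)
    then have "2 ^ k * d k x \<le> sqrt c" for k
      by (simp add: real_le_rsqrt)
    then have le: "d k x \<le> sqrt c * (1/2) ^ k" for k
      by (simp add: field_simps)
    have "summable (\<lambda>k. f (r (Suc k)) x - f (r k) x)"
    proof (rule summable_comparison_test)
      show "summable (\<lambda>k. sqrt c * (1/2) ^ k)"
        by (intro summable_mult summable_geometric) simp
      show "\<exists>N. \<forall>n\<ge>N. norm (f (r (Suc n)) x - f (r n) x) \<le> sqrt c * (1 / 2) ^ n"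
        using le by (auto simp: d_def)
    qed
    then have "convergent (\<lambda>n. (\<Sum>k<n. f (r (Suc k)) x - f (r k) x))"
      by (simp add: summable_iff_convergent)
    then have "convergent (\<lambda>n. f (r n) x - f (r 0) x)"
      by (simp only: sum_lessThan_telescope[of "\<lambda>k. f (r k) x"])
    from convergent_add[OF this convergent_const[of "f (r 0) x"]] show ?case by simp
  qed
  define g where "g x = lim (\<lambda>k. f (r k) x)" for x
  have [measurable]: "g \<in> borel_measurable borel"
    unfolding g_def by measurable
  have lim: "AE x in lborel. (\<lambda>k. f (r k) x) \<longlonglongrightarrow> g x"
    using conv unfolding g_def by eventually_elim (simp add: convergent_LIMSEQ_iff)
  have mono: "strict_mono r" using r(2) by (simp add: strict_mono_Suc_iff)
  \<comment> \<open>Fatou along the subsequence: for fixed m the squared distance to the limit is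
    pointwise the liminf of the squared distances to \<open>f (r k)\<close>, whose norms are at most
    e once \<open>r k\<close> has passed N.\<close>
  have bound: "square_integrable (\<lambda>x. f m x - g x) \<and> l2norm (\<lambda>x. f m x - g x) \<le> e"
    if "e > 0" and N: "\<forall>m\<ge>N. \<forall>n\<ge>N. l2norm (\<lambda>x. f m x - f n x) < e" and "m \<ge> N" for e N m
  proof -
    have "(\<integral>\<^sup>+x. ennreal ((cmod (f m x - g x))\<^sup>2) \<partial>lborel)
        = (\<integral>\<^sup>+x. liminf (\<lambda>k. ennreal ((cmod (f m x - f (r k) x))\<^sup>2)) \<partial>lborel)"
    proof (rule nn_integral_cong_AE)
      show "AE x in lborel. ennreal ((cmod (f m x - g x))\<^sup>2) = liminf (\<lambda>k. ennreal ((cmod (f m x - f (r k) x))\<^sup>2))"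
        using lim
      proof eventually_elim
        case (elim x)
        then have "(\<lambda>k. ennreal ((cmod (f m x - f (r k) x))\<^sup>2)) \<longlonglongrightarrow> ennreal ((cmod (f m x - g x))\<^sup>2)"
          by (intro tendsto_intros tendsto_ennrealI)
        then show ?case
          by (intro lim_imp_Liminf[symmetric]) auto
      qed
    qed
    also have "\<dots> \<le> liminf (\<lambda>k. \<integral>\<^sup>+x. ennreal ((cmod (f m x - f (r k) x))\<^sup>2) \<partial>lborel)"
      by (rule nn_integral_liminf) simp
    also have "\<dots> \<le> ennreal (e\<^sup>2)"
    proof (rule Liminf_le)
      show "\<forall>\<^sub>F k in sequentially. (\<integral>\<^sup>+x. ennreal ((cmod (f m x - f (r k) x))\<^sup>2) \<partial>lborel) \<le> ennreal (e\<^sup>2)"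
        using eventually_ge_at_top[of N]
      proof eventually_elim
        case (elim k)
        then have "r k \<ge> N" using seq_suble[OF mono, of k] by simp
        then have "l2norm (\<lambda>x. f m x - f (r k) x) \<le> e" using N \<open>m \<ge> N\<close> by (simp add: less_imp_le)
        then show ?case
          unfolding nn_integral_cmod_sq[OF square_integrable_diff[OF f f]]
          using \<open>e > 0\<close> by (intro ennreal_leI power_mono) auto
      qed
    qed simp
    finally show ?thesis
      using l2norm_le_nn[of "\<lambda>x. f m x - g x" e] \<open>e > 0\<close> by simp
  qed
  have sq: "square_integrable g"
  proof -
    obtain N where "\<forall>m\<ge>N. \<forall>n\<ge>N. l2norm (\<lambda>x. f m x - f n x) < 1" using cauchy[of 1] by auto
    then have "square_integrable (\<lambda>x. f N x - g x)" using bound[of 1 N N] by auto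
    from square_integrable_diff[OF f[of N] this] show ?thesis by simp
  qed
  moreover have "(\<lambda>k. l2norm (\<lambda>x. f k x - g x)) \<longlonglongrightarrow> 0"
  proof (rule LIMSEQ_I)
    fix e :: real assume "e > 0"
    then obtain N where N: "\<forall>m\<ge>N. \<forall>n\<ge>N. l2norm (\<lambda>x. f m x - f n x) < e/2" using cauchy[of "e/2"] by auto
    have "l2norm (\<lambda>x. f m x - g x) \<le> e/2" if "m \<ge> N" for m
      using bound[of "e/2" N m] N that \<open>e > 0\<close> by auto
    with \<open>e > 0\<close> show "\<exists>no. \<forall>n\<ge>no. norm (l2norm (\<lambda>x. f n x - g x) - 0) < e"
      by (intro exI[of _ N]) force
  qed
  ultimately show ?thesis by blast
qed

section \<open>Truncation to balls\<close>

definition truncate_ball :: "nat \<Rightarrow> ('a::euclidean_space \<Rightarrow> complex) \<Rightarrow> 'a \<Rightarrow> complex" where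
  "truncate_ball k u = (\<lambda>x. indicator (cball 0 (real k)) x * u x)"

lemma truncate_ball_measurable [measurable]:
  "u \<in> borel_measurable borel \<Longrightarrow> truncate_ball k u \<in> borel_measurable borel"
  unfolding truncate_ball_def
  by (intro borel_measurable_times borel_measurable_indicator) auto

lemma cmod_truncate_ball_le: "cmod (truncate_ball k u x) \<le> cmod (u x)"
  by (auto simp: truncate_ball_def indicator_def)

lemma square_integrable_truncate_ball:
  "square_integrable u \<Longrightarrow> square_integrable (truncate_ball k u)"
  by (rule square_integrable_bound(1)[of u _ 1])
     (simp_all add: truncate_ball_measurable square_integrable_measurable cmod_truncate_ball_le)

text \<open>The indicator of a ball is itself square integrable, so Cauchy-Schwarz makes the
  truncation integrable and its Fourier integral meaningful.\<close>

lemma integrable_truncate_ball: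
  assumes "square_integrable u"
  shows "integrable lborel (truncate_ball k u)"
proof -
  have "square_integrable (indicator (cball (0::'a) (real k)))"
    unfolding square_integrable_iff_nn
  proof
    have "(\<integral>\<^sup>+ x. ennreal ((cmod (indicator (cball (0::'a) (real k)) x))\<^sup>2) \<partial>lborel)
        = (\<integral>\<^sup>+ x. indicator (cball (0::'a) (real k)) x \<partial>lborel)"
      by (intro nn_integral_cong) (simp add: indicator_def)
    also have "\<dots> < \<infinity>"
      using emeasure_bounded_finite[OF bounded_cball, of "0::'a" "real k"] by simp
    finally show "(\<integral>\<^sup>+ x. ennreal ((cmod (indicator (cball (0::'a) (real k)) x))\<^sup>2) \<partial>lborel) < \<infinity>" .
  qed (intro borel_measurable_indicator, auto)
  from square_integrable_mult_integrable[OF this assms]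
  show ?thesis by (simp add: truncate_ball_def)
qed

text \<open>Dominated convergence: every point eventually lies in the ball.\<close>

lemma truncate_ball_tendsto:
  assumes "square_integrable u"
  shows "(\<lambda>k. l2norm (\<lambda>x. truncate_ball k u x - u x)) \<longlonglongrightarrow> 0"
proof -
  have [measurable]: "u \<in> borel_measurable borel" using square_integrable_measurable[OF assms] .
  have "(\<lambda>k. LINT x|lborel. (cmod (truncate_ball k u x - u x))\<^sup>2) \<longlonglongrightarrow> (LINT (x::'a)|lborel. 0)"
  proof (rule integral_dominated_convergence[where w="\<lambda>x. (cmod (u x))\<^sup>2"])
    show "integrable lborel (\<lambda>x. (cmod (u x))\<^sup>2)" using assms by (simp add: square_integrable_def)
    show "AE x in lborel. (\<lambda>k. (cmod (truncate_ball k u x - u x))\<^sup>2) \<longlonglongrightarrow> 0"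
    proof (intro AE_I2 tendsto_eventually)
      fix x :: 'a
      show "\<forall>\<^sub>F k in sequentially. (cmod (truncate_ball k u x - u x))\<^sup>2 = 0"
        using eventually_ge_at_top[of "nat \<lceil>norm x\<rceil>"]
        by eventually_elim (auto simp: truncate_ball_def indicator_def dest: nat_ceiling_le_eq[THEN iffD1])
    qed
    show "AE x in lborel. norm ((cmod (truncate_ball k u x - u x))\<^sup>2) \<le> (cmod (u x))\<^sup>2" for k
      by (auto simp: truncate_ball_def indicator_def)
  qed auto
  then have "(\<lambda>k. sqrt (LINT x|lborel. (cmod (truncate_ball k u x - u x))\<^sup>2)) \<longlonglongrightarrow> sqrt 0"
    by (intro tendsto_real_sqrt) simp
  then show ?thesis by (simp add: l2norm_def)
qed

subsection \<open>Affine changes of variables\<close>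

text \<open>The instances used are translations, the reflection c = -1 and dilations: for
  convolutions, for the autocorrelation of a function, and for rescaling Gaussians.\<close>

lemma nn_integral_lborel_affine:
  fixes f :: "'a::euclidean_space \<Rightarrow> ennreal"
  assumes [measurable]: "f \<in> borel_measurable borel" and c: "c \<noteq> 0"
  shows "(\<integral>\<^sup>+x. f x \<partial>lborel) = \<bar>c\<bar> ^ DIM('a) * (\<integral>\<^sup>+x. f (t + c *\<^sub>R x) \<partial>lborel)"
  by (subst lborel_affine[OF c, of t])
     (simp add: nn_integral_density nn_integral_distr nn_integral_cmult ennreal_power)

lemma integrable_lborel_affine:
  fixes f :: "'a::euclidean_space \<Rightarrow> 'b::{banach, second_countable_topology}"
  assumes f: "integrable lborel f" and c: "c \<noteq> 0"
  shows "integrable lborel (\<lambda>x. f (t + c *\<^sub>R x))"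
proof -
  have [measurable]: "f \<in> borel_measurable borel"
    using borel_measurable_integrable[OF f] by simp
  have "(\<integral>\<^sup>+x. ennreal (norm (f x)) \<partial>lborel) < \<infinity>"
    using f by (simp add: integrable_iff_bounded)
  then show ?thesis
    using c unfolding integrable_iff_bounded
    by (subst (asm) nn_integral_lborel_affine[where c=c and t=t]) (auto simp: ennreal_mult_less_top)
qed

lemma integral_lborel_affine:
  fixes f :: "'a::euclidean_space \<Rightarrow> 'b::{banach, second_countable_topology}"
  assumes f: "integrable lborel f" and c: "c \<noteq> 0"
  shows "(LINT x|lborel. f x) = \<bar>c\<bar> ^ DIM('a) *\<^sub>R (LINT x|lborel. f (t + c *\<^sub>R x))"
proof -
  have [measurable]: "f \<in> borel_measurable borel"
    using borel_measurable_integrable[OF f] by simp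
  show ?thesis
    using integrable_lborel_affine[OF f c, of t] c
    by (subst lborel_affine[OF c, of t]) (simp add: integral_density integral_distr)
qed

lemma integral_lborel_translate:
  fixes f :: "'a::euclidean_space \<Rightarrow> 'b::{banach, second_countable_topology}"
  assumes "integrable lborel f"
  shows "(LINT x|lborel. f (x - t)) = (LINT x|lborel. f x)"
  using integral_lborel_affine[OF assms, of 1 "- t"] by (simp add: add.commute)

lemma integrable_lborel_translate:
  fixes f :: "'a::euclidean_space \<Rightarrow> 'b::{banach, second_countable_topology}"
  assumes "integrable lborel f"
  shows "integrable lborel (\<lambda>x. f (x - t))"
  using integrable_lborel_affine[OF assms, of 1 "- t"] by (simp add: add.commute)

lemma nn_integral_lborel_translate:
  fixes f :: "'a::euclidean_space \<Rightarrow> ennreal"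
  assumes "f \<in> borel_measurable borel"
  shows "(\<integral>\<^sup>+x. f (x - t) \<partial>lborel) = (\<integral>\<^sup>+x. f x \<partial>lborel)"
  using nn_integral_lborel_affine[OF assms, of 1 "- t"] by (simp add: add.commute)

lemma nn_integral_lborel_reflect:
  fixes f :: "'a::euclidean_space \<Rightarrow> ennreal"
  assumes "f \<in> borel_measurable borel"
  shows "(\<integral>\<^sup>+x. f (t - x) \<partial>lborel) = (\<integral>\<^sup>+x. f x \<partial>lborel)"
  using nn_integral_lborel_affine[OF assms, of "-1" t] by simp

lemma integral_lborel_reflect:
  fixes f :: "'a::euclidean_space \<Rightarrow> 'b::{banach, second_countable_topology}"
  assumes "integrable lborel f"
  shows "(LINT x|lborel. f (t - x)) = (LINT x|lborel. f x)" "integrable lborel (\<lambda>x. f (t - x))"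
  using integral_lborel_affine[OF assms, of "-1" t] integrable_lborel_affine[OF assms, of "-1" t] by simp_all

subsection \<open>The Gaussian\<close>

text \<open>Lebesgue measure is the image of the product measure under expansion in the basis; this
  reduces the Gaussian integral to one dimension.\<close>

lemma integral_lborel_prod_complex:
  fixes f :: "'a::euclidean_space \<Rightarrow> real \<Rightarrow> complex"
  assumes "\<And>b. b \<in> Basis \<Longrightarrow> integrable lborel (f b)"
  shows "(LINT x|lborel. (\<Prod>b\<in>Basis. f b (x \<bullet> b))) = (\<Prod>b\<in>Basis. LINT t|lborel. f b t)"
proof -
  interpret product_sigma_finite "\<lambda>_::'a. lborel :: real measure" ..
  have [measurable]: "f b \<in> borel_measurable borel" if "b \<in> Basis" for b
    using borel_measurable_integrable[OF assms[OF that]] by simp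
  have "(LINT x|lborel. (\<Prod>b\<in>Basis. f b (x \<bullet> b)))
      = (LINT g|(\<Pi>\<^sub>M b\<in>(Basis::'a set). lborel). (\<Prod>b\<in>Basis. f b ((\<Sum>b\<in>Basis. g b *\<^sub>R b) \<bullet> b)))"
    by (subst lborel_eq, subst integral_distr) auto
  also have "\<dots> = (LINT g|(\<Pi>\<^sub>M b\<in>(Basis::'a set). lborel). (\<Prod>b\<in>Basis. f b (g b)))"
    by (intro Bochner_Integration.integral_cong prod.cong) simp_all
  also have "\<dots> = (\<Prod>b\<in>Basis. LINT t|lborel. f b t)"
    by (rule product_integral_prod) (use assms in auto)
  finally show ?thesis .
qed

lemma integral_gaussian_real:
  "(LINT x|lborel. exp (\<i> * of_real (t * x)) * of_real (exp (- x\<^sup>2 / 2))) = of_real (sqrt (2 * pi) * exp (- t\<^sup>2 / 2))"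
  "integrable lborel (\<lambda>x::real. exp (\<i> * of_real (t * x)) * complex_of_real (exp (- x\<^sup>2 / 2)))"
proof -
  have d: "std_normal_density x = exp (- x\<^sup>2 / 2) / sqrt (2 * pi)" for x
    by (simp add: std_normal_density_def)
  have int: "integrable lborel (\<lambda>x::real. exp (- x\<^sup>2 / 2))"
    using integrable_mult_right[OF integrable_normal_moment[where \<mu>=0 and \<sigma>=1 and k=0], of "sqrt (2 * pi)"]
    by (simp add: d)
  show i: "integrable lborel (\<lambda>x::real. exp (\<i> * of_real (t * x)) * complex_of_real (exp (- x\<^sup>2 / 2)))"
    by (rule Bochner_Integration.integrable_bound[OF int]) (auto simp: norm_mult)
  \<comment> \<open>The one-dimensional transform is read off from the characteristic function of
    the standard normal distribution, after removing the normalising factor of the density.\<close>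
  have "char std_normal_distribution t = (LINT x|lborel. std_normal_density x *\<^sub>R iexp (t * x))"
    unfolding char_def by (rule integral_density) (auto simp: normal_density_nonneg)
  also have "\<dots> = (LINT x|lborel. of_real (1 / sqrt (2 * pi)) * (exp (\<i> * of_real (t * x)) * of_real (exp (- x\<^sup>2 / 2))))"
    by (intro Bochner_Integration.integral_cong) (simp_all add: d scaleR_conv_of_real)
  also have "\<dots> = of_real (1 / sqrt (2 * pi)) * (LINT x|lborel. exp (\<i> * of_real (t * x)) * of_real (exp (- x\<^sup>2 / 2)))"
    by (rule integral_mult_right_zero)
  finally show "(LINT x|lborel. exp (\<i> * of_real (t * x)) * of_real (exp (- x\<^sup>2 / 2))) = of_real (sqrt (2 * pi) * exp (- t\<^sup>2 / 2))"
    unfolding char_std_normal_distribution by (simp add: field_simps)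
qed

lemma norm_sq_Basis: "(norm (x::'a::euclidean_space))\<^sup>2 = (\<Sum>b\<in>Basis. (x \<bullet> b)\<^sup>2)"
  by (subst power2_norm_eq_inner, subst euclidean_inner) (simp add: power2_eq_square)

lemma integrable_gaussian:
  "integrable lborel (\<lambda>x::'a::euclidean_space. exp (- (norm x)\<^sup>2 / 2))"
proof -
  have int: "integrable lborel (\<lambda>x::real. exp (- x\<^sup>2 / 2))"
    using integrable_norm[OF integral_gaussian_real(2)[of 0]] by simp
  have "(\<integral>\<^sup>+x. ennreal (exp (- (norm x)\<^sup>2 / 2)) \<partial>(lborel :: 'a measure))
      = (\<integral>\<^sup>+x. (\<Prod>b\<in>Basis. ennreal (exp (- (x \<bullet> b)\<^sup>2 / 2))) \<partial>(lborel :: 'a measure))"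
    by (intro nn_integral_cong)
       (simp add: norm_sq_Basis prod_ennreal exp_sum[symmetric] sum_negf sum_divide_distrib)
  also have "\<dots> = (\<Prod>b\<in>(Basis::'a set). \<integral>\<^sup>+x. ennreal (exp (- x\<^sup>2 / 2)) \<partial>lborel)"
    by (rule nn_integral_lborel_prod) auto
  also have "\<dots> < \<infinity>"
    using int by (simp add: integrable_iff_bounded power_less_top_ennreal)
  finally show ?thesis by (simp add: integrable_iff_bounded)
qed

lemma integral_gaussian:
  fixes z :: "'a::euclidean_space"
  shows "(LINT x|lborel. exp (- \<i> * of_real (x \<bullet> z)) * of_real (exp (- (norm x)\<^sup>2 / 2)))
    = of_real ((2 * pi) powr (real DIM('a) / 2) * exp (- (norm z)\<^sup>2 / 2))"
proof -
  have "(LINT x|lborel. exp (- \<i> * of_real (x \<bullet> z)) * of_real (exp (- (norm x)\<^sup>2 / 2)))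
    = (LINT x|lborel. (\<Prod>b\<in>Basis. exp (\<i> * of_real (- (z \<bullet> b) * (x \<bullet> b))) * of_real (exp (- (x \<bullet> b)\<^sup>2 / 2))))"
    by (intro Bochner_Integration.integral_cong refl)
       (simp add: prod.distrib exp_sum[symmetric] sum_negf sum_distrib_left[symmetric] norm_sq_Basis
          sum_divide_distrib[symmetric] euclidean_inner[of _ z] mult.commute
          flip: of_real_prod of_real_sum of_real_mult)
  also have "\<dots> = (\<Prod>b\<in>Basis. of_real (sqrt (2 * pi) * exp (- (- (z \<bullet> b))\<^sup>2 / 2)))"
    by (subst integral_lborel_prod_complex) (simp_all only: integral_gaussian_real)
  also have "\<dots> = of_real (sqrt (2 * pi) ^ DIM('a) * exp (- (norm z)\<^sup>2 / 2))"
    by (simp add: prod.distrib exp_sum[symmetric] sum_negf norm_sq_Basis sum_divide_distrib[symmetric] flip: of_real_prod of_real_mult of_real_power)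
  also have "sqrt (2 * pi) ^ DIM('a) = (2 * pi) powr (real DIM('a) / 2)"
    by (simp add: powr_half_sqrt[symmetric] powr_powr powr_realpow[symmetric])
  finally show ?thesis .
qed

subsection \<open>Continuity of translations in the mean\<close>

text \<open>Simple functions reduce the claim to the indicator of a set, and outer regularity
  reduces that to the indicator of an open set, where pointwise convergence is available. Sums and
  limits are handled by the induction rule for integrable functions.\<close>

lemma translation_tendsto_L1:
  fixes f :: "'a::euclidean_space \<Rightarrow> real" and z :: "nat \<Rightarrow> 'a"
  assumes f: "integrable lborel f" and z: "z \<longlonglongrightarrow> 0"
  shows "(\<lambda>k. LINT x|lborel. \<bar>f (x - z k) - f x\<bar>) \<longlonglongrightarrow> 0"
  using f
proof (induction rule: integrable_induct)
  case (base A c)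
  have A: "A \<in> sets borel" "emeasure lborel A < \<infinity>" using base by simp_all
  show ?case
  proof (rule LIMSEQ_I)
    fix e :: real assume e: "e > 0"
    \<comment> \<open>Two approximation errors of size e' and twice a positive part below e' add up
      to 4 e', multiplied by |c|; the summand 1 covers c = 0.\<close>
    define e' where "e' = e / (4 * (\<bar>c\<bar> + 1))"
    have e': "e' > 0" using e by (simp add: e'_def)
    obtain U where U: "open U" "A \<subseteq> U" "emeasure lborel (U - A) < ennreal e'"
      using outer_regular_lborel[OF A(1) e'] by blast
    have UA: "U = A \<union> (U - A)" using U by blast
    have Uf: "emeasure lborel U < \<infinity>"
    proof -
      have "emeasure lborel (A \<union> (U - A)) \<le> emeasure lborel A + emeasure lborel (U - A)"
        using A U by (intro emeasure_subadditive) auto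
      also have "\<dots> < \<infinity>"
        using A(2) order.strict_trans[OF U(3) ennreal_less_top] by (simp add: ennreal_add_less_top)
      also have "A \<union> (U - A) = U" using U by blast
      finally show ?thesis .
    qed
    have iU: "integrable lborel (indicator U :: 'a \<Rightarrow> real)" using U Uf by simp
    have iA: "integrable lborel (indicator A :: 'a \<Rightarrow> real)" using A by simp
    have iUz: "integrable lborel (\<lambda>x. indicator U (x - z k) :: real)" for k
      by (rule integrable_lborel_translate[OF iU])
    \<comment> \<open>Only the positive part is treated: it vanishes off U, and at a point of U it
      is eventually zero because U is open. At boundary points of U the negative part need not
      converge.\<close>
    let ?m = "\<lambda>k x. max 0 (indicator U x - indicator U (x - z k)) :: real"
    have mm: "?m k \<in> borel_measurable lborel" for k
      using borel_measurable_integrable[OF iUz[of k]] borel_measurable_integrable[OF iU]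
      by (intro borel_measurable_max borel_measurable_diff) auto
    have "(\<lambda>k. LINT x|lborel. ?m k x) \<longlonglongrightarrow> (LINT x|(lborel::'a measure). 0)"
    proof (rule integral_dominated_convergence[where w="indicator U"])
      show "AE x in lborel. (\<lambda>k. ?m k x) \<longlonglongrightarrow> 0"
      proof (intro AE_I2 tendsto_eventually)
        fix x
        show "\<forall>\<^sub>F k in sequentially. ?m k x = 0"
        proof (cases "x \<in> U")
          case True
          have "(\<lambda>k. x - z k) \<longlonglongrightarrow> x" using tendsto_diff[OF tendsto_const z, of x] by simp
          then have "\<forall>\<^sub>F k in sequentially. x - z k \<in> U"
            using U True by (simp add: tendsto_def)
          then show ?thesis by eventually_elim simp
        qed (simp add: indicator_def)
      qed
    qed (use iU mm in \<open>auto simp: indicator_def\<close>)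
    then have lim: "(\<lambda>k. LINT x|lborel. ?m k x) \<longlonglongrightarrow> 0" by simp
    have iAz: "integrable lborel (\<lambda>x. indicator A (x - z k) :: real)" for k
      by (rule integrable_lborel_translate[OF iA])
    \<comment> \<open>Both indicators have the same integral, so the positive and negative parts of
      their difference have equal integrals, and the L1 distance is twice the integral of the
      positive part.\<close>
    have Ueq: "(LINT x|lborel. \<bar>indicator U (x - z k) - indicator U x\<bar>) = 2 * (LINT x|lborel. ?m k x)" for k
    proof -
      have im: "integrable lborel (\<lambda>x. ?m k x)" using iUz[of k] iU by (intro integrable_max) auto
      have "(LINT x|lborel. \<bar>indicator U (x - z k) - indicator U x\<bar>)
         = (LINT x|lborel. 2 * ?m k x + (indicator U (x - z k) - indicator U x))"
        by (intro Bochner_Integration.integral_cong) (auto simp: indicator_def)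
      also have "\<dots> = 2 * (LINT x|lborel. ?m k x)
           + ((LINT x|lborel. indicator U (x - z k)) - (LINT x|lborel. indicator U x))"
        using im iUz[of k] iU by simp
      also have "(LINT x|lborel. indicator U (x - z k)) = (LINT x|lborel. indicator U x :: real)"
        by (rule integral_lborel_translate[OF iU])
      finally show ?thesis by simp
    qed
    have dUA: "(LINT x|lborel. \<bar>indicator U x - indicator A x\<bar>) \<le> e'"
    proof -
      have "(LINT x|lborel. \<bar>indicator U x - indicator A x\<bar>) = (LINT x|lborel. indicator (U - A) x :: real)"
        using U by (intro Bochner_Integration.integral_cong) (auto simp: indicator_def)
      also have "\<dots> = measure lborel (U - A)" by simp
      also have "\<dots> \<le> e'"
        using U e' unfolding measure_def by (intro enn2real_leI) auto
      finally show ?thesis .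
    qed
    have main: "(LINT x|lborel. \<bar>indicator A (x - z k) - indicator A x\<bar>)
        \<le> 2 * e' + 2 * (LINT x|lborel. ?m k x)" for k
    proof -
      have d: "integrable lborel (\<lambda>x. \<bar>indicator U x - indicator A x\<bar> :: real)"
        using iU iA by auto
      have "(LINT x|lborel. \<bar>indicator A (x - z k) - indicator A x\<bar>)
         \<le> (LINT x|lborel. \<bar>indicator U (x - z k) - indicator A (x - z k)\<bar>
              + \<bar>indicator U x - indicator A x\<bar> + \<bar>indicator U (x - z k) - indicator U x\<bar> :: real)"
        using iU iA iAz[of k] iUz[of k] by (intro integral_mono) auto
      also have "\<dots> = (LINT x|lborel. \<bar>indicator U (x - z k) - indicator A (x - z k)\<bar>)
              + (LINT x|lborel. \<bar>indicator U x - indicator A x\<bar>) + (LINT x|lborel. \<bar>indicator U (x - z k) - indicator U x\<bar>)"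
        using iU iA iAz[of k] iUz[of k] by simp
      also have "(LINT x|lborel. \<bar>indicator U (x - z k) - indicator A (x - z k)\<bar>) = (LINT x|lborel. \<bar>indicator U x - indicator A x\<bar> :: real)"
        by (rule integral_lborel_translate[OF d])
      finally show ?thesis using dUA unfolding Ueq by simp
    qed
    obtain N where N: "\<And>k. k \<ge> N \<Longrightarrow> \<bar>LINT x|lborel. ?m k x\<bar> < e'"
      using LIMSEQ_D[OF lim e'] by auto
    have "norm ((LINT x|lborel. \<bar>indicator A (x - z k) *\<^sub>R c - indicator A x *\<^sub>R c\<bar>) - 0) < e" if "k \<ge> N" for k
    proof -
      have eq: "(LINT x|lborel. \<bar>indicator A (x - z k) *\<^sub>R c - indicator A x *\<^sub>R c\<bar>) = \<bar>c\<bar> * (LINT x|lborel. \<bar>indicator A (x - z k) - indicator A x\<bar>)"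
        by (subst integral_mult_right_zero[symmetric], intro Bochner_Integration.integral_cong)
           (auto simp: indicator_def)
      have "\<bar>c\<bar> * (LINT x|lborel. \<bar>indicator A (x - z k) - indicator A x\<bar>) \<le> \<bar>c\<bar> * (4 * e')"
        using main[of k] N[OF that] by (intro mult_left_mono) auto
      also have "\<dots> < e" using e by (simp add: e'_def field_simps)
      finally show ?thesis unfolding eq by (simp add: abs_mult)
    qed
    then show "\<exists>no. \<forall>k\<ge>no. norm ((LINT x|lborel. \<bar>indicator A (x - z k) *\<^sub>R c - indicator A x *\<^sub>R c\<bar>) - 0) < e"
      by blast
  qed
next
  case (add f g)
  show ?case
  proof (rule Lim_null_comparison)
    show "(\<lambda>k. (LINT x|lborel. \<bar>f (x - z k) - f x\<bar>) + (LINT x|lborel. \<bar>g (x - z k) - g x\<bar>)) \<longlonglongrightarrow> 0"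
      using tendsto_add[OF add.IH] by simp
    show "\<forall>\<^sub>F k in sequentially. norm (LINT x|lborel. \<bar>f (x - z k) + g (x - z k) - (f x + g x)\<bar>)
        \<le> (LINT x|lborel. \<bar>f (x - z k) - f x\<bar>) + (LINT x|lborel. \<bar>g (x - z k) - g x\<bar>)"
    proof (intro always_eventually allI)
      fix k
      note i = add.hyps integrable_lborel_translate[OF add.hyps(1), of "z k"] integrable_lborel_translate[OF add.hyps(2), of "z k"]
      have "norm (LINT x|lborel. \<bar>f (x - z k) + g (x - z k) - (f x + g x)\<bar>)
         = (LINT x|lborel. \<bar>f (x - z k) + g (x - z k) - (f x + g x)\<bar>)" by simp
      also have "\<dots> \<le> (LINT x|lborel. \<bar>f (x - z k) - f x\<bar> + \<bar>g (x - z k) - g x\<bar>)"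
        using i by (intro integral_mono) auto
      also have "\<dots> = (LINT x|lborel. \<bar>f (x - z k) - f x\<bar>) + (LINT x|lborel. \<bar>g (x - z k) - g x\<bar>)"
        using i by simp
      finally show "norm (LINT x|lborel. \<bar>f (x - z k) + g (x - z k) - (f x + g x)\<bar>)
        \<le> (LINT x|lborel. \<bar>f (x - z k) - f x\<bar>) + (LINT x|lborel. \<bar>g (x - z k) - g x\<bar>)" .
    qed
  qed
next
  case (lim f s)
  note i = lim.hyps(1,4)
  have "(\<lambda>j. LINT x|lborel. \<bar>s j x - f x\<bar>) \<longlonglongrightarrow> (LINT (x::'a)|lborel. 0)"
  \<comment> \<open>The approximating simple functions are bounded by 2 |f|, hence the majorant 3
    |f|.\<close>
  proof (rule integral_dominated_convergence[where w="\<lambda>x. 3 * \<bar>f x\<bar>"])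
    show "AE x in lborel. (\<lambda>j. \<bar>s j x - f x\<bar>) \<longlonglongrightarrow> 0"
      using lim.hyps(2) by (intro AE_I2 tendsto_rabs_zero LIM_zero) auto
    show "AE x in lborel. norm (\<bar>s j x - f x\<bar>) \<le> 3 * \<bar>f x\<bar>" for j
    proof (intro AE_I2)
      fix x :: 'a
      have "\<bar>s j x\<bar> \<le> 2 * \<bar>f x\<bar>" using lim.hyps(3)[of x j] by simp
      then show "norm (\<bar>s j x - f x\<bar>) \<le> 3 * \<bar>f x\<bar>"
        by (simp add: abs_if split: if_splits)
    qed
  qed (use i in auto)
  then have sf: "(\<lambda>j. LINT x|lborel. \<bar>s j x - f x\<bar>) \<longlonglongrightarrow> 0" by simp
  show ?case
  proof (rule LIMSEQ_I)
    fix e :: real assume e: "e > 0"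
    obtain j where j: "\<bar>LINT x|lborel. \<bar>s j x - f x\<bar>\<bar> < e / 3"
      using LIMSEQ_D[OF sf, of "e/3"] e by auto
    obtain N where N: "\<And>k. k \<ge> N \<Longrightarrow> \<bar>LINT x|lborel. \<bar>s j (x - z k) - s j x\<bar>\<bar> < e / 3"
      using LIMSEQ_D[OF lim.IH[of j], of "e/3"] e by auto
    have "norm ((LINT x|lborel. \<bar>f (x - z k) - f x\<bar>) - 0) < e" if "k \<ge> N" for k
    proof -
      note iz = i(1)[of j] i(2) integrable_lborel_translate[OF i(1)[of j], of "z k"] integrable_lborel_translate[OF i(2), of "z k"]
      have d: "integrable lborel (\<lambda>x. \<bar>s j x - f x\<bar>)" using iz by auto
      have "(LINT x|lborel. \<bar>f (x - z k) - f x\<bar>) \<le> (LINT x|lborel. \<bar>s j (x - z k) - f (x - z k)\<bar> + \<bar>s j x - f x\<bar> + \<bar>s j (x - z k) - s j x\<bar>)"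
        using iz by (intro integral_mono) auto
      also have "\<dots> = (LINT x|lborel. \<bar>s j (x - z k) - f (x - z k)\<bar>) + (LINT x|lborel. \<bar>s j x - f x\<bar>) + (LINT x|lborel. \<bar>s j (x - z k) - s j x\<bar>)"
        using iz by simp
      also have "(LINT x|lborel. \<bar>s j (x - z k) - f (x - z k)\<bar>) = (LINT x|lborel. \<bar>s j x - f x\<bar>)"
        by (rule integral_lborel_translate[OF d])
      finally show ?thesis using j N[OF that] by simp
    qed
    then show "\<exists>no. \<forall>k\<ge>no. norm ((LINT x|lborel. \<bar>f (x - z k) - f x\<bar>) - 0) < e" by blast
  qed
qed


text \<open>Reduction to L1: for p, q \<ge> 0 one has (p - q)^2 \<le> |p^2 - q^2|, so the positive
  and negative parts of the real and imaginary parts may be squared and treated as integrable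
  functions.\<close>

lemma translation_tendsto_L2:
  fixes u :: "'a::euclidean_space \<Rightarrow> complex" and z :: "nat \<Rightarrow> 'a"
  assumes u: "square_integrable u" and z: "z \<longlonglongrightarrow> 0"
  shows "(\<lambda>k. l2norm (\<lambda>x. u (x - z k) - u x)) \<longlonglongrightarrow> 0"
proof -
  have um [measurable]: "u \<in> borel_measurable borel" using square_integrable_measurable[OF u] .
  let ?g = "\<lambda>h x. (max 0 (h (u x)))\<^sup>2 :: real"
  have key: "integrable lborel (?g h)" "(\<lambda>k. LINT x|lborel. \<bar>?g h (x - z k) - ?g h x\<bar>) \<longlonglongrightarrow> 0"
    if h: "\<And>w. \<bar>h w\<bar> \<le> cmod w" "h \<in> borel_measurable borel" for h :: "complex \<Rightarrow> real"
  proof -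
    show "integrable lborel (?g h)"
    proof (rule Bochner_Integration.integrable_bound[of _ "\<lambda>x. (cmod (u x))\<^sup>2"])
      show "integrable lborel (\<lambda>x. (cmod (u x))\<^sup>2)" using u by (simp add: square_integrable_def)
      show "(?g h) \<in> borel_measurable lborel" using h(2) by measurable
      have "(max 0 (h w))\<^sup>2 \<le> (cmod w)\<^sup>2" for w
        using h(1)[of w] by (intro power_mono) auto
      then show "AE x in lborel. norm ((max 0 (h (u x)))\<^sup>2) \<le> norm ((cmod (u x))\<^sup>2)" by simp
    qed
    then show "(\<lambda>k. LINT x|lborel. \<bar>?g h (x - z k) - ?g h x\<bar>) \<longlonglongrightarrow> 0"
      by (rule translation_tendsto_L1[OF _ z])
  qed
  \<comment> \<open>The indices 0 to 3 run through Re, -Re, Im and -Im; the positive parts of these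
    four are the nonnegative functions to be squared.\<close>
  let ?h = "\<lambda>j w. if j = (0::nat) then Re w else if j = 1 then - Re w else if j = 2 then Im w else - Im w"
  have h: "\<And>w. \<bar>?h j w\<bar> \<le> cmod w" "?h j \<in> borel_measurable borel" for j
    by (auto simp: abs_Re_le_cmod abs_Im_le_cmod)
  have sq: "(max 0 a - max 0 b)\<^sup>2 \<le> \<bar>(max 0 a)\<^sup>2 - (max 0 b)\<^sup>2\<bar>" for a b :: real
  proof -
    have "(max 0 a - max 0 b)\<^sup>2 = \<bar>max 0 a - max 0 b\<bar> * \<bar>max 0 a - max 0 b\<bar>" by (simp add: power2_eq_square)
    also have "\<dots> \<le> \<bar>max 0 a - max 0 b\<bar> * \<bar>max 0 a + max 0 b\<bar>" by (intro mult_left_mono) auto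
    also have "\<dots> = \<bar>(max 0 a)\<^sup>2 - (max 0 b)\<^sup>2\<bar>" by (simp only: abs_mult[symmetric] power2_eq_square square_diff_square_factored mult.commute)
    finally show ?thesis .
  qed
  have pw: "(cmod (v - w))\<^sup>2 \<le> (\<Sum>j<4. 2 * \<bar>(max 0 (?h j v))\<^sup>2 - (max 0 (?h j w))\<^sup>2\<bar>)" for v w
  proof -
    have sqd: "(p - q)\<^sup>2 \<le> 2 * p\<^sup>2 + 2 * q\<^sup>2" for p q :: real
      using sum_squares_bound[of p "- q"] by (simp add: power2_diff)
    have r: "(a - b)\<^sup>2 \<le> 2 * \<bar>(max 0 a)\<^sup>2 - (max 0 b)\<^sup>2\<bar> + 2 * \<bar>(max 0 (-a))\<^sup>2 - (max 0 (-b))\<^sup>2\<bar>" for a b :: real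
    proof -
      let ?p = "max 0 a - max 0 b" and ?q = "max 0 (-a) - max 0 (-b)"
      have "(a - b)\<^sup>2 = (?p - ?q)\<^sup>2" by (rule arg_cong[where f="\<lambda>x. x\<^sup>2"]) simp
      also have "\<dots> \<le> 2 * ?p\<^sup>2 + 2 * ?q\<^sup>2"
        by (rule sqd)
      also have "\<dots> \<le> 2 * \<bar>(max 0 a)\<^sup>2 - (max 0 b)\<^sup>2\<bar> + 2 * \<bar>(max 0 (-a))\<^sup>2 - (max 0 (-b))\<^sup>2\<bar>"
        using sq[of a b] sq[of "-a" "-b"] by linarith
      finally show ?thesis .
    qed
    have "(cmod (v - w))\<^sup>2 = (Re v - Re w)\<^sup>2 + (Im v - Im w)\<^sup>2"
      by (simp add: cmod_power2)
    also have "\<dots> \<le> (\<Sum>j<4. 2 * \<bar>(max 0 (?h j v))\<^sup>2 - (max 0 (?h j w))\<^sup>2\<bar>)"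
    proof -
      have sum4: "(\<Sum>j<4. f j) = f 0 + f 1 + f 2 + f 3" for f :: "nat \<Rightarrow> real"
        by (simp add: eval_nat_numeral)
      have n: "(1::nat) \<noteq> 0" "(2::nat) \<noteq> 0" "(2::nat) \<noteq> 1" "(3::nat) \<noteq> 0" "(3::nat) \<noteq> 1" "(3::nat) \<noteq> 2" by simp_all
      show ?thesis
        unfolding sum4 using r[of "Re v" "Re w"] r[of "Im v" "Im w"]
        by (simp only: n if_True if_False refl)
    qed
    finally show ?thesis .
  qed
  have iz: "integrable lborel (\<lambda>x. ?g (?h j) (x - z k))" for j k
    by (rule integrable_lborel_translate[OF key(1)[OF h]])
  have lim: "(\<lambda>k. \<Sum>j<4. 2 * (LINT x|lborel. \<bar>?g (?h j) (x - z k) - ?g (?h j) x\<bar>)) \<longlonglongrightarrow> (\<Sum>j<(4::nat). 2 * 0)"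
    by (intro tendsto_sum tendsto_mult tendsto_const key(2)[OF h])
  have uz: "square_integrable (\<lambda>x. u (x - z k) - u x)" for k
  proof (rule square_integrable_diff[OF _ u])
    show "square_integrable (\<lambda>x. u (x - z k))"
      using u integrable_lborel_translate[of "\<lambda>x. (cmod (u x))\<^sup>2" "z k"] by (simp add: square_integrable_def)
  qed
  have "(\<lambda>k. (l2norm (\<lambda>x. u (x - z k) - u x))\<^sup>2) \<longlonglongrightarrow> 0"
  proof (rule tendsto_sandwich[OF _ _ tendsto_const])
    show "(\<lambda>k. \<Sum>j<4. 2 * (LINT x|lborel. \<bar>?g (?h j) (x - z k) - ?g (?h j) x\<bar>)) \<longlonglongrightarrow> 0"
      using lim by (simp only: mult_zero_right sum.neutral_const)
    show "\<forall>\<^sub>F k in sequentially. (l2norm (\<lambda>x. u (x - z k) - u x))\<^sup>2 \<le> (\<Sum>j<4. 2 * (LINT x|lborel. \<bar>?g (?h j) (x - z k) - ?g (?h j) x\<bar>))"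
    proof (intro always_eventually allI)
      fix k
      have i: "integrable lborel (\<lambda>x. 2 * \<bar>?g (?h j) (x - z k) - ?g (?h j) x\<bar>)" for j
        by (intro integrable_mult_right integrable_abs Bochner_Integration.integrable_diff iz key(1)[OF h])
      have "(l2norm (\<lambda>x. u (x - z k) - u x))\<^sup>2 \<le> (LINT x|lborel. (\<Sum>j<4. 2 * \<bar>?g (?h j) (x - z k) - ?g (?h j) x\<bar>))"
        unfolding l2norm_sq
      proof (intro integral_mono Bochner_Integration.integrable_sum i pw)
        show "integrable lborel (\<lambda>x. (cmod (u (x - z k) - u x))\<^sup>2)" using uz[of k] by (simp add: square_integrable_def)
      qed
      also have "\<dots> = (\<Sum>j<4. LINT x|lborel. 2 * \<bar>?g (?h j) (x - z k) - ?g (?h j) x\<bar>)"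
        by (rule Bochner_Integration.integral_sum) (rule i)
      also have "\<dots> = (\<Sum>j<4. 2 * (LINT x|lborel. \<bar>?g (?h j) (x - z k) - ?g (?h j) x\<bar>))"
        by (intro sum.cong refl integral_mult_right_zero)
      finally show "(l2norm (\<lambda>x. u (x - z k) - u x))\<^sup>2 \<le> (\<Sum>j<4. 2 * (LINT x|lborel. \<bar>?g (?h j) (x - z k) - ?g (?h j) x\<bar>))" .
    qed
  qed simp
  then have "(\<lambda>k. sqrt ((l2norm (\<lambda>x. u (x - z k) - u x))\<^sup>2)) \<longlonglongrightarrow> sqrt 0"
    by (rule tendsto_real_sqrt)
  then show ?thesis by simp
qed

subsection \<open>Fourier integrals of integrable functions\<close>

abbreviation fourier_const :: "'a::euclidean_space itself \<Rightarrow> real" where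
  "fourier_const _ \<equiv> (2 * pi) powr (- real DIM('a) / 2)"

lemma fourier_integral_measurable [measurable]:
  assumes [measurable]: "u \<in> borel_measurable borel"
  shows "fourier_integral u \<in> borel_measurable borel"
  unfolding fourier_integral_def by measurable

lemma integrable_fourier_kernel:
  assumes "integrable lborel (u :: 'a::euclidean_space \<Rightarrow> complex)"
  shows "integrable lborel (\<lambda>x. exp (- \<i> * of_real (x \<bullet> \<xi>)) * u x)"
proof (rule Bochner_Integration.integrable_bound[OF assms])
  have [measurable]: "u \<in> borel_measurable borel" using borel_measurable_integrable[OF assms] by simp
  show "(\<lambda>x. exp (- \<i> * of_real (x \<bullet> \<xi>)) * u x) \<in> borel_measurable lborel" by measurable
qed (simp add: norm_mult)

lemma cmod_fourier_integral_le:
  fixes u :: "'a::euclidean_space \<Rightarrow> complex"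
  shows "cmod (fourier_integral u \<xi>) \<le> fourier_const TYPE('a) * (LINT x|lborel. cmod (u x))"
proof -
  have "cmod (LINT x|lborel. exp (- \<i> * of_real (x \<bullet> \<xi>)) * u x) \<le> (LINT x|lborel. cmod (exp (- \<i> * of_real (x \<bullet> \<xi>)) * u x))"
    by (rule integral_norm_bound)
  then show ?thesis
    by (simp add: fourier_integral_def norm_mult mult_left_mono)
qed

lemma fourier_integral_diff:
  assumes "integrable lborel u" "integrable lborel v"
  shows "fourier_integral (\<lambda>x. u x - v x) \<xi> = fourier_integral u \<xi> - fourier_integral v \<xi>"
  using assms[THEN integrable_fourier_kernel, of \<xi>]
  by (simp add: fourier_integral_def right_diff_distrib)

lemma fourier_integral_add:
  assumes "integrable lborel u" "integrable lborel v"
  shows "fourier_integral (\<lambda>x. u x + v x) \<xi> = fourier_integral u \<xi> + fourier_integral v \<xi>"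
  using assms[THEN integrable_fourier_kernel, of \<xi>]
  by (simp add: fourier_integral_def distrib_left)

lemma fourier_integral_cmult:
  "fourier_integral (\<lambda>x. c * u x) \<xi> = c * fourier_integral u \<xi>"
proof -
  have "(LINT x|lborel. exp (- \<i> * of_real (x \<bullet> \<xi>)) * (c * u x)) = (LINT x|lborel. c * (exp (- \<i> * of_real (x \<bullet> \<xi>)) * u x))"
    by (simp add: ac_simps)
  also have "\<dots> = c * (LINT x|lborel. exp (- \<i> * of_real (x \<bullet> \<xi>)) * u x)"
    by (rule integral_mult_right_zero)
  finally show ?thesis by (simp add: fourier_integral_def)
qed

lemma fourier_integral_cnj:
  "fourier_integral (\<lambda>x. cnj (u x)) \<xi> = cnj (fourier_integral u (- \<xi>))"
proof -
  have "cnj (LINT x|lborel. exp (- \<i> * of_real (x \<bullet> - \<xi>)) * u x) = (LINT x|lborel. cnj (exp (- \<i> * of_real (x \<bullet> - \<xi>)) * u x))"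
    by (simp del: complex_cnj_mult)
  also have "\<dots> = (LINT x|lborel. exp (- \<i> * of_real (x \<bullet> \<xi>)) * cnj (u x))"
    by (simp add: exp_cnj)
  finally show ?thesis by (simp add: fourier_integral_def)
qed

lemma integrable_tensor:
  fixes u v :: "'a::euclidean_space \<Rightarrow> complex"
  assumes "integrable lborel u" "integrable lborel v"
    and [measurable]: "K \<in> borel_measurable (borel \<Otimes>\<^sub>M borel)" and K: "\<And>p. cmod (K p) \<le> 1"
  shows "integrable (lborel \<Otimes>\<^sub>M lborel) (\<lambda>(x, y). K (x, y) * (u x * v y))"
proof -
  have [measurable]: "u \<in> borel_measurable borel" "v \<in> borel_measurable borel"
    using assms(1,2)[THEN borel_measurable_integrable] by simp_all
  have i: "integrable (lborel \<Otimes>\<^sub>M lborel) (\<lambda>(x, y). u x * v y)"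
  proof (rule lborel_pair.Fubini_integrable)
    have "integrable lborel (\<lambda>x. cmod (u x) * (LINT y|lborel. cmod (v y)))"
      using assms(1) by simp
    then show "integrable lborel (\<lambda>x. LINT y|lborel. norm (case (x, y) of (x, y) \<Rightarrow> u x * v y))"
      by (simp add: norm_mult)
    show "AE x in lborel. integrable lborel (\<lambda>y. case (x, y) of (x, y) \<Rightarrow> u x * v y)"
      using assms(2) by simp
  qed measurable
  show ?thesis
  proof (rule Bochner_Integration.integrable_bound[OF i])
    show "AE x in lborel \<Otimes>\<^sub>M lborel. norm (case x of (x, y) \<Rightarrow> K (x, y) * (u x * v y)) \<le> norm (case x of (x, y) \<Rightarrow> u x * v y)"
      using K by (intro AE_I2) (auto simp: norm_mult intro!: mult_left_le_one_le)
  qed measurable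
qed

text \<open>Fubini for a bounded kernel that is symmetric in its two arguments. In the proof of
  Plancherel's theorem this identity takes the place of an inversion formula.\<close>

lemma fourier_integral_multiplication:
  fixes u v :: "'a::euclidean_space \<Rightarrow> complex"
  assumes "integrable lborel u" "integrable lborel v"
  shows "l2pair (fourier_integral u) v = l2pair u (fourier_integral v)"
proof -
  let ?K = "\<lambda>p::'a \<times> 'a. exp (- \<i> * of_real (fst p \<bullet> snd p))"
  have int: "integrable (lborel \<Otimes>\<^sub>M lborel) (\<lambda>(x, y). ?K (x, y) * (u x * v y))"
    by (rule integrable_tensor[OF assms]) auto
  let ?c = "complex_of_real (fourier_const TYPE('a))"
  have "l2pair (fourier_integral u) v = (LINT \<xi>|lborel. ?c * (LINT x|lborel. ?K (x, \<xi>) * (u x * v \<xi>)))"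
    unfolding l2pair_def fourier_integral_def
    by (intro Bochner_Integration.integral_cong refl)
       (simp only: integral_mult_left_zero[symmetric] mult.assoc fst_conv snd_conv)
  also have "\<dots> = ?c * (LINT \<xi>|lborel. LINT x|lborel. ?K (x, \<xi>) * (u x * v \<xi>))"
    by (rule integral_mult_right_zero)
  also have "(LINT \<xi>|lborel. LINT x|lborel. ?K (x, \<xi>) * (u x * v \<xi>)) = (LINT x|lborel. LINT \<xi>|lborel. ?K (x, \<xi>) * (u x * v \<xi>))"
    by (rule lborel_pair.Fubini_integral[OF int])
  also have "?c * \<dots> = (LINT x|lborel. ?c * (LINT \<xi>|lborel. ?K (x, \<xi>) * (u x * v \<xi>)))"
    by (rule integral_mult_right_zero[symmetric])
  also have "\<dots> = l2pair u (fourier_integral v)"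
    unfolding l2pair_def fourier_integral_def
  proof (intro Bochner_Integration.integral_cong refl)
    fix x
    have "(LINT \<xi>|lborel. ?K (x, \<xi>) * (u x * v \<xi>)) = (LINT \<xi>|lborel. u x * (exp (- \<i> * of_real (\<xi> \<bullet> x)) * v \<xi>))"
      by (simp add: inner_commute ac_simps)
    also have "\<dots> = u x * (LINT \<xi>|lborel. exp (- \<i> * of_real (\<xi> \<bullet> x)) * v \<xi>)"
      by (rule integral_mult_right_zero)
    finally show "?c * (LINT \<xi>|lborel. ?K (x, \<xi>) * (u x * v \<xi>))
        = u x * (?c * (LINT \<xi>|lborel. exp (- \<i> * of_real (\<xi> \<bullet> x)) * v \<xi>))"
      by simp
  qed
  finally show ?thesis .
qed

text \<open>Where the integrand fails to be integrable the value is the default 0, so upper bounds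
  by the integral of the modulus persist there.\<close>

definition fun_convolution :: "('a::euclidean_space \<Rightarrow> complex) \<Rightarrow> ('a \<Rightarrow> complex) \<Rightarrow> 'a \<Rightarrow> complex" where
  "fun_convolution p q z = (LINT y|lborel. p (z - y) * q y)"

lemma fun_convolution_measurable [measurable]:
  assumes [measurable]: "p \<in> borel_measurable borel" "q \<in> borel_measurable borel"
  shows "fun_convolution p q \<in> borel_measurable borel"
  unfolding fun_convolution_def by measurable

text \<open>By translation invariance the inner integral of the modulus is a constant times |q y|,
  which is integrable in y.\<close>

lemma integrable_shear:
  fixes p q :: "'a::euclidean_space \<Rightarrow> complex"
  assumes "integrable lborel p" "integrable lborel q"
  shows "integrable (lborel \<Otimes>\<^sub>M lborel) (\<lambda>(y, z). p (z - y) * q y)"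
proof (rule lborel_pair.Fubini_integrable)
  have [measurable]: "p \<in> borel_measurable borel" "q \<in> borel_measurable borel"
    using assms[THEN borel_measurable_integrable] by simp_all
  show "(\<lambda>(y, z). p (z - y) * q y) \<in> borel_measurable (lborel \<Otimes>\<^sub>M lborel)" by measurable
  have "integrable lborel (\<lambda>y. (LINT z|lborel. cmod (p z)) * cmod (q y))"
    using assms by simp
  moreover have "(LINT z|lborel. cmod (p (z - y)) * cmod (q y)) = (LINT z|lborel. cmod (p z)) * cmod (q y)" for y
    using integral_lborel_translate[of "\<lambda>z. cmod (p z)" y] assms by simp
  ultimately show "integrable lborel (\<lambda>y. LINT z|lborel. norm (case (y, z) of (y, z) \<Rightarrow> p (z - y) * q y))"
    by (simp only: prod.case norm_mult)
  show "AE y in lborel. integrable lborel (\<lambda>z. case (y, z) of (y, z) \<Rightarrow> p (z - y) * q y)"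
    using integrable_lborel_translate[OF assms(1)] by simp
qed

lemma integrable_convolution:
  fixes p q :: "'a::euclidean_space \<Rightarrow> complex"
  assumes "integrable lborel p" "integrable lborel q"
  shows "integrable lborel (fun_convolution p q)"
  using lborel_pair.integrable_snd[OF integrable_shear[OF assms]] by (simp add: fun_convolution_def[abs_def])

text \<open>The symmetric normalisation puts the constant into each transform: the product carries
  it twice, the transform of the convolution once, hence the extra factor.\<close>

lemma fourier_integral_convolution:
  fixes p q :: "'a::euclidean_space \<Rightarrow> complex"
  assumes "integrable lborel p" "integrable lborel q"
  shows "of_real (fourier_const TYPE('a)) * fourier_integral (fun_convolution p q) \<xi>
    = fourier_integral p \<xi> * fourier_integral q \<xi>"
proof -
  let ?e = "\<lambda>x. exp (- \<i> * of_real (x \<bullet> \<xi>))"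
  have [measurable]: "p \<in> borel_measurable borel" "q \<in> borel_measurable borel"
    using assms[THEN borel_measurable_integrable] by simp_all
  have int: "integrable (lborel \<Otimes>\<^sub>M lborel) (\<lambda>(y, z). ?e z * (p (z - y) * q y))"
    by (rule Bochner_Integration.integrable_bound[OF integrable_shear[OF assms]]) (measurable, auto simp: norm_mult)
  have "(LINT z|lborel. ?e z * fun_convolution p q z) = (LINT z|lborel. LINT y|lborel. ?e z * (p (z - y) * q y))"
    by (simp add: fun_convolution_def)
  also have "\<dots> = (LINT y|lborel. LINT z|lborel. ?e z * (p (z - y) * q y))"
    by (rule lborel_pair.Fubini_integral[OF int])
  also have "\<dots> = (LINT y|lborel. (?e y * q y) * (LINT z|lborel. ?e z * p z))"
  proof (intro Bochner_Integration.integral_cong refl)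
    fix y
    have "(LINT z|lborel. ?e z * (p (z - y) * q y)) = (LINT z|lborel. (?e y * q y) * (?e (z - y) * p (z - y)))"
      by (intro Bochner_Integration.integral_cong refl) (simp add: inner_diff_left ring_distribs exp_diff exp_minus field_simps)
    also have "\<dots> = (?e y * q y) * (LINT z|lborel. ?e (z - y) * p (z - y))"
      by (rule integral_mult_right_zero)
    also have "(LINT z|lborel. ?e (z - y) * p (z - y)) = (LINT z|lborel. ?e z * p z)"
      by (rule integral_lborel_translate) (rule integrable_fourier_kernel[OF assms(1)])
    finally show "(LINT z|lborel. ?e z * (p (z - y) * q y)) = (?e y * q y) * (LINT z|lborel. ?e z * p z)" .
  qed
  also have "\<dots> = (LINT y|lborel. ?e y * q y) * (LINT z|lborel. ?e z * p z)"
    by (rule integral_mult_left_zero)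
  finally show ?thesis by (simp add: fourier_integral_def)
qed

subsection \<open>Plancherel theorem\<close>

lemma square_integrable_reflect:
  assumes "square_integrable u"
  shows "square_integrable (\<lambda>x. u (t - x))" "l2norm (\<lambda>x. u (t - x)) = l2norm u"
proof -
  have [measurable]: "u \<in> borel_measurable borel" using square_integrable_measurable[OF assms] .
  have i: "integrable lborel (\<lambda>x. (cmod (u x))\<^sup>2)" using assms by (simp add: square_integrable_def)
  show "square_integrable (\<lambda>x. u (t - x))"
    using integral_lborel_reflect(2)[OF i, of t] by (simp add: square_integrable_def)
  show "l2norm (\<lambda>x. u (t - x)) = l2norm u"
    using integral_lborel_reflect(1)[OF i, of t] by (simp add: l2norm_def)
qed

lemma fourier_integral_reflect_cnj:
  assumes "integrable lborel u"
  shows "fourier_integral (\<lambda>x. cnj (u (- x))) \<xi> = cnj (fourier_integral u \<xi>)"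
proof -
  have "(LINT x|lborel. exp (- \<i> * of_real (x \<bullet> - \<xi>)) * u (- x)) = (LINT x|lborel. exp (- \<i> * of_real (x \<bullet> \<xi>)) * u x)"
    using integral_lborel_reflect(1)[OF integrable_fourier_kernel[OF assms, of \<xi>], of 0] by simp
  then have "fourier_integral (\<lambda>x. u (- x)) (- \<xi>) = fourier_integral u \<xi>"
    by (simp add: fourier_integral_def)
  then show ?thesis by (simp add: fourier_integral_cnj)
qed

section \<open>Isometry on integrable, square-integrable functions\<close>

definition gaussian :: "real \<Rightarrow> 'a::euclidean_space \<Rightarrow> complex" where
  "gaussian \<sigma> \<xi> = of_real (exp (- (norm (\<sigma> *\<^sub>R \<xi>))\<^sup>2 / 2))"

lemma gaussian_measurable [measurable]: "gaussian \<sigma> \<in> borel_measurable borel"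
  unfolding gaussian_def by measurable

lemma integrable_gaussian_scaled:
  assumes "\<sigma> > 0" shows "integrable lborel (gaussian \<sigma> :: 'a::euclidean_space \<Rightarrow> complex)"
  using integrable_lborel_affine[OF integrable_gaussian, of \<sigma> "0::'a"] assms
  unfolding gaussian_def by (intro integrable_of_real) simp

text \<open>Dilation exchanges wide and narrow Gaussians: for small \<sigma> the right side is an
  approximate identity, which is how the value at the origin is extracted below.\<close>

lemma fourier_integral_gaussian:
  fixes z :: "'a::euclidean_space"
  assumes "\<sigma> > 0"
  shows "fourier_integral (gaussian \<sigma>) z = of_real (1 / \<sigma> ^ DIM('a)) * gaussian (1 / \<sigma>) z"
proof -
  let ?f = "\<lambda>x::'a. exp (- \<i> * of_real (x \<bullet> ((1 / \<sigma>) *\<^sub>R z))) * of_real (exp (- (norm x)\<^sup>2 / 2))"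
  have i: "integrable lborel ?f"
    by (rule integrable_fourier_kernel) (rule integrable_of_real[OF integrable_gaussian])
  have "(LINT x|lborel. ?f x) = \<sigma> ^ DIM('a) *\<^sub>R (LINT x|lborel. ?f (\<sigma> *\<^sub>R x))"
    using integral_lborel_affine[OF i, of \<sigma> 0] assms by simp
  also have "(LINT x|lborel. ?f (\<sigma> *\<^sub>R x)) = (LINT x|lborel. exp (- \<i> * of_real (x \<bullet> z)) * gaussian \<sigma> x)"
    using assms by (simp add: gaussian_def)
  finally have e: "(LINT x|lborel. exp (- \<i> * of_real (x \<bullet> z)) * gaussian \<sigma> x)
      = (1 / \<sigma> ^ DIM('a)) *\<^sub>R (LINT x|lborel. ?f x)"
    using assms by simp
  show ?thesis
    unfolding fourier_integral_def e integral_gaussian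
    using assms
    by (simp add: gaussian_def scaleR_conv_of_real powr_minus field_simps flip: of_real_mult of_real_divide of_real_power)
qed

text \<open>The autocorrelation R of u has a transform proportional to |F u|^2, and R 0 is the
  square of \<open>l2norm u\<close>. Integrating |F u|^2 against widening Gaussians amounts, by the
  multiplication formula, to averaging R against concentrating ones. One side converges
  monotonically, the other by continuity of R at the origin.\<close>

lemma plancherel_L1_L2:
  fixes u :: "'a::euclidean_space \<Rightarrow> complex"
  assumes u1: "integrable lborel u" and u2: "square_integrable u"
  shows "square_integrable (fourier_integral u)" "l2norm (fourier_integral u) = l2norm u"
proof -
  have [measurable]: "u \<in> borel_measurable borel" using square_integrable_measurable[OF u2] .
  define c where "c = fourier_const TYPE('a)"
  have c: "c > 0" by (simp add: c_def)
  \<comment> \<open>Convolving u with its reflected conjugate gives the autocorrelation, the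
    transform of q being the conjugate of that of u.\<close>
  define q where "q = (\<lambda>y. cnj (u (0 - y)))"
  have qi: "integrable lborel q"
    unfolding q_def using integral_lborel_reflect(2)[OF u1, of 0] by simp
  have q2: "square_integrable q" "l2norm q = l2norm u"
    unfolding q_def using square_integrable_reflect[OF u2, of 0] by simp_all
  define R where "R = fun_convolution u q"
  have R_pair: "R z = l2pair (\<lambda>y. u (z - y)) q" for z
    by (simp add: R_def fun_convolution_def l2pair_def)
  have R_bd: "cmod (R z) \<le> (l2norm u)\<^sup>2" for z
    unfolding R_pair using l2pair_le[OF square_integrable_reflect(1)[OF u2, of z] q2(1)]
    by (simp add: square_integrable_reflect(2)[OF u2] q2(2) power2_eq_square)
  have R0: "R 0 = of_real ((l2norm u)\<^sup>2)"
    using l2norm_sq_pair[of "\<lambda>y. u (0 - y)"] square_integrable_reflect(2)[OF u2, of 0]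
    by (simp add: R_pair q_def)
  \<comment> \<open>Continuity at the origin is inherited from the continuity of translations in L2,
    since R pairs a moving translate with a fixed function.\<close>
  have R_cont: "(\<lambda>k. R (z k)) \<longlonglongrightarrow> R 0" if z: "z \<longlonglongrightarrow> 0" for z :: "nat \<Rightarrow> 'a"
    unfolding R_pair
  proof (rule l2pair_tendsto)
    show "(\<lambda>k. l2norm (\<lambda>x. u (z k - x) - u (0 - x))) \<longlonglongrightarrow> 0"
    proof -
      have "(\<lambda>k. l2norm (\<lambda>x. u (x - (- z k)) - u x)) \<longlonglongrightarrow> 0"
        by (rule translation_tendsto_L2[OF u2]) (use tendsto_minus[OF z] in simp)
      moreover have "l2norm (\<lambda>x. u (z k - x) - u (0 - x)) = l2norm (\<lambda>x. u (x - (- z k)) - u x)" for k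
      proof -
        have "square_integrable (\<lambda>x. u (x - - z k) - u x)"
        proof (rule square_integrable_diff[OF _ u2])
          show "square_integrable (\<lambda>x. u (x - - z k))"
            using u2 integrable_lborel_translate[of "\<lambda>x. (cmod (u x))\<^sup>2" "- z k"] by (simp add: square_integrable_def)
        qed
        from square_integrable_reflect(2)[OF this, of 0] show ?thesis by simp
      qed
      ultimately show ?thesis by simp
    qed
  qed (use square_integrable_reflect(1)[OF u2, of 0] in \<open>simp_all add: square_integrable_reflect(1)[OF u2] q2 l2norm_def\<close>)
  have R_meas [measurable]: "R \<in> borel_measurable borel"
    unfolding R_def using borel_measurable_integrable[OF qi] by measurable
  have Ri: "integrable lborel R" unfolding R_def by (rule integrable_convolution[OF u1 qi])
  have FR: "of_real c * fourier_integral R \<xi> = of_real ((cmod (fourier_integral u \<xi>))\<^sup>2)" for \<xi>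
    using fourier_integral_convolution[OF u1 qi, of \<xi>] fourier_integral_reflect_cnj[OF u1, of \<xi>]
    by (simp add: R_def q_def c_def complex_norm_square del: of_real_power)
  define s where "s k = 1 / (real k + 1)" for k
  have s: "s k > 0" for k by (simp add: s_def)
  have s0: "s \<longlonglongrightarrow> 0"
    unfolding s_def using LIMSEQ_inverse_real_of_nat by (simp add: inverse_eq_divide add.commute)
  \<comment> \<open>Regularised integrals of |F u|^2: finite because the transform is bounded, and
    increasing to the full integral as \<open>s k\<close> decreases to 0.\<close>
  define a where "a k = (LINT \<xi>|lborel. (cmod (fourier_integral u \<xi>))\<^sup>2 * exp (- (norm (s k *\<^sub>R \<xi>))\<^sup>2 / 2))" for k
  have a_eq: "complex_of_real (a k) = of_real c * (LINT w|lborel. R (s k *\<^sub>R w) * gaussian 1 w)" for k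
  proof -
    let ?g = "\<lambda>x. R x * (of_real (1 / s k ^ DIM('a)) * gaussian (1 / s k) x)"
    have "complex_of_real (a k) = (LINT \<xi>|lborel. (of_real c * fourier_integral R \<xi>) * gaussian (s k) \<xi>)"
      unfolding a_def FR gaussian_def by (simp flip: integral_complex_of_real)
    also have "\<dots> = of_real c * l2pair (fourier_integral R) (gaussian (s k))"
      unfolding l2pair_def by (subst integral_mult_right_zero[symmetric]) (simp add: mult.assoc)
    also have "l2pair (fourier_integral R) (gaussian (s k)) = l2pair R (fourier_integral (gaussian (s k)))"
      by (rule fourier_integral_multiplication[OF Ri integrable_gaussian_scaled[OF s]])
    also have "\<dots> = (LINT x|lborel. ?g x)"
      unfolding l2pair_def fourier_integral_gaussian[OF s] ..
    also have "\<dots> = s k ^ DIM('a) *\<^sub>R (LINT x|lborel. ?g (s k *\<^sub>R x))"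
    proof -
      have "integrable lborel ?g"
      proof (rule Bochner_Integration.integrable_bound)
        show "integrable lborel (\<lambda>x. (l2norm u)\<^sup>2 * cmod (of_real (1 / s k ^ DIM('a)) * gaussian (1 / s k) x))"
          by (intro integrable_mult_right integrable_norm integrable_gaussian_scaled) (use s[of k] in simp)
        show "AE x in lborel. norm (?g x) \<le> norm ((l2norm u)\<^sup>2 * cmod (of_real (1 / s k ^ DIM('a)) * gaussian (1 / s k) x))"
          unfolding norm_mult by (intro AE_I2 mult_mono) (auto simp: R_bd)
      qed measurable
      from integral_lborel_affine[OF this, of "s k" 0] s[of k] show ?thesis by simp
    qed
    also have "(LINT x|lborel. ?g (s k *\<^sub>R x)) = (LINT x|lborel. of_real (1 / s k ^ DIM('a)) * (R (s k *\<^sub>R x) * gaussian 1 x))"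
      using s[of k] by (intro Bochner_Integration.integral_cong refl) (simp add: gaussian_def)
    also have "\<dots> = of_real (1 / s k ^ DIM('a)) * (LINT w|lborel. R (s k *\<^sub>R w) * gaussian 1 w)"
      by (rule integral_mult_right_zero)
    also have "s k ^ DIM('a) *\<^sub>R \<dots> = (LINT w|lborel. R (s k *\<^sub>R w) * gaussian 1 w)"
      using s[of k] by (simp add: scaleR_conv_of_real)
    finally show ?thesis .
  qed
  \<comment> \<open>After the substitution x = (s k) w the Gaussian is fixed and R is evaluated at
    points tending to 0, so dominated convergence applies with the uniform bound on R.\<close>
  have "(\<lambda>k. LINT w|lborel. R (s k *\<^sub>R w) * gaussian 1 w) \<longlonglongrightarrow> (LINT w|lborel. R 0 * gaussian 1 (w :: 'a))"
  proof (rule integral_dominated_convergence[where w="\<lambda>w. (l2norm u)\<^sup>2 * cmod (gaussian 1 w)"])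
    show "integrable lborel (\<lambda>w::'a. (l2norm u)\<^sup>2 * cmod (gaussian 1 w))"
      by (intro integrable_mult_right integrable_norm integrable_gaussian_scaled) simp
    show "AE w in lborel. (\<lambda>k. R (s k *\<^sub>R w) * gaussian 1 w) \<longlonglongrightarrow> R 0 * gaussian 1 w"
    proof (intro AE_I2 tendsto_mult tendsto_const R_cont)
      fix w :: 'a
      from tendsto_scaleR[OF s0 tendsto_const[of w]] show "(\<lambda>k. s k *\<^sub>R w) \<longlonglongrightarrow> 0" by simp
    qed
    show "AE w in lborel. norm (R (s k *\<^sub>R w) * gaussian 1 w) \<le> (l2norm u)\<^sup>2 * cmod (gaussian 1 w)" for k
      unfolding norm_mult by (intro AE_I2 mult_mono) (auto simp: R_bd)
  qed measurable
  also have "(LINT w|lborel. R 0 * gaussian 1 (w :: 'a)) = R 0 * (LINT w|lborel. gaussian 1 (w :: 'a))"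
    by (rule integral_mult_right_zero)
  also have "(LINT w|lborel. gaussian 1 (w :: 'a)) = of_real (1 / c)"
    using integral_gaussian[of "0::'a"] by (simp add: gaussian_def c_def powr_minus field_simps)
  finally have "(\<lambda>k. of_real c * (LINT w|lborel. R (s k *\<^sub>R w) * gaussian 1 w)) \<longlonglongrightarrow> of_real c * (R 0 * of_real (1 / c))"
    by (intro tendsto_mult tendsto_const)
  also have "of_real c * (R 0 * of_real (1 / c)) = of_real ((l2norm u)\<^sup>2)"
    using c by (simp add: R0)
  finally have "(\<lambda>k. complex_of_real (a k)) \<longlonglongrightarrow> of_real ((l2norm u)\<^sup>2)" unfolding a_eq .
  then have a_lim: "a \<longlonglongrightarrow> (l2norm u)\<^sup>2" by (simp only: tendsto_of_real_iff)
  \<comment> \<open>Monotone convergence yields the value of the integral together with its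
    finiteness; square integrability of the transform is not known before this point.\<close>
  let ?h = "\<lambda>k \<xi>. ennreal ((cmod (fourier_integral u \<xi>))\<^sup>2 * exp (- (norm (s k *\<^sub>R \<xi>))\<^sup>2 / 2))"
  have "(\<lambda>k. \<integral>\<^sup>+\<xi>. ?h k \<xi> \<partial>lborel) \<longlonglongrightarrow> (\<integral>\<^sup>+\<xi>. ennreal ((cmod (fourier_integral u \<xi>))\<^sup>2) \<partial>lborel)"
  proof (rule nn_integral_LIMSEQ)
    show "incseq ?h"
    proof (intro incseq_SucI le_funI ennreal_leI mult_left_mono)
      fix k and \<xi> :: 'a
      have "norm (s (Suc k) *\<^sub>R \<xi>) \<le> norm (s k *\<^sub>R \<xi>)"
        using s[of k] s[of "Suc k"] by (simp add: mult_right_mono) (simp add: s_def frac_le mult_right_mono)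
      then show "exp (- (norm (s k *\<^sub>R \<xi>))\<^sup>2 / 2) \<le> exp (- (norm (s (Suc k) *\<^sub>R \<xi>))\<^sup>2 / 2)"
        by (simp add: power_mono)
    qed simp
    show "(\<lambda>k. ?h k \<xi>) \<longlonglongrightarrow> ennreal ((cmod (fourier_integral u \<xi>))\<^sup>2)" for \<xi>
    proof -
      from s0 have "(\<lambda>k. (cmod (fourier_integral u \<xi>))\<^sup>2 * exp (- (norm (s k *\<^sub>R \<xi>))\<^sup>2 / 2)) \<longlonglongrightarrow> (cmod (fourier_integral u \<xi>))\<^sup>2 * exp (- (norm (0 *\<^sub>R \<xi>))\<^sup>2 / 2)"
        by (intro tendsto_intros) auto
      then show ?thesis by (intro tendsto_ennrealI) simp
    qed
  qed measurable
  moreover have "(\<integral>\<^sup>+\<xi>. ?h k \<xi> \<partial>lborel) = ennreal (a k)" for k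
    unfolding a_def
  proof (rule nn_integral_eq_integral)
    define M where "M = c * (LINT x|lborel. cmod (u x))"
    have M: "cmod (fourier_integral u \<xi>) \<le> M" for \<xi>
      unfolding M_def c_def by (rule cmod_fourier_integral_le)
    show "integrable lborel (\<lambda>\<xi>. (cmod (fourier_integral u \<xi>))\<^sup>2 * exp (- (norm (s k *\<^sub>R \<xi>))\<^sup>2 / 2))"
    proof (rule Bochner_Integration.integrable_bound)
      show "integrable lborel (\<lambda>\<xi>::'a. M\<^sup>2 * cmod (gaussian (s k) \<xi>))"
        by (intro integrable_mult_right integrable_norm integrable_gaussian_scaled s)
      show "AE \<xi> in lborel. norm ((cmod (fourier_integral u \<xi>))\<^sup>2 * exp (- (norm (s k *\<^sub>R \<xi>))\<^sup>2 / 2)) \<le> norm (M\<^sup>2 * cmod (gaussian (s k) \<xi>))"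
        using M by (intro AE_I2) (auto simp: gaussian_def intro!: mult_right_mono power_mono)
    qed measurable
  qed simp
  ultimately have "(\<lambda>k. ennreal (a k)) \<longlonglongrightarrow> (\<integral>\<^sup>+\<xi>. ennreal ((cmod (fourier_integral u \<xi>))\<^sup>2) \<partial>lborel)"
    by simp
  from LIMSEQ_unique[OF this tendsto_ennrealI[OF a_lim]]
  have e: "(\<integral>\<^sup>+\<xi>. ennreal ((cmod (fourier_integral u \<xi>))\<^sup>2) \<partial>lborel) = ennreal ((l2norm u)\<^sup>2)" .
  have Fm: "fourier_integral u \<in> borel_measurable borel" by measurable
  show sq: "square_integrable (fourier_integral u)" using l2norm_le_nn[OF Fm, of "l2norm u"] e by simp
  show "l2norm (fourier_integral u) = l2norm u"
    using nn_integral_cmod_sq[OF sq] e by simp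
qed

section \<open>Extension of the transform to L2\<close>

lemma truncate_fourier:
  assumes "square_integrable u"
  shows "square_integrable (fourier_integral (truncate_ball k u))"
    "l2norm (\<lambda>\<xi>. fourier_integral (truncate_ball m u) \<xi> - fourier_integral (truncate_ball n u) \<xi>)
      = l2norm (\<lambda>x. truncate_ball m u x - truncate_ball n u x)"
proof -
  note i = integrable_truncate_ball[OF assms] and s = square_integrable_truncate_ball[OF assms]
  show "square_integrable (fourier_integral (truncate_ball k u))"
    by (rule plancherel_L1_L2(1)[OF i s])
  have "l2norm (fourier_integral (\<lambda>x. truncate_ball m u x - truncate_ball n u x)) = l2norm (\<lambda>x. truncate_ball m u x - truncate_ball n u x)"
    using i s by (intro plancherel_L1_L2 Bochner_Integration.integrable_diff square_integrable_diff)
  then show "l2norm (\<lambda>\<xi>. fourier_integral (truncate_ball m u) \<xi> - fourier_integral (truncate_ball n u) \<xi>)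
      = l2norm (\<lambda>x. truncate_ball m u x - truncate_ball n u x)"
    unfolding fourier_integral_diff[OF i i, abs_def] .
qed

text \<open>Restates the defining convergence, given by extended nonnegative integrals, through
  \<open>l2norm\<close>; the two agree because all functions involved are square integrable.\<close>

lemma has_fourier_L2_iff:
  "has_fourier_L2 u g \<longleftrightarrow> square_integrable u \<and> square_integrable g \<and>
     (\<lambda>k. l2norm (\<lambda>\<xi>. fourier_integral (truncate_ball k u) \<xi> - g \<xi>)) \<longlonglongrightarrow> 0"
proof (cases "square_integrable u \<and> square_integrable g")
  case True
  have eq: "(\<integral>\<^sup>+ \<xi>. ennreal ((cmod (fourier_integral (\<lambda>x. indicator (cball 0 (real k)) x * u x) \<xi> - g \<xi>))\<^sup>2) \<partial>lborel)
     = ennreal ((l2norm (\<lambda>\<xi>. fourier_integral (truncate_ball k u) \<xi> - g \<xi>))\<^sup>2)" for k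
    using nn_integral_cmod_sq[of "\<lambda>\<xi>. fourier_integral (truncate_ball k u) \<xi> - g \<xi>"] True
    by (simp add: truncate_ball_def[symmetric] square_integrable_diff truncate_fourier)
  have "(\<lambda>k. ennreal ((l2norm (\<lambda>\<xi>. fourier_integral (truncate_ball k u) \<xi> - g \<xi>))\<^sup>2)) \<longlonglongrightarrow> 0
    \<longleftrightarrow> (\<lambda>k. (l2norm (\<lambda>\<xi>. fourier_integral (truncate_ball k u) \<xi> - g \<xi>))\<^sup>2) \<longlonglongrightarrow> 0"
    by (rule ennreal_tendsto_0_iff) simp
  also have "\<dots> \<longleftrightarrow> (\<lambda>k. l2norm (\<lambda>\<xi>. fourier_integral (truncate_ball k u) \<xi> - g \<xi>)) \<longlonglongrightarrow> 0"
  proof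
    assume "(\<lambda>k. (l2norm (\<lambda>\<xi>. fourier_integral (truncate_ball k u) \<xi> - g \<xi>))\<^sup>2) \<longlonglongrightarrow> 0"
    from tendsto_real_sqrt[OF this]
    show "(\<lambda>k. l2norm (\<lambda>\<xi>. fourier_integral (truncate_ball k u) \<xi> - g \<xi>)) \<longlonglongrightarrow> 0" by simp
  next
    assume "(\<lambda>k. l2norm (\<lambda>\<xi>. fourier_integral (truncate_ball k u) \<xi> - g \<xi>)) \<longlonglongrightarrow> 0"
    from tendsto_power[OF this, of 2]
    show "(\<lambda>k. (l2norm (\<lambda>\<xi>. fourier_integral (truncate_ball k u) \<xi> - g \<xi>))\<^sup>2) \<longlonglongrightarrow> 0" by simp
  qed
  finally show ?thesis using True unfolding has_fourier_L2_def eq by simp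
qed (auto simp: has_fourier_L2_def)

text \<open>The transforms of the truncations form a Cauchy sequence, their distances being those of
  the truncations themselves, and L2 is complete.\<close>

lemma has_fourier_L2_exists:
  assumes u: "square_integrable u" shows "\<exists>g. has_fourier_L2 u g"
proof -
  have "\<exists>g. square_integrable g \<and> (\<lambda>k. l2norm (\<lambda>\<xi>. fourier_integral (truncate_ball k u) \<xi> - g \<xi>)) \<longlonglongrightarrow> 0"
  proof (rule l2_complete)
    show "square_integrable (fourier_integral (truncate_ball k u))" for k by (rule truncate_fourier[OF u])
    fix e :: real assume "e > 0"
    then obtain N where N: "\<And>k. k \<ge> N \<Longrightarrow> l2norm (\<lambda>x. truncate_ball k u x - u x) < e / 2"
      using LIMSEQ_D[OF truncate_ball_tendsto[OF u], of "e/2"] by auto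
    have "l2norm (\<lambda>x. truncate_ball m u x - truncate_ball n u x) < e" if "m \<ge> N" "n \<ge> N" for m n
      using l2norm_triangle_diff[OF square_integrable_truncate_ball[OF u, of m] u square_integrable_truncate_ball[OF u, of n]]
        N[OF that(1)] N[OF that(2)] l2norm_minus_commute[of u "truncate_ball n u"] by simp
    then show "\<exists>N. \<forall>m\<ge>N. \<forall>n\<ge>N. l2norm (\<lambda>\<xi>. fourier_integral (truncate_ball m u) \<xi> - fourier_integral (truncate_ball n u) \<xi>) < e"
      unfolding truncate_fourier[OF u] by blast
  qed
  then show ?thesis using u by (auto simp: has_fourier_L2_iff)
qed

lemma has_fourier_L2_fourier_L2: "square_integrable u \<Longrightarrow> has_fourier_L2 u (fourier_L2 u)"
  unfolding fourier_L2_def by (rule someI_ex[OF has_fourier_L2_exists])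

lemma has_fourier_L2_square_integrable:
  "has_fourier_L2 u g \<Longrightarrow> square_integrable u" "has_fourier_L2 u g \<Longrightarrow> square_integrable g"
  by (simp_all add: has_fourier_L2_def)

lemma square_integrable_fourier_L2: "square_integrable u \<Longrightarrow> square_integrable (fourier_L2 u)"
  using has_fourier_L2_fourier_L2 has_fourier_L2_square_integrable by blast

lemma has_fourier_L2_unique:
  assumes "has_fourier_L2 u g" "has_fourier_L2 u h" shows "ae_eq g h"
  using assms by (intro l2norm_limit_unique[of "\<lambda>k. fourier_integral (truncate_ball k u)"])
    (auto simp: has_fourier_L2_iff truncate_fourier)

text \<open>The truncations and their transforms have equal norms at every stage, and both sequences
  converge in L2.\<close>

lemma has_fourier_L2_norm:
  assumes "has_fourier_L2 u g" shows "l2norm g = l2norm u"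
proof -
  have u: "square_integrable u" "square_integrable g"
    and lim: "(\<lambda>k. l2norm (\<lambda>\<xi>. fourier_integral (truncate_ball k u) \<xi> - g \<xi>)) \<longlonglongrightarrow> 0"
    using assms by (simp_all add: has_fourier_L2_iff)
  have "(\<lambda>k. l2norm (fourier_integral (truncate_ball k u))) \<longlonglongrightarrow> l2norm g"
    by (rule l2norm_tendsto[OF truncate_fourier(1)[OF u(1)] u(2) lim])
  moreover have "l2norm (fourier_integral (truncate_ball k u)) = l2norm (truncate_ball k u)" for k
    by (rule plancherel_L1_L2[OF integrable_truncate_ball[OF u(1)] square_integrable_truncate_ball[OF u(1)]])
  moreover have "(\<lambda>k. l2norm (truncate_ball k u)) \<longlonglongrightarrow> l2norm u"
    by (rule l2norm_tendsto[OF square_integrable_truncate_ball[OF u(1)] u(1) truncate_ball_tendsto[OF u(1)]])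
  ultimately show ?thesis using LIMSEQ_unique by simp
qed

lemma has_fourier_L2_cmult:
  assumes "has_fourier_L2 u g" shows "has_fourier_L2 (\<lambda>x. c * u x) (\<lambda>\<xi>. c * g \<xi>)"
proof -
  have "truncate_ball k (\<lambda>x. c * u x) = (\<lambda>x. c * truncate_ball k u x)" for k
    by (auto simp: truncate_ball_def)
  then have e: "l2norm (\<lambda>\<xi>. fourier_integral (truncate_ball k (\<lambda>x. c * u x)) \<xi> - c * g \<xi>)
     = cmod c * l2norm (\<lambda>\<xi>. fourier_integral (truncate_ball k u) \<xi> - g \<xi>)" for k
    by (simp add: fourier_integral_cmult l2norm_cmult flip: right_diff_distrib)
  have "(\<lambda>k. cmod c * l2norm (\<lambda>\<xi>. fourier_integral (truncate_ball k u) \<xi> - g \<xi>)) \<longlonglongrightarrow> cmod c * 0"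
    using assms by (intro tendsto_intros) (simp add: has_fourier_L2_iff)
  then show ?thesis using assms by (simp add: has_fourier_L2_iff square_integrable_cmult e)
qed

lemma has_fourier_L2_add:
  assumes "has_fourier_L2 u g" "has_fourier_L2 v h"
  shows "has_fourier_L2 (\<lambda>x. u x + v x) (\<lambda>\<xi>. g \<xi> + h \<xi>)"
proof -
  have s: "square_integrable u" "square_integrable g" "square_integrable v" "square_integrable h"
    using assms by (simp_all add: has_fourier_L2_iff)
  have t: "truncate_ball k (\<lambda>x. u x + v x) = (\<lambda>x. truncate_ball k u x + truncate_ball k v x)" for k
    by (auto simp: truncate_ball_def distrib_left)
  have e: "(\<lambda>\<xi>. fourier_integral (truncate_ball k (\<lambda>x. u x + v x)) \<xi> - (g \<xi> + h \<xi>))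
     = (\<lambda>\<xi>. (fourier_integral (truncate_ball k u) \<xi> - g \<xi>) + (fourier_integral (truncate_ball k v) \<xi> - h \<xi>))" for k
    unfolding t by (intro ext) (simp add: fourier_integral_add integrable_truncate_ball s)
  have "(\<lambda>k. l2norm (\<lambda>\<xi>. fourier_integral (truncate_ball k (\<lambda>x. u x + v x)) \<xi> - (g \<xi> + h \<xi>))) \<longlonglongrightarrow> 0"
  proof (rule Lim_null_comparison)
    show "\<forall>\<^sub>F k in sequentially. norm (l2norm (\<lambda>\<xi>. fourier_integral (truncate_ball k (\<lambda>x. u x + v x)) \<xi> - (g \<xi> + h \<xi>)))
      \<le> l2norm (\<lambda>\<xi>. fourier_integral (truncate_ball k u) \<xi> - g \<xi>) + l2norm (\<lambda>\<xi>. fourier_integral (truncate_ball k v) \<xi> - h \<xi>)"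
      unfolding e using s by (auto intro!: always_eventually l2norm_triangle square_integrable_diff truncate_fourier)
    show "(\<lambda>k. l2norm (\<lambda>\<xi>. fourier_integral (truncate_ball k u) \<xi> - g \<xi>) + l2norm (\<lambda>\<xi>. fourier_integral (truncate_ball k v) \<xi> - h \<xi>)) \<longlonglongrightarrow> 0"
      by (rule tendsto_add_zero) (use assms in \<open>simp_all add: has_fourier_L2_iff\<close>)
  qed
  then show ?thesis using s by (simp add: has_fourier_L2_iff square_integrable_add)
qed

lemma has_fourier_L2_diff:
  assumes "has_fourier_L2 u g" "has_fourier_L2 v h"
  shows "has_fourier_L2 (\<lambda>x. u x - v x) (\<lambda>\<xi>. g \<xi> - h \<xi>)"
  using has_fourier_L2_add[OF assms(1) has_fourier_L2_cmult[OF assms(2), of "-1"]] by simp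

text \<open>Almost everywhere equality does not preserve Borel measurability, so the latter is a
  separate premise, here and in the later congruence rules.\<close>

lemma has_fourier_L2_cong_left:
  assumes "has_fourier_L2 u g" "ae_eq u v" "v \<in> borel_measurable borel"
  shows "has_fourier_L2 v g"
proof -
  have u: "square_integrable u" using assms by (simp add: has_fourier_L2_iff)
  have v: "square_integrable v"
    by (rule square_integrable_bound(1)[OF u assms(3), of 1]) (use assms(2) in \<open>auto simp: ae_eq_def\<close>)
  have "fourier_integral (truncate_ball k u) \<xi> = fourier_integral (truncate_ball k v) \<xi>" for k \<xi>
  proof -
    have [measurable]: "u \<in> borel_measurable borel" "v \<in> borel_measurable borel"
      using u v square_integrable_measurable by auto
    have "(LINT x|lborel. exp (- \<i> * of_real (x \<bullet> \<xi>)) * truncate_ball k u x) = (LINT x|lborel. exp (- \<i> * of_real (x \<bullet> \<xi>)) * truncate_ball k v x)"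
    proof (rule integral_cong_AE)
      show "AE x in lborel. exp (- \<i> * of_real (x \<bullet> \<xi>)) * truncate_ball k u x = exp (- \<i> * of_real (x \<bullet> \<xi>)) * truncate_ball k v x"
        using assms(2) unfolding ae_eq_def by eventually_elim (simp add: truncate_ball_def)
    qed measurable
    then show ?thesis by (simp add: fourier_integral_def)
  qed
  then have "fourier_integral (truncate_ball k u) = fourier_integral (truncate_ball k v)" for k by auto
  then show ?thesis using assms(1) v by (simp add: has_fourier_L2_iff)
qed

lemma has_fourier_L2_cong_right:
  assumes "has_fourier_L2 u g" "ae_eq g h" "h \<in> borel_measurable borel"
  shows "has_fourier_L2 u h"
proof -
  have s: "square_integrable u" "square_integrable g" using assms by (simp_all add: has_fourier_L2_iff)
  have h: "square_integrable h"
    by (rule square_integrable_bound(1)[OF s(2) assms(3), of 1]) (use assms(2) in \<open>auto simp: ae_eq_def\<close>)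
  have "l2norm (\<lambda>\<xi>. fourier_integral (truncate_ball k u) \<xi> - g \<xi>) = l2norm (\<lambda>\<xi>. fourier_integral (truncate_ball k u) \<xi> - h \<xi>)" for k
    by (rule l2norm_cong)
       (use assms(2) square_integrable_diff[OF truncate_fourier(1)[OF s(1)] s(2), THEN square_integrable_measurable]
         square_integrable_diff[OF truncate_fourier(1)[OF s(1)] h, THEN square_integrable_measurable] in \<open>auto simp: ae_eq_def\<close>)
  then show ?thesis using assms(1) s h by (simp add: has_fourier_L2_iff)
qed

text \<open>The isometry, applied to the difference of the truncation and u, which is both
  integrable and square integrable, identifies the limit.\<close>

lemma has_fourier_L2_integral:
  assumes u1: "integrable lborel u" and u2: "square_integrable u"
  shows "has_fourier_L2 u (fourier_integral u)"
proof -
  have "l2norm (\<lambda>\<xi>. fourier_integral (truncate_ball k u) \<xi> - fourier_integral u \<xi>) = l2norm (\<lambda>x. truncate_ball k u x - u x)" for k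
  proof -
    note i = integrable_truncate_ball[OF u2, of k]
    have "l2norm (fourier_integral (\<lambda>x. truncate_ball k u x - u x)) = l2norm (\<lambda>x. truncate_ball k u x - u x)"
      by (intro plancherel_L1_L2 Bochner_Integration.integrable_diff i u1 square_integrable_diff
          square_integrable_truncate_ball u2)
    then show ?thesis unfolding fourier_integral_diff[OF i u1, abs_def] .
  qed
  then show ?thesis
    using u2 truncate_ball_tendsto[OF u2] plancherel_L1_L2(1)[OF u1 u2] by (simp add: has_fourier_L2_iff)
qed

lemma has_fourier_L2_cnj:
  assumes "has_fourier_L2 u g" shows "has_fourier_L2 (\<lambda>x. cnj (u x)) (\<lambda>\<xi>. cnj (g (- \<xi>)))"
proof -
  have s: "square_integrable u" "square_integrable g" using assms by (simp_all add: has_fourier_L2_iff)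
  have g': "square_integrable (\<lambda>\<xi>. cnj (g (- \<xi>)))"
    using square_integrable_reflect(1)[OF s(2), of 0] by simp
  have "truncate_ball k (\<lambda>x. cnj (u x)) = (\<lambda>x. cnj (truncate_ball k u x))" for k
    by (auto simp: truncate_ball_def indicator_def)
  then have "l2norm (\<lambda>\<xi>. fourier_integral (truncate_ball k (\<lambda>x. cnj (u x))) \<xi> - cnj (g (- \<xi>)))
     = l2norm (\<lambda>\<xi>. fourier_integral (truncate_ball k u) \<xi> - g \<xi>)" for k
    using square_integrable_reflect(2)[OF square_integrable_diff[OF truncate_fourier(1)[OF s(1), of k] s(2)], of 0]
    by (simp add: fourier_integral_cnj flip: complex_cnj_diff)
  then show ?thesis using assms g' s by (simp add: has_fourier_L2_iff)
qed

text \<open>Both sides are limits of the identity for truncations, the pairing being continuous in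
  its two arguments jointly.\<close>

lemma has_fourier_L2_multiplication:
  assumes u: "has_fourier_L2 u g" and v: "has_fourier_L2 v h"
  shows "l2pair g v = l2pair u h"
proof (rule LIMSEQ_unique)
  have s: "square_integrable u" "square_integrable g" "square_integrable v" "square_integrable h"
    using assms by (simp_all add: has_fourier_L2_iff)
  note t = truncate_fourier(1) square_integrable_truncate_ball truncate_ball_tendsto
  show "(\<lambda>k. l2pair (fourier_integral (truncate_ball k u)) (truncate_ball k v)) \<longlonglongrightarrow> l2pair g v"
    using u v by (intro l2pair_tendsto t s) (simp add: has_fourier_L2_iff)
  have "(\<lambda>k. l2pair (truncate_ball k u) (fourier_integral (truncate_ball k v))) \<longlonglongrightarrow> l2pair u h"
    using u v by (intro l2pair_tendsto t s) (simp add: has_fourier_L2_iff)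
  then show "(\<lambda>k. l2pair (fourier_integral (truncate_ball k u)) (truncate_ball k v)) \<longlonglongrightarrow> l2pair u h"
    by (simp add: fourier_integral_multiplication integrable_truncate_ball s)
qed

text \<open>
  The inverse transform is \<^term>\<open>\<lambda>g. cnj \<circ> fourier_L2 (cnj \<circ> g)\<close>, by expanding
  the square of the norm of the difference.
\<close>

lemma has_fourier_L2_inversion:
  assumes h: "has_fourier_L2 (\<lambda>\<xi>. cnj (g \<xi>)) h"
  shows "has_fourier_L2 (\<lambda>x. cnj (h x)) g"
proof -
  have sh: "square_integrable (\<lambda>x. cnj (h x))" and sg': "square_integrable (\<lambda>\<xi>. cnj (g \<xi>))"
    using h by (simp_all add: has_fourier_L2_iff)
  have sg: "square_integrable g" using square_integrable_cnj[OF sg'] by simp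
  obtain f where f: "has_fourier_L2 (\<lambda>x. cnj (h x)) f" using has_fourier_L2_exists[OF sh] by blast
  have sf: "square_integrable f" using f by (simp add: has_fourier_L2_iff)
  have n: "l2norm f = l2norm h" "l2norm h = l2norm g"
    using has_fourier_L2_norm[OF f] has_fourier_L2_norm[OF h] by simp_all
  have "l2pair f (\<lambda>\<xi>. cnj (g \<xi>)) = l2pair (\<lambda>x. cnj (h x)) h"
    by (rule has_fourier_L2_multiplication[OF f h])
  also have "\<dots> = of_real ((l2norm h)\<^sup>2)"
    by (simp only: l2norm_sq_pair l2pair_commute)
  finally have "(l2norm (\<lambda>x. f x - g x))\<^sup>2 = 0"
    using l2norm_diff_sq[OF sf sg] n by simp
  then have "ae_eq f g"
    using l2norm_eq_0_iff[OF square_integrable_diff[OF sf sg]] by (simp add: ae_eq_def)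
  from has_fourier_L2_cong_right[OF f this] square_integrable_measurable[OF sg]
  show ?thesis by simp
qed

lemma has_fourier_L2_surj:
  assumes "square_integrable g" shows "\<exists>w. has_fourier_L2 w g"
  using has_fourier_L2_exists[OF square_integrable_cnj[OF assms]] has_fourier_L2_inversion by blast

text \<open>By linearity and the isometry. Operator identities below are typically proved by
  comparing transforms and then applying this.\<close>

lemma has_fourier_L2_inj:
  assumes "has_fourier_L2 u g" "has_fourier_L2 v h" "ae_eq g h"
  shows "ae_eq u v"
proof -
  have "has_fourier_L2 (\<lambda>x. u x - v x) (\<lambda>\<xi>. g \<xi> - h \<xi>)" by (rule has_fourier_L2_diff[OF assms(1,2)])
  then have "l2norm (\<lambda>x. u x - v x) = l2norm (\<lambda>\<xi>. g \<xi> - h \<xi>)" "square_integrable (\<lambda>\<xi>. g \<xi> - h \<xi>)" "square_integrable (\<lambda>x. u x - v x)"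
    by (auto simp: has_fourier_L2_norm[symmetric] has_fourier_L2_iff)
  then show ?thesis using assms(3) l2norm_eq_0_iff[of "\<lambda>\<xi>. g \<xi> - h \<xi>"] l2norm_eq_0_iff[of "\<lambda>x. u x - v x"]
    by (simp add: ae_eq_def)
qed

text \<open>Carries the square root of the weight in the Sobolev norm, so that this norm is the L2
  norm of a weighted transform and the L2 theory transfers. Negative orders are allowed; they undo
  the weight.\<close>

definition weighted :: "real \<Rightarrow> ('a::euclidean_space \<Rightarrow> complex) \<Rightarrow> 'a \<Rightarrow> complex" where
  "weighted \<sigma> g \<xi> = of_real ((1 + (norm \<xi>)\<^sup>2) powr (\<sigma> / 2)) * g \<xi>"

lemma weighted_measurable [measurable]:
  assumes [measurable]: "g \<in> borel_measurable borel"
  shows "weighted \<sigma> g \<in> borel_measurable borel"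
  unfolding weighted_def by measurable

lemma one_le_weight: "1 \<le> 1 + (norm \<xi>)\<^sup>2" by simp

lemma cmod_weighted: "cmod (weighted \<sigma> g \<xi>) = (1 + (norm \<xi>)\<^sup>2) powr (\<sigma> / 2) * cmod (g \<xi>)"
  by (simp add: weighted_def norm_mult)

lemma cmod_weighted_sq: "(cmod (weighted \<sigma> g \<xi>))\<^sup>2 = (1 + (norm \<xi>)\<^sup>2) powr \<sigma> * (cmod (g \<xi>))\<^sup>2"
proof -
  have "((1 + (norm \<xi>)\<^sup>2) powr (\<sigma> / 2))\<^sup>2 = (1 + (norm \<xi>)\<^sup>2) powr \<sigma>"
    by (simp add: power2_eq_square flip: powr_add)
  then show ?thesis by (simp add: cmod_weighted power_mult_distrib)
qed

lemma cmod_weighted_mono: "\<sigma> \<le> \<rho> \<Longrightarrow> cmod (weighted \<sigma> g \<xi>) \<le> cmod (weighted \<rho> g \<xi>)"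
  unfolding cmod_weighted by (intro mult_right_mono powr_mono) auto

lemma cmod_le_weighted: "0 \<le> \<sigma> \<Longrightarrow> cmod (g \<xi>) \<le> cmod (weighted \<sigma> g \<xi>)"
  using cmod_weighted_mono[of 0 \<sigma> g \<xi>] by (simp add: weighted_def add_nonneg_eq_0_iff)

lemma weighted_add: "weighted \<sigma> (\<lambda>\<xi>. f \<xi> + g \<xi>) = (\<lambda>\<xi>. weighted \<sigma> f \<xi> + weighted \<sigma> g \<xi>)"
  by (auto simp: weighted_def distrib_left)

lemma weighted_diff: "weighted \<sigma> (\<lambda>\<xi>. f \<xi> - g \<xi>) = (\<lambda>\<xi>. weighted \<sigma> f \<xi> - weighted \<sigma> g \<xi>)"
  by (auto simp: weighted_def right_diff_distrib)

lemma weighted_cmult: "weighted \<sigma> (\<lambda>\<xi>. c * f \<xi>) = (\<lambda>\<xi>. c * weighted \<sigma> f \<xi>)"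
  by (auto simp: weighted_def)

lemma weighted_mult: "weighted \<sigma> (\<lambda>\<xi>. m \<xi> * f \<xi>) = (\<lambda>\<xi>. m \<xi> * weighted \<sigma> f \<xi>)"
  by (auto simp: weighted_def)

text \<open>Minkowski under pointwise domination: in the stability estimate a transform is bounded
  by the sum of two moduli.\<close>

lemma l2norm_le_add:
  assumes "square_integrable f" "square_integrable g" "h \<in> borel_measurable borel"
    and "AE x in lborel. cmod (h x) \<le> cmod (f x) + cmod (g x)"
  shows "square_integrable h" "l2norm h \<le> l2norm f + l2norm g"
proof -
  have [measurable]: "f \<in> borel_measurable borel" "g \<in> borel_measurable borel"
    using assms(1,2)[THEN square_integrable_measurable] by simp_all
  have s: "square_integrable (\<lambda>x. complex_of_real (cmod (f x)))" "square_integrable (\<lambda>x. complex_of_real (cmod (g x)))"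
    using assms(1,2) by (simp_all add: square_integrable_def)
  have n: "l2norm (\<lambda>x. complex_of_real (cmod (f x))) = l2norm f" "l2norm (\<lambda>x. complex_of_real (cmod (g x))) = l2norm g"
    by (simp_all add: l2norm_def)
  have ae: "AE x in lborel. cmod (h x) \<le> 1 * cmod (complex_of_real (cmod (f x)) + complex_of_real (cmod (g x)))"
    using assms(4) by eventually_elim (simp flip: of_real_add)
  show "square_integrable h" using square_integrable_bound(1)[OF square_integrable_add[OF s] assms(3) ae] by simp
  have "l2norm h \<le> l2norm (\<lambda>x. complex_of_real (cmod (f x)) + complex_of_real (cmod (g x)))"
    using square_integrable_bound(2)[OF square_integrable_add[OF s] assms(3) ae] by simp
  also have "\<dots> \<le> l2norm f + l2norm g" using l2norm_triangle[OF s] by (simp add: n)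
  finally show "l2norm h \<le> l2norm f + l2norm g" .
qed

lemma ae_eq_refl [simp]: "ae_eq u u" by (simp add: ae_eq_def)

lemma ae_eq_sym: "ae_eq u v \<Longrightarrow> ae_eq v u" by (auto simp: ae_eq_def)

subsection \<open>Sobolev spaces\<close>

lemma sobolev_iff_weighted:
  "u \<in> sobolev \<sigma> \<longleftrightarrow> square_integrable u \<and> square_integrable (weighted \<sigma> (fourier_L2 u))"
  using square_integrable_measurable[OF square_integrable_fourier_L2, of u]
  by (auto simp: sobolev_def square_integrable_def[of "weighted \<sigma> (fourier_L2 u)"] cmod_weighted_sq)

lemma sobolev_norm_weighted: "sobolev_norm \<sigma> u = l2norm (weighted \<sigma> (fourier_L2 u))"
  by (simp add: sobolev_norm_def l2norm_def cmod_weighted_sq)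

lemma sobolev_norm_nonneg [simp]: "0 \<le> sobolev_norm \<sigma> u"
  by (simp add: sobolev_norm_weighted)

lemma sobolev_square_integrable: "u \<in> sobolev \<sigma> \<Longrightarrow> square_integrable u"
  by (simp add: sobolev_iff_weighted)

lemma sobolev_measurable: "u \<in> sobolev \<sigma> \<Longrightarrow> u \<in> borel_measurable borel"
  using sobolev_square_integrable square_integrable_measurable by blast

lemma has_fourier_sobolev: "u \<in> sobolev \<sigma> \<Longrightarrow> has_fourier_L2 u (fourier_L2 u)"
  by (simp add: sobolev_square_integrable has_fourier_L2_fourier_L2)

lemma weighted_ae_cong: "ae_eq f g \<Longrightarrow> ae_eq (weighted \<sigma> f) (weighted \<sigma> g)"
  unfolding ae_eq_def weighted_def by auto

lemma square_integrable_ae_cong: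
  assumes "ae_eq f g" "square_integrable f" "g \<in> borel_measurable borel"
  shows "square_integrable g" "l2norm g = l2norm f"
proof -
  show "square_integrable g"
    by (rule square_integrable_bound(1)[OF assms(2,3), of 1]) (use assms(1) in \<open>auto simp: ae_eq_def\<close>)
  show "l2norm g = l2norm f"
    by (rule l2norm_cong) (use assms square_integrable_measurable[OF assms(2)] in \<open>auto simp: ae_eq_def\<close>)
qed

text \<open>Membership and norm may be computed from any transform g of u, since
  \<open>fourier_L2 u\<close> is just one choice among functions equal almost everywhere;
  \<open>sobolevD\<close> goes the other way.\<close>

lemma sobolevI:
  assumes "has_fourier_L2 u g" "square_integrable (weighted \<sigma> g)"
  shows "u \<in> sobolev \<sigma>" "sobolev_norm \<sigma> u = l2norm (weighted \<sigma> g)"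
proof -
  have u: "square_integrable u" using assms(1) by (simp add: has_fourier_L2_iff)
  have e: "ae_eq (weighted \<sigma> g) (weighted \<sigma> (fourier_L2 u))"
    using has_fourier_L2_unique[OF assms(1) has_fourier_L2_fourier_L2[OF u]] by (rule weighted_ae_cong)
  have [measurable]: "fourier_L2 u \<in> borel_measurable borel"
    using square_integrable_measurable[OF square_integrable_fourier_L2[OF u]] .
  have m: "weighted \<sigma> (fourier_L2 u) \<in> borel_measurable borel" by measurable
  show "u \<in> sobolev \<sigma>" "sobolev_norm \<sigma> u = l2norm (weighted \<sigma> g)"
    using square_integrable_ae_cong[OF e assms(2) m] u
    by (simp_all add: sobolev_iff_weighted sobolev_norm_weighted)
qed

lemma sobolevD:
  assumes "u \<in> sobolev \<sigma>" "has_fourier_L2 u g"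
  shows "square_integrable (weighted \<sigma> g)" "sobolev_norm \<sigma> u = l2norm (weighted \<sigma> g)"
proof -
  have u: "square_integrable u" "square_integrable (weighted \<sigma> (fourier_L2 u))"
    using assms(1) by (simp_all add: sobolev_iff_weighted)
  have e: "ae_eq (weighted \<sigma> (fourier_L2 u)) (weighted \<sigma> g)"
    using has_fourier_L2_unique[OF has_fourier_L2_fourier_L2[OF u(1)] assms(2)] by (rule weighted_ae_cong)
  have [measurable]: "g \<in> borel_measurable borel"
    using assms(2) square_integrable_measurable by (auto simp: has_fourier_L2_iff)
  have m: "weighted \<sigma> g \<in> borel_measurable borel" by measurable
  show "square_integrable (weighted \<sigma> g)" "sobolev_norm \<sigma> u = l2norm (weighted \<sigma> g)"
    using square_integrable_ae_cong[OF e u(2) m] by (simp_all add: sobolev_norm_weighted)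
qed

lemma sobolev_cong_ae:
  assumes "u \<in> sobolev \<sigma>" "ae_eq u v" "v \<in> borel_measurable borel"
  shows "v \<in> sobolev \<sigma>" "sobolev_norm \<sigma> v = sobolev_norm \<sigma> u"
  using sobolevI[OF has_fourier_L2_cong_left[OF has_fourier_sobolev[OF assms(1)] assms(2,3)] sobolevD(1)[OF assms(1) has_fourier_sobolev[OF assms(1)]]]
  by (simp_all add: sobolev_norm_weighted)

lemma sobolev_add:
  assumes "u \<in> sobolev \<sigma>" "v \<in> sobolev \<sigma>"
  shows "(\<lambda>x. u x + v x) \<in> sobolev \<sigma>" "sobolev_norm \<sigma> (\<lambda>x. u x + v x) \<le> sobolev_norm \<sigma> u + sobolev_norm \<sigma> v"
proof -
  note h = has_fourier_sobolev[OF assms(1)] has_fourier_sobolev[OF assms(2)]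
  note s = sobolevD(1)[OF assms(1) h(1)] sobolevD(1)[OF assms(2) h(2)]
  note I = sobolevI[OF has_fourier_L2_add[OF h], of \<sigma>, unfolded weighted_add, OF square_integrable_add[OF s]]
  show "(\<lambda>x. u x + v x) \<in> sobolev \<sigma>" by (rule I)
  show "sobolev_norm \<sigma> (\<lambda>x. u x + v x) \<le> sobolev_norm \<sigma> u + sobolev_norm \<sigma> v"
    by (simp only: I(2) sobolev_norm_weighted[of \<sigma> u] sobolev_norm_weighted[of \<sigma> v] l2norm_triangle[OF s])
qed

lemma sobolev_cmult:
  assumes "u \<in> sobolev \<sigma>"
  shows "(\<lambda>x. c * u x) \<in> sobolev \<sigma>" "sobolev_norm \<sigma> (\<lambda>x. c * u x) = cmod c * sobolev_norm \<sigma> u"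
proof -
  note h = has_fourier_sobolev[OF assms(1)]
  note s = sobolevD(1)[OF assms(1) h(1)]
  note I = sobolevI[OF has_fourier_L2_cmult[OF h], of \<sigma>, unfolded weighted_cmult, OF square_integrable_cmult[OF s]]
  show "(\<lambda>x. c * u x) \<in> sobolev \<sigma>" by (rule I)
  show "sobolev_norm \<sigma> (\<lambda>x. c * u x) = cmod c * sobolev_norm \<sigma> u"
    by (simp only: I(2) sobolev_norm_weighted[of \<sigma> u] l2norm_cmult)
qed

lemma sobolev_uminus:
  assumes "u \<in> sobolev \<sigma>"
  shows "(\<lambda>x. - u x) \<in> sobolev \<sigma>" "sobolev_norm \<sigma> (\<lambda>x. - u x) = sobolev_norm \<sigma> u"
  using sobolev_cmult[OF assms, of "-1"] by simp_all

lemma sobolev_diff: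
  assumes "u \<in> sobolev \<sigma>" "v \<in> sobolev \<sigma>"
  shows "(\<lambda>x. u x - v x) \<in> sobolev \<sigma>" "sobolev_norm \<sigma> (\<lambda>x. u x - v x) \<le> sobolev_norm \<sigma> u + sobolev_norm \<sigma> v"
  using sobolev_add[OF assms(1) sobolev_uminus(1)[OF assms(2)]] sobolev_uminus(2)[OF assms(2)] by simp_all

lemma sobolev_norm_minus_commute:
  assumes "u \<in> sobolev \<sigma>" "v \<in> sobolev \<sigma>"
  shows "sobolev_norm \<sigma> (\<lambda>x. u x - v x) = sobolev_norm \<sigma> (\<lambda>x. v x - u x)"
  using sobolev_uminus(2)[OF sobolev_diff(1)[OF assms]] by simp

lemma sobolev_mono:
  assumes "u \<in> sobolev \<rho>" "\<sigma> \<le> \<rho>"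
  shows "u \<in> sobolev \<sigma>" "sobolev_norm \<sigma> u \<le> sobolev_norm \<rho> u"
proof -
  note h = has_fourier_sobolev[OF assms(1)]
  note s = sobolevD(1)[OF assms(1) h(1)]
  have [measurable]: "fourier_L2 u \<in> borel_measurable borel"
    using square_integrable_measurable[OF has_fourier_L2_square_integrable(2)[OF h]] .
  have m: "weighted \<sigma> (fourier_L2 u) \<in> borel_measurable borel" by measurable
  have ae: "AE x in lborel. cmod (weighted \<sigma> (fourier_L2 u) x) \<le> 1 * cmod (weighted \<rho> (fourier_L2 u) x)"
    by (intro AE_I2) (simp add: cmod_weighted_mono[OF assms(2)])
  note b = square_integrable_bound[OF s m ae]
  show "u \<in> sobolev \<sigma>" using sobolevI(1)[OF h b(1)] by simp
  show "sobolev_norm \<sigma> u \<le> sobolev_norm \<rho> u" using b(2) by (simp add: sobolev_norm_weighted)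
qed

lemma sobolev_zero [simp]:
  "(\<lambda>x::'a::euclidean_space. 0) \<in> sobolev \<sigma>" "sobolev_norm \<sigma> (\<lambda>x::'a. 0) = 0"
proof -
  have "has_fourier_L2 (\<lambda>x::'a. 0) (\<lambda>x. 0)"
    using has_fourier_L2_cmult[OF has_fourier_L2_fourier_L2[OF square_integrable_zero], of 0] by simp
  moreover have e: "weighted \<sigma> (\<lambda>x::'a. 0) = (\<lambda>x. 0)" by (auto simp: weighted_def)
  ultimately show "(\<lambda>x::'a. 0) \<in> sobolev \<sigma>" "sobolev_norm \<sigma> (\<lambda>x::'a. 0) = 0"
    using sobolevI[of "\<lambda>x::'a. 0" "\<lambda>x. 0" \<sigma>] unfolding e by (simp_all add: l2norm_def)
qed

text \<open>The weight is nowhere zero, so the transform vanishes almost everywhere, and injectivity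
  returns to u. Limits in the norm therefore determine functions up to null sets.\<close>

lemma sobolev_norm_eq_0:
  assumes "u \<in> sobolev \<sigma>" "sobolev_norm \<sigma> u = 0"
  shows "ae_eq u (\<lambda>x. 0)"
proof -
  note h = has_fourier_sobolev[OF assms(1)]
  have "AE \<xi> in lborel. weighted \<sigma> (fourier_L2 u) \<xi> = 0"
    using l2norm_eq_0_iff[OF sobolevD(1)[OF assms(1) h]] assms(2) by (simp add: sobolev_norm_weighted)
  then have "ae_eq (fourier_L2 u) (\<lambda>\<xi>. 0 * fourier_L2 u \<xi>)"
    unfolding ae_eq_def
  proof eventually_elim
    case (elim \<xi>)
    have "1 + (norm \<xi>)\<^sup>2 \<noteq> 0" using one_le_weight[of \<xi>] by linarith
    with elim show ?case by (simp add: weighted_def)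
  qed
  from has_fourier_L2_inj[OF h has_fourier_L2_cmult[OF h, of 0] this] show ?thesis by simp
qed

lemma sobolev_norm_diff_eq_0:
  assumes "u \<in> sobolev \<sigma>" "v \<in> sobolev \<sigma>" "sobolev_norm \<sigma> (\<lambda>x. u x - v x) = 0"
  shows "ae_eq u v"
  using sobolev_norm_eq_0[OF sobolev_diff(1)[OF assms(1,2)] assms(3)] by (simp add: ae_eq_def)

text \<open>Conjugation reflects and conjugates the transform, and the weight is even. With it
  densities, as products of u and \<open>cnj u\<close>, come under the product estimate.\<close>

lemma sobolev_cnj:
  assumes "u \<in> sobolev \<sigma>"
  shows "(\<lambda>x. cnj (u x)) \<in> sobolev \<sigma>" "sobolev_norm \<sigma> (\<lambda>x. cnj (u x)) = sobolev_norm \<sigma> u"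
proof -
  note h = has_fourier_sobolev[OF assms(1)]
  note s = sobolevD(1)[OF assms(1) h(1)]
  have e: "weighted \<sigma> (\<lambda>\<xi>. cnj (fourier_L2 u (- \<xi>))) = (\<lambda>\<xi>. cnj (weighted \<sigma> (fourier_L2 u) (0 - \<xi>)))"
    by (auto simp: weighted_def)
  have s': "square_integrable (weighted \<sigma> (\<lambda>\<xi>. cnj (fourier_L2 u (- \<xi>))))"
    unfolding e by (intro square_integrable_cnj square_integrable_reflect s)
  note I = sobolevI[OF has_fourier_L2_cnj[OF h] s']
  show "(\<lambda>x. cnj (u x)) \<in> sobolev \<sigma>" by (rule I)
  show "sobolev_norm \<sigma> (\<lambda>x. cnj (u x)) = sobolev_norm \<sigma> u"
    by (simp only: I(2) e l2norm_cnj square_integrable_reflect(2)[OF s] sobolev_norm_weighted[of \<sigma> u])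
qed

subsection \<open>Fourier multipliers\<close>

text \<open>The \<open>SOME\<close> in \<open>fourier_multiplier\<close> has a witness because the
  transform is onto L2, so square integrability of the multiplied transform suffices.\<close>

lemma has_fourier_multiplier:
  assumes "has_fourier_L2 u g" "square_integrable (\<lambda>\<xi>. m \<xi> * g \<xi>)" "m \<in> borel_measurable borel"
  shows "has_fourier_L2 (fourier_multiplier m u) (\<lambda>\<xi>. m \<xi> * g \<xi>)"
proof -
  have u: "square_integrable u" using assms by (simp add: has_fourier_L2_iff)
  have [measurable]: "fourier_L2 u \<in> borel_measurable borel" "m \<in> borel_measurable borel"
    using square_integrable_measurable[OF square_integrable_fourier_L2[OF u]] assms(3) .
  have e: "ae_eq (\<lambda>\<xi>. m \<xi> * g \<xi>) (\<lambda>\<xi>. m \<xi> * fourier_L2 u \<xi>)"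
    using has_fourier_L2_unique[OF assms(1) has_fourier_L2_fourier_L2[OF u]] by (auto simp: ae_eq_def)
  have "square_integrable (\<lambda>\<xi>. m \<xi> * fourier_L2 u \<xi>)"
    by (rule square_integrable_ae_cong(1)[OF e assms(2)]) measurable
  then have "has_fourier_L2 (fourier_multiplier m u) (\<lambda>\<xi>. m \<xi> * fourier_L2 u \<xi>)"
    unfolding fourier_multiplier_def by (rule someI_ex[OF has_fourier_L2_surj])
  from has_fourier_L2_cong_right[OF this ae_eq_sym[OF e]] square_integrable_measurable[OF assms(2)]
  show ?thesis by simp
qed

text \<open>Comparing the symbol with a quotient of weights covers all operators used: the Laplacian
  losing two orders, A and B keeping the order, and the smoothing of B gaining two.\<close>

lemma fourier_multiplier_sobolev:
  assumes u: "u \<in> sobolev \<rho>" and m [measurable]: "m \<in> borel_measurable borel" and "0 \<le> \<sigma>" "0 \<le> C"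
    and bound: "\<And>\<xi>. cmod (m \<xi>) * (1 + (norm \<xi>)\<^sup>2) powr (\<sigma> / 2) \<le> C * (1 + (norm \<xi>)\<^sup>2) powr (\<rho> / 2)"
  shows "has_fourier_L2 (fourier_multiplier m u) (\<lambda>\<xi>. m \<xi> * fourier_L2 u \<xi>)"
    "fourier_multiplier m u \<in> sobolev \<sigma>" "sobolev_norm \<sigma> (fourier_multiplier m u) \<le> C * sobolev_norm \<rho> u"
proof -
  note h = has_fourier_sobolev[OF u]
  note s = sobolevD(1)[OF u h]
  have [measurable]: "fourier_L2 u \<in> borel_measurable borel"
    using square_integrable_measurable[OF has_fourier_L2_square_integrable(2)[OF h]] .
  have le: "cmod (weighted \<sigma> (\<lambda>\<xi>. m \<xi> * fourier_L2 u \<xi>) \<xi>) \<le> C * cmod (weighted \<rho> (fourier_L2 u) \<xi>)" for \<xi>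
    using mult_right_mono[OF bound[of \<xi>], of "cmod (fourier_L2 u \<xi>)"]
    by (simp add: cmod_weighted norm_mult ac_simps)
  have mm: "weighted \<sigma> (\<lambda>\<xi>. m \<xi> * fourier_L2 u \<xi>) \<in> borel_measurable borel" by measurable
  note b = square_integrable_bound[OF s mm AE_I2[OF le] \<open>0 \<le> C\<close>]
  have "square_integrable (\<lambda>\<xi>. m \<xi> * fourier_L2 u \<xi>)"
    by (rule square_integrable_bound(1)[OF b(1), of _ 1]) (use cmod_le_weighted[OF \<open>0 \<le> \<sigma>\<close>, of "\<lambda>\<xi>. m \<xi> * fourier_L2 u \<xi>"] in auto)
  then show *: "has_fourier_L2 (fourier_multiplier m u) (\<lambda>\<xi>. m \<xi> * fourier_L2 u \<xi>)"
    by (rule has_fourier_multiplier[OF h _ m])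
  show "fourier_multiplier m u \<in> sobolev \<sigma>" "sobolev_norm \<sigma> (fourier_multiplier m u) \<le> C * sobolev_norm \<rho> u"
    using sobolevI[OF * b(1)] b(2) by (simp_all add: sobolev_norm_weighted[of \<rho>])
qed

lemma laplacian_symbol_measurable [measurable]: "laplacian_symbol \<in> borel_measurable borel"
  unfolding laplacian_symbol_def by measurable

lemma laplacian_sobolev:
  assumes "u \<in> sobolev (\<sigma> + 2)" "0 \<le> \<sigma>"
  shows "has_fourier_L2 (laplacian u) (\<lambda>\<xi>. laplacian_symbol \<xi> * fourier_L2 u \<xi>)"
    "laplacian u \<in> sobolev \<sigma>" "sobolev_norm \<sigma> (laplacian u) \<le> sobolev_norm (\<sigma> + 2) u"
proof -
  have b: "cmod (laplacian_symbol \<xi>) * (1 + (norm \<xi>)\<^sup>2) powr (\<sigma> / 2) \<le> 1 * (1 + (norm \<xi>)\<^sup>2) powr ((\<sigma> + 2) / 2)" for \<xi> :: 'a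
  proof -
    have "(1 + (norm \<xi>)\<^sup>2) powr ((\<sigma> + 2) / 2) = (1 + (norm \<xi>)\<^sup>2) * (1 + (norm \<xi>)\<^sup>2) powr (\<sigma> / 2)"
      by (simp add: add_divide_distrib powr_add)
    then show ?thesis
      by (simp add: laplacian_symbol_def norm_power mult_right_mono)
  qed
  show "has_fourier_L2 (laplacian u) (\<lambda>\<xi>. laplacian_symbol \<xi> * fourier_L2 u \<xi>)"
    "laplacian u \<in> sobolev \<sigma>" "sobolev_norm \<sigma> (laplacian u) \<le> sobolev_norm (\<sigma> + 2) u"
    using fourier_multiplier_sobolev[OF assms(1) _ assms(2) _ b] by (simp_all add: laplacian_def)
qed

text \<open>Multipliers are selected representatives, so linearity holds almost everywhere only and
  is proved on transforms.\<close>

lemma laplacian_add: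
  assumes "u \<in> sobolev 2" "v \<in> sobolev 2"
  shows "ae_eq (laplacian (\<lambda>x. u x + v x)) (\<lambda>x. laplacian u x + laplacian v x)"
proof -
  note h = has_fourier_sobolev[OF assms(1)] has_fourier_sobolev[OF assms(2)]
  have l: "has_fourier_L2 (\<lambda>x. laplacian u x + laplacian v x) (\<lambda>\<xi>. laplacian_symbol \<xi> * fourier_L2 u \<xi> + laplacian_symbol \<xi> * fourier_L2 v \<xi>)"
    using assms by (intro has_fourier_L2_add laplacian_sobolev(1)[where \<sigma>=0]) auto
  have "has_fourier_L2 (laplacian (\<lambda>x. u x + v x)) (\<lambda>\<xi>. laplacian_symbol \<xi> * (fourier_L2 u \<xi> + fourier_L2 v \<xi>))"
    unfolding laplacian_def
    by (rule has_fourier_multiplier[OF has_fourier_L2_add[OF h]])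
       (use has_fourier_L2_square_integrable(2)[OF l] in \<open>simp_all add: distrib_left laplacian_symbol_measurable\<close>)
  from has_fourier_L2_inj[OF this l] show ?thesis by (simp add: distrib_left)
qed

lemma laplacian_cmult:
  assumes "u \<in> sobolev 2"
  shows "ae_eq (laplacian (\<lambda>x. c * u x)) (\<lambda>x. c * laplacian u x)"
proof -
  note h = has_fourier_sobolev[OF assms(1)]
  have l: "has_fourier_L2 (\<lambda>x. c * laplacian u x) (\<lambda>\<xi>. c * (laplacian_symbol \<xi> * fourier_L2 u \<xi>))"
    using assms by (intro has_fourier_L2_cmult laplacian_sobolev(1)[where \<sigma>=0]) auto
  have "has_fourier_L2 (laplacian (\<lambda>x. c * u x)) (\<lambda>\<xi>. laplacian_symbol \<xi> * (c * fourier_L2 u \<xi>))"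
    unfolding laplacian_def
    by (rule has_fourier_multiplier[OF has_fourier_L2_cmult[OF h]])
       (use has_fourier_L2_square_integrable(2)[OF l] in \<open>simp_all add: mult.left_commute laplacian_symbol_measurable\<close>)
  from has_fourier_L2_inj[OF this l] show ?thesis by (simp add: mult.left_commute)
qed

lemma laplacian_diff:
  assumes "u \<in> sobolev 2" "v \<in> sobolev 2"
  shows "ae_eq (laplacian (\<lambda>x. u x - v x)) (\<lambda>x. laplacian u x - laplacian v x)"
  using laplacian_add[OF assms(1) sobolev_cmult(1)[OF assms(2), of "-1"]] laplacian_cmult[OF assms(2), of "-1"]
  by (auto simp: ae_eq_def)

lemma laplacian_cong:
  assumes "u \<in> sobolev 2" "ae_eq u v" "v \<in> borel_measurable borel"
  shows "ae_eq (laplacian u) (laplacian v)"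
proof -
  note v = sobolev_cong_ae(1)[OF assms]
  have l: "has_fourier_L2 (laplacian u) (\<lambda>\<xi>. laplacian_symbol \<xi> * fourier_L2 u \<xi>)"
    "has_fourier_L2 (laplacian v) (\<lambda>\<xi>. laplacian_symbol \<xi> * fourier_L2 v \<xi>)"
    using laplacian_sobolev(1)[where \<sigma>=0] assms v by auto
  have "ae_eq (fourier_L2 u) (fourier_L2 v)"
    using has_fourier_L2_unique[OF has_fourier_L2_cong_left[OF has_fourier_sobolev[OF assms(1)] assms(2,3)] has_fourier_sobolev[OF v]] .
  then have "ae_eq (\<lambda>\<xi>. laplacian_symbol \<xi> * fourier_L2 u \<xi>) (\<lambda>\<xi>. laplacian_symbol \<xi> * fourier_L2 v \<xi>)"
    unfolding ae_eq_def by eventually_elim simp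
  then show ?thesis by (rule has_fourier_L2_inj[OF l])
qed

subsection \<open>The Crank--Nicolson operator\<close>

text \<open>Changing the sign of c gives the operator on the other side of a Crank-Nicolson step, so
  one family serves for both sides.\<close>

definition crank :: "real \<Rightarrow> ('a::euclidean_space \<Rightarrow> complex) \<Rightarrow> 'a \<Rightarrow> complex" where
  "crank c u = (\<lambda>x. \<i> * u x + of_real (c / 4) * laplacian u x)"

abbreviation crank_symbol :: "real \<Rightarrow> 'a::euclidean_space \<Rightarrow> complex" where
  "crank_symbol c \<xi> \<equiv> \<i> + of_real c * laplacian_symbol \<xi> / 4"

text \<open>The symbol of the Laplacian is real, so the imaginary part is always 1. Hence the
  modulus is at least 1, whatever c, and does not change with the sign of c; stability rests on
  these two facts.\<close>

lemma crank_symbol_eq: "crank_symbol c \<xi> = Complex (- c * (norm \<xi>)\<^sup>2 / 4) 1"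
  by (simp add: laplacian_symbol_def complex_eq_iff)

lemma cmod_crank_symbol: "(cmod (crank_symbol c \<xi>))\<^sup>2 = (c * (norm \<xi>)\<^sup>2 / 4)\<^sup>2 + 1"
  by (simp add: crank_symbol_eq cmod_power2)

lemma cmod_crank_symbol_minus: "cmod (crank_symbol (- c) \<xi>) = cmod (crank_symbol c \<xi>)"
  unfolding crank_symbol_eq by (simp add: cmod_def)

lemma one_le_cmod_crank_symbol: "1 \<le> cmod (crank_symbol c \<xi>)"
proof (rule power2_le_imp_le)
  show "1\<^sup>2 \<le> (cmod (crank_symbol c \<xi>))\<^sup>2" unfolding cmod_crank_symbol by simp
qed simp

lemma crank_symbol_nonzero: "crank_symbol c \<xi> \<noteq> 0"
  using one_le_cmod_crank_symbol[of c \<xi>] by (metis norm_zero not_one_le_zero)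

lemma crank_fourier:
  assumes "u \<in> sobolev 2"
  shows "has_fourier_L2 (crank c u) (\<lambda>\<xi>. crank_symbol c \<xi> * fourier_L2 u \<xi>)"
proof -
  have "has_fourier_L2 (crank c u) (\<lambda>\<xi>. \<i> * fourier_L2 u \<xi> + of_real (c / 4) * (laplacian_symbol \<xi> * fourier_L2 u \<xi>))"
    unfolding crank_def using assms
    by (intro has_fourier_L2_add has_fourier_L2_cmult laplacian_sobolev(1)[where \<sigma>=0] has_fourier_sobolev) auto
  then show ?thesis by (simp add: algebra_simps)
qed

lemma crank_sobolev:
  assumes "u \<in> sobolev (\<sigma> + 2)" "0 \<le> \<sigma>"
  shows "crank c u \<in> sobolev \<sigma>" "sobolev_norm \<sigma> (crank c u) \<le> (1 + \<bar>c\<bar>) * sobolev_norm (\<sigma> + 2) u"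
proof -
  note u = sobolev_mono[OF assms(1), of \<sigma>, simplified]
  note l = laplacian_sobolev[OF assms]
  note a = sobolev_cmult[OF u(1), of \<i>] sobolev_cmult[OF l(2), of "of_real (c / 4)"]
  show "crank c u \<in> sobolev \<sigma>" unfolding crank_def by (intro sobolev_add a)
  have "sobolev_norm \<sigma> (crank c u) \<le> sobolev_norm \<sigma> u + \<bar>c / 4\<bar> * sobolev_norm \<sigma> (laplacian u)"
    unfolding crank_def using sobolev_add(2)[OF a(1,3)] a(2,4) by (simp add: norm_mult)
  also have "\<dots> \<le> sobolev_norm (\<sigma> + 2) u + \<bar>c\<bar> * sobolev_norm (\<sigma> + 2) u"
    using u(2) l(3) by (intro add_mono mult_mono) auto
  finally show "sobolev_norm \<sigma> (crank c u) \<le> (1 + \<bar>c\<bar>) * sobolev_norm (\<sigma> + 2) u" by (simp add: algebra_simps)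
qed

text \<open>The two symbols have equal modulus. This is the unitarity of A, expressed without
  A.\<close>

lemma crank_minus_norm:
  assumes "u \<in> sobolev (\<sigma> + 2)" "0 \<le> \<sigma>"
  shows "sobolev_norm \<sigma> (crank (- c) u) = sobolev_norm \<sigma> (crank c u)"
proof -
  have u2: "u \<in> sobolev 2" using sobolev_mono(1)[OF assms(1)] assms(2) by simp
  note f = crank_fourier[OF u2]
  note s = sobolevD[OF crank_sobolev(1)[OF assms] f]
  show ?thesis
    unfolding s(2)
  proof (rule l2norm_cong)
    show "AE \<xi> in lborel. cmod (weighted \<sigma> (\<lambda>\<xi>. crank_symbol (- c) \<xi> * fourier_L2 u \<xi>) \<xi>)
        = cmod (weighted \<sigma> (\<lambda>\<xi>. crank_symbol c \<xi> * fourier_L2 u \<xi>) \<xi>)"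
      by (intro AE_I2) (simp only: cmod_weighted norm_mult cmod_crank_symbol_minus)
  qed (rule square_integrable_measurable[OF s(1)])+
qed

text \<open>The symbol has modulus at least 1, so inverting the operator costs nothing, uniformly in
  c. Membership of order \<sigma> is obtained along with the bound, starting from order 2.\<close>

lemma norm_le_crank:
  assumes "u \<in> sobolev 2" "crank c u \<in> sobolev \<sigma>"
  shows "u \<in> sobolev \<sigma>" "sobolev_norm \<sigma> u \<le> sobolev_norm \<sigma> (crank c u)"
proof -
  note h = has_fourier_sobolev[OF assms(1)]
  note s = sobolevD[OF assms(2) crank_fourier[OF assms(1)]]
  have [measurable]: "fourier_L2 u \<in> borel_measurable borel"
    using square_integrable_measurable[OF has_fourier_L2_square_integrable(2)[OF h]] .
  have m: "weighted \<sigma> (fourier_L2 u) \<in> borel_measurable borel" by measurable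
  have "cmod (weighted \<sigma> (fourier_L2 u) \<xi>) \<le> 1 * cmod (weighted \<sigma> (\<lambda>\<xi>. crank_symbol c \<xi> * fourier_L2 u \<xi>) \<xi>)" for \<xi>
    using mult_right_mono[OF one_le_cmod_crank_symbol[of c \<xi>], of "cmod (weighted \<sigma> (fourier_L2 u) \<xi>)"]
    by (simp add: weighted_mult norm_mult)
  note b = square_integrable_bound[OF s(1) m AE_I2[OF this]]
  show "u \<in> sobolev \<sigma>" using sobolevI(1)[OF h b(1)] by simp
  show "sobolev_norm \<sigma> u \<le> sobolev_norm \<sigma> (crank c u)"
    using sobolevI(2)[OF h b(1)] b(2) s(2) by simp
qed

lemma crank_add:
  assumes "u \<in> sobolev 2" "v \<in> sobolev 2"
  shows "ae_eq (crank c (\<lambda>x. u x + v x)) (\<lambda>x. crank c u x + crank c v x)"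
  using laplacian_add[OF assms] unfolding ae_eq_def crank_def
  by eventually_elim (simp add: algebra_simps)

lemma crank_diff:
  assumes "u \<in> sobolev 2" "v \<in> sobolev 2"
  shows "ae_eq (crank c (\<lambda>x. u x - v x)) (\<lambda>x. crank c u x - crank c v x)"
  using laplacian_diff[OF assms] unfolding ae_eq_def crank_def
proof eventually_elim
  case (elim x)
  show ?case unfolding elim by (simp add: algebra_simps diff_divide_distrib)
qed

lemma crank_cmult:
  assumes "u \<in> sobolev 2"
  shows "ae_eq (crank c (\<lambda>x. a * u x)) (\<lambda>x. a * crank c u x)"
  using laplacian_cmult[OF assms, of a] unfolding ae_eq_def crank_def
  by eventually_elim (simp only:, simp add: algebra_simps)

lemma crank_cong:
  assumes "u \<in> sobolev 2" "ae_eq u v" "v \<in> borel_measurable borel"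
  shows "ae_eq (crank c u) (crank c v)"
  using laplacian_cong[OF assms] assms(2) unfolding ae_eq_def crank_def
  by eventually_elim simp

text \<open>Numerator and denominator of the symbol are \<open>crank_symbol\<close> at -c and at c,
  of equal modulus, so the quotient lies on the unit circle.\<close>

lemma opA_sobolev:
  assumes "u \<in> sobolev \<sigma>" "0 \<le> \<sigma>"
  shows "opA c u \<in> sobolev \<sigma>" "sobolev_norm \<sigma> (opA c u) \<le> sobolev_norm \<sigma> u"
    "has_fourier_L2 (opA c u) (\<lambda>\<xi>. ((\<i> - of_real c * laplacian_symbol \<xi> / 4) / crank_symbol c \<xi>) * fourier_L2 u \<xi>)"
proof -
  have "cmod ((\<i> - of_real c * laplacian_symbol \<xi> / 4) / crank_symbol c \<xi>) = 1" for \<xi> :: 'a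
    using cmod_crank_symbol_minus[of c \<xi>] crank_symbol_nonzero[of c \<xi>] by (simp add: norm_divide)
  then have b: "cmod ((\<i> - of_real c * laplacian_symbol \<xi> / 4) / crank_symbol c \<xi>) * (1 + (norm \<xi>)\<^sup>2) powr (\<sigma> / 2)
      \<le> 1 * (1 + (norm \<xi>)\<^sup>2) powr (\<sigma> / 2)" for \<xi> :: 'a
    by simp
  have m: "(\<lambda>\<xi>::'a. (\<i> - of_real c * laplacian_symbol \<xi> / 4) / crank_symbol c \<xi>) \<in> borel_measurable borel"
    by measurable
  show "opA c u \<in> sobolev \<sigma>" "sobolev_norm \<sigma> (opA c u) \<le> sobolev_norm \<sigma> u"
    "has_fourier_L2 (opA c u) (\<lambda>\<xi>. ((\<i> - of_real c * laplacian_symbol \<xi> / 4) / crank_symbol c \<xi>) * fourier_L2 u \<xi>)"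
    unfolding opA_def using fourier_multiplier_sobolev[OF assms(1) m assms(2) _ b] by simp_all
qed

lemma opB_sobolev:
  assumes "u \<in> sobolev \<sigma>" "0 \<le> \<sigma>"
  shows "opB c u \<in> sobolev \<sigma>" "sobolev_norm \<sigma> (opB c u) \<le> sobolev_norm \<sigma> u"
    "has_fourier_L2 (opB c u) (\<lambda>\<xi>. (1 / crank_symbol c \<xi>) * fourier_L2 u \<xi>)"
proof -
  have b: "cmod (1 / crank_symbol c \<xi>) * (1 + (norm \<xi>)\<^sup>2) powr (\<sigma> / 2)
      \<le> 1 * (1 + (norm \<xi>)\<^sup>2) powr (\<sigma> / 2)" for \<xi> :: 'a
    using one_le_cmod_crank_symbol[of c \<xi>]
    by (intro mult_right_mono) (simp_all add: norm_divide divide_le_eq_1)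
  have m: "(\<lambda>\<xi>::'a. 1 / crank_symbol c \<xi>) \<in> borel_measurable borel"
    by measurable
  show "opB c u \<in> sobolev \<sigma>" "sobolev_norm \<sigma> (opB c u) \<le> sobolev_norm \<sigma> u"
    "has_fourier_L2 (opB c u) (\<lambda>\<xi>. (1 / crank_symbol c \<xi>) * fourier_L2 u \<xi>)"
    unfolding opB_def using fourier_multiplier_sobolev[OF assms(1) m assms(2) _ b] by simp_all
qed

lemma crank_opA:
  assumes "u \<in> sobolev 2"
  shows "ae_eq (crank c (opA c u)) (crank (- c) u)"
proof -
  have A: "opA c u \<in> sobolev 2" using opA_sobolev[OF assms] by simp
  have "ae_eq (fourier_L2 (opA c u)) (\<lambda>\<xi>. ((\<i> - of_real c * laplacian_symbol \<xi> / 4) / crank_symbol c \<xi>) * fourier_L2 u \<xi>)"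
    by (rule has_fourier_L2_unique[OF has_fourier_sobolev[OF A] opA_sobolev(3)[OF assms]]) simp
  then have "ae_eq (\<lambda>\<xi>. crank_symbol c \<xi> * fourier_L2 (opA c u) \<xi>) (\<lambda>\<xi>. crank_symbol (- c) \<xi> * fourier_L2 u \<xi>)"
    unfolding ae_eq_def by eventually_elim (simp add: crank_symbol_nonzero)
  then show ?thesis by (rule has_fourier_L2_inj[OF crank_fourier[OF A] crank_fourier[OF assms]])
qed

text \<open>At high frequencies the symbol of B decays like 4 / (|c| |\<xi>|^2). The constant
  degenerates as c tends to 0, so only membership is recorded; quantitative bounds come from the
  uniform estimates.\<close>

lemma opB_sobolev_gain:
  assumes "u \<in> sobolev \<sigma>" "0 \<le> \<sigma>" "c \<noteq> 0"
  shows "opB c u \<in> sobolev (\<sigma> + 2)"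
proof -
  have b: "cmod (1 / crank_symbol c \<xi>) * (1 + (norm \<xi>)\<^sup>2) powr ((\<sigma> + 2) / 2)
      \<le> (1 + 4 / \<bar>c\<bar>) * (1 + (norm \<xi>)\<^sup>2) powr (\<sigma> / 2)" for \<xi> :: 'a
  proof -
    have "\<bar>c\<bar> * (norm \<xi>)\<^sup>2 / 4 \<le> cmod (crank_symbol c \<xi>)"
      using abs_Re_le_cmod[of "crank_symbol c \<xi>"] by (simp add: crank_symbol_eq abs_mult)
    then have "(norm \<xi>)\<^sup>2 \<le> 4 / \<bar>c\<bar> * cmod (crank_symbol c \<xi>)"
      using assms(3) by (simp add: field_simps)
    then have "1 + (norm \<xi>)\<^sup>2 \<le> (1 + 4 / \<bar>c\<bar>) * cmod (crank_symbol c \<xi>)"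
      using one_le_cmod_crank_symbol[of c \<xi>] by (simp add: distrib_right)
    then have "cmod (1 / crank_symbol c \<xi>) * (1 + (norm \<xi>)\<^sup>2) \<le> 1 + 4 / \<bar>c\<bar>"
      using crank_symbol_nonzero[of c \<xi>] by (simp add: norm_divide pos_divide_le_eq)
    from mult_right_mono[OF this, of "(1 + (norm \<xi>)\<^sup>2) powr (\<sigma> / 2)"]
    show ?thesis
      by (simp add: add_divide_distrib powr_add mult.assoc) (simp add: ac_simps)
  qed
  have m: "(\<lambda>\<xi>::'a. 1 / crank_symbol c \<xi>) \<in> borel_measurable borel"
    by measurable
  show ?thesis
    unfolding opB_def using fourier_multiplier_sobolev(2)[OF assms(1) m _ _ b] assms(2) by simp
qed

lemma crank_opB:
  assumes "u \<in> sobolev 0" "c \<noteq> 0"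
  shows "ae_eq (crank c (opB c u)) u"
proof -
  have B: "opB c u \<in> sobolev 2" using opB_sobolev_gain[OF assms(1) _ assms(2)] by simp
  have "ae_eq (fourier_L2 (opB c u)) (\<lambda>\<xi>. (1 / crank_symbol c \<xi>) * fourier_L2 u \<xi>)"
    by (rule has_fourier_L2_unique[OF has_fourier_sobolev[OF B] opB_sobolev(3)[OF assms(1)]]) simp
  then have "ae_eq (\<lambda>\<xi>. crank_symbol c \<xi> * fourier_L2 (opB c u) \<xi>) (fourier_L2 u)"
    unfolding ae_eq_def by eventually_elim (simp add: crank_symbol_nonzero)
  then show ?thesis by (rule has_fourier_L2_inj[OF crank_fourier[OF B] has_fourier_sobolev[OF assms(1)]])
qed

subsection \<open>The Sobolev algebra\<close>

text \<open>Comparison with a step function on dyadic balls: outside the ball of radius 2^k the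
  function is at most 4^(-k \<sigma>), the ball of radius 2^(k+1) has volume of order 2^(k d), and
  the resulting geometric series has ratio 2^(d - 2 \<sigma>) < 1.\<close>

lemma integrable_weight:
  assumes "\<sigma> > real DIM('a) / 2"
  shows "integrable lborel (\<lambda>\<xi>::'a::euclidean_space. (1 + (norm \<xi>)\<^sup>2) powr (- \<sigma>))"
proof -
  define d where "d = real DIM('a)"
  define V where "V = unit_ball_vol d"
  have V: "V \<ge> 0" by (simp add: V_def unit_ball_vol_def d_def)
  have vol: "emeasure lborel (cball (0::'a) (2 ^ k)) = ennreal (V * (2 ^ k) ^ DIM('a))" for k :: nat
    by (simp add: emeasure_cball V_def d_def)
  have \<sigma>: "\<sigma> > 0" using assms of_nat_0_le_iff[of "DIM('a)", where 'a=real] by linarith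
  let ?f = "\<lambda>\<xi>::'a. (1 + (norm \<xi>)\<^sup>2) powr (- \<sigma>)"
  let ?g = "\<lambda>k \<xi>::'a. ennreal ((4 ^ k) powr (- \<sigma>)) * indicator (cball 0 (2 ^ Suc k)) \<xi>"
  have [measurable]: "cball (0::'a) r \<in> sets borel" for r
    by (rule borel_closed[OF closed_cball])
  have term_le: "f k \<le> suminf f" for f :: "nat \<Rightarrow> ennreal" and k
    using sum_le_suminf[of f "{k}"] by simp
  have le: "ennreal (?f \<xi>) \<le> indicator (cball 0 (2 ^ 0)) \<xi> + (\<Sum>k. ?g k \<xi>)" for \<xi> :: 'a
  proof (cases "norm \<xi> \<le> 1")
    case True
    have "?f \<xi> \<le> 1 powr (- \<sigma>)" using \<sigma> by (intro powr_mono2') auto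
    then have "ennreal (?f \<xi>) \<le> 1" by simp
    also have "1 \<le> (indicator (cball 0 (2 ^ 0)) \<xi> :: ennreal) + (\<Sum>k. ?g k \<xi>)"
      using True by simp
    finally show ?thesis .
  next
    case False
    \<comment> \<open>Index of the dyadic shell containing \<xi>: the norm lies between 2^k and
      2^(k+1).\<close>
    define k where "k = nat \<lfloor>log 2 (norm \<xi>)\<rfloor>"
    have gt: "0 < norm \<xi>" "1 \<le> norm \<xi>" using False by linarith+
    have pos: "0 \<le> log 2 (norm \<xi>)" using gt by (subst zero_le_log_cancel_iff) auto
    have k: "real k \<le> log 2 (norm \<xi>)" "log 2 (norm \<xi>) < real k + 1"
      using pos by (simp_all add: k_def)
    have lo: "2 ^ k \<le> norm \<xi>"
      using k(1) gt by (simp add: le_log_iff powr_realpow)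
    have hi: "norm \<xi> \<le> 2 ^ Suc k"
      using k(2) gt powr_realpow[of 2 "Suc k"] by (simp add: log_less_iff powr_add powr_realpow)
    have "(4::real) ^ k = (2 ^ k)\<^sup>2" by (simp add: power2_eq_square flip: power_mult_distrib)
    also have "\<dots> \<le> (norm \<xi>)\<^sup>2" using lo by (intro power_mono) auto
    finally have "4 ^ k \<le> 1 + (norm \<xi>)\<^sup>2" by simp
    then have "?f \<xi> \<le> (4 ^ k) powr (- \<sigma>)" using \<sigma> by (intro powr_mono2') auto
    then have "ennreal (?f \<xi>) \<le> ?g k \<xi>" using hi by (simp add: ennreal_leI)
    also have "\<dots> \<le> (\<Sum>k. ?g k \<xi>)"
      by (rule term_le)
    finally show ?thesis by (simp add: add_increasing)
  qed
  have "(\<integral>\<^sup>+\<xi>. ennreal (?f \<xi>) \<partial>lborel) \<le> (\<integral>\<^sup>+\<xi>. indicator (cball 0 (2 ^ 0)) \<xi> + (\<Sum>k. ?g k \<xi>) \<partial>lborel)"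
    by (rule nn_integral_mono) (rule le)
  also have "\<dots> = (\<integral>\<^sup>+\<xi>. indicator (cball (0::'a) (2 ^ 0)) \<xi> \<partial>lborel) + (\<integral>\<^sup>+\<xi>. (\<Sum>k. ?g k \<xi>) \<partial>lborel)"
    by (rule nn_integral_add) measurable
  also have "(\<integral>\<^sup>+\<xi>. (\<Sum>k. ?g k \<xi>) \<partial>lborel) = (\<Sum>k. \<integral>\<^sup>+\<xi>. ?g k \<xi> \<partial>lborel)"
    by (rule nn_integral_suminf) measurable
  also have "(\<lambda>k. \<integral>\<^sup>+\<xi>. ?g k \<xi> \<partial>lborel) = (\<lambda>k. ennreal (V * 2 ^ DIM('a) * (2 powr (d - 2 * \<sigma>)) ^ k))"
  proof
    fix k
    have "(4 ^ k) powr (- \<sigma>) * (V * (2 ^ Suc k) ^ DIM('a)) = V * 2 ^ DIM('a) * (2 powr (d - 2 * \<sigma>)) ^ k"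
    proof -
      have "(4 ^ k) powr (- \<sigma>) = 2 powr (real k * (- 2 * \<sigma>))"
      proof -
        have "(4::real) ^ k = 2 powr (real k * 2)"
        proof -
          have "(4::real) ^ k = (2 ^ 2) ^ k" by simp
          also have "\<dots> = 2 ^ (2 * k)" by (rule power_mult[symmetric])
          also have "\<dots> = 2 powr real (2 * k)" by (rule powr_realpow[symmetric]) simp
          finally show ?thesis by (simp add: mult.commute)
        qed
        then show ?thesis by (simp add: powr_powr mult.assoc)
      qed
      moreover have "(2 ^ Suc k) ^ DIM('a) = 2 ^ DIM('a) * (2::real) powr (real k * d)"
      proof -
        have "(2::real) powr (real k * d) = 2 ^ (k * DIM('a))"
          unfolding d_def of_nat_mult[symmetric] by (rule powr_realpow) simp
        then show ?thesis by (simp add: power_mult_distrib power_mult)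
      qed
      moreover have "(2 powr (d - 2 * \<sigma>)) ^ k = 2 powr (real k * (- 2 * \<sigma>)) * 2 powr (real k * d)"
      proof -
        have "(2 powr (d - 2 * \<sigma>)) ^ k = 2 powr ((d - 2 * \<sigma>) * real k)"
          by (simp only: powr_powr[symmetric]) (rule powr_realpow[symmetric], simp)
        also have "(d - 2 * \<sigma>) * real k = real k * (- 2 * \<sigma>) + real k * d" by (simp add: algebra_simps)
        finally show ?thesis by (simp only: powr_add)
      qed
      ultimately show ?thesis by simp
    qed
    then show "(\<integral>\<^sup>+\<xi>. ?g k \<xi> \<partial>lborel) = ennreal (V * 2 ^ DIM('a) * (2 powr (d - 2 * \<sigma>)) ^ k)"
      using V by (simp add: nn_integral_cmult_indicator vol[of "Suc k", simplified] flip: ennreal_mult)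
  qed
  also have "(\<Sum>k. ennreal (V * 2 ^ DIM('a) * (2 powr (d - 2 * \<sigma>)) ^ k)) = ennreal (\<Sum>k. V * 2 ^ DIM('a) * (2 powr (d - 2 * \<sigma>)) ^ k)"
  proof (rule suminf_ennreal2)
    have "2 powr (d - 2 * \<sigma>) < 2 powr 0"
      using assms by (intro powr_less_mono) (auto simp: d_def)
    then show "summable (\<lambda>k. V * 2 ^ DIM('a) * (2 powr (d - 2 * \<sigma>)) ^ k)"
      by (intro summable_mult summable_geometric) simp
  qed (use V in simp)
  also have "(\<integral>\<^sup>+\<xi>. indicator (cball (0::'a) (2 ^ 0)) \<xi> \<partial>lborel) = ennreal V"
    using vol[of 0] by simp
  also have "ennreal V + ennreal (\<Sum>k. V * 2 ^ DIM('a) * (2 powr (d - 2 * \<sigma>)) ^ k) < \<infinity>"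
    by simp
  finally show ?thesis by (simp add: integrable_iff_bounded)
qed

text \<open>Young's inequality, by Cauchy--Schwarz with respect to the measure of density \<^term>\<open>b\<close>.\<close>

lemma young_L2_L1:
  fixes a b :: "'a::euclidean_space \<Rightarrow> real"
  assumes [measurable]: "a \<in> borel_measurable borel" "b \<in> borel_measurable borel"
    and nn: "\<And>x. 0 \<le> a x" "\<And>x. 0 \<le> b x"
  shows "(\<integral>\<^sup>+\<xi>. (\<integral>\<^sup>+\<eta>. ennreal (a (\<xi> - \<eta>) * b \<eta>) \<partial>lborel)\<^sup>2 \<partial>lborel)
    \<le> (\<integral>\<^sup>+\<eta>. ennreal (b \<eta>) \<partial>lborel)\<^sup>2 * (\<integral>\<^sup>+\<xi>. ennreal ((a \<xi>)\<^sup>2) \<partial>lborel)"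
proof -
  let ?B = "\<integral>\<^sup>+\<eta>. ennreal (b \<eta>) \<partial>lborel"
  have cs: "(\<integral>\<^sup>+\<eta>. ennreal (a (\<xi> - \<eta>) * b \<eta>) \<partial>lborel)\<^sup>2 \<le> (\<integral>\<^sup>+\<eta>. ennreal ((a (\<xi> - \<eta>))\<^sup>2 * b \<eta>) \<partial>lborel) * ?B" for \<xi>
  proof -
    have "(\<integral>\<^sup>+\<eta>. ennreal (a (\<xi> - \<eta>) * b \<eta>) \<partial>lborel)
       = (\<integral>\<^sup>+\<eta>. ennreal (a (\<xi> - \<eta>) * sqrt (b \<eta>)) * ennreal (sqrt (b \<eta>)) \<partial>lborel)"
      using nn by (intro nn_integral_cong) (simp add: mult.assoc flip: ennreal_mult)
    also have "\<dots>\<^sup>2 \<le> (\<integral>\<^sup>+\<eta>. (ennreal (a (\<xi> - \<eta>) * sqrt (b \<eta>)))\<^sup>2 \<partial>lborel) * (\<integral>\<^sup>+\<eta>. (ennreal (sqrt (b \<eta>)))\<^sup>2 \<partial>lborel)"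
      by (rule Cauchy_Schwarz_nn_integral) measurable
    also have "\<dots> = (\<integral>\<^sup>+\<eta>. ennreal ((a (\<xi> - \<eta>))\<^sup>2 * b \<eta>) \<partial>lborel) * ?B"
      using nn by (simp add: ennreal_power power_mult_distrib)
    finally show ?thesis .
  qed
  have "(\<integral>\<^sup>+\<xi>. (\<integral>\<^sup>+\<eta>. ennreal (a (\<xi> - \<eta>) * b \<eta>) \<partial>lborel)\<^sup>2 \<partial>lborel)
      \<le> (\<integral>\<^sup>+\<xi>. (\<integral>\<^sup>+\<eta>. ennreal ((a (\<xi> - \<eta>))\<^sup>2 * b \<eta>) \<partial>lborel) * ?B \<partial>lborel)"
    by (rule nn_integral_mono) (rule cs)
  also have "\<dots> = (\<integral>\<^sup>+\<xi>. (\<integral>\<^sup>+\<eta>. ennreal ((a (\<xi> - \<eta>))\<^sup>2 * b \<eta>) \<partial>lborel) \<partial>lborel) * ?B"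
    by (rule nn_integral_multc) measurable
  also have "(\<integral>\<^sup>+\<xi>. (\<integral>\<^sup>+\<eta>. ennreal ((a (\<xi> - \<eta>))\<^sup>2 * b \<eta>) \<partial>lborel) \<partial>lborel)
     = (\<integral>\<^sup>+\<eta>. (\<integral>\<^sup>+\<xi>. ennreal ((a (\<xi> - \<eta>))\<^sup>2 * b \<eta>) \<partial>lborel) \<partial>lborel)"
    by (rule lborel_pair.Fubini') measurable
  also have "\<dots> = (\<integral>\<^sup>+\<eta>. (\<integral>\<^sup>+\<xi>. ennreal ((a \<xi>)\<^sup>2) \<partial>lborel) * ennreal (b \<eta>) \<partial>lborel)"
  proof (rule nn_integral_cong)
    fix \<eta>
    have "(\<integral>\<^sup>+\<xi>. ennreal ((a (\<xi> - \<eta>))\<^sup>2 * b \<eta>) \<partial>lborel) = (\<integral>\<^sup>+\<xi>. ennreal ((a (\<xi> - \<eta>))\<^sup>2) \<partial>lborel) * ennreal (b \<eta>)"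
      using nn by (subst nn_integral_multc[symmetric]) (simp_all add: ennreal_mult)
    also have "(\<integral>\<^sup>+\<xi>. ennreal ((a (\<xi> - \<eta>))\<^sup>2) \<partial>lborel) = (\<integral>\<^sup>+\<xi>. ennreal ((a \<xi>)\<^sup>2) \<partial>lborel)"
      by (rule nn_integral_lborel_translate) measurable
    finally show "(\<integral>\<^sup>+\<xi>. ennreal ((a (\<xi> - \<eta>))\<^sup>2 * b \<eta>) \<partial>lborel) = (\<integral>\<^sup>+\<xi>. ennreal ((a \<xi>)\<^sup>2) \<partial>lborel) * ennreal (b \<eta>)" .
  qed
  also have "\<dots> = (\<integral>\<^sup>+\<xi>. ennreal ((a \<xi>)\<^sup>2) \<partial>lborel) * ?B"
    by (rule nn_integral_cmult) measurable
  finally show ?thesis by (simp add: power2_eq_square ac_simps)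
qed

text \<open>One of \<xi> - \<eta> and \<eta> is always comparable to \<xi>, so the weight of a
  convolution can be moved to one factor at a time. Of the factor 4, one 2 comes from squaring the
  triangle inequality and one from passing to the maximum.\<close>

lemma weight_triangle:
  fixes \<xi> \<eta> :: "'a::real_normed_vector"
  assumes "0 \<le> \<sigma>"
  shows "(1 + (norm \<xi>)\<^sup>2) powr (\<sigma> / 2)
    \<le> 4 powr (\<sigma> / 2) * ((1 + (norm (\<xi> - \<eta>))\<^sup>2) powr (\<sigma> / 2) + (1 + (norm \<eta>)\<^sup>2) powr (\<sigma> / 2))"
proof -
  let ?a = "1 + (norm (\<xi> - \<eta>))\<^sup>2" and ?b = "1 + (norm \<eta>)\<^sup>2"
  have "(norm \<xi>)\<^sup>2 \<le> (norm (\<xi> - \<eta>) + norm \<eta>)\<^sup>2"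
    using norm_triangle_ineq[of "\<xi> - \<eta>" \<eta>] by (intro power_mono) auto
  also have "\<dots> \<le> 2 * (norm (\<xi> - \<eta>))\<^sup>2 + 2 * (norm \<eta>)\<^sup>2"
    using sum_squares_bound[of "norm (\<xi> - \<eta>)" "norm \<eta>"] by (simp add: power2_sum)
  finally have "1 + (norm \<xi>)\<^sup>2 \<le> 2 * ?a + 2 * ?b" by simp
  also have "\<dots> \<le> 4 * max ?a ?b" by (simp add: max_def)
  finally have "(1 + (norm \<xi>)\<^sup>2) powr (\<sigma> / 2) \<le> (4 * max ?a ?b) powr (\<sigma> / 2)"
    using assms by (intro powr_mono2) auto
  also have "\<dots> = 4 powr (\<sigma> / 2) * max ?a ?b powr (\<sigma> / 2)"
    by (rule powr_mult)
  also have "max ?a ?b powr (\<sigma> / 2) \<le> ?a powr (\<sigma> / 2) + ?b powr (\<sigma> / 2)"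
    by (simp add: max_def)
  finally show ?thesis by simp
qed

text \<open>Cauchy-Schwarz against the inverse weight, whose L2 norm is K; the condition \<sigma> >
  d/2 makes K finite.\<close>

lemma sobolev_fourier_integrable:
  fixes u :: "'a::euclidean_space \<Rightarrow> complex"
  assumes \<sigma>: "\<sigma> > real DIM('a) / 2" and u: "u \<in> sobolev \<sigma>"
  defines "K \<equiv> l2norm (\<lambda>\<xi>::'a. complex_of_real ((1 + (norm \<xi>)\<^sup>2) powr (- (\<sigma> / 2))))"
  shows "integrable lborel (fourier_L2 u)" "(LINT \<xi>|lborel. cmod (fourier_L2 u \<xi>)) \<le> K * sobolev_norm \<sigma> u"
proof -
  let ?w = "\<lambda>\<xi>::'a. complex_of_real ((1 + (norm \<xi>)\<^sup>2) powr (- (\<sigma> / 2)))"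
  have "(cmod (?w \<xi>))\<^sup>2 = (1 + (norm \<xi>)\<^sup>2) powr (- \<sigma>)" for \<xi>
    by (simp add: power2_eq_square flip: powr_add)
  then have w: "square_integrable ?w"
    using integrable_weight[OF \<sigma>] by (auto simp: square_integrable_def)
  have g: "square_integrable (weighted \<sigma> (fourier_L2 u))"
    using u by (simp add: sobolev_iff_weighted)
  have e: "?w \<xi> * weighted \<sigma> (fourier_L2 u) \<xi> = fourier_L2 u \<xi>" for \<xi>
  proof -
    have "(1 + (norm \<xi>)\<^sup>2) powr (- (\<sigma> / 2)) * (1 + (norm \<xi>)\<^sup>2) powr (\<sigma> / 2) = 1"
      using one_le_weight[of \<xi>] by (simp flip: powr_add) (simp add: add_nonneg_eq_0_iff)
    then show ?thesis by (simp add: weighted_def flip: mult.assoc of_real_mult)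
  qed
  show i: "integrable lborel (fourier_L2 u)"
    using square_integrable_mult_integrable[OF w g] unfolding e .
  have "ennreal (LINT \<xi>|lborel. cmod (fourier_L2 u \<xi>)) = (\<integral>\<^sup>+\<xi>. ennreal (cmod (fourier_L2 u \<xi>)) \<partial>lborel)"
    using i by (intro nn_integral_eq_integral[symmetric]) auto
  also have "\<dots> = (\<integral>\<^sup>+\<xi>. ennreal (cmod (?w \<xi>) * cmod (weighted \<sigma> (fourier_L2 u) \<xi>)) \<partial>lborel)"
    by (simp only: norm_mult[symmetric] e)
  also have "\<dots> \<le> ennreal (K * sobolev_norm \<sigma> u)"
    unfolding K_def sobolev_norm_weighted by (rule nn_integral_mult_le_l2norm[OF w g])
  finally show "(LINT \<xi>|lborel. cmod (fourier_L2 u \<xi>)) \<le> K * sobolev_norm \<sigma> u"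
    by (simp add: K_def)
qed

text \<open>After the weight has been moved to one factor, each half is a convolution of an L2
  function with an L1 function, to which Young's inequality applies.\<close>

lemma weighted_convolution_bound:
  fixes p q :: "'a::euclidean_space \<Rightarrow> complex"
  assumes p: "integrable lborel p" "square_integrable (weighted \<sigma> p)"
    and q: "integrable lborel q" "square_integrable (weighted \<sigma> q)" and "0 \<le> \<sigma>"
  defines "C \<equiv> 4 powr (\<sigma> / 2)"
  defines "P1 \<equiv> LINT \<xi>|lborel. cmod (p \<xi>)" and "Q1 \<equiv> LINT \<xi>|lborel. cmod (q \<xi>)"
  shows "square_integrable (weighted \<sigma> (fun_convolution p q))"
    "l2norm (weighted \<sigma> (fun_convolution p q)) \<le> C * 2 * (l2norm (weighted \<sigma> p) * Q1 + l2norm (weighted \<sigma> q) * P1)"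
proof -
  have [measurable]: "p \<in> borel_measurable borel" "q \<in> borel_measurable borel"
    using p(1) q(1) borel_measurable_integrable by fastforce+
  have nn: "0 \<le> P1" "0 \<le> Q1" "0 \<le> C" by (simp_all add: P1_def Q1_def C_def)
  let ?P = "weighted \<sigma> p" and ?Q = "weighted \<sigma> q"
  define S where "S \<xi> = (\<integral>\<^sup>+\<eta>. ennreal (cmod (?P (\<xi> - \<eta>)) * cmod (q \<eta>)) \<partial>lborel)" for \<xi>
  define R where "R \<xi> = (\<integral>\<^sup>+\<eta>. ennreal (cmod (?Q (\<xi> - \<eta>)) * cmod (p \<eta>)) \<partial>lborel)" for \<xi>
  have [measurable]: "S \<in> borel_measurable borel" "R \<in> borel_measurable borel"
    unfolding S_def R_def by measurable
  have pw: "ennreal (cmod (weighted \<sigma> (fun_convolution p q) \<xi>)) \<le> ennreal C * (S \<xi> + R \<xi>)" for \<xi>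
  proof -
    let ?w = "(1 + (norm \<xi>)\<^sup>2) powr (\<sigma> / 2)"
    have cc: "ennreal (cmod (fun_convolution p q \<xi>)) \<le> (\<integral>\<^sup>+\<eta>. ennreal (cmod (p (\<xi> - \<eta>) * q \<eta>)) \<partial>lborel)"
    proof (cases "integrable lborel (\<lambda>\<eta>. p (\<xi> - \<eta>) * q \<eta>)")
      case True
      then show ?thesis unfolding fun_convolution_def by (rule integral_norm_bound_ennreal)
    next
      \<comment> \<open>The convolution has its default value 0 here, so the bound is
        trivial.\<close>
      case False
      then show ?thesis by (simp add: fun_convolution_def not_integrable_integral_eq)
    qed
    have "ennreal (cmod (weighted \<sigma> (fun_convolution p q) \<xi>)) = ennreal ?w * ennreal (cmod (fun_convolution p q \<xi>))"
      by (simp add: cmod_weighted ennreal_mult)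
    also have "\<dots> \<le> ennreal ?w * (\<integral>\<^sup>+\<eta>. ennreal (cmod (p (\<xi> - \<eta>) * q \<eta>)) \<partial>lborel)"
      by (intro mult_left_mono cc) simp
    also have "\<dots> = (\<integral>\<^sup>+\<eta>. ennreal (?w * cmod (p (\<xi> - \<eta>) * q \<eta>)) \<partial>lborel)"
      by (subst nn_integral_cmult[symmetric]) (simp_all add: ennreal_mult)
    \<comment> \<open>In the second summand \<eta> is written as \<xi> - (\<xi> - \<eta>), so that
      reflecting the variable of integration turns it into a convolution with the roles of p and q
      exchanged.\<close>
    also have "\<dots> \<le> (\<integral>\<^sup>+\<eta>. ennreal C * (ennreal (cmod (?P (\<xi> - \<eta>)) * cmod (q \<eta>)) + ennreal (cmod (?Q (\<xi> - (\<xi> - \<eta>))) * cmod (p (\<xi> - \<eta>)))) \<partial>lborel)"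
    proof (rule nn_integral_mono)
      fix \<eta>
      have "?w * cmod (p (\<xi> - \<eta>) * q \<eta>) \<le> (C * ((1 + (norm (\<xi> - \<eta>))\<^sup>2) powr (\<sigma> / 2) + (1 + (norm \<eta>)\<^sup>2) powr (\<sigma> / 2))) * cmod (p (\<xi> - \<eta>) * q \<eta>)"
        unfolding C_def by (intro mult_right_mono weight_triangle \<open>0 \<le> \<sigma>\<close>) simp
      also have "\<dots> = C * (cmod (?P (\<xi> - \<eta>)) * cmod (q \<eta>) + cmod (?Q (\<xi> - (\<xi> - \<eta>))) * cmod (p (\<xi> - \<eta>)))"
        by (simp add: cmod_weighted norm_mult algebra_simps)
      finally show "ennreal (?w * cmod (p (\<xi> - \<eta>) * q \<eta>))
         \<le> ennreal C * (ennreal (cmod (?P (\<xi> - \<eta>)) * cmod (q \<eta>)) + ennreal (cmod (?Q (\<xi> - (\<xi> - \<eta>))) * cmod (p (\<xi> - \<eta>))))"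
        using nn by (simp add: ennreal_leI flip: ennreal_plus ennreal_mult)
    qed
    also have "\<dots> = ennreal C * (S \<xi> + (\<integral>\<^sup>+\<eta>. ennreal (cmod (?Q (\<xi> - (\<xi> - \<eta>))) * cmod (p (\<xi> - \<eta>))) \<partial>lborel))"
      unfolding S_def by (subst nn_integral_cmult, measurable, subst nn_integral_add) simp_all
    also have "(\<integral>\<^sup>+\<eta>. ennreal (cmod (?Q (\<xi> - (\<xi> - \<eta>))) * cmod (p (\<xi> - \<eta>))) \<partial>lborel) = R \<xi>"
      unfolding R_def by (rule nn_integral_lborel_reflect[of "\<lambda>\<eta>. ennreal (cmod (?Q (\<xi> - \<eta>)) * cmod (p \<eta>))"]) measurable
    finally show ?thesis .
  qed
  have i1: "(\<integral>\<^sup>+\<xi>. (S \<xi>)\<^sup>2 \<partial>lborel) \<le> ennreal ((Q1 * l2norm ?P)\<^sup>2)"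
  proof -
    have "(\<integral>\<^sup>+\<xi>. (S \<xi>)\<^sup>2 \<partial>lborel) \<le> (\<integral>\<^sup>+\<eta>. ennreal (cmod (q \<eta>)) \<partial>lborel)\<^sup>2 * (\<integral>\<^sup>+\<xi>. ennreal ((cmod (?P \<xi>))\<^sup>2) \<partial>lborel)"
      unfolding S_def by (rule young_L2_L1; (measurable | simp))
    also have "\<dots> = ennreal ((Q1 * l2norm ?P)\<^sup>2)"
      using nn q(1) by (subst nn_integral_eq_integral) (simp_all add: nn_integral_cmod_sq[OF p(2)] Q1_def[symmetric] ennreal_power power_mult_distrib flip: ennreal_mult)
    finally show ?thesis .
  qed
  have i2: "(\<integral>\<^sup>+\<xi>. (R \<xi>)\<^sup>2 \<partial>lborel) \<le> ennreal ((P1 * l2norm ?Q)\<^sup>2)"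
  proof -
    have "(\<integral>\<^sup>+\<xi>. (R \<xi>)\<^sup>2 \<partial>lborel) \<le> (\<integral>\<^sup>+\<eta>. ennreal (cmod (p \<eta>)) \<partial>lborel)\<^sup>2 * (\<integral>\<^sup>+\<xi>. ennreal ((cmod (?Q \<xi>))\<^sup>2) \<partial>lborel)"
      unfolding R_def by (rule young_L2_L1; (measurable | simp))
    also have "\<dots> = ennreal ((P1 * l2norm ?Q)\<^sup>2)"
      using nn p(1) by (subst nn_integral_eq_integral) (simp_all add: nn_integral_cmod_sq[OF q(2)] P1_def[symmetric] ennreal_power power_mult_distrib flip: ennreal_mult)
    finally show ?thesis .
  qed
  \<comment> \<open>Extended nonnegative numbers admit no usual subtraction, so the square of the
    sum is bounded through the maximum, at the price of 4 in place of 2.\<close>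
  have sq: "(x + y)\<^sup>2 \<le> 4 * x\<^sup>2 + 4 * y\<^sup>2" for x y :: ennreal
  proof -
    have "(x + y)\<^sup>2 \<le> (2 * max x y)\<^sup>2" by (intro power_mono) (auto simp: mult_2 intro: add_mono)
    also have "\<dots> = 4 * (max x y)\<^sup>2" by (simp add: power_mult_distrib)
    also have "\<dots> \<le> 4 * x\<^sup>2 + 4 * y\<^sup>2" by (auto simp: max_def add_increasing add_increasing2)
    finally show ?thesis .
  qed
  have "(\<integral>\<^sup>+\<xi>. ennreal ((cmod (weighted \<sigma> (fun_convolution p q) \<xi>))\<^sup>2) \<partial>lborel) \<le> (\<integral>\<^sup>+\<xi>. (ennreal C)\<^sup>2 * (4 * (S \<xi>)\<^sup>2 + 4 * (R \<xi>)\<^sup>2) \<partial>lborel)"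
  proof (rule nn_integral_mono)
    fix \<xi>
    have "ennreal ((cmod (weighted \<sigma> (fun_convolution p q) \<xi>))\<^sup>2) = (ennreal (cmod (weighted \<sigma> (fun_convolution p q) \<xi>)))\<^sup>2"
      by (simp add: ennreal_power)
    also have "\<dots> \<le> (ennreal C * (S \<xi> + R \<xi>))\<^sup>2" by (intro power_mono pw) simp
    also have "\<dots> \<le> (ennreal C)\<^sup>2 * (4 * (S \<xi>)\<^sup>2 + 4 * (R \<xi>)\<^sup>2)"
      unfolding power_mult_distrib by (intro mult_left_mono sq) simp
    finally show "ennreal ((cmod (weighted \<sigma> (fun_convolution p q) \<xi>))\<^sup>2) \<le> (ennreal C)\<^sup>2 * (4 * (S \<xi>)\<^sup>2 + 4 * (R \<xi>)\<^sup>2)" .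
  qed
  also have "\<dots> = (ennreal C)\<^sup>2 * (4 * (\<integral>\<^sup>+\<xi>. (S \<xi>)\<^sup>2 \<partial>lborel) + 4 * (\<integral>\<^sup>+\<xi>. (R \<xi>)\<^sup>2 \<partial>lborel))"
    by (simp add: nn_integral_cmult nn_integral_add)
  also have "\<dots> \<le> (ennreal C)\<^sup>2 * (4 * ennreal ((Q1 * l2norm ?P)\<^sup>2) + 4 * ennreal ((P1 * l2norm ?Q)\<^sup>2))"
    by (intro mult_left_mono add_mono i1 i2) auto
  also have "\<dots> = ennreal (C\<^sup>2 * (4 * (Q1 * l2norm ?P)\<^sup>2 + 4 * (P1 * l2norm ?Q)\<^sup>2))"
    using nn by (simp add: ennreal_power ennreal_mult ennreal_plus)
  also have "\<dots> \<le> ennreal ((C * 2 * (l2norm ?P * Q1 + l2norm ?Q * P1))\<^sup>2)"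
  proof (rule ennreal_leI)
    have sq4: "4 * x\<^sup>2 + 4 * y\<^sup>2 \<le> 4 * (x + y)\<^sup>2" if "0 \<le> x * y" for x y :: real
      using that by (simp add: power2_sum)
    have "0 \<le> (Q1 * l2norm ?P) * (P1 * l2norm ?Q)" using nn by simp
    then have "4 * (Q1 * l2norm ?P)\<^sup>2 + 4 * (P1 * l2norm ?Q)\<^sup>2 \<le> 4 * (Q1 * l2norm ?P + P1 * l2norm ?Q)\<^sup>2"
      by (rule sq4)
    then have "C\<^sup>2 * (4 * (Q1 * l2norm ?P)\<^sup>2 + 4 * (P1 * l2norm ?Q)\<^sup>2) \<le> C\<^sup>2 * (4 * (Q1 * l2norm ?P + P1 * l2norm ?Q)\<^sup>2)"
      by (intro mult_left_mono) auto
    also have "\<dots> = (C * 2 * (l2norm ?P * Q1 + l2norm ?Q * P1))\<^sup>2"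
      by (simp add: power_mult_distrib mult.commute)
    finally show "C\<^sup>2 * (4 * (Q1 * l2norm ?P)\<^sup>2 + 4 * (P1 * l2norm ?Q)\<^sup>2) \<le> (C * 2 * (l2norm ?P * Q1 + l2norm ?Q * P1))\<^sup>2" .
  qed
  finally have *: "(\<integral>\<^sup>+\<xi>. ennreal ((cmod (weighted \<sigma> (fun_convolution p q) \<xi>))\<^sup>2) \<partial>lborel)
     \<le> ennreal ((C * 2 * (l2norm ?P * Q1 + l2norm ?Q * P1))\<^sup>2)" .
  have m: "weighted \<sigma> (fun_convolution p q) \<in> borel_measurable borel" by measurable
  show "square_integrable (weighted \<sigma> (fun_convolution p q))"
    "l2norm (weighted \<sigma> (fun_convolution p q)) \<le> C * 2 * (l2norm ?P * Q1 + l2norm ?Q * P1)"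
    using l2norm_le_nn[OF m *] nn by simp_all
qed

text \<open>The transform of a product is the normalised convolution of the transforms, which
  \<open>weighted_convolution_bound\<close> controls by a weighted L2 norm of one factor times the
  L1 norm of the other; the L1 norms are in turn bounded by Sobolev norms.\<close>

theorem sobolev_algebra:
  assumes \<sigma>: "\<sigma> > real DIM('a) / 2"
  shows "\<exists>K>0. \<forall>u v :: 'a::euclidean_space \<Rightarrow> complex. u \<in> sobolev \<sigma> \<longrightarrow> v \<in> sobolev \<sigma> \<longrightarrow>
    (\<lambda>x. u x * v x) \<in> sobolev \<sigma> \<and> sobolev_norm \<sigma> (\<lambda>x. u x * v x) \<le> K * sobolev_norm \<sigma> u * sobolev_norm \<sigma> v"
proof -
  define c where "c = fourier_const TYPE('a)"
  have c: "c > 0" by (simp add: c_def)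
  define K1 where "K1 = l2norm (\<lambda>\<xi>::'a. complex_of_real ((1 + (norm \<xi>)\<^sup>2) powr (- (\<sigma> / 2))))"
  define C where "C = (4::real) powr (\<sigma> / 2)"
  have K1: "K1 \<ge> 0" by (simp add: K1_def)
  have C: "C \<ge> 0" by (simp add: C_def)
  have \<sigma>0: "0 \<le> \<sigma>" using \<sigma> of_nat_0_le_iff[of "DIM('a)", where 'a=real] by linarith
  have main: "(\<lambda>x. u x * v x) \<in> sobolev \<sigma> \<and> sobolev_norm \<sigma> (\<lambda>x. u x * v x) \<le> (c * (C * 4 * K1)) * sobolev_norm \<sigma> u * sobolev_norm \<sigma> v"
    if u: "u \<in> sobolev \<sigma>" and v: "v \<in> sobolev \<sigma>" for u v :: "'a \<Rightarrow> complex"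
  proof -
    note fi = sobolev_fourier_integrable[OF \<sigma> u, folded K1_def] sobolev_fourier_integrable[OF \<sigma> v, folded K1_def]
    note hu = has_fourier_sobolev[OF u] and hv = has_fourier_sobolev[OF v]
    \<comment> \<open>The inverse transform is available as conjugation, transform, conjugation.
      Conjugating first represents u and v as conjugates of genuine Fourier integrals, those of p
      and q.\<close>
    define p where "p = (\<lambda>\<xi>. cnj (fourier_L2 u \<xi>))"
    define q where "q = (\<lambda>\<xi>. cnj (fourier_L2 v \<xi>))"
    have pq1: "integrable lborel p" "integrable lborel q"
      using fi by (simp_all add: p_def q_def)
    have pq2: "square_integrable p" "square_integrable q"
      using hu hv by (simp_all add: p_def q_def has_fourier_L2_square_integrable)
    have wp: "weighted \<sigma> p = (\<lambda>\<xi>. cnj (weighted \<sigma> (fourier_L2 u) \<xi>))" "weighted \<sigma> q = (\<lambda>\<xi>. cnj (weighted \<sigma> (fourier_L2 v) \<xi>))"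
      by (auto simp: weighted_def p_def q_def)
    have pqw: "square_integrable (weighted \<sigma> p)" "square_integrable (weighted \<sigma> q)"
      "l2norm (weighted \<sigma> p) = sobolev_norm \<sigma> u" "l2norm (weighted \<sigma> q) = sobolev_norm \<sigma> v"
      using u v by (simp_all add: wp sobolev_iff_weighted sobolev_norm_weighted)
    have ue: "ae_eq (\<lambda>x. cnj (fourier_integral p x)) u"
      by (rule has_fourier_L2_inj[OF has_fourier_L2_inversion[of "fourier_L2 u", folded p_def, OF has_fourier_L2_integral[OF pq1(1) pq2(1)]] hu]) simp
    have ve: "ae_eq (\<lambda>x. cnj (fourier_integral q x)) v"
      by (rule has_fourier_L2_inj[OF has_fourier_L2_inversion[of "fourier_L2 v", folded q_def, OF has_fourier_L2_integral[OF pq1(2) pq2(2)]] hv]) simp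
    define r where "r = (\<lambda>\<xi>. of_real c * fun_convolution p q \<xi>)"
    have wr: "weighted \<sigma> r = (\<lambda>\<xi>. of_real c * weighted \<sigma> (fun_convolution p q) \<xi>)"
      unfolding r_def by (rule weighted_cmult)
    note wc = weighted_convolution_bound[OF pq1(1) pqw(1) pq1(2) pqw(2) \<sigma>0]
    have r1: "integrable lborel r"
      unfolding r_def by (intro integrable_mult_right integrable_convolution pq1)
    have rw: "square_integrable (weighted \<sigma> r)"
      unfolding wr by (rule square_integrable_cmult[OF wc(1)])
    have r2: "square_integrable r"
      by (rule square_integrable_bound(1)[OF rw, of _ 1])
         (use borel_measurable_integrable[OF r1] cmod_le_weighted[OF \<sigma>0, of r] in auto)
    have Fr: "fourier_integral r = (\<lambda>x. fourier_integral p x * fourier_integral q x)"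
      unfolding r_def fourier_integral_cmult c_def
      by (rule ext) (use fourier_integral_convolution[OF pq1] in \<open>simp add: fourier_integral_cmult\<close>)
    have "has_fourier_L2 (\<lambda>x. cnj (fourier_integral r x)) (\<lambda>\<xi>. cnj (r \<xi>))"
      by (rule has_fourier_L2_inversion) (simp add: has_fourier_L2_integral[OF r1 r2])
    moreover have "ae_eq (\<lambda>x. cnj (fourier_integral r x)) (\<lambda>x. u x * v x)"
      using ue ve unfolding ae_eq_def Fr by eventually_elim simp
    ultimately have h: "has_fourier_L2 (\<lambda>x. u x * v x) (\<lambda>\<xi>. cnj (r \<xi>))"
      by (rule has_fourier_L2_cong_left) (use u v sobolev_measurable in \<open>auto intro!: borel_measurable_times\<close>)
    have wcr: "weighted \<sigma> (\<lambda>\<xi>. cnj (r \<xi>)) = (\<lambda>\<xi>. cnj (weighted \<sigma> r \<xi>))"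
      by (auto simp: weighted_def)
    have sq: "square_integrable (weighted \<sigma> (\<lambda>\<xi>. cnj (r \<xi>)))"
      unfolding wcr by (rule square_integrable_cnj[OF rw])
    have "sobolev_norm \<sigma> (\<lambda>x. u x * v x) = c * l2norm (weighted \<sigma> (fun_convolution p q))"
      unfolding sobolevI(2)[OF h sq] wcr l2norm_cnj wr l2norm_cmult using c by simp
    also have "\<dots> \<le> c * (C * 2 * (sobolev_norm \<sigma> u * (K1 * sobolev_norm \<sigma> v) + sobolev_norm \<sigma> v * (K1 * sobolev_norm \<sigma> u)))"
    proof (rule mult_left_mono)
      have "(LINT \<xi>|lborel. cmod (q \<xi>)) \<le> K1 * sobolev_norm \<sigma> v" "(LINT \<xi>|lborel. cmod (p \<xi>)) \<le> K1 * sobolev_norm \<sigma> u"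
        using fi by (simp_all add: p_def q_def)
      then show "l2norm (weighted \<sigma> (fun_convolution p q)) \<le> C * 2 * (sobolev_norm \<sigma> u * (K1 * sobolev_norm \<sigma> v) + sobolev_norm \<sigma> v * (K1 * sobolev_norm \<sigma> u))"
        using C by (intro order_trans[OF wc(2)[folded C_def, unfolded pqw(3,4)]] mult_left_mono add_mono) auto
    qed (use c in simp)
    also have "\<dots> = (c * (C * 4 * K1)) * sobolev_norm \<sigma> u * sobolev_norm \<sigma> v" by (simp add: algebra_simps)
    finally show ?thesis using sobolevI(1)[OF h sq] by blast
  qed
  \<comment> \<open>The added 1 secures positivity without examining whether the computed constant
    is nonzero.\<close>
  let ?K = "c * (C * 4 * K1) + 1"
  have K: "?K > 0" using c C K1 by (intro add_nonneg_pos mult_nonneg_nonneg) auto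
  have "(c * (C * 4 * K1)) * a * b \<le> ?K * a * b" if "0 \<le> a" "0 \<le> b" for a b
    using that by (intro mult_right_mono) auto
  then show ?thesis
    using main K by (intro exI[of _ ?K]) (meson order_trans sobolev_norm_nonneg)
qed

subsection \<open>Completeness and the Cayley transform\<close>

lemma sobolev_norm_diff_fourier:
  assumes "u \<in> sobolev \<sigma>" "has_fourier_L2 v g" "v \<in> sobolev \<sigma>"
  shows "sobolev_norm \<sigma> (\<lambda>x. u x - v x) = l2norm (\<lambda>\<xi>. weighted \<sigma> (fourier_L2 u) \<xi> - weighted \<sigma> g \<xi>)"
  using sobolevD(2)[OF sobolev_diff(1)[OF assms(1,3)] has_fourier_L2_diff[OF has_fourier_sobolev[OF assms(1)] assms(2)]]
  by (simp add: weighted_diff)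

text \<open>Weighted transforms map the space isometrically into L2. The limit found there is
  divided by the weight; for \<sigma> \<ge> 0 the quotient is again square integrable and is the
  transform of some v.\<close>

lemma sobolev_complete:
  fixes w :: "nat \<Rightarrow> 'a::euclidean_space \<Rightarrow> complex"
  assumes w: "\<And>k. w k \<in> sobolev \<sigma>" and "0 \<le> \<sigma>"
    and cauchy: "\<And>e. e > 0 \<Longrightarrow> \<exists>N. \<forall>m\<ge>N. \<forall>n\<ge>N. sobolev_norm \<sigma> (\<lambda>x. w m x - w n x) < e"
  shows "\<exists>v. v \<in> sobolev \<sigma> \<and> (\<lambda>k. sobolev_norm \<sigma> (\<lambda>x. w k x - v x)) \<longlonglongrightarrow> 0"
proof -
  let ?W = "\<lambda>k. weighted \<sigma> (fourier_L2 (w k))"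
  have W: "square_integrable (?W k)" for k using w[of k] by (simp add: sobolev_iff_weighted)
  have e: "sobolev_norm \<sigma> (\<lambda>x. w m x - w n x) = l2norm (\<lambda>\<xi>. ?W m \<xi> - ?W n \<xi>)" for m n
    by (rule sobolev_norm_diff_fourier[OF w has_fourier_sobolev[OF w] w])
  obtain G where G: "square_integrable G" "(\<lambda>k. l2norm (\<lambda>\<xi>. ?W k \<xi> - G \<xi>)) \<longlonglongrightarrow> 0"
    using l2_complete[of ?W, OF W] cauchy unfolding e by blast
  define g where "g = weighted (- \<sigma>) G"
  have [measurable]: "G \<in> borel_measurable borel" using square_integrable_measurable[OF G(1)] .
  have gm: "g \<in> borel_measurable borel" unfolding g_def by measurable
  have "cmod (g \<xi>) \<le> 1 * cmod (G \<xi>)" for \<xi>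
    using cmod_weighted_mono[of "- \<sigma>" 0 G \<xi>] \<open>0 \<le> \<sigma>\<close> by (simp add: g_def cmod_weighted[of 0] add_nonneg_eq_0_iff)
  then have g: "square_integrable g"
    by (intro square_integrable_bound(1)[OF G(1) gm, of 1] AE_I2) auto
  have wg: "weighted \<sigma> g = G"
  proof
    fix \<xi> :: 'a
    have "(1 + (norm \<xi>)\<^sup>2) powr (\<sigma> / 2) * (1 + (norm \<xi>)\<^sup>2) powr (- \<sigma> / 2) = 1"
      by (simp flip: powr_add add: add_nonneg_eq_0_iff)
    then show "weighted \<sigma> g \<xi> = G \<xi>" by (simp add: g_def weighted_def flip: mult.assoc of_real_mult)
  qed
  obtain v where v: "has_fourier_L2 v g" using has_fourier_L2_surj[OF g] by blast
  have vs: "v \<in> sobolev \<sigma>" by (rule sobolevI(1)[OF v]) (simp add: wg G)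
  have "(\<lambda>k. sobolev_norm \<sigma> (\<lambda>x. w k x - v x)) \<longlonglongrightarrow> 0"
    unfolding sobolev_norm_diff_fourier[OF w v vs] wg by (rule G)
  with vs show ?thesis by blast
qed

lemma sobolev_triangle_diff:
  assumes "u \<in> sobolev \<sigma>" "v \<in> sobolev \<sigma>" "w \<in> sobolev \<sigma>"
  shows "sobolev_norm \<sigma> (\<lambda>x. u x - w x) \<le> sobolev_norm \<sigma> (\<lambda>x. u x - v x) + sobolev_norm \<sigma> (\<lambda>x. v x - w x)"
  using sobolev_add(2)[OF sobolev_diff(1)[OF assms(1,2)] sobolev_diff(1)[OF assms(2,3)]] by simp

text \<open>Banach's theorem with contraction factor 1/2, iterating from 0. As norms see only
  classes, the fixed point equation is obtained up to a null set.\<close>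

lemma sobolev_fixpoint:
  assumes T: "\<And>u. u \<in> sobolev \<sigma> \<Longrightarrow> T u \<in> sobolev \<sigma>" and "0 \<le> \<sigma>"
    and contr: "\<And>u v. u \<in> sobolev \<sigma> \<Longrightarrow> v \<in> sobolev \<sigma> \<Longrightarrow>
      sobolev_norm \<sigma> (\<lambda>x. T u x - T v x) \<le> sobolev_norm \<sigma> (\<lambda>x. u x - v x) / 2"
  shows "\<exists>w. w \<in> sobolev \<sigma> \<and> ae_eq (T w) w"
proof -
  define w where "w k = (T ^^ k) (\<lambda>x. 0)" for k
  have w: "w k \<in> sobolev \<sigma>" for k
    by (induction k) (auto simp: w_def T)
  define a where "a = sobolev_norm \<sigma> (\<lambda>x. w 1 x - w 0 x)"
  have a: "a \<ge> 0" by (simp add: a_def)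
  have step: "sobolev_norm \<sigma> (\<lambda>x. w (Suc k) x - w k x) \<le> a * (1/2) ^ k" for k
  proof (induction k)
    case (Suc k)
    have "sobolev_norm \<sigma> (\<lambda>x. w (Suc (Suc k)) x - w (Suc k) x) \<le> sobolev_norm \<sigma> (\<lambda>x. w (Suc k) x - w k x) / 2"
      using contr[OF w[of "Suc k"] w[of k]] by (simp add: w_def)
    then show ?case using Suc by simp
  qed (simp add: a_def)
  \<comment> \<open>The subtracted term makes the induction on j close; dropping it leaves the
    geometric tail bound.\<close>
  have tail: "sobolev_norm \<sigma> (\<lambda>x. w (k + j) x - w k x) \<le> 2 * a * (1/2) ^ k - 2 * a * (1/2) ^ (k + j)" for k j
  proof (induction j)
    case (Suc j)
    have "sobolev_norm \<sigma> (\<lambda>x. w (k + Suc j) x - w k x)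
       \<le> sobolev_norm \<sigma> (\<lambda>x. w (Suc (k + j)) x - w (k + j) x) + sobolev_norm \<sigma> (\<lambda>x. w (k + j) x - w k x)"
      using sobolev_triangle_diff[OF w w w] by simp
    also have "\<dots> \<le> a * (1/2) ^ (k + j) + (2 * a * (1/2) ^ k - 2 * a * (1/2) ^ (k + j))"
      by (intro add_mono step Suc)
    also have "\<dots> = 2 * a * (1/2) ^ k - 2 * a * (1/2) ^ (k + Suc j)" by simp
    finally show ?case .
  qed simp
  have tail': "sobolev_norm \<sigma> (\<lambda>x. w m x - w k x) \<le> 2 * a * (1/2) ^ k" if "m \<ge> k" for m k
    using tail[of k "m - k"] that a by (simp add: order_trans)
  have lim: "(\<lambda>k. 2 * a * (1/2) ^ k) \<longlonglongrightarrow> 2 * a * 0"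
    by (intro tendsto_intros LIMSEQ_realpow_zero) auto
  have "\<exists>v. v \<in> sobolev \<sigma> \<and> (\<lambda>k. sobolev_norm \<sigma> (\<lambda>x. w k x - v x)) \<longlonglongrightarrow> 0"
  proof (rule sobolev_complete[OF w \<open>0 \<le> \<sigma>\<close>])
    fix e :: real assume "e > 0"
    then obtain N where N: "2 * a * (1/2) ^ N < e / 2"
      using LIMSEQ_D[OF lim, of "e/2"] a by auto
    have "sobolev_norm \<sigma> (\<lambda>x. w m x - w n x) < e" if "m \<ge> N" "n \<ge> N" for m n
      using sobolev_triangle_diff[OF w[of m] w[of N] w[of n]] tail'[OF that(1)] tail'[OF that(2)]
        sobolev_norm_minus_commute[OF w[of N] w[of n]] N by simp
    then show "\<exists>N. \<forall>m\<ge>N. \<forall>n\<ge>N. sobolev_norm \<sigma> (\<lambda>x. w m x - w n x) < e" by blast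
  qed
  then obtain v where v: "v \<in> sobolev \<sigma>" and vl: "(\<lambda>k. sobolev_norm \<sigma> (\<lambda>x. w k x - v x)) \<longlonglongrightarrow> 0" by blast
  have bd: "sobolev_norm \<sigma> (\<lambda>x. T v x - v x) \<le> sobolev_norm \<sigma> (\<lambda>x. w k x - v x) / 2 + sobolev_norm \<sigma> (\<lambda>x. w (Suc k) x - v x)" for k
  proof -
    have "sobolev_norm \<sigma> (\<lambda>x. T v x - v x) \<le> sobolev_norm \<sigma> (\<lambda>x. T v x - w (Suc k) x) + sobolev_norm \<sigma> (\<lambda>x. w (Suc k) x - v x)"
      by (rule sobolev_triangle_diff[OF T[OF v] w v])
    also have "sobolev_norm \<sigma> (\<lambda>x. T v x - w (Suc k) x) \<le> sobolev_norm \<sigma> (\<lambda>x. v x - w k x) / 2"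
      using contr[OF v w[of k]] by (simp add: w_def)
    also have "sobolev_norm \<sigma> (\<lambda>x. v x - w k x) = sobolev_norm \<sigma> (\<lambda>x. w k x - v x)"
      by (rule sobolev_norm_minus_commute[OF v w])
    finally show ?thesis by simp
  qed
  have "(\<lambda>k. sobolev_norm \<sigma> (\<lambda>x. w k x - v x) / 2 + sobolev_norm \<sigma> (\<lambda>x. w (Suc k) x - v x)) \<longlonglongrightarrow> 0 / 2 + 0"
    by (intro tendsto_add tendsto_divide tendsto_const vl LIMSEQ_Suc[OF vl]) simp
  then have "sobolev_norm \<sigma> (\<lambda>x. T v x - v x) \<le> 0 / 2 + 0"
    by (rule LIMSEQ_le_const) (use bd in blast)
  then have "sobolev_norm \<sigma> (\<lambda>x. T v x - v x) = 0" using sobolev_norm_nonneg[of \<sigma> "\<lambda>x. T v x - v x"] by linarith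
  from sobolev_norm_diff_eq_0[OF T[OF v] v this] v show ?thesis by blast
qed

section \<open>Solvability of the equation behind the Cayley transform\<close>

lemma opB_diff_norm:
  assumes "u \<in> sobolev \<sigma>" "v \<in> sobolev \<sigma>" "0 \<le> \<sigma>" "c \<noteq> 0"
  shows "sobolev_norm \<sigma> (\<lambda>x. opB c u x - opB c v x) \<le> sobolev_norm \<sigma> (\<lambda>x. u x - v x)"
proof -
  have B: "opB c u \<in> sobolev (\<sigma> + 2)" "opB c v \<in> sobolev (\<sigma> + 2)"
    using assms by (simp_all add: opB_sobolev_gain)
  then have B2: "opB c u \<in> sobolev 2" "opB c v \<in> sobolev 2"
    using sobolev_mono(1)[of _ "\<sigma> + 2" 2] assms(3) by simp_all
  have z: "u \<in> sobolev 0" "v \<in> sobolev 0" using assms sobolev_mono(1) by auto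
  have D: "(\<lambda>x. opB c u x - opB c v x) \<in> sobolev (\<sigma> + 2)" by (rule sobolev_diff(1)[OF B])
  note Dc = crank_sobolev(1)[OF D assms(3), of c]
  \<comment> \<open>\<open>opB\<close> is linear almost everywhere only. Applying
    \<open>crank c\<close> to the difference recovers the difference of the data, and does not
    decrease the norm.\<close>
  have "ae_eq (crank c (\<lambda>x. opB c u x - opB c v x)) (\<lambda>x. u x - v x)"
    using crank_diff[OF B2, of c] crank_opB[OF z(1) assms(4)] crank_opB[OF z(2) assms(4)]
    unfolding ae_eq_def by eventually_elim simp
  then have "sobolev_norm \<sigma> (crank c (\<lambda>x. opB c u x - opB c v x)) = sobolev_norm \<sigma> (\<lambda>x. u x - v x)"
    using sobolev_cong_ae(2)[OF Dc] sobolev_measurable[OF sobolev_diff(1)[OF assms(1,2)]] by simp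
  with norm_le_crank(2)[OF sobolev_diff(1)[OF B2] Dc] show ?thesis by simp
qed

text \<open>Splits the left side of the Cayley equation into a constant-coefficient operator, which
  can be inverted on the Fourier side, and a potential term of size c, which is treated as a
  perturbation.\<close>

lemma hamiltonian_crank:
  "2 * u x + \<i> * of_real c * hamiltonian \<beta> V u x = - 2 * \<i> * crank c u x + \<i> * of_real (c * \<beta>) * (V x * u x)"
  by (simp add: hamiltonian_def crank_def algebra_simps)

text \<open>Provides the witness for the \<open>SOME\<close> in \<open>cayley\<close>. The operator
  \<open>crank c\<close> is inverted by \<open>opB c\<close>, and the smallness premise makes the
  remaining potential term a contraction with factor 1/2.\<close>

lemma cayley_exists:
  fixes V \<phi> :: "'a::euclidean_space \<Rightarrow> complex"
  assumes K: "\<And>u v :: 'a \<Rightarrow> complex. u \<in> sobolev \<sigma> \<Longrightarrow> v \<in> sobolev \<sigma> \<Longrightarrow> (\<lambda>x. u x * v x) \<in> sobolev \<sigma> \<and>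
      sobolev_norm \<sigma> (\<lambda>x. u x * v x) \<le> K * sobolev_norm \<sigma> u * sobolev_norm \<sigma> v"
    and "0 \<le> \<sigma>" and V: "V \<in> sobolev \<sigma>" and \<phi>: "\<phi> \<in> sobolev (\<sigma> + 2)" and c: "c \<noteq> 0"
    and small: "\<bar>c * \<beta>\<bar> * K * sobolev_norm \<sigma> V \<le> 1"
  shows "\<exists>w. w \<in> sobolev 2 \<and>
     ae_eq (\<lambda>x. 2 * w x + \<i> * of_real c * hamiltonian \<beta> V w x)
           (\<lambda>x. 2 * \<phi> x - \<i> * of_real c * hamiltonian \<beta> V \<phi> x)"
proof -
  define f where "f = (\<lambda>x. 2 * \<phi> x - \<i> * of_real c * hamiltonian \<beta> V \<phi> x)"
  have \<phi>\<sigma>: "\<phi> \<in> sobolev \<sigma>" using sobolev_mono(1)[OF \<phi>] by simp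
  have "(\<lambda>x. - 2 * \<i> * crank (- c) \<phi> x + \<i> * of_real (- c * \<beta>) * (V x * \<phi> x)) \<in> sobolev \<sigma>"
    using K[OF V \<phi>\<sigma>] by (intro sobolev_add(1) sobolev_cmult(1) crank_sobolev(1)[OF \<phi> \<open>0 \<le> \<sigma>\<close>]) auto
  also have "(\<lambda>x. - 2 * \<i> * crank (- c) \<phi> x + \<i> * of_real (- c * \<beta>) * (V x * \<phi> x)) = f"
    by (rule ext) (simp add: f_def hamiltonian_def crank_def algebra_simps)
  finally have f: "f \<in> sobolev \<sigma>" .
  \<comment> \<open>The equation solved for \<open>crank c w\<close>; the factor \<i> / 2 is the
    inverse of -2 \<i>.\<close>
  define g where "g w = (\<lambda>x. (\<i> / 2) * (f x - \<i> * of_real (c * \<beta>) * (V x * w x)))" for w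
  have g: "g w \<in> sobolev \<sigma>" if "w \<in> sobolev \<sigma>" for w
    unfolding g_def using K[OF V that] f by (intro sobolev_cmult(1) sobolev_diff(1)) auto
  define T where "T w = opB c (g w)" for w
  have T: "T w \<in> sobolev \<sigma>" if "w \<in> sobolev \<sigma>" for w
    unfolding T_def by (rule opB_sobolev(1)[OF g[OF that] \<open>0 \<le> \<sigma>\<close>])
  have contr: "sobolev_norm \<sigma> (\<lambda>x. T u x - T v x) \<le> sobolev_norm \<sigma> (\<lambda>x. u x - v x) / 2"
    if u: "u \<in> sobolev \<sigma>" and v: "v \<in> sobolev \<sigma>" for u v
  proof -
    note d = sobolev_diff(1)[OF u v]
    have e: "(\<lambda>x. g u x - g v x) = (\<lambda>x. of_real (c * \<beta> / 2) * (V x * (u x - v x)))"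
      by (rule ext) (simp add: g_def algebra_simps)
    have "sobolev_norm \<sigma> (\<lambda>x. T u x - T v x) \<le> sobolev_norm \<sigma> (\<lambda>x. g u x - g v x)"
      unfolding T_def by (rule opB_diff_norm[OF g[OF u] g[OF v] \<open>0 \<le> \<sigma>\<close> c])
    also have "\<dots> = \<bar>c * \<beta>\<bar> / 2 * sobolev_norm \<sigma> (\<lambda>x. V x * (u x - v x))"
      unfolding e using K[OF V d] by (subst sobolev_cmult(2)) (auto simp: norm_mult norm_divide abs_mult)
    also have "\<dots> \<le> \<bar>c * \<beta>\<bar> / 2 * (K * sobolev_norm \<sigma> V * sobolev_norm \<sigma> (\<lambda>x. u x - v x))"
      using K[OF V d] by (intro mult_left_mono) auto
    also have "\<dots> = (\<bar>c * \<beta>\<bar> * K * sobolev_norm \<sigma> V) * (sobolev_norm \<sigma> (\<lambda>x. u x - v x) / 2)" by simp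
    also have "\<dots> \<le> 1 * (sobolev_norm \<sigma> (\<lambda>x. u x - v x) / 2)"
      by (intro mult_right_mono small) simp
    finally show ?thesis by simp
  qed
  obtain w where w: "w \<in> sobolev \<sigma>" "ae_eq (T w) w"
    using sobolev_fixpoint[OF T \<open>0 \<le> \<sigma>\<close> contr] by blast
  \<comment> \<open>The witness is \<open>T w\<close> in place of w: being a value of
    \<open>opB\<close>, it has two more derivatives and so lies in the space of order 2 demanded by
    \<open>cayley\<close>.\<close>
  have T2: "T w \<in> sobolev 2"
    using sobolev_mono(1)[OF opB_sobolev_gain[OF g[OF w(1)] \<open>0 \<le> \<sigma>\<close> c], of 2] \<open>0 \<le> \<sigma>\<close> by (simp add: T_def)
  have "ae_eq (crank c (T w)) (g w)"
    unfolding T_def using sobolev_mono(1)[OF g[OF w(1)], of 0] \<open>0 \<le> \<sigma>\<close> c by (intro crank_opB) auto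
  then have "ae_eq (\<lambda>x. 2 * T w x + \<i> * of_real c * hamiltonian \<beta> V (T w) x) f"
    using w(2) unfolding hamiltonian_crank ae_eq_def
    by eventually_elim (simp add: g_def algebra_simps)
  with T2 show ?thesis unfolding f_def by blast
qed

subsection \<open>Differentiation in Sobolev spaces\<close>

text \<open>Only the real part, so that testing a curve with a fixed function gives a real function
  of time, to which Taylor's theorem with Lagrange remainder applies.\<close>

definition sobolev_inner :: "real \<Rightarrow> ('a::euclidean_space \<Rightarrow> complex) \<Rightarrow> ('a \<Rightarrow> complex) \<Rightarrow> real" where
  "sobolev_inner \<sigma> u v = Re (l2pair (weighted \<sigma> (fourier_L2 u)) (\<lambda>\<xi>. cnj (weighted \<sigma> (fourier_L2 v) \<xi>)))"

lemma l2pair_cong_left: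
  assumes "ae_eq f g" "f \<in> borel_measurable borel" "g \<in> borel_measurable borel" "h \<in> borel_measurable borel"
  shows "l2pair f h = l2pair g h"
  unfolding l2pair_def using assms by (intro integral_cong_AE) (auto simp: ae_eq_def)

lemma sobolev_inner_eq:
  assumes "u \<in> sobolev \<sigma>" "v \<in> sobolev \<sigma>" "has_fourier_L2 u g"
  shows "sobolev_inner \<sigma> u v = Re (l2pair (weighted \<sigma> g) (\<lambda>\<xi>. cnj (weighted \<sigma> (fourier_L2 v) \<xi>)))"
proof -
  have "ae_eq (weighted \<sigma> (fourier_L2 u)) (weighted \<sigma> g)"
    by (intro weighted_ae_cong has_fourier_L2_unique[OF has_fourier_sobolev[OF assms(1)] assms(3)])
  then show ?thesis
    unfolding sobolev_inner_def
    using sobolevD(1)[OF assms(1) has_fourier_sobolev[OF assms(1)]] sobolevD(1)[OF assms(1,3)]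
      square_integrable_cnj[OF sobolevD(1)[OF assms(2) has_fourier_sobolev[OF assms(2)]]]
    by (subst l2pair_cong_left) (auto dest: square_integrable_measurable)
qed

lemma sobolev_inner_le:
  assumes "u \<in> sobolev \<sigma>" "v \<in> sobolev \<sigma>"
  shows "\<bar>sobolev_inner \<sigma> u v\<bar> \<le> sobolev_norm \<sigma> u * sobolev_norm \<sigma> v"
proof -
  have "\<bar>sobolev_inner \<sigma> u v\<bar> \<le> cmod (l2pair (weighted \<sigma> (fourier_L2 u)) (\<lambda>\<xi>. cnj (weighted \<sigma> (fourier_L2 v) \<xi>)))"
    unfolding sobolev_inner_def by (rule abs_Re_le_cmod)
  also have "\<dots> \<le> sobolev_norm \<sigma> u * sobolev_norm \<sigma> v"
    using l2pair_le[of "weighted \<sigma> (fourier_L2 u)" "\<lambda>\<xi>. cnj (weighted \<sigma> (fourier_L2 v) \<xi>)"] assms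
    by (simp add: sobolev_iff_weighted sobolev_norm_weighted)
  finally show ?thesis .
qed

lemma sobolev_inner_self: "sobolev_inner \<sigma> u u = (sobolev_norm \<sigma> u)\<^sup>2"
  unfolding sobolev_inner_def l2norm_sq_pair[symmetric] sobolev_norm_weighted by simp

lemma sobolev_inner_add:
  assumes "u \<in> sobolev \<sigma>" "v \<in> sobolev \<sigma>" "w \<in> sobolev \<sigma>"
  shows "sobolev_inner \<sigma> (\<lambda>x. u x + v x) w = sobolev_inner \<sigma> u w + sobolev_inner \<sigma> v w"
proof -
  note h = has_fourier_sobolev[OF assms(1)] has_fourier_sobolev[OF assms(2)] has_fourier_sobolev[OF assms(3)]
  note s = sobolevD(1)[OF assms(1) h(1)] sobolevD(1)[OF assms(2) h(2)] square_integrable_cnj[OF sobolevD(1)[OF assms(3) h(3)]]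
  show ?thesis
    unfolding sobolev_inner_eq[OF sobolev_add(1)[OF assms(1,2)] assms(3) has_fourier_L2_add[OF h(1,2)]] weighted_add
      l2pair_add_left[OF s]
    by (simp add: sobolev_inner_def)
qed

lemma sobolev_inner_scale:
  assumes "u \<in> sobolev \<sigma>" "w \<in> sobolev \<sigma>"
  shows "sobolev_inner \<sigma> (\<lambda>x. of_real c * u x) w = c * sobolev_inner \<sigma> u w"
proof -
  have e: "l2pair (\<lambda>\<xi>. of_real c * f \<xi>) h = of_real c * l2pair f h" for f h :: "'a \<Rightarrow> complex"
    unfolding l2pair_def by (subst integral_mult_right_zero[symmetric]) (simp add: mult.assoc)
  show ?thesis
    unfolding sobolev_inner_eq[OF sobolev_cmult(1)[OF assms(1)] assms(2) has_fourier_L2_cmult[OF has_fourier_sobolev[OF assms(1)]]]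
      weighted_cmult e
    by (simp add: sobolev_inner_def)
qed

lemma sobolev_inner_diff:
  assumes "u \<in> sobolev \<sigma>" "v \<in> sobolev \<sigma>" "w \<in> sobolev \<sigma>"
  shows "sobolev_inner \<sigma> (\<lambda>x. u x - v x) w = sobolev_inner \<sigma> u w - sobolev_inner \<sigma> v w"
  using sobolev_inner_add[OF assms(1) sobolev_cmult(1)[OF assms(2), of "of_real (-1)"] assms(3)]
    sobolev_inner_scale[OF assms(2,3), of "-1"] by simp

text \<open>Pairing with a fixed w is a real-linear functional bounded by the norm of w, so it
  commutes with the limit of difference quotients.\<close>

lemma has_sobolev_derivative_inner:
  assumes u: "has_sobolev_derivative \<sigma> u v t I" and w: "w \<in> sobolev \<sigma>"
  shows "((\<lambda>\<tau>. sobolev_inner \<sigma> (u \<tau>) w) has_real_derivative sobolev_inner \<sigma> v w) (at t within I)"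
proof -
  have ut: "u t \<in> sobolev \<sigma>" and v: "v \<in> sobolev \<sigma>" and ev: "\<forall>\<^sub>F \<tau> in at t within I. u \<tau> \<in> sobolev \<sigma>"
    and lim: "((\<lambda>\<tau>. sobolev_norm \<sigma> (\<lambda>x. (u \<tau> x - u t x) / of_real (\<tau> - t) - v x)) \<longlongrightarrow> 0) (at t within I)"
    using u by (simp_all add: has_sobolev_derivative_def)
  have "((\<lambda>\<tau>. (sobolev_inner \<sigma> (u \<tau>) w - sobolev_inner \<sigma> (u t) w) / (\<tau> - t) - sobolev_inner \<sigma> v w) \<longlongrightarrow> 0) (at t within I)"
  proof (rule Lim_null_comparison)
    show "((\<lambda>\<tau>. sobolev_norm \<sigma> (\<lambda>x. (u \<tau> x - u t x) / of_real (\<tau> - t) - v x) * sobolev_norm \<sigma> w) \<longlongrightarrow> 0) (at t within I)"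
      using tendsto_mult[OF lim tendsto_const[of "sobolev_norm \<sigma> w"]] by simp
    show "\<forall>\<^sub>F \<tau> in at t within I. norm ((sobolev_inner \<sigma> (u \<tau>) w - sobolev_inner \<sigma> (u t) w) / (\<tau> - t) - sobolev_inner \<sigma> v w)
      \<le> sobolev_norm \<sigma> (\<lambda>x. (u \<tau> x - u t x) / of_real (\<tau> - t) - v x) * sobolev_norm \<sigma> w"
      using ev
    proof eventually_elim
      case (elim \<tau>)
      note d = sobolev_diff(1)[OF elim ut]
      have q: "(\<lambda>x. of_real (1 / (\<tau> - t)) * (u \<tau> x - u t x)) \<in> sobolev \<sigma>" by (rule sobolev_cmult(1)[OF d])
      have "(sobolev_inner \<sigma> (u \<tau>) w - sobolev_inner \<sigma> (u t) w) / (\<tau> - t) - sobolev_inner \<sigma> v w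
        = sobolev_inner \<sigma> (\<lambda>x. of_real (1 / (\<tau> - t)) * (u \<tau> x - u t x) - v x) w"
        unfolding sobolev_inner_diff[OF q v w] sobolev_inner_scale[OF d w] sobolev_inner_diff[OF elim ut w] by simp
      also have "\<bar>\<dots>\<bar> \<le> sobolev_norm \<sigma> (\<lambda>x. of_real (1 / (\<tau> - t)) * (u \<tau> x - u t x) - v x) * sobolev_norm \<sigma> w"
        by (rule sobolev_inner_le[OF sobolev_diff(1)[OF q v] w])
      finally show ?case by (simp add: field_simps)
    qed
  qed
  then show ?thesis
    unfolding has_field_derivative_iff by (rule LIM_zero_cancel)
qed

text \<open>The increment is \<tau> - t times a quotient of bounded norm. Continuity of the norms is
  what yields uniform bounds on compact time intervals.\<close>

lemma has_sobolev_derivative_norm_continuous: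
  assumes u: "has_sobolev_derivative \<sigma> u v t I"
  shows "((\<lambda>\<tau>. sobolev_norm \<sigma> (u \<tau>)) \<longlongrightarrow> sobolev_norm \<sigma> (u t)) (at t within I)"
proof -
  have ut: "u t \<in> sobolev \<sigma>" and v: "v \<in> sobolev \<sigma>" and ev: "\<forall>\<^sub>F \<tau> in at t within I. u \<tau> \<in> sobolev \<sigma>"
    and lim: "((\<lambda>\<tau>. sobolev_norm \<sigma> (\<lambda>x. (u \<tau> x - u t x) / of_real (\<tau> - t) - v x)) \<longlongrightarrow> 0) (at t within I)"
    using u by (simp_all add: has_sobolev_derivative_def)
  have "((\<lambda>\<tau>. sobolev_norm \<sigma> (u \<tau>) - sobolev_norm \<sigma> (u t)) \<longlongrightarrow> 0) (at t within I)"
  proof (rule Lim_null_comparison)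
    have "((\<lambda>\<tau>. \<bar>\<tau> - t\<bar> * (sobolev_norm \<sigma> (\<lambda>x. (u \<tau> x - u t x) / of_real (\<tau> - t) - v x) + sobolev_norm \<sigma> v)) \<longlongrightarrow> \<bar>t - t\<bar> * (0 + sobolev_norm \<sigma> v)) (at t within I)"
      by (intro tendsto_intros lim)
    then show "((\<lambda>\<tau>. \<bar>\<tau> - t\<bar> * (sobolev_norm \<sigma> (\<lambda>x. (u \<tau> x - u t x) / of_real (\<tau> - t) - v x) + sobolev_norm \<sigma> v)) \<longlongrightarrow> 0) (at t within I)"
      by simp
    have ne: "\<forall>\<^sub>F \<tau> in at t within I. \<tau> \<noteq> t" by (simp add: eventually_at_filter)
    show "\<forall>\<^sub>F \<tau> in at t within I. norm (sobolev_norm \<sigma> (u \<tau>) - sobolev_norm \<sigma> (u t))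
        \<le> \<bar>\<tau> - t\<bar> * (sobolev_norm \<sigma> (\<lambda>x. (u \<tau> x - u t x) / of_real (\<tau> - t) - v x) + sobolev_norm \<sigma> v)"
      using ev ne
    proof eventually_elim
      case (elim \<tau>)
      note d = sobolev_diff(1)[OF elim(1) ut]
      let ?q = "\<lambda>x. (u \<tau> x - u t x) / of_real (\<tau> - t)"
      have q: "?q \<in> sobolev \<sigma>"
        using sobolev_cmult(1)[OF d, of "1 / of_real (\<tau> - t)"] by simp
      have "sobolev_norm \<sigma> (u \<tau>) \<le> sobolev_norm \<sigma> (u t) + sobolev_norm \<sigma> (\<lambda>x. u \<tau> x - u t x)"
        using sobolev_add(2)[OF ut d] by simp
      moreover have "sobolev_norm \<sigma> (u t) \<le> sobolev_norm \<sigma> (u \<tau>) + sobolev_norm \<sigma> (\<lambda>x. u \<tau> x - u t x)"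
        using sobolev_add(2)[OF elim(1) sobolev_diff(1)[OF ut elim(1)]] sobolev_norm_minus_commute[OF elim(1) ut] by simp
      ultimately have "norm (sobolev_norm \<sigma> (u \<tau>) - sobolev_norm \<sigma> (u t)) \<le> sobolev_norm \<sigma> (\<lambda>x. u \<tau> x - u t x)"
        by simp
      also have "(\<lambda>x. u \<tau> x - u t x) = (\<lambda>x. of_real (\<tau> - t) * ?q x)"
        using elim(2) by (intro ext) simp
      also have "sobolev_norm \<sigma> \<dots> = \<bar>\<tau> - t\<bar> * sobolev_norm \<sigma> ?q"
        by (subst sobolev_cmult(2)[OF q]) (simp only: norm_of_real)
      also have "\<dots> \<le> \<bar>\<tau> - t\<bar> * (sobolev_norm \<sigma> (\<lambda>x. ?q x - v x) + sobolev_norm \<sigma> v)"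
        using sobolev_add(2)[OF sobolev_diff(1)[OF q v] v] by (intro mult_left_mono) auto
      finally show ?case .
    qed
  qed
  then show ?thesis by (rule LIM_zero_cancel)
qed

text \<open>The derivative of the smooth curve, the one in the equation and
  \<open>sobolev_deriv\<close> are chosen independently; this identifies them. The condition on the
  filter excludes isolated times.\<close>

lemma has_sobolev_derivative_unique:
  assumes "has_sobolev_derivative \<sigma> u v t I" "has_sobolev_derivative \<sigma> u v' t I" "at t within I \<noteq> bot"
  shows "ae_eq v v'"
proof -
  have ut: "u t \<in> sobolev \<sigma>" and v: "v \<in> sobolev \<sigma>" "v' \<in> sobolev \<sigma>" and ev: "\<forall>\<^sub>F \<tau> in at t within I. u \<tau> \<in> sobolev \<sigma>"
    and lim: "((\<lambda>\<tau>. sobolev_norm \<sigma> (\<lambda>x. (u \<tau> x - u t x) / of_real (\<tau> - t) - v x)) \<longlongrightarrow> 0) (at t within I)"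
      "((\<lambda>\<tau>. sobolev_norm \<sigma> (\<lambda>x. (u \<tau> x - u t x) / of_real (\<tau> - t) - v' x)) \<longlongrightarrow> 0) (at t within I)"
    using assms by (simp_all add: has_sobolev_derivative_def)
  have "((\<lambda>\<tau>::real. sobolev_norm \<sigma> (\<lambda>x. v x - v' x)) \<longlongrightarrow> 0) (at t within I)"
  proof (rule Lim_null_comparison)
    show "((\<lambda>\<tau>. sobolev_norm \<sigma> (\<lambda>x. (u \<tau> x - u t x) / of_real (\<tau> - t) - v x) + sobolev_norm \<sigma> (\<lambda>x. (u \<tau> x - u t x) / of_real (\<tau> - t) - v' x)) \<longlongrightarrow> 0) (at t within I)"
      by (rule tendsto_add_zero[OF lim])
    show "\<forall>\<^sub>F \<tau> in at t within I. norm (sobolev_norm \<sigma> (\<lambda>x. v x - v' x))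
       \<le> sobolev_norm \<sigma> (\<lambda>x. (u \<tau> x - u t x) / of_real (\<tau> - t) - v x) + sobolev_norm \<sigma> (\<lambda>x. (u \<tau> x - u t x) / of_real (\<tau> - t) - v' x)"
      using ev
    proof eventually_elim
      case (elim \<tau>)
      have q: "(\<lambda>x. (u \<tau> x - u t x) / of_real (\<tau> - t)) \<in> sobolev \<sigma>"
        using sobolev_cmult(1)[OF sobolev_diff(1)[OF elim ut], of "1 / of_real (\<tau> - t)"] by simp
      show ?case
        using sobolev_triangle_diff[OF v(1) q v(2)] sobolev_norm_minus_commute[OF v(1) q] by simp
    qed
  qed
  then have "sobolev_norm \<sigma> (\<lambda>x. v x - v' x) = 0"
    using tendsto_unique[OF assms(3) tendsto_const] by blast
  then show ?thesis by (rule sobolev_norm_diff_eq_0[OF v])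
qed

lemma has_sobolev_derivative_mono:
  assumes "has_sobolev_derivative \<rho> u v t I" "\<sigma> \<le> \<rho>"
  shows "has_sobolev_derivative \<sigma> u v t I"
proof -
  have ut: "u t \<in> sobolev \<rho>" and v: "v \<in> sobolev \<rho>" and ev: "\<forall>\<^sub>F \<tau> in at t within I. u \<tau> \<in> sobolev \<rho>"
    and lim: "((\<lambda>\<tau>. sobolev_norm \<rho> (\<lambda>x. (u \<tau> x - u t x) / of_real (\<tau> - t) - v x)) \<longlongrightarrow> 0) (at t within I)"
    using assms by (simp_all add: has_sobolev_derivative_def)
  have "((\<lambda>\<tau>. sobolev_norm \<sigma> (\<lambda>x. (u \<tau> x - u t x) / of_real (\<tau> - t) - v x)) \<longlongrightarrow> 0) (at t within I)"
  proof (rule Lim_null_comparison[OF _ lim])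
    show "\<forall>\<^sub>F \<tau> in at t within I. norm (sobolev_norm \<sigma> (\<lambda>x. (u \<tau> x - u t x) / of_real (\<tau> - t) - v x)) \<le> sobolev_norm \<rho> (\<lambda>x. (u \<tau> x - u t x) / of_real (\<tau> - t) - v x)"
      using ev
    proof eventually_elim
      case (elim \<tau>)
      have q: "(\<lambda>x. (u \<tau> x - u t x) / of_real (\<tau> - t)) \<in> sobolev \<rho>"
        using sobolev_cmult(1)[OF sobolev_diff(1)[OF elim ut], of "1 / of_real (\<tau> - t)"] by simp
      show ?case using sobolev_mono(2)[OF sobolev_diff(1)[OF q v] assms(2)] by simp
    qed
  qed
  then show ?thesis
    using ut v ev sobolev_mono(1)[OF _ assms(2)]
    by (auto simp: has_sobolev_derivative_def elim: eventually_mono)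
qed

text \<open>\<open>sobolev_deriv\<close> is taken over all real times, the derivatives of the
  solution within an interval; inside an open interval the two filters agree.\<close>

lemma sobolev_deriv_eq:
  assumes "has_sobolev_derivative \<sigma> u v t I" "open I" "t \<in> I"
  shows "ae_eq (sobolev_deriv \<sigma> u t) v" "sobolev_deriv \<sigma> u t \<in> sobolev \<sigma>"
proof -
  have v: "has_sobolev_derivative \<sigma> u v t UNIV"
    using assms(1) unfolding has_sobolev_derivative_def at_within_open[OF assms(3,2)] .
  have d: "has_sobolev_derivative \<sigma> u (sobolev_deriv \<sigma> u t) t UNIV"
    unfolding sobolev_deriv_def using v by (rule someI[where P="\<lambda>v. has_sobolev_derivative \<sigma> u v t UNIV"])
  show "ae_eq (sobolev_deriv \<sigma> u t) v"
    by (rule has_sobolev_derivative_unique[OF d v]) simp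
  show "sobolev_deriv \<sigma> u t \<in> sobolev \<sigma>" using d by (simp add: has_sobolev_derivative_def)
qed

text \<open>Testing against the remainder itself reduces Taylor's formula to real functions.\<close>

lemma sobolev_norm_le_inner:
  assumes "E \<in> sobolev \<sigma>" "sobolev_inner \<sigma> E E \<le> C * sobolev_norm \<sigma> E" "0 \<le> C"
  shows "sobolev_norm \<sigma> E \<le> C"
proof (cases "sobolev_norm \<sigma> E = 0")
  case False
  then have pos: "0 < sobolev_norm \<sigma> E" using sobolev_norm_nonneg[of \<sigma> E] by linarith
  have "sobolev_norm \<sigma> E * sobolev_norm \<sigma> E \<le> C * sobolev_norm \<sigma> E"
    using assms(2) by (simp add: sobolev_inner_self power2_eq_square)
  with pos show ?thesis by simp
qed (use assms in simp)

text \<open>Taylor expansion about the midpoint in both directions; the terms of the wrong parity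
  cancel. The two Lagrange remainders of the last formula give B/3, rounded up to B.\<close>

lemma real_taylor:
  fixes p :: "nat \<Rightarrow> real \<Rightarrow> real"
  assumes der: "\<And>k t. \<tau> - h \<le> t \<Longrightarrow> t \<le> \<tau> + h \<Longrightarrow> (p k has_real_derivative p (Suc k) t) (at t)"
    and "h > 0"
  shows "\<And>k B. (\<And>t. \<tau> - h \<le> t \<Longrightarrow> t \<le> \<tau> + h \<Longrightarrow> \<bar>p (Suc k) t\<bar> \<le> B) \<Longrightarrow> \<bar>p k (\<tau> + h) - p k (\<tau> - h)\<bar> \<le> 2 * h * B"
    and "\<And>k B. (\<And>t. \<tau> - h \<le> t \<Longrightarrow> t \<le> \<tau> + h \<Longrightarrow> \<bar>p (k + 2) t\<bar> \<le> B) \<Longrightarrow> \<bar>p k (\<tau> + h) + p k (\<tau> - h) - 2 * p k \<tau>\<bar> \<le> B * h\<^sup>2"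
    and "\<And>k B. (\<And>t. \<tau> - h \<le> t \<Longrightarrow> t \<le> \<tau> + h \<Longrightarrow> \<bar>p (k + 3) t\<bar> \<le> B) \<Longrightarrow> \<bar>p k (\<tau> + h) - p k (\<tau> - h) - 2 * h * p (Suc k) \<tau>\<bar> \<le> B * h ^ 3"
proof -
  have up: "\<exists>t. \<tau> < t \<and> t < \<tau> + h \<and> p k (\<tau> + h) = (\<Sum>m<n. p (k + m) \<tau> / fact m * h ^ m) + p (k + n) t / fact n * h ^ n"
    if "n > 0" for k n
    using Taylor_up[of n "\<lambda>m. p (k + m)" "p k" "\<tau> - h" "\<tau> + h" \<tau>] that der \<open>h > 0\<close> by auto
  have down: "\<exists>t. \<tau> - h < t \<and> t < \<tau> \<and> p k (\<tau> - h) = (\<Sum>m<n. p (k + m) \<tau> / fact m * (- h) ^ m) + p (k + n) t / fact n * (- h) ^ n"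
    if "n > 0" for k n
    using Taylor_down[of n "\<lambda>m. p (k + m)" "p k" "\<tau> - h" "\<tau> + h" \<tau>] that der \<open>h > 0\<close> by auto
  { fix k B assume B: "\<And>t. \<tau> - h \<le> t \<Longrightarrow> t \<le> \<tau> + h \<Longrightarrow> \<bar>p (Suc k) t\<bar> \<le> B"
    obtain t where t: "\<tau> < t" "t < \<tau> + h" "p k (\<tau> + h) = p k \<tau> + p (Suc k) t * h"
      using up[of 1 k] by auto
    obtain r where r: "\<tau> - h < r" "r < \<tau>" "p k (\<tau> - h) = p k \<tau> - p (Suc k) r * h"
      using down[of 1 k] by auto
    have "p k (\<tau> + h) - p k (\<tau> - h) = (p (Suc k) t + p (Suc k) r) * h"
      unfolding t(3) r(3) by (simp add: algebra_simps)
    moreover have "\<bar>p (Suc k) t + p (Suc k) r\<bar> \<le> 2 * B"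
      using B[of t] B[of r] t r by linarith
    ultimately show "\<bar>p k (\<tau> + h) - p k (\<tau> - h)\<bar> \<le> 2 * h * B"
      using \<open>h > 0\<close> mult_right_mono[of "\<bar>p (Suc k) t + p (Suc k) r\<bar>" "2 * B" h] by (simp add: abs_mult ac_simps) }
  { fix k B assume B: "\<And>t. \<tau> - h \<le> t \<Longrightarrow> t \<le> \<tau> + h \<Longrightarrow> \<bar>p (k + 2) t\<bar> \<le> B"
    obtain t where t: "\<tau> < t" "t < \<tau> + h" "p k (\<tau> + h) = p k \<tau> + p (Suc k) \<tau> * h + p (k + 2) t / 2 * h\<^sup>2"
      using up[of 2 k] by (auto simp: numeral_2_eq_2)
    obtain r where r: "\<tau> - h < r" "r < \<tau>" "p k (\<tau> - h) = p k \<tau> - p (Suc k) \<tau> * h + p (k + 2) r / 2 * h\<^sup>2"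
      using down[of 2 k] by (auto simp: numeral_2_eq_2)
    have "p k (\<tau> + h) + p k (\<tau> - h) - 2 * p k \<tau> = (p (k + 2) t / 2 + p (k + 2) r / 2) * h\<^sup>2"
      unfolding t(3) r(3) by (simp add: algebra_simps)
    moreover have "\<bar>p (k + 2) t / 2 + p (k + 2) r / 2\<bar> \<le> B"
      using B[of t] B[of r] t r by linarith
    ultimately show "\<bar>p k (\<tau> + h) + p k (\<tau> - h) - 2 * p k \<tau>\<bar> \<le> B * h\<^sup>2"
      using mult_right_mono[of "\<bar>p (k + 2) t / 2 + p (k + 2) r / 2\<bar>" B "h\<^sup>2"] by (simp add: abs_mult) }
  { fix k B assume B: "\<And>t. \<tau> - h \<le> t \<Longrightarrow> t \<le> \<tau> + h \<Longrightarrow> \<bar>p (k + 3) t\<bar> \<le> B"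
    obtain t where t: "\<tau> < t" "t < \<tau> + h" "p k (\<tau> + h) = p k \<tau> + p (Suc k) \<tau> * h + p (k + 2) \<tau> / 2 * h\<^sup>2 + p (k + 3) t / 6 * h ^ 3"
      using up[of 3 k] by (auto simp: numeral_3_eq_3 numeral_2_eq_2 fact_numeral)
    obtain r where r: "\<tau> - h < r" "r < \<tau>" "p k (\<tau> - h) = p k \<tau> - p (Suc k) \<tau> * h + p (k + 2) \<tau> / 2 * h\<^sup>2 - p (k + 3) r / 6 * h ^ 3"
      using down[of 3 k] by (auto simp: numeral_3_eq_3 numeral_2_eq_2 fact_numeral)
    have "p k (\<tau> + h) - p k (\<tau> - h) - 2 * h * p (Suc k) \<tau> = (p (k + 3) t / 6 + p (k + 3) r / 6) * h ^ 3"
      unfolding t(3) r(3) by (simp add: algebra_simps)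
    moreover have "\<bar>p (k + 3) t / 6 + p (k + 3) r / 6\<bar> \<le> B"
      using B[of t] B[of r] t r by linarith
    ultimately show "\<bar>p k (\<tau> + h) - p k (\<tau> - h) - 2 * h * p (Suc k) \<tau>\<bar> \<le> B * h ^ 3"
      using \<open>h > 0\<close> mult_right_mono[of "\<bar>p (k + 3) t / 6 + p (k + 3) r / 6\<bar>" B "h ^ 3"] by (simp add: abs_mult) }
qed

text \<open>M bounds the derivatives up to order 3. This limits k in the three formulas, which
  involve the first, second and third derivative of \<open>D k\<close> respectively.\<close>

lemma sobolev_taylor:
  fixes D :: "nat \<Rightarrow> real \<Rightarrow> 'a::euclidean_space \<Rightarrow> complex"
  assumes D: "\<And>k t. t \<in> I \<Longrightarrow> has_sobolev_derivative \<sigma> (D k) (D (Suc k) t) t I"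
    and I: "open I" "{\<tau> - h..\<tau> + h} \<subseteq> I" and h: "h > 0"
    and M: "\<And>k t. k \<le> 3 \<Longrightarrow> t \<in> {\<tau> - h..\<tau> + h} \<Longrightarrow> sobolev_norm \<sigma> (D k t) \<le> M"
  shows "k \<le> 2 \<Longrightarrow> sobolev_norm \<sigma> (\<lambda>x. D k (\<tau> + h) x - D k (\<tau> - h) x) \<le> 2 * h * M"
    and "k \<le> 1 \<Longrightarrow> sobolev_norm \<sigma> (\<lambda>x. D k (\<tau> + h) x + D k (\<tau> - h) x - 2 * D k \<tau> x) \<le> M * h\<^sup>2"
    and "sobolev_norm \<sigma> (\<lambda>x. D 0 (\<tau> + h) x - D 0 (\<tau> - h) x - of_real (2 * h) * D 1 \<tau> x) \<le> M * h ^ 3"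
proof -
  have Ds: "D k t \<in> sobolev \<sigma>" if "t \<in> {\<tau> - h..\<tau> + h}" for k t
    using D[of t k] I that by (auto simp: has_sobolev_derivative_def)
  have mem: "\<tau> + h \<in> {\<tau> - h..\<tau> + h}" "\<tau> - h \<in> {\<tau> - h..\<tau> + h}" "\<tau> \<in> {\<tau> - h..\<tau> + h}" using h by auto
  note S = Ds[OF mem(1)] Ds[OF mem(2)] Ds[OF mem(3)]
  have M0: "0 \<le> M" using M[of 0 \<tau>] mem(3) sobolev_norm_nonneg order_trans by blast
  have der: "((\<lambda>t. sobolev_inner \<sigma> (D k t) E) has_real_derivative sobolev_inner \<sigma> (D (Suc k) t) E) (at t)"
    if "\<tau> - h \<le> t" "t \<le> \<tau> + h" "E \<in> sobolev \<sigma>" for k t E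
  proof -
    have t: "t \<in> I" using that I by auto
    show ?thesis using has_sobolev_derivative_inner[OF D[OF t, of k] that(3)] at_within_open[OF t I(1)] by simp
  qed
  have bd: "\<bar>sobolev_inner \<sigma> (D k t) E\<bar> \<le> M * sobolev_norm \<sigma> E"
    if "\<tau> - h \<le> t" "t \<le> \<tau> + h" "E \<in> sobolev \<sigma>" "k \<le> 3" for k t E
    using sobolev_inner_le[OF Ds that(3), of t k] mult_right_mono[OF M[of k t], of "sobolev_norm \<sigma> E"] that by auto
  { assume k: "k \<le> 2"
    let ?E = "\<lambda>x. D k (\<tau> + h) x - D k (\<tau> - h) x"
    have E: "?E \<in> sobolev \<sigma>" by (intro sobolev_diff(1) S)
    have b: "\<And>t. \<tau> - h \<le> t \<Longrightarrow> t \<le> \<tau> + h \<Longrightarrow> \<bar>sobolev_inner \<sigma> (D (Suc k) t) ?E\<bar> \<le> M * sobolev_norm \<sigma> ?E"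
      by (rule bd[OF _ _ E]) (use k in auto)
    note T = real_taylor[where p="\<lambda>k t. sobolev_inner \<sigma> (D k t) ?E", OF der[OF _ _ E] h]
    have "sobolev_inner \<sigma> ?E ?E \<le> 2 * h * (M * sobolev_norm \<sigma> ?E)"
      unfolding sobolev_inner_diff[OF S(1) S(2) E]
      by (rule order_trans[OF abs_ge_self], rule T(1)) (assumption | rule b)+
    then show "sobolev_norm \<sigma> ?E \<le> 2 * h * M"
      using M0 h by (intro sobolev_norm_le_inner[OF E]) (auto simp: mult.assoc) }
  { assume k: "k \<le> 1"
    let ?E = "\<lambda>x. D k (\<tau> + h) x + D k (\<tau> - h) x - of_real 2 * D k \<tau> x"
    have E: "?E \<in> sobolev \<sigma>" by (intro sobolev_diff(1) sobolev_add(1) sobolev_cmult(1) S)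
    have b: "\<And>t. \<tau> - h \<le> t \<Longrightarrow> t \<le> \<tau> + h \<Longrightarrow> \<bar>sobolev_inner \<sigma> (D (k + 2) t) ?E\<bar> \<le> M * sobolev_norm \<sigma> ?E"
      by (rule bd[OF _ _ E]) (use k in auto)
    note T = real_taylor[where p="\<lambda>k t. sobolev_inner \<sigma> (D k t) ?E", OF der[OF _ _ E] h]
    have "sobolev_inner \<sigma> ?E ?E \<le> (M * sobolev_norm \<sigma> ?E) * h\<^sup>2"
      unfolding sobolev_inner_diff[OF sobolev_add(1)[OF S(1) S(2)] sobolev_cmult(1)[OF S(3)] E]
        sobolev_inner_add[OF S(1) S(2) E] sobolev_inner_scale[OF S(3) E]
      by (rule order_trans[OF abs_ge_self], rule T(2)) (assumption | rule b)+
    then have "sobolev_norm \<sigma> ?E \<le> M * h\<^sup>2"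
      using M0 h by (intro sobolev_norm_le_inner[OF E]) (auto simp: ac_simps)
    then show "sobolev_norm \<sigma> (\<lambda>x. D k (\<tau> + h) x + D k (\<tau> - h) x - 2 * D k \<tau> x) \<le> M * h\<^sup>2" by simp }
  { let ?E = "\<lambda>x. D 0 (\<tau> + h) x - D 0 (\<tau> - h) x - of_real (2 * h) * D (Suc 0) \<tau> x"
    have E: "?E \<in> sobolev \<sigma>" by (intro sobolev_diff(1) sobolev_add(1) sobolev_cmult(1) S)
    have b: "\<And>t. \<tau> - h \<le> t \<Longrightarrow> t \<le> \<tau> + h \<Longrightarrow> \<bar>sobolev_inner \<sigma> (D (0 + 3) t) ?E\<bar> \<le> M * sobolev_norm \<sigma> ?E"
      by (rule bd[OF _ _ E]) auto
    note T = real_taylor[where p="\<lambda>k t. sobolev_inner \<sigma> (D k t) ?E", OF der[OF _ _ E] h]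
    have "sobolev_inner \<sigma> ?E ?E \<le> (M * sobolev_norm \<sigma> ?E) * h ^ 3"
      unfolding sobolev_inner_diff[OF sobolev_diff(1)[OF S(1) S(2)] sobolev_cmult(1)[OF S(3)] E]
        sobolev_inner_diff[OF S(1) S(2) E] sobolev_inner_scale[OF S(3) E]
      by (rule order_trans[OF abs_ge_self], rule T(3)[where k=0]) (assumption | rule b)+
    then show "sobolev_norm \<sigma> (\<lambda>x. D 0 (\<tau> + h) x - D 0 (\<tau> - h) x - of_real (2 * h) * D 1 \<tau> x) \<le> M * h ^ 3"
      unfolding One_nat_def using M0 h by (intro sobolev_norm_le_inner[OF E]) (auto simp: ac_simps) }
qed

text \<open>Each norm is a continuous function of time, hence bounded on a compact set; finitely
  many orders then share one M.\<close>

lemma sobolev_smooth_bounded: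
  fixes D :: "nat \<Rightarrow> real \<Rightarrow> 'a::euclidean_space \<Rightarrow> complex"
  assumes D: "\<And>k t. t \<in> I \<Longrightarrow> has_sobolev_derivative \<sigma> (D k) (D (Suc k) t) t I"
    and "compact J" "J \<subseteq> I"
  shows "\<exists>M. \<forall>k\<le>(n::nat). \<forall>t\<in>J. sobolev_norm \<sigma> (D k t) \<le> M"
proof -
  have one: "\<exists>M. \<forall>t\<in>J. sobolev_norm \<sigma> (D k t) \<le> M" for k
  proof -
    have "continuous_on J (\<lambda>t. sobolev_norm \<sigma> (D k t))"
      unfolding continuous_on_def
      using has_sobolev_derivative_norm_continuous[OF D] tendsto_within_subset[OF _ assms(3)] assms(3) by blast
    then have "bounded ((\<lambda>t. sobolev_norm \<sigma> (D k t)) ` J)"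
      using compact_continuous_image[OF _ assms(2)] compact_imp_bounded by blast
    then show ?thesis unfolding bounded_real by (meson abs_le_D1 imageI)
  qed
  show ?thesis
  proof (induction n)
    case 0
    show ?case using one[of 0] by simp
  next
    case (Suc n)
    obtain M1 where M1: "\<forall>k\<le>n. \<forall>t\<in>J. sobolev_norm \<sigma> (D k t) \<le> M1" using Suc by blast
    obtain M2 where M2: "\<forall>t\<in>J. sobolev_norm \<sigma> (D (Suc n) t) \<le> M2" using one by blast
    show ?case
      using M1 M2 by (intro exI[of _ "max M1 M2"]) (auto simp: le_Suc_eq max.coboundedI1 max.coboundedI2)
  qed
qed

subsection \<open>Consistency\<close>

text \<open>\<open>sobolev_norm\<close> has a meaning only inside the space, so membership and bound
  travel together. The rules below compute a bound for a composite expression along its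
  syntax.\<close>

definition sobolev_bd :: "real \<Rightarrow> ('a::euclidean_space \<Rightarrow> complex) \<Rightarrow> real \<Rightarrow> bool" where
  "sobolev_bd \<sigma> u c \<longleftrightarrow> u \<in> sobolev \<sigma> \<and> sobolev_norm \<sigma> u \<le> c"

lemma sobolev_bdI: "u \<in> sobolev \<sigma> \<Longrightarrow> sobolev_norm \<sigma> u \<le> c \<Longrightarrow> sobolev_bd \<sigma> u c"
  by (simp add: sobolev_bd_def)

lemma sobolev_bd_self: "u \<in> sobolev \<sigma> \<Longrightarrow> sobolev_bd \<sigma> u (sobolev_norm \<sigma> u)"
  by (simp add: sobolev_bd_def)

lemma sobolev_bdD: "sobolev_bd \<sigma> u c \<Longrightarrow> u \<in> sobolev \<sigma>" "sobolev_bd \<sigma> u c \<Longrightarrow> sobolev_norm \<sigma> u \<le> c"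
  by (simp_all add: sobolev_bd_def)

lemma sobolev_bd_nonneg: "sobolev_bd \<sigma> u c \<Longrightarrow> 0 \<le> c"
  using sobolev_norm_nonneg order_trans unfolding sobolev_bd_def by blast

lemma sobolev_bd_mono: "sobolev_bd \<sigma> u a \<Longrightarrow> a \<le> b \<Longrightarrow> sobolev_bd \<sigma> u b"
  by (auto simp: sobolev_bd_def)

lemma sobolev_bd_order: "sobolev_bd \<rho> u a \<Longrightarrow> \<sigma> \<le> \<rho> \<Longrightarrow> sobolev_bd \<sigma> u a"
  unfolding sobolev_bd_def using sobolev_mono[of u \<rho> \<sigma>] by auto

lemma sobolev_bd_add: "sobolev_bd \<sigma> u a \<Longrightarrow> sobolev_bd \<sigma> v b \<Longrightarrow> sobolev_bd \<sigma> (\<lambda>x. u x + v x) (a + b)"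
  unfolding sobolev_bd_def using sobolev_add[of u \<sigma> v] by auto

lemma sobolev_bd_diff: "sobolev_bd \<sigma> u a \<Longrightarrow> sobolev_bd \<sigma> v b \<Longrightarrow> sobolev_bd \<sigma> (\<lambda>x. u x - v x) (a + b)"
  unfolding sobolev_bd_def using sobolev_diff[of u \<sigma> v] by auto

lemma sobolev_bd_cmult: "sobolev_bd \<sigma> u a \<Longrightarrow> sobolev_bd \<sigma> (\<lambda>x. c * u x) (cmod c * a)"
  unfolding sobolev_bd_def using sobolev_cmult[of u \<sigma> c] by (auto intro: mult_left_mono)

lemma sobolev_bd_cnj: "sobolev_bd \<sigma> u a \<Longrightarrow> sobolev_bd \<sigma> (\<lambda>x. cnj (u x)) a"
  unfolding sobolev_bd_def using sobolev_cnj[of u \<sigma>] by auto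

lemma sobolev_bd_cong:
  "sobolev_bd \<sigma> u a \<Longrightarrow> ae_eq u v \<Longrightarrow> v \<in> borel_measurable borel \<Longrightarrow> sobolev_bd \<sigma> v a"
  unfolding sobolev_bd_def using sobolev_cong_ae[of u \<sigma> v] by auto

lemma sobolev_bd_laplacian:
  assumes "sobolev_bd \<rho> u a" "\<sigma> + 2 \<le> \<rho>" "0 \<le> \<sigma>" shows "sobolev_bd \<sigma> (laplacian u) a"
  using sobolev_bd_order[OF assms(1,2)] laplacian_sobolev[of u \<sigma>] assms(3)
  by (auto simp: sobolev_bd_def)

text \<open>Fixes one order together with its product constant, so that the same estimates can be
  instantiated at s, s + 2 and s + 4; \<open>dummy\<close> carries the underlying space.\<close>

locale sobolev_alg =
  fixes \<sigma> K :: real and dummy :: "'a::euclidean_space itself"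
  assumes order: "0 \<le> \<sigma>" and K_pos: "0 < K"
    and alg: "\<And>u v :: 'a \<Rightarrow> complex. u \<in> sobolev \<sigma> \<Longrightarrow> v \<in> sobolev \<sigma> \<Longrightarrow> (\<lambda>x. u x * v x) \<in> sobolev \<sigma> \<and>
      sobolev_norm \<sigma> (\<lambda>x. u x * v x) \<le> K * sobolev_norm \<sigma> u * sobolev_norm \<sigma> v"
begin

lemma bd_mult:
  fixes u v :: "'a \<Rightarrow> complex"
  assumes "sobolev_bd \<sigma> u a" "sobolev_bd \<sigma> v b"
  shows "sobolev_bd \<sigma> (\<lambda>x. u x * v x) (K * a * b)"
proof -
  have "sobolev_norm \<sigma> (\<lambda>x. u x * v x) \<le> K * sobolev_norm \<sigma> u * sobolev_norm \<sigma> v"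
    using alg assms by (auto simp: sobolev_bd_def)
  also have "\<dots> \<le> K * a * b"
    using assms K_pos sobolev_bd_nonneg[OF assms(1)] by (intro mult_mono) (auto simp: sobolev_bd_def)
  finally show ?thesis using alg assms by (auto simp: sobolev_bd_def)
qed

lemma bd_Re:
  fixes u v :: "'a \<Rightarrow> complex"
  assumes "sobolev_bd \<sigma> u a" "sobolev_bd \<sigma> v b"
  shows "sobolev_bd \<sigma> (\<lambda>x. of_real (Re (u x * cnj (v x)))) (K * a * b)"
proof -
  have e: "of_real (Re (p * cnj q)) = (1/2) * (p * cnj q + cnj p * q)" for p q :: complex
    by (simp add: complex_eq_iff)
  have "sobolev_bd \<sigma> (\<lambda>x. (1/2) * (u x * cnj (v x) + cnj (u x) * v x)) (cmod (1/2) * (K * a * b + K * a * b))"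
    by (intro sobolev_bd_cmult sobolev_bd_add bd_mult sobolev_bd_cnj assms)
  then show ?thesis unfolding e by (rule sobolev_bd_mono) simp
qed

lemma bd_abs2:
  fixes u :: "'a \<Rightarrow> complex"
  assumes "sobolev_bd \<sigma> u a"
  shows "sobolev_bd \<sigma> (\<lambda>x. of_real ((cmod (u x))\<^sup>2)) (K * a * a)"
  using bd_mult[OF assms sobolev_bd_cnj[OF assms]] by (simp add: complex_norm_square del: of_real_power)

end

lemma cmod_square_diff:
  "of_real ((cmod p)\<^sup>2) - of_real ((cmod q)\<^sup>2) = (of_real (Re ((p - q) * cnj (p + q))) :: complex)"
proof -
  have "(cmod p)\<^sup>2 - (cmod q)\<^sup>2 = Re ((p - q) * cnj (p + q))"
    unfolding cmod_power2 by (simp add: power2_eq_square algebra_simps)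
  then show ?thesis by (simp only: of_real_diff[symmetric])
qed

text \<open>\<open>D k\<close> is the k-th time derivative of the solution, of regularity \<rho>.
  Estimates are made at order \<sigma>, the gap of 2 paying for one Laplacian. Bounds up to the
  third derivative are what second-order centred differences require.\<close>

locale nls_curve = sobolev_alg \<sigma> K dummy
  for \<sigma> K :: real and dummy :: "'a::euclidean_space itself" +
  fixes \<beta> \<rho> M a b :: real and I :: "real set" and D :: "nat \<Rightarrow> real \<Rightarrow> 'a \<Rightarrow> complex"
  assumes \<rho>: "\<sigma> + 2 \<le> \<rho>" and I: "open I" "{a..b} \<subseteq> I"
    and der: "\<And>k t. t \<in> I \<Longrightarrow> has_sobolev_derivative \<rho> (D k) (D (Suc k) t) t I"
    and bounded: "\<And>k t. k \<le> 3 \<Longrightarrow> t \<in> {a..b} \<Longrightarrow> sobolev_norm \<rho> (D k t) \<le> M"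
    and nls: "\<And>t. t \<in> {a..b} \<Longrightarrow> ae_eq (\<lambda>x. \<i> * D 1 t x)
       (\<lambda>x. - laplacian (D 0 t) x / 2 + of_real \<beta> * of_real ((cmod (D 0 t x))\<^sup>2) * D 0 t x)"
begin

lemma D_sobolev: "t \<in> {a..b} \<Longrightarrow> D k t \<in> sobolev \<rho>"
  using der[of t k] I by (auto simp: has_sobolev_derivative_def)

lemma D_bd: "t \<in> {a..b} \<Longrightarrow> k \<le> 3 \<Longrightarrow> sobolev_bd \<rho> (D k t) M"
  using bounded[of k t] D_sobolev[of t k] by (simp add: sobolev_bd_def)

lemma D_bd': "t \<in> {a..b} \<Longrightarrow> k \<le> 3 \<Longrightarrow> sobolev_bd \<sigma> (D k t) M"
  using sobolev_bd_order[OF D_bd] \<rho> by simp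

lemma D_2: "t \<in> {a..b} \<Longrightarrow> D k t \<in> sobolev 2"
  using sobolev_mono(1)[OF D_sobolev, of t 2 k] \<rho> order by simp

lemma M_nonneg: "t \<in> {a..b} \<Longrightarrow> 0 \<le> M"
  using sobolev_bd_nonneg[OF D_bd[of t 0]] by simp

lemma taylor:
  assumes h: "h > 0" "a \<le> \<tau> - h" "\<tau> + h \<le> b"
  shows "k \<le> 2 \<Longrightarrow> sobolev_bd \<rho> (\<lambda>x. D k (\<tau> + h) x - D k (\<tau> - h) x) (2 * h * M)"
    and "k \<le> 1 \<Longrightarrow> sobolev_bd \<rho> (\<lambda>x. D k (\<tau> + h) x + D k (\<tau> - h) x - 2 * D k \<tau> x) (M * h\<^sup>2)"
    and "sobolev_bd \<rho> (\<lambda>x. D 0 (\<tau> + h) x - D 0 (\<tau> - h) x - of_real (2 * h) * D 1 \<tau> x) (M * h ^ 3)"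
proof -
  have sub: "{\<tau> - h..\<tau> + h} \<subseteq> I" using h I by auto
  have Mb: "\<And>k t. k \<le> 3 \<Longrightarrow> t \<in> {\<tau> - h..\<tau> + h} \<Longrightarrow> sobolev_norm \<rho> (D k t) \<le> M"
    using h by (intro bounded) auto
  note T = sobolev_taylor[where D=D and \<sigma>=\<rho> and I=I and \<tau>=\<tau> and h=h and M=M, OF der I(1) sub h(1) Mb]
  have mem: "\<tau> + h \<in> {a..b}" "\<tau> - h \<in> {a..b}" "\<tau> \<in> {a..b}" using h by auto
  note S = D_sobolev[OF mem(1)] D_sobolev[OF mem(2)] D_sobolev[OF mem(3)]
  show "k \<le> 2 \<Longrightarrow> sobolev_bd \<rho> (\<lambda>x. D k (\<tau> + h) x - D k (\<tau> - h) x) (2 * h * M)"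
    by (intro sobolev_bdI sobolev_diff(1) S T(1))
  show "k \<le> 1 \<Longrightarrow> sobolev_bd \<rho> (\<lambda>x. D k (\<tau> + h) x + D k (\<tau> - h) x - 2 * D k \<tau> x) (M * h\<^sup>2)"
    by (intro sobolev_bdI sobolev_diff(1) sobolev_add(1) sobolev_cmult(1) S T(2))
  show "sobolev_bd \<rho> (\<lambda>x. D 0 (\<tau> + h) x - D 0 (\<tau> - h) x - of_real (2 * h) * D 1 \<tau> x) (M * h ^ 3)"
    by (intro sobolev_bdI sobolev_diff(1) sobolev_cmult(1) S T(3))
qed

section \<open>Residuals of the exact solution\<close>

lemma laplacian_symmetric:
  assumes "t \<in> {a..b}" "r \<in> {a..b}" "q \<in> {a..b}"
  shows "ae_eq (laplacian (\<lambda>x. D k t x + D k r x - 2 * D k q x)) (\<lambda>x. laplacian (D k t) x + laplacian (D k r) x - 2 * laplacian (D k q) x)"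
  using laplacian_diff[OF sobolev_add(1)[OF D_2[OF assms(1), of k] D_2[OF assms(2), of k]] sobolev_cmult(1)[OF D_2[OF assms(3), of k], of 2]]
    laplacian_add[OF D_2[OF assms(1), of k] D_2[OF assms(2), of k]] laplacian_cmult[OF D_2[OF assms(3), of k], of 2]
  unfolding ae_eq_def by eventually_elim simp

lemma laplacian_antisymmetric:
  assumes "t \<in> {a..b}" "r \<in> {a..b}" "q \<in> {a..b}"
  shows "ae_eq (laplacian (\<lambda>x. D k t x - D k r x - c * D j q x)) (\<lambda>x. laplacian (D k t) x - laplacian (D k r) x - c * laplacian (D j q) x)"
  using laplacian_diff[OF sobolev_diff(1)[OF D_2[OF assms(1), of k] D_2[OF assms(2), of k]] sobolev_cmult(1)[OF D_2[OF assms(3), of j], of c]]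
    laplacian_diff[OF D_2[OF assms(1), of k] D_2[OF assms(2), of k]] laplacian_cmult[OF D_2[OF assms(3), of j], of c]
  unfolding ae_eq_def by eventually_elim simp

text \<open>Residual constant of the fifth component, as \<open>C2\<close> and \<open>C7\<close> are
  for the second and seventh. Taylor remainders of the solution and of its Laplacian contribute
  multiples of M, the potential term the product; the computed coefficients are rounded up.\<close>

definition C5 where "C5 = M + \<bar>\<beta>\<bar> * K * (K * M * M) * M"

text \<open>Up to symmetric Taylor remainders the step is its length times the equation at the
  midpoint \<tau>. With half-width h the step has length 2 h, so h = dt/2 in the recursion.\<close>

lemma midpoint_consistency:
  assumes h: "h > 0" "a \<le> \<tau> - h" "\<tau> + h \<le> b"
  shows "\<exists>e. sobolev_bd \<sigma> e (C5 * h\<^sup>2) \<and>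
    ae_eq (crank (2 * h) (D 0 (\<tau> + h))) (\<lambda>x. crank (- (2 * h)) (D 0 (\<tau> - h)) x + of_real (2 * h) *
       (of_real \<beta> * (of_real ((cmod (D 0 \<tau> x))\<^sup>2) * ((D 0 (\<tau> + h) x + D 0 (\<tau> - h) x) / 2)) + e x))"
proof -
  have mem: "\<tau> + h \<in> {a..b}" "\<tau> - h \<in> {a..b}" "\<tau> \<in> {a..b}" using h by auto
  note M0 = M_nonneg[OF mem(3)]
  let ?E1 = "\<lambda>x. D 0 (\<tau> + h) x - D 0 (\<tau> - h) x - of_real (2 * h) * D 1 \<tau> x"
  let ?E2 = "\<lambda>x. D 0 (\<tau> + h) x + D 0 (\<tau> - h) x - 2 * D 0 \<tau> x"
  let ?V = "\<lambda>x. complex_of_real ((cmod (D 0 \<tau> x))\<^sup>2)"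
  have \<rho>\<sigma>: "\<sigma> \<le> \<rho>" using \<rho> by simp
  note E1 = sobolev_bd_order[OF taylor(3)[OF h] \<rho>\<sigma>] and E2 = sobolev_bd_order[OF taylor(2)[OF h, of 0] \<rho>\<sigma>]
  note LE2 = sobolev_bd_laplacian[OF taylor(2)[OF h, of 0] \<rho> order]
  note V = bd_abs2[OF D_bd'[OF mem(3), of 0]]
  \<comment> \<open>What remains after subtracting the equation at \<tau>: an odd remainder of third
    order and even ones of second order with a factor h, divided by the step 2 h.\<close>
  define e where "e x = of_real (1 / (2 * h)) * (\<i> * ?E1 x + of_real (h / 2) * laplacian ?E2 x - of_real (h * \<beta>) * (?V x * ?E2 x))" for x
  have "sobolev_bd \<sigma> e (cmod (of_real (1 / (2 * h))) * ((cmod \<i> * (M * h ^ 3) + cmod (of_real (h / 2)) * (M * h\<^sup>2)) + cmod (of_real (h * \<beta>)) * (K * (K * M * M) * (M * h\<^sup>2))))"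
    unfolding e_def by (intro sobolev_bd_cmult sobolev_bd_diff sobolev_bd_add bd_mult E1 LE2 E2 V) simp_all
  moreover have "cmod (of_real (1 / (2 * h))) * ((cmod \<i> * (M * h ^ 3) + cmod (of_real (h / 2)) * (M * h\<^sup>2)) + cmod (of_real (h * \<beta>)) * (K * (K * M * M) * (M * h\<^sup>2)))
     = (3 / 4 * M + \<bar>\<beta>\<bar> * K * (K * M * M) * M / 2) * h\<^sup>2"
    using h(1) by (simp add: norm_divide norm_mult abs_mult field_simps power2_eq_square power3_eq_cube)
  moreover have "(3 / 4 * M + \<bar>\<beta>\<bar> * K * (K * M * M) * M / 2) * h\<^sup>2 \<le> C5 * h\<^sup>2"
  proof (rule mult_right_mono)
    have "0 \<le> \<bar>\<beta>\<bar> * K * (K * M * M) * M" using M0 K_pos by simp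
    then show "3 / 4 * M + \<bar>\<beta>\<bar> * K * (K * M * M) * M / 2 \<le> C5" unfolding C5_def using M0 by linarith
  qed simp
  ultimately have bd: "sobolev_bd \<sigma> e (C5 * h\<^sup>2)" by (metis sobolev_bd_mono)
  \<comment> \<open>The defect of the step equals 2 H times the residual of the equation at the
    midpoint. It is stated for free complex numbers, so that values of Laplacians count as
    independent variables.\<close>
  have ring: "\<i> * p + (2 * H / 4) * Lp - (\<i> * m + (- (2 * H) / 4) * Lm + (2 * H) * (B * (W * ((p + m) / 2)))
       + (\<i> * (p - m - 2 * H * g) + (H / 2) * (Lp + Lm - 2 * Lf) - (H * B) * (W * (p + m - 2 * f))))
     = 2 * H * (\<i> * g - (- Lf / 2 + B * W * f))" for p m g f Lp Lm Lf H B W :: complex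
    by (simp add: field_simps)
  have "ae_eq (crank (2 * h) (D 0 (\<tau> + h))) (\<lambda>x. crank (- (2 * h)) (D 0 (\<tau> - h)) x + of_real (2 * h) *
       (of_real \<beta> * (of_real ((cmod (D 0 \<tau> x))\<^sup>2) * ((D 0 (\<tau> + h) x + D 0 (\<tau> - h) x) / 2)) + e x))"
    using nls[OF mem(3)] laplacian_symmetric[OF mem, of 0] unfolding ae_eq_def
  proof eventually_elim
    case (elim x)
    have e: "of_real (2 * h) * e x = \<i> * ?E1 x + of_real (h / 2) * laplacian ?E2 x - of_real (h * \<beta>) * (?V x * ?E2 x)"
      using h(1) by (simp add: e_def)
    show ?case
      unfolding distrib_left[of "of_real (2 * h)"] e elim(2) crank_def
      using ring[of "D 0 (\<tau> + h) x" "of_real h" "laplacian (D 0 (\<tau> + h)) x" "D 0 (\<tau> - h) x" "laplacian (D 0 (\<tau> - h)) x"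
          "of_real \<beta>" "?V x" "D 1 \<tau> x" "laplacian (D 0 \<tau>) x" "D 0 \<tau> x"] elim(1)
      by simp
  qed
  with bd show ?thesis by blast
qed

definition C2 where "C2 = 8 * K * M * M"

text \<open>Rests on |p|^2 - |m|^2 = Re ((p - m) * cnj (p + m)) and Taylor expansion, hence an
  identity at every x. The two densities are 2 h apart while h plays the role of \<open>dt\<close>,
  which explains the factor 2 in front of the rate.\<close>

lemma density_consistency:
  assumes h: "h > 0" "a \<le> \<tau> - h" "\<tau> + h \<le> b"
  shows "\<exists>e. sobolev_bd \<sigma> e (C2 * h\<^sup>2) \<and>
    (\<forall>x. of_real ((cmod (D 0 (\<tau> + h) x))\<^sup>2) = of_real ((cmod (D 0 (\<tau> - h) x))\<^sup>2) + of_real h *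
       (2 * of_real (2 * Re (D 1 \<tau> x * cnj ((D 0 (\<tau> + h / 2) x + D 0 (\<tau> - h / 2) x) / 2))) + e x))"
proof -
  have mem: "\<tau> + h \<in> {a..b}" "\<tau> - h \<in> {a..b}" "\<tau> \<in> {a..b}" using h by auto
  have h2: "h / 2 > 0" "a \<le> \<tau> - h / 2" "\<tau> + h / 2 \<le> b" using h by auto
  note M0 = M_nonneg[OF mem(3)]
  let ?E1 = "\<lambda>x. D 0 (\<tau> + h) x - D 0 (\<tau> - h) x - of_real (2 * h) * D 1 \<tau> x"
  let ?E2 = "\<lambda>x. D 0 (\<tau> + h) x + D 0 (\<tau> - h) x - 2 * D 0 \<tau> x"
  let ?E3 = "\<lambda>x. D 0 (\<tau> + h / 2) x + D 0 (\<tau> - h / 2) x - 2 * D 0 \<tau> x"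
  have \<rho>\<sigma>: "\<sigma> \<le> \<rho>" using \<rho> by simp
  note E1 = sobolev_bd_order[OF taylor(3)[OF h] \<rho>\<sigma>] and E2 = sobolev_bd_order[OF taylor(2)[OF h, of 0] \<rho>\<sigma>]
    and E3 = sobolev_bd_order[OF taylor(2)[OF h2, of 0] \<rho>\<sigma>]
  define e where "e x = complex_of_real (1 / h) * (of_real (Re (?E1 x * cnj (D 0 (\<tau> + h) x + D 0 (\<tau> - h) x)))
      + of_real (2 * h) * of_real (Re (D 1 \<tau> x * cnj (?E2 x - ?E3 x))))" for x
  have "sobolev_bd \<sigma> e (cmod (of_real (1 / h)) * (K * (M * h ^ 3) * (M + M) + cmod (of_real (2 * h)) * (K * M * (M * h\<^sup>2 + M * (h / 2)\<^sup>2))))"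
    unfolding e_def by (intro sobolev_bd_cmult sobolev_bd_diff sobolev_bd_add bd_Re E1 E2 E3 D_bd' mem) simp_all
  moreover have "cmod (of_real (1 / h)) * (K * (M * h ^ 3) * (M + M) + cmod (of_real (2 * h)) * (K * M * (M * h\<^sup>2 + M * (h / 2)\<^sup>2)))
     = (9 / 2) * K * M * M * h\<^sup>2"
    using h(1) by (simp add: norm_divide norm_mult abs_mult field_simps power2_eq_square power3_eq_cube)
  moreover have "(9 / 2) * K * M * M * h\<^sup>2 \<le> C2 * h\<^sup>2"
    unfolding C2_def using M0 K_pos by (intro mult_right_mono) auto
  ultimately have bd: "sobolev_bd \<sigma> e (C2 * h\<^sup>2)" by (metis sobolev_bd_mono)
  have "of_real ((cmod (D 0 (\<tau> + h) x))\<^sup>2) = of_real ((cmod (D 0 (\<tau> - h) x))\<^sup>2) + of_real h *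
       (2 * of_real (2 * Re (D 1 \<tau> x * cnj ((D 0 (\<tau> + h / 2) x + D 0 (\<tau> - h / 2) x) / 2))) + e x)" for x
  proof -
    have he: "of_real h * e x = of_real (Re (?E1 x * cnj (D 0 (\<tau> + h) x + D 0 (\<tau> - h) x)))
      + of_real (2 * h) * of_real (Re (D 1 \<tau> x * cnj (?E2 x - ?E3 x)))"
      using h(1) by (simp add: e_def)
    \<comment> \<open>The midpoint value f cancels; it is inserted so that the two means enter
      through second differences.\<close>
    have r: "Re ((p - m) * cnj (p + m)) = h * (2 * (2 * Re (g * cnj ((q + r) / 2))))
       + (Re ((p - m - of_real (2 * h) * g) * cnj (p + m)) + 2 * h * Re (g * cnj ((p + m - 2 * f) - (q + r - 2 * f))))" for p m q r f g :: complex
      by (simp add: algebra_simps)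
    have "complex_of_real ((cmod (D 0 (\<tau> + h) x))\<^sup>2) - of_real ((cmod (D 0 (\<tau> - h) x))\<^sup>2)
      = of_real h * (2 * of_real (2 * Re (D 1 \<tau> x * cnj ((D 0 (\<tau> + h / 2) x + D 0 (\<tau> - h / 2) x) / 2)))) + of_real h * e x"
      unfolding cmod_square_diff he r[of "D 0 (\<tau> + h) x" "D 0 (\<tau> - h) x" "D 1 \<tau> x" "D 0 (\<tau> + h / 2) x" "D 0 (\<tau> - h / 2) x" "D 0 \<tau> x"]
      by simp
    then show ?thesis by (simp add: algebra_simps)
  qed
  with bd show ?thesis by blast
qed

definition C7 where "C7 = 2 * M + \<bar>\<beta>\<bar> * K * (2 * K * M * M) * (2 * M) + \<bar>\<beta>\<bar> * K * C2 * M + 8 * \<bar>\<beta>\<bar> * K * (2 * K * M * M) * M"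

text \<open>The difference of the equation at \<tau> + h and \<tau> - h replaces its time
  derivative. Its nonlinear part is split as P p - Q m = (P + Q) (p - m) / 2 + (P - Q) (p + m) / 2,
  and P - Q is given by the density identity, whose residual r2 enters here.\<close>

lemma velocity_consistency:
  assumes h: "h > 0" "a \<le> \<tau> - 3 * h / 2" "\<tau> + 3 * h / 2 \<le> b"
  shows "\<exists>e. sobolev_bd \<sigma> e (C7 * h\<^sup>2) \<and>
    ae_eq (crank h (D 1 (\<tau> + h))) (\<lambda>x. crank (- h) (D 1 (\<tau> - h)) x + crank (- h) (D 1 \<tau>) x - crank h (D 1 \<tau>) x + of_real h *
      (2 * of_real \<beta> * ((of_real ((cmod (D 0 (\<tau> + h) x))\<^sup>2) + of_real ((cmod (D 0 (\<tau> - h) x))\<^sup>2)) / 2 * ((D 1 (\<tau> + h) x + 2 * D 1 \<tau> x + D 1 (\<tau> - h) x) / 4)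
        + of_real (2 * Re (D 1 \<tau> x * cnj ((D 0 (\<tau> + h / 2) x + D 0 (\<tau> - h / 2) x) / 2)))
          * ((D 0 (\<tau> + 3 * h / 2) x + D 0 (\<tau> + h / 2) x + D 0 (\<tau> - h / 2) x + D 0 (\<tau> - 3 * h / 2) x) / 4)) + e x))"
proof -
  have h1: "h > 0" "a \<le> \<tau> - h" "\<tau> + h \<le> b" using h by auto
  have h2: "h / 2 > 0" "a \<le> \<tau> - h / 2" "\<tau> + h / 2 \<le> b" using h by auto
  have h3: "3 * h / 2 > 0" "a \<le> \<tau> - 3 * h / 2" "\<tau> + 3 * h / 2 \<le> b" using h by auto
  have mem: "\<tau> + h \<in> {a..b}" "\<tau> - h \<in> {a..b}" "\<tau> \<in> {a..b}" using h1 by auto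
  have mem2: "\<tau> + h / 2 \<in> {a..b}" "\<tau> - h / 2 \<in> {a..b}" using h2 by auto
  note M0 = M_nonneg[OF mem(3)]
  obtain r2 where r2: "sobolev_bd \<sigma> r2 (C2 * h\<^sup>2)"
    and dens: "\<And>x. of_real ((cmod (D 0 (\<tau> + h) x))\<^sup>2) = of_real ((cmod (D 0 (\<tau> - h) x))\<^sup>2) + of_real h *
       (2 * of_real (2 * Re (D 1 \<tau> x * cnj ((D 0 (\<tau> + h / 2) x + D 0 (\<tau> - h / 2) x) / 2))) + r2 x)"
    using density_consistency[OF h1] by blast
  let ?E1 = "\<lambda>x. D 0 (\<tau> + h) x - D 0 (\<tau> - h) x - of_real (2 * h) * D 1 \<tau> x"
  let ?G2 = "\<lambda>x. D 1 (\<tau> + h) x + D 1 (\<tau> - h) x - 2 * D 1 \<tau> x"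
  let ?E2 = "\<lambda>x. D 0 (\<tau> + h) x + D 0 (\<tau> - h) x - 2 * D 0 \<tau> x"
  let ?E3 = "\<lambda>x. D 0 (\<tau> + h / 2) x + D 0 (\<tau> - h / 2) x - 2 * D 0 \<tau> x"
  let ?E4 = "\<lambda>x. D 0 (\<tau> + 3 * h / 2) x + D 0 (\<tau> - 3 * h / 2) x - 2 * D 0 \<tau> x"
  let ?A = "\<lambda>x. complex_of_real ((cmod (D 0 (\<tau> + h) x))\<^sup>2)" and ?B = "\<lambda>x. complex_of_real ((cmod (D 0 (\<tau> - h) x))\<^sup>2)"
  let ?X = "\<lambda>x. complex_of_real (Re (D 1 \<tau> x * cnj (D 0 (\<tau> + h / 2) x + D 0 (\<tau> - h / 2) x)))"
  have \<rho>\<sigma>: "\<sigma> \<le> \<rho>" using \<rho> by simp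
  note E1 = sobolev_bd_order[OF taylor(3)[OF h1] \<rho>\<sigma>] and E2 = sobolev_bd_order[OF taylor(2)[OF h1, of 0] \<rho>\<sigma>]
    and E3 = sobolev_bd_order[OF taylor(2)[OF h2, of 0] \<rho>\<sigma>] and E4 = sobolev_bd_order[OF taylor(2)[OF h3, of 0] \<rho>\<sigma>]
    and G2 = sobolev_bd_order[OF taylor(2)[OF h1, of 1] \<rho>\<sigma>]
  note LE1 = sobolev_bd_laplacian[OF taylor(3)[OF h1] \<rho> order] and LG2 = sobolev_bd_laplacian[OF taylor(2)[OF h1, of 1] \<rho> order]
  \<comment> \<open>Collects the errors of replacing the difference of the solution by 2 h times its
    derivative, the velocity at the centre by a three-point mean, and the mean of the end values by
    the four-point mean, together with the density residual; all divided by the step h.\<close>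
  define e where "e x = of_real (1 / h) * (of_real (h / 4) * laplacian ?G2 x - (1 / 2) * laplacian ?E1 x
      + of_real \<beta> * ((1 / 2) * ((?A x + ?B x) * (?E1 x - of_real (h / 2) * ?G2 x))
        + of_real (h / 2) * (r2 x * (D 0 (\<tau> + h) x + D 0 (\<tau> - h) x))
        + of_real (h / 2) * (?X x * (2 * ?E2 x - (?E3 x + ?E4 x)))))" for x
  let ?bd = "cmod (of_real (1 / h)) * (cmod (of_real (h / 4)) * (M * h\<^sup>2) + cmod (1 / 2) * (M * h ^ 3)
      + cmod (of_real \<beta>) * (cmod (1 / 2) * (K * (K * M * M + K * M * M) * (M * h ^ 3 + cmod (of_real (h / 2)) * (M * h\<^sup>2)))
        + cmod (of_real (h / 2)) * (K * (C2 * h\<^sup>2) * (M + M))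
        + cmod (of_real (h / 2)) * (K * (K * M * (M + M)) * (cmod 2 * (M * h\<^sup>2) + (M * (h / 2)\<^sup>2 + M * (3 * h / 2)\<^sup>2)))))"
  have bd0: "sobolev_bd \<sigma> e ?bd"
    unfolding e_def
    by (intro sobolev_bd_cmult sobolev_bd_diff sobolev_bd_add bd_mult bd_abs2 bd_Re E1 E2 E3 E4 G2 LE1 LG2 r2 D_bd' mem mem2) simp_all
  have "?bd = (3 / 4 * M + \<bar>\<beta>\<bar> * (3 / 2 * K * (K * M * M) * M + K * C2 * M + 9 / 2 * K * (K * M * M) * M)) * h\<^sup>2"
    using h(1) by (simp add: norm_divide norm_mult abs_mult field_simps power2_eq_square power3_eq_cube)
  also have "(3 / 4 * M + \<bar>\<beta>\<bar> * (3 / 2 * K * (K * M * M) * M + K * C2 * M + 9 / 2 * K * (K * M * M) * M)) * h\<^sup>2 \<le> C7 * h\<^sup>2"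
  proof (rule mult_right_mono)
    have "0 \<le> \<bar>\<beta>\<bar> * (K * (K * M * M) * M)" "0 \<le> \<bar>\<beta>\<bar> * (K * C2 * M)" using M0 K_pos by (simp_all add: C2_def)
    then show "3 / 4 * M + \<bar>\<beta>\<bar> * (3 / 2 * K * (K * M * M) * M + K * C2 * M + 9 / 2 * K * (K * M * M) * M) \<le> C7"
      unfolding C7_def using M0 by (simp add: algebra_simps)
  qed simp
  finally have bd: "sobolev_bd \<sigma> e (C7 * h\<^sup>2)" by (rule sobolev_bd_mono[OF bd0])
  \<comment> \<open>The defect is the residual of the equation at \<tau> + h minus that at \<tau> -
    h, plus a multiple of the defect of the density identity; all three vanish.\<close>
  have ring: "(\<i> * gp + (H / 4) * Lgp) - ((\<i> * gm + (- H / 4) * Lgm) + (\<i> * g + (- H / 4) * Lg) - (\<i> * g + (H / 4) * Lg)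
       + (H * (2 * B * ((P + Q) / 2 * ((gp + 2 * g + gm) / 4) + X * ((s1 + s2 + s3 + s4) / 4)))
       + ((H / 4) * (Lgp + Lgm - 2 * Lg) - (1 / 2) * (Lp - Lm - 2 * H * Lg)
          + B * ((1 / 2) * ((P + Q) * ((p - m - 2 * H * g) - (H / 2) * (gp + gm - 2 * g)))
             + (H / 2) * (R * (p + m)) + (H / 2) * (X * (2 * (p + m - 2 * f) - ((s2 + s3 - 2 * f) + (s1 + s4 - 2 * f))))))))
     = (\<i> * gp - (- Lp / 2 + B * P * p)) - (\<i> * gm - (- Lm / 2 + B * Q * m)) + B * (p + m) / 2 * (P - (Q + H * (2 * X + R)))"
    for gp gm g Lgp Lgm Lg H B P Q X s1 s2 s3 s4 Lp Lm p m R f :: complex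
    by (simp add: field_simps)
  have X: "of_real (2 * Re (D 1 \<tau> x * cnj ((D 0 (\<tau> + h / 2) x + D 0 (\<tau> - h / 2) x) / 2))) = ?X x" for x
    by (simp add: algebra_simps)
  have "ae_eq (crank h (D 1 (\<tau> + h))) (\<lambda>x. crank (- h) (D 1 (\<tau> - h)) x + crank (- h) (D 1 \<tau>) x - crank h (D 1 \<tau>) x + of_real h *
      (2 * of_real \<beta> * ((?A x + ?B x) / 2 * ((D 1 (\<tau> + h) x + 2 * D 1 \<tau> x + D 1 (\<tau> - h) x) / 4)
        + ?X x * ((D 0 (\<tau> + 3 * h / 2) x + D 0 (\<tau> + h / 2) x + D 0 (\<tau> - h / 2) x + D 0 (\<tau> - 3 * h / 2) x) / 4)) + e x))"
    using nls[OF mem(1)] nls[OF mem(2)] laplacian_symmetric[OF mem, of 1] laplacian_antisymmetric[OF mem, of 0 "of_real (2 * h)" 1]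
    unfolding ae_eq_def
  proof eventually_elim
    case (elim x)
    have e: "of_real h * e x = of_real (h / 4) * laplacian ?G2 x - (1 / 2) * laplacian ?E1 x
      + of_real \<beta> * ((1 / 2) * ((?A x + ?B x) * (?E1 x - of_real (h / 2) * ?G2 x))
        + of_real (h / 2) * (r2 x * (D 0 (\<tau> + h) x + D 0 (\<tau> - h) x))
        + of_real (h / 2) * (?X x * (2 * ?E2 x - (?E3 x + ?E4 x))))"
      using h(1) by (simp add: e_def)
    have d: "?A x - (?B x + of_real h * (2 * ?X x + r2 x)) = 0"
      using dens[of x] unfolding X by simp
    have z: "\<i> * D 1 (\<tau> + h) x - (- laplacian (D 0 (\<tau> + h)) x / 2 + of_real \<beta> * ?A x * D 0 (\<tau> + h) x) = 0"
      "\<i> * D 1 (\<tau> - h) x - (- laplacian (D 0 (\<tau> - h)) x / 2 + of_real \<beta> * ?B x * D 0 (\<tau> - h) x) = 0"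
      using elim(1,2) by simp_all
    have "crank h (D 1 (\<tau> + h)) x - (crank (- h) (D 1 (\<tau> - h)) x + crank (- h) (D 1 \<tau>) x - crank h (D 1 \<tau>) x +
      (of_real h * (2 * of_real \<beta> * ((?A x + ?B x) / 2 * ((D 1 (\<tau> + h) x + 2 * D 1 \<tau> x + D 1 (\<tau> - h) x) / 4)
        + ?X x * ((D 0 (\<tau> + 3 * h / 2) x + D 0 (\<tau> + h / 2) x + D 0 (\<tau> - h / 2) x + D 0 (\<tau> - 3 * h / 2) x) / 4))) + of_real h * e x)) = 0"
      unfolding e elim(3,4) crank_def
      using ring[of "D 1 (\<tau> + h) x" "of_real h" "laplacian (D 1 (\<tau> + h)) x" "D 1 (\<tau> - h) x" "laplacian (D 1 (\<tau> - h)) x"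
          "D 1 \<tau> x" "laplacian (D 1 \<tau>) x" "of_real \<beta>" "?A x" "?B x" "?X x" "D 0 (\<tau> + 3 * h / 2) x" "D 0 (\<tau> + h / 2) x"
          "D 0 (\<tau> - h / 2) x" "D 0 (\<tau> - 3 * h / 2) x" "laplacian (D 0 (\<tau> + h)) x" "laplacian (D 0 (\<tau> - h)) x"
          "D 0 (\<tau> + h) x" "D 0 (\<tau> - h) x" "r2 x" "D 0 \<tau> x", unfolded z d]
      by simp
    then show ?case by (simp only: distrib_left[of "complex_of_real h"] right_minus_eq)
  qed
  then show ?thesis using bd unfolding X by blast
qed

end

subsection \<open>Stability\<close>

text \<open>The moduli of the two symbols coincide and are at least 1, so dividing by them leaves
  the old transform with coefficient 1 and the force with coefficient at most \<open>dt\<close>. The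
  linear part contributes no growth factor.\<close>

lemma crank_step:
  assumes u: "u \<in> sobolev (\<sigma> + 2)" and v: "v \<in> sobolev (\<sigma> + 2)" and "0 \<le> \<sigma>" "0 \<le> dt"
    and q: "sobolev_bd \<sigma> q R"
    and eq: "ae_eq (crank dt u) (\<lambda>x. crank (- dt) v x + of_real dt * q x)"
  shows "sobolev_norm \<sigma> u \<le> sobolev_norm \<sigma> v + dt * R"
proof -
  have u2: "u \<in> sobolev 2" and v2: "v \<in> sobolev 2" and us: "u \<in> sobolev \<sigma>" and vs: "v \<in> sobolev \<sigma>"
    using sobolev_mono(1)[OF u] sobolev_mono(1)[OF v] \<open>0 \<le> \<sigma>\<close> by simp_all
  note hu = has_fourier_sobolev[OF us] and hv = has_fourier_sobolev[OF vs] and hq = has_fourier_sobolev[OF sobolev_bdD(1)[OF q]]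
  have h: "has_fourier_L2 (\<lambda>x. crank (- dt) v x + of_real dt * q x) (\<lambda>\<xi>. crank_symbol (- dt) \<xi> * fourier_L2 v \<xi> + of_real dt * fourier_L2 q \<xi>)"
    by (intro has_fourier_L2_add has_fourier_L2_cmult crank_fourier v2 hq)
  have m: "(\<lambda>x. crank (- dt) v x + of_real dt * q x) \<in> borel_measurable borel"
    using has_fourier_L2_square_integrable(1)[OF h] square_integrable_measurable by blast
  have ae: "ae_eq (\<lambda>\<xi>. crank_symbol dt \<xi> * fourier_L2 u \<xi>) (\<lambda>\<xi>. crank_symbol (- dt) \<xi> * fourier_L2 v \<xi> + of_real dt * fourier_L2 q \<xi>)"
    by (rule has_fourier_L2_unique[OF has_fourier_L2_cong_left[OF crank_fourier[OF u2] eq m] h])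
  note sv = sobolevD(1)[OF vs hv] and sq = square_integrable_cmult[OF sobolevD(1)[OF sobolev_bdD(1)[OF q] hq], of "of_real dt"]
  have le: "AE \<xi> in lborel. cmod (weighted \<sigma> (fourier_L2 u) \<xi>) \<le> cmod (weighted \<sigma> (fourier_L2 v) \<xi>) + cmod (of_real dt * weighted \<sigma> (fourier_L2 q) \<xi>)"
    using ae unfolding ae_eq_def
  proof eventually_elim
    case (elim \<xi>)
    define s where "s = cmod (crank_symbol dt \<xi>)"
    have s: "1 \<le> s" unfolding s_def by (rule one_le_cmod_crank_symbol)
    have "s * cmod (fourier_L2 u \<xi>) = cmod (crank_symbol (- dt) \<xi> * fourier_L2 v \<xi> + of_real dt * fourier_L2 q \<xi>)"
      unfolding s_def norm_mult[symmetric] elim ..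
    also have "\<dots> \<le> cmod (crank_symbol (- dt) \<xi> * fourier_L2 v \<xi>) + cmod (of_real dt * fourier_L2 q \<xi>)"
      by (rule norm_triangle_ineq)
    also have "cmod (crank_symbol (- dt) \<xi> * fourier_L2 v \<xi>) = s * cmod (fourier_L2 v \<xi>)"
      unfolding norm_mult cmod_crank_symbol_minus s_def ..
    also have "cmod (of_real dt * fourier_L2 q \<xi>) \<le> s * cmod (of_real dt * fourier_L2 q \<xi>)"
      using mult_right_mono[OF s, of "cmod (of_real dt * fourier_L2 q \<xi>)"] by simp
    finally have "s * cmod (fourier_L2 u \<xi>) \<le> s * (cmod (fourier_L2 v \<xi>) + cmod (of_real dt * fourier_L2 q \<xi>))"
      by (simp add: distrib_left)
    then have "cmod (fourier_L2 u \<xi>) \<le> cmod (fourier_L2 v \<xi>) + cmod (of_real dt * fourier_L2 q \<xi>)"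
      using s by (simp add: mult_le_cancel_left)
    from mult_left_mono[OF this, of "(1 + (norm \<xi>)\<^sup>2) powr (\<sigma> / 2)"]
    show ?case by (simp add: cmod_weighted norm_mult algebra_simps)
  qed
  have "sobolev_norm \<sigma> u \<le> sobolev_norm \<sigma> v + l2norm (\<lambda>\<xi>. of_real dt * weighted \<sigma> (fourier_L2 q) \<xi>)"
    unfolding sobolev_norm_weighted
    by (rule l2norm_le_add(2)[OF sv sq square_integrable_measurable[OF sobolevD(1)[OF us hu]] le])
  also have "l2norm (\<lambda>\<xi>. of_real dt * weighted \<sigma> (fourier_L2 q) \<xi>) = dt * sobolev_norm \<sigma> q"
    unfolding l2norm_cmult sobolev_norm_weighted using \<open>0 \<le> dt\<close> by simp
  also have "\<dots> \<le> dt * R" using q \<open>0 \<le> dt\<close> by (intro mult_left_mono) (auto simp: sobolev_bd_def)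
  finally show ?thesis by simp
qed

text \<open>
  The last two summands diagonalise the block of the increments, whose powers grow linearly
  at frequencies where the symbol of \<^term>\<open>opA dt\<close> is close to \<^term>\<open>- 1 :: complex\<close>.
\<close>

definition err :: "real \<Rightarrow> real \<Rightarrow> 'a::euclidean_space state \<Rightarrow> real" where
  "err \<sigma> dt = (\<lambda>(z1, z2, z3, z4, z5, z6, z7).
     max (sobolev_norm \<sigma> z1) (sobolev_norm \<sigma> z2)
     + max (sobolev_norm \<sigma> z3) (max (sobolev_norm \<sigma> z4) (sobolev_norm \<sigma> z5))
     + sobolev_norm \<sigma> (crank dt (\<lambda>x. z6 x + z7 x))
     + sobolev_norm \<sigma> (\<lambda>x. crank dt z7 x - crank (- dt) z6 x))"

text \<open>\<open>crank dt\<close> and \<open>crank (- dt)\<close> add up to 2 \<i>. Hence, with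
  \<alpha> and \<gamma> standing for the functions behind the norms, \<alpha> - \<gamma> is 2 \<i>
  z6, and \<open>crank (- dt)\<close> of the sum of the increments plus \<gamma> is 2 \<i> z7. The
  increments are thus controlled at order \<sigma> without loss.\<close>

lemma err_velocity:
  fixes dt :: real and z6 z7 :: "'a::euclidean_space \<Rightarrow> complex"
  assumes z: "z6 \<in> sobolev (\<sigma> + 2)" "z7 \<in> sobolev (\<sigma> + 2)" and "0 \<le> \<sigma>"
  defines "\<alpha> \<equiv> sobolev_norm \<sigma> (crank dt (\<lambda>x. z6 x + z7 x))"
    and "\<gamma> \<equiv> sobolev_norm \<sigma> (\<lambda>x. crank dt z7 x - crank (- dt) z6 x)"
  shows "2 * sobolev_norm \<sigma> z6 \<le> \<alpha> + \<gamma>" "2 * sobolev_norm \<sigma> z7 \<le> \<alpha> + \<gamma>"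
proof -
  have z2: "z6 \<in> sobolev 2" "z7 \<in> sobolev 2" and zs: "z6 \<in> sobolev \<sigma>" "z7 \<in> sobolev \<sigma>"
    using sobolev_mono(1)[OF z(1)] sobolev_mono(1)[OF z(2)] \<open>0 \<le> \<sigma>\<close> by simp_all
  note a = sobolev_add(1)[OF z]
  note ca = crank_sobolev(1)[OF a \<open>0 \<le> \<sigma>\<close>]
  note cg = sobolev_diff(1)[OF crank_sobolev(1)[OF z(2) \<open>0 \<le> \<sigma>\<close>, of dt] crank_sobolev(1)[OF z(1) \<open>0 \<le> \<sigma>\<close>, of "- dt"]]
  have e6: "ae_eq (\<lambda>x. crank dt (\<lambda>x. z6 x + z7 x) x - (crank dt z7 x - crank (- dt) z6 x)) (\<lambda>x. (2 * \<i>) * z6 x)"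
    using crank_add[OF z2, of dt] unfolding ae_eq_def by eventually_elim (simp add: crank_def algebra_simps)
  have e7: "ae_eq (\<lambda>x. crank (- dt) (\<lambda>x. z6 x + z7 x) x + (crank dt z7 x - crank (- dt) z6 x)) (\<lambda>x. (2 * \<i>) * z7 x)"
    using crank_add[OF z2, of "- dt"] unfolding ae_eq_def by eventually_elim (simp add: crank_def algebra_simps)
  note m6 = sobolev_measurable[OF sobolev_cmult(1)[OF zs(1), of "2 * \<i>"]]
  note m7 = sobolev_measurable[OF sobolev_cmult(1)[OF zs(2), of "2 * \<i>"]]
  have "2 * sobolev_norm \<sigma> z6 = sobolev_norm \<sigma> (\<lambda>x. (2 * \<i>) * z6 x)"
    by (subst sobolev_cmult(2)[OF zs(1)]) (simp add: norm_mult)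
  also have "\<dots> = sobolev_norm \<sigma> (\<lambda>x. crank dt (\<lambda>x. z6 x + z7 x) x - (crank dt z7 x - crank (- dt) z6 x))"
    by (rule sobolev_cong_ae(2)[OF sobolev_diff(1)[OF ca cg] e6 m6])
  also have "\<dots> \<le> \<alpha> + \<gamma>" unfolding \<alpha>_def \<gamma>_def by (rule sobolev_diff(2)[OF ca cg])
  finally show "2 * sobolev_norm \<sigma> z6 \<le> \<alpha> + \<gamma>" .
  have "2 * sobolev_norm \<sigma> z7 = sobolev_norm \<sigma> (\<lambda>x. (2 * \<i>) * z7 x)"
    by (subst sobolev_cmult(2)[OF zs(2)]) (simp add: norm_mult)
  also have "\<dots> = sobolev_norm \<sigma> (\<lambda>x. crank (- dt) (\<lambda>x. z6 x + z7 x) x + (crank dt z7 x - crank (- dt) z6 x))"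
    by (rule sobolev_cong_ae(2)[OF sobolev_add(1)[OF ca cg] e7 m7])
  also have "\<dots> \<le> sobolev_norm \<sigma> (crank (- dt) (\<lambda>x. z6 x + z7 x)) + \<gamma>" unfolding \<gamma>_def by (rule sobolev_add(2)[OF ca cg])
  also have "sobolev_norm \<sigma> (crank (- dt) (\<lambda>x. z6 x + z7 x)) = \<alpha>" unfolding \<alpha>_def by (rule crank_minus_norm[OF a \<open>0 \<le> \<sigma>\<close>])
  finally show "2 * sobolev_norm \<sigma> z7 \<le> \<alpha> + \<gamma>" .
qed

lemma err_component:
  assumes "Z \<in> state_sobolev (\<sigma> + 2)" "0 \<le> \<sigma>" "z \<in> set (components Z)"
  shows "sobolev_norm \<sigma> z \<le> err \<sigma> dt Z"
proof -
  obtain z1 z2 z3 z4 z5 z6 z7 where Z: "Z = (z1, z2, z3, z4, z5, z6, z7)" by (cases Z) auto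
  have z: "z6 \<in> sobolev (\<sigma> + 2)" "z7 \<in> sobolev (\<sigma> + 2)"
    using assms(1) by (auto simp: Z state_sobolev_def components_def)
  note v = err_velocity[OF z \<open>0 \<le> \<sigma>\<close>, of dt]
  have nn: "0 \<le> sobolev_norm \<sigma> z1" "0 \<le> sobolev_norm \<sigma> z3" "0 \<le> sobolev_norm \<sigma> (crank dt (\<lambda>x. z6 x + z7 x))"
    "0 \<le> sobolev_norm \<sigma> (\<lambda>x. crank dt z7 x - crank (- dt) z6 x)" "0 \<le> sobolev_norm \<sigma> z6" "0 \<le> sobolev_norm \<sigma> z7" by simp_all
  define p where "p = max (sobolev_norm \<sigma> z1) (sobolev_norm \<sigma> z2)"
  define q where "q = max (sobolev_norm \<sigma> z3) (max (sobolev_norm \<sigma> z4) (sobolev_norm \<sigma> z5))"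
  have p: "sobolev_norm \<sigma> z1 \<le> p" "sobolev_norm \<sigma> z2 \<le> p" by (simp_all add: p_def)
  have q: "sobolev_norm \<sigma> z3 \<le> q" "sobolev_norm \<sigma> z4 \<le> q" "sobolev_norm \<sigma> z5 \<le> q" by (simp_all add: q_def)
  have "z = z1 \<or> z = z2 \<or> z = z3 \<or> z = z4 \<or> z = z5 \<or> z = z6 \<or> z = z7"
    using assms(3) by (simp add: Z components_def)
  then show ?thesis
    unfolding Z err_def prod.case p_def[symmetric] q_def[symmetric]
    by (elim disjE; hypsubst) (use p q v nn in linarith)+
qed

lemma err_nonneg: "0 \<le> err \<sigma> dt Z"
proof -
  obtain z1 z2 z3 z4 z5 z6 z7 where Z: "Z = (z1, z2, z3, z4, z5, z6, z7)" by (cases Z) auto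
  show ?thesis unfolding Z err_def by (simp add: le_max_iff_disj add_nonneg_nonneg)
qed

text \<open>Index shifts only move entries under a maximum. For the increments the shift y6 = z7
  acts twice: in the sum it cancels \<open>crank dt z7\<close>, in the difference
  \<open>crank (- dt) z7\<close>, which leaves the isometric image of the old sum and minus the old
  difference. Four summands each gain at most dt R.\<close>

lemma err_step:
  fixes z1 :: "'a::euclidean_space \<Rightarrow> complex"
  assumes s: "0 \<le> \<sigma>" "0 \<le> dt"
    and Z: "(z1, z2, z3, z4, z5, z6, z7) \<in> state_sobolev (\<sigma> + 2)"
    and Z': "(y1, y2, y3, y4, y5, y6, y7) \<in> state_sobolev (\<sigma> + 2)"
    and q: "sobolev_bd \<sigma> q2 R" "sobolev_bd \<sigma> q5 R" "sobolev_bd \<sigma> q7 R"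
    and e1: "ae_eq y1 z2" and e2: "ae_eq y2 (\<lambda>x. z1 x + of_real dt * q2 x)"
    and e3: "ae_eq y3 z4" and e4: "ae_eq y4 z5"
    and e5: "ae_eq (crank dt y5) (\<lambda>x. crank (- dt) z5 x + of_real dt * q5 x)"
    and e6: "ae_eq y6 z7"
    and e7: "ae_eq (crank dt y7) (\<lambda>x. crank (- dt) z6 x + crank (- dt) z7 x - crank dt z7 x + of_real dt * q7 x)"
  shows "err \<sigma> dt (y1, y2, y3, y4, y5, y6, y7) \<le> err \<sigma> dt (z1, z2, z3, z4, z5, z6, z7) + 4 * dt * R"
proof -
  have R: "0 \<le> dt * R" using sobolev_bd_nonneg[OF q(1)] s(2) by simp
  have zz: "z1 \<in> sobolev (\<sigma> + 2)" "z2 \<in> sobolev (\<sigma> + 2)" "z3 \<in> sobolev (\<sigma> + 2)" "z4 \<in> sobolev (\<sigma> + 2)"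
    "z5 \<in> sobolev (\<sigma> + 2)" "z6 \<in> sobolev (\<sigma> + 2)" "z7 \<in> sobolev (\<sigma> + 2)"
    and yy: "y1 \<in> sobolev (\<sigma> + 2)" "y2 \<in> sobolev (\<sigma> + 2)" "y3 \<in> sobolev (\<sigma> + 2)" "y4 \<in> sobolev (\<sigma> + 2)"
    "y5 \<in> sobolev (\<sigma> + 2)" "y6 \<in> sobolev (\<sigma> + 2)" "y7 \<in> sobolev (\<sigma> + 2)"
    using Z Z' by (simp_all add: state_sobolev_def components_def)
  have lo: "\<And>u::'a \<Rightarrow> complex. u \<in> sobolev (\<sigma> + 2) \<Longrightarrow> u \<in> sobolev \<sigma>" "\<And>u::'a \<Rightarrow> complex. u \<in> sobolev (\<sigma> + 2) \<Longrightarrow> u \<in> sobolev 2"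
    by (erule sobolev_mono(1), use s(1) in simp)+
  have n1: "sobolev_norm \<sigma> y1 = sobolev_norm \<sigma> z2" and n3: "sobolev_norm \<sigma> y3 = sobolev_norm \<sigma> z4" and n4: "sobolev_norm \<sigma> y4 = sobolev_norm \<sigma> z5"
    using sobolev_cong_ae(2)[OF lo(1)[OF yy(1)] e1 sobolev_measurable[OF zz(2)]]
      sobolev_cong_ae(2)[OF lo(1)[OF yy(3)] e3 sobolev_measurable[OF zz(4)]]
      sobolev_cong_ae(2)[OF lo(1)[OF yy(4)] e4 sobolev_measurable[OF zz(5)]] by simp_all
  have n2: "sobolev_norm \<sigma> y2 \<le> sobolev_norm \<sigma> z1 + dt * R"
  proof -
    have b: "sobolev_bd \<sigma> (\<lambda>x. z1 x + of_real dt * q2 x) (sobolev_norm \<sigma> z1 + cmod (of_real dt) * R)"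
      by (intro sobolev_bd_add sobolev_bd_cmult q sobolev_bd_self lo zz)
    show ?thesis
      using sobolev_cong_ae(2)[OF lo(1)[OF yy(2)] e2 sobolev_measurable[OF sobolev_bdD(1)[OF b]]] sobolev_bdD(2)[OF b] s(2) by simp
  qed
  have n5: "sobolev_norm \<sigma> y5 \<le> sobolev_norm \<sigma> z5 + dt * R"
    by (rule crank_step[OF yy(5) zz(5) s q(2) e5])
  have c6: "ae_eq (crank c y6) (crank c z7)" for c
    by (rule crank_cong[OF lo(2)[OF yy(6)] e6 sobolev_measurable[OF zz(7)]])
  note qd = sobolev_bd_cmult[OF q(3), of "of_real dt"]
  note az = sobolev_add(1)[OF zz(6,7)] and ay = sobolev_add(1)[OF yy(6,7)]
  have n\<alpha>: "sobolev_norm \<sigma> (crank dt (\<lambda>x. y6 x + y7 x)) \<le> sobolev_norm \<sigma> (crank dt (\<lambda>x. z6 x + z7 x)) + dt * R"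
  proof -
    have b: "sobolev_bd \<sigma> (\<lambda>x. crank (- dt) (\<lambda>x. z6 x + z7 x) x + of_real dt * q7 x) (sobolev_norm \<sigma> (crank (- dt) (\<lambda>x. z6 x + z7 x)) + cmod (of_real dt) * R)"
      by (intro sobolev_bd_add sobolev_bd_self crank_sobolev(1)[OF az s(1)] qd)
    have e: "ae_eq (crank dt (\<lambda>x. y6 x + y7 x)) (\<lambda>x. crank (- dt) (\<lambda>x. z6 x + z7 x) x + of_real dt * q7 x)"
      using crank_add[OF lo(2)[OF yy(6)] lo(2)[OF yy(7)], of dt] crank_add[OF lo(2)[OF zz(6)] lo(2)[OF zz(7)], of "- dt"] c6[of dt] e7
      unfolding ae_eq_def by eventually_elim simp
    show ?thesis
      using sobolev_cong_ae(2)[OF crank_sobolev(1)[OF ay s(1)] e sobolev_measurable[OF sobolev_bdD(1)[OF b]]] sobolev_bdD(2)[OF b] s(2)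
        crank_minus_norm[OF az s(1), of dt] by simp
  qed
  have n\<gamma>: "sobolev_norm \<sigma> (\<lambda>x. crank dt y7 x - crank (- dt) y6 x) \<le> sobolev_norm \<sigma> (\<lambda>x. crank dt z7 x - crank (- dt) z6 x) + dt * R"
  proof -
    note cz = sobolev_diff(1)[OF crank_sobolev(1)[OF zz(7) s(1), of dt] crank_sobolev(1)[OF zz(6) s(1), of "- dt"]]
      and cy = sobolev_diff(1)[OF crank_sobolev(1)[OF yy(7) s(1), of dt] crank_sobolev(1)[OF yy(6) s(1), of "- dt"]]
    have b: "sobolev_bd \<sigma> (\<lambda>x. of_real dt * q7 x - (crank dt z7 x - crank (- dt) z6 x)) (cmod (of_real dt) * R + sobolev_norm \<sigma> (\<lambda>x. crank dt z7 x - crank (- dt) z6 x))"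
      by (rule sobolev_bd_diff[OF qd sobolev_bd_self[OF cz]])
    have e: "ae_eq (\<lambda>x. crank dt y7 x - crank (- dt) y6 x) (\<lambda>x. of_real dt * q7 x - (crank dt z7 x - crank (- dt) z6 x))"
      using c6[of "- dt"] e7 unfolding ae_eq_def by eventually_elim simp
    show ?thesis
      using sobolev_cong_ae(2)[OF cy e sobolev_measurable[OF sobolev_bdD(1)[OF b]]] sobolev_bdD(2)[OF b] s(2) by simp
  qed
  have "max (sobolev_norm \<sigma> y1) (sobolev_norm \<sigma> y2) \<le> max (sobolev_norm \<sigma> z1) (sobolev_norm \<sigma> z2) + dt * R"
    using n1 n2 R by (simp add: max_def)
  moreover have "max (sobolev_norm \<sigma> y3) (max (sobolev_norm \<sigma> y4) (sobolev_norm \<sigma> y5))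
     \<le> max (sobolev_norm \<sigma> z3) (max (sobolev_norm \<sigma> z4) (sobolev_norm \<sigma> z5)) + dt * R"
    using n3 n4 n5 R by (simp add: max_def)
  ultimately show ?thesis using n\<alpha> n\<gamma> unfolding err_def prod.case mult.assoc by linarith
qed

section \<open>Perturbed steps and Lipschitz bounds for the nonlinear terms\<close>

definition density_rate :: "'a::euclidean_space field \<Rightarrow> 'a field \<Rightarrow> 'a field \<Rightarrow> 'a field" where
  "density_rate x4 x5 x7 = (\<lambda>x. of_real (2 * Re (x7 x * cnj ((x5 x + x4 x) / 2))))"

definition velocity_force :: "'a::euclidean_space state \<Rightarrow> 'a state \<Rightarrow> 'a field" where
  "velocity_force = (\<lambda>(x1, x2, x3, x4, x5, x6, x7) (y1, y2, y3, y4, y5, y6, y7).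
     (\<lambda>x. (y2 x + x1 x) / 2 * ((y7 x + 2 * x7 x + x6 x) / 4)
        + density_rate x4 x5 x7 x * ((y5 x + x5 x + x4 x + x3 x) / 4)))"

text \<open>One step with the inverse operators cleared and residuals in the three components that
  are not mere shifts. The scheme satisfies it with zero residuals and the exact solution with
  residuals of size dt^2, so the two can be subtracted row by row.\<close>

definition perturbed_step ::
    "real \<Rightarrow> real \<Rightarrow> 'a::euclidean_space state \<Rightarrow> 'a state \<Rightarrow> 'a field \<Rightarrow> 'a field \<Rightarrow> 'a field \<Rightarrow> bool" where
  "perturbed_step \<beta> dt X Y r2 r5 r7 = (case (X, Y) of
     ((x1, x2, x3, x4, x5, x6, x7), (y1, y2, y3, y4, y5, y6, y7)) \<Rightarrow>
       ae_eq y1 x2 \<and> ae_eq y2 (\<lambda>x. x1 x + of_real dt * (2 * density_rate x4 x5 x7 x + r2 x)) \<and>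
       ae_eq y3 x4 \<and> ae_eq y4 x5 \<and>
       ae_eq (crank dt y5) (\<lambda>x. crank (- dt) x5 x + of_real dt * (of_real \<beta> * (y2 x * ((y5 x + y4 x) / 2)) + r5 x)) \<and>
       ae_eq y6 x7 \<and>
       ae_eq (crank dt y7) (\<lambda>x. crank (- dt) x6 x + crank (- dt) x7 x - crank dt x7 x
          + of_real dt * (2 * of_real \<beta> * velocity_force X Y x + r7 x)))"

context sobolev_alg
begin

lemma bd_mult_diff:
  fixes u v u' v' :: "'a \<Rightarrow> complex"
  assumes "sobolev_bd \<sigma> (\<lambda>x. u x - u' x) p" "sobolev_bd \<sigma> v G" "sobolev_bd \<sigma> u' H" "sobolev_bd \<sigma> (\<lambda>x. v x - v' x) q"
  shows "sobolev_bd \<sigma> (\<lambda>x. u x * v x - u' x * v' x) (K * p * G + K * H * q)"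
proof -
  have "(\<lambda>x. u x * v x - u' x * v' x) = (\<lambda>x. (u x - u' x) * v x + u' x * (v x - v' x))"
    by (auto simp: algebra_simps)
  then show ?thesis using sobolev_bd_add[OF bd_mult[OF assms(1,2)] bd_mult[OF assms(3,4)]] by simp
qed

lemma bd_density_rate:
  fixes x4 x5 x7 :: "'a \<Rightarrow> complex"
  assumes "sobolev_bd \<sigma> x4 G" "sobolev_bd \<sigma> x5 G" "sobolev_bd \<sigma> x7 G"
  shows "sobolev_bd \<sigma> (density_rate x4 x5 x7) (2 * K * G * G)"
proof -
  have e: "density_rate x4 x5 x7 = (\<lambda>x. of_real (Re (x7 x * cnj (x5 x + x4 x))))"
    by (auto simp: density_rate_def algebra_simps)
  show ?thesis unfolding e
    by (rule sobolev_bd_mono[OF bd_Re[OF assms(3) sobolev_bd_add[OF assms(2,1)]]]) simp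
qed

lemma bd_density_rate_diff:
  fixes x4 x5 x7 :: "'a \<Rightarrow> complex"
  assumes "sobolev_bd \<sigma> x4 G" "sobolev_bd \<sigma> x5 G" "sobolev_bd \<sigma> w7 G"
    and "sobolev_bd \<sigma> (\<lambda>x. x4 x - w4 x) S" "sobolev_bd \<sigma> (\<lambda>x. x5 x - w5 x) S" "sobolev_bd \<sigma> (\<lambda>x. x7 x - w7 x) S"
  shows "sobolev_bd \<sigma> (\<lambda>x. density_rate x4 x5 x7 x - density_rate w4 w5 w7 x) (4 * K * G * S)"
proof -
  have e: "(\<lambda>x. density_rate x4 x5 x7 x - density_rate w4 w5 w7 x)
     = (\<lambda>x. of_real (Re ((x7 x - w7 x) * cnj (x5 x + x4 x))) + of_real (Re (w7 x * cnj ((x5 x - w5 x) + (x4 x - w4 x)))))"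
  proof
    fix x
    have "2 * Re (x7 x * cnj ((x5 x + x4 x) / 2)) - 2 * Re (w7 x * cnj ((w5 x + w4 x) / 2))
      = Re ((x7 x - w7 x) * cnj (x5 x + x4 x)) + Re (w7 x * cnj ((x5 x - w5 x) + (x4 x - w4 x)))"
      by (simp add: field_simps)
    then show "density_rate x4 x5 x7 x - density_rate w4 w5 w7 x
      = of_real (Re ((x7 x - w7 x) * cnj (x5 x + x4 x))) + of_real (Re (w7 x * cnj ((x5 x - w5 x) + (x4 x - w4 x))))"
      unfolding density_rate_def of_real_diff[symmetric] of_real_add[symmetric] by (rule arg_cong)
  qed
  show ?thesis unfolding e
    by (rule sobolev_bd_mono[OF sobolev_bd_add[OF bd_Re[OF assms(6) sobolev_bd_add[OF assms(2,1)]] bd_Re[OF assms(3) sobolev_bd_add[OF assms(5,4)]]]])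
       (simp add: algebra_simps)
qed

lemma bd_half_sum:
  "sobolev_bd \<sigma> u c \<Longrightarrow> sobolev_bd \<sigma> v c \<Longrightarrow> sobolev_bd \<sigma> (\<lambda>x. (u x + v x) / 2) c"
  using sobolev_bd_cmult[OF sobolev_bd_add, of \<sigma> u c v c "1/2"] by simp

lemma bd_quarter_sum3:
  assumes "sobolev_bd \<sigma> u c" "sobolev_bd \<sigma> v c" "sobolev_bd \<sigma> w c"
  shows "sobolev_bd \<sigma> (\<lambda>x. (u x + 2 * v x + w x) / 4) c"
  using sobolev_bd_cmult[OF sobolev_bd_add[OF sobolev_bd_add[OF assms(1) sobolev_bd_cmult[OF assms(2), of 2]] assms(3)], of "1/4"]
  by simp

lemma bd_quarter_sum4:
  assumes "sobolev_bd \<sigma> u c" "sobolev_bd \<sigma> v c" "sobolev_bd \<sigma> w c" "sobolev_bd \<sigma> z c"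
  shows "sobolev_bd \<sigma> (\<lambda>x. (u x + v x + w x + z x) / 4) c"
  using sobolev_bd_cmult[OF sobolev_bd_add[OF sobolev_bd_add[OF sobolev_bd_add[OF assms(1,2)] assms(3)] assms(4)], of "1/4"]
  by simp

text \<open>Common majorant of three Lipschitz constants: 8 K G from the density; 4 |\<beta>| K G
  from density times velocity, which also covers the fifth component; 12 |\<beta>| K^2 G^2 from the
  density rate times the four-point mean.\<close>

definition lip where "lip \<beta> G = 8 * K * G + 4 * \<bar>\<beta>\<bar> * K * G + 12 * \<bar>\<beta>\<bar> * K * K * G * G" for \<beta> G :: real

text \<open>The two perturbed steps are subtracted, and the differences of the nonlinear terms
  become the forces in \<open>err_step\<close>. The nonlinearity is evaluated at both ends of the
  step, so the new error also appears on the right; it is left there for the Gronwall argument to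
  absorb.\<close>

lemma stability:
  fixes X Y U V :: "'a state"
  assumes dt: "0 \<le> dt"
    and X: "X \<in> state_sobolev (\<sigma> + 2)" "Y \<in> state_sobolev (\<sigma> + 2)" "U \<in> state_sobolev (\<sigma> + 2)" "V \<in> state_sobolev (\<sigma> + 2)"
    and G: "\<And>u. u \<in> set (components X) \<union> set (components Y) \<union> set (components U) \<union> set (components V) \<Longrightarrow> sobolev_norm \<sigma> u \<le> G"
    and num: "perturbed_step \<beta> dt X Y (\<lambda>x. 0) (\<lambda>x. 0) (\<lambda>x. 0)"
    and ex: "perturbed_step \<beta> dt U V r2 r5 r7"
    and r: "sobolev_bd \<sigma> r2 \<delta>" "sobolev_bd \<sigma> r5 \<delta>" "sobolev_bd \<sigma> r7 \<delta>"
  shows "err \<sigma> dt (Y - V) \<le> err \<sigma> dt (X - U) + 4 * dt * (lip \<beta> G * (err \<sigma> dt (X - U) + err \<sigma> dt (Y - V)) + \<delta>)"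
proof -
  obtain x1 x2 x3 x4 x5 x6 x7 where Xe: "X = (x1, x2, x3, x4, x5, x6, x7)" by (cases X) auto
  obtain y1 y2 y3 y4 y5 y6 y7 where Ye: "Y = (y1, y2, y3, y4, y5, y6, y7)" by (cases Y) auto
  obtain u1 u2 u3 u4 u5 u6 u7 where Ue: "U = (u1, u2, u3, u4, u5, u6, u7)" by (cases U) auto
  obtain v1 v2 v3 v4 v5 v6 v7 where Ve: "V = (v1, v2, v3, v4, v5, v6, v7)" by (cases V) auto
  have DX: "X - U = (\<lambda>x. x1 x - u1 x, \<lambda>x. x2 x - u2 x, \<lambda>x. x3 x - u3 x, \<lambda>x. x4 x - u4 x, \<lambda>x. x5 x - u5 x, \<lambda>x. x6 x - u6 x, \<lambda>x. x7 x - u7 x)"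
    and DY: "Y - V = (\<lambda>x. y1 x - v1 x, \<lambda>x. y2 x - v2 x, \<lambda>x. y3 x - v3 x, \<lambda>x. y4 x - v4 x, \<lambda>x. y5 x - v5 x, \<lambda>x. y6 x - v6 x, \<lambda>x. y7 x - v7 x)"
    by (simp_all add: Xe Ye Ue Ve fun_diff_def)
  note mem = Xe Ye Ue Ve state_sobolev_def components_def
  have xs: "x1 \<in> sobolev (\<sigma> + 2)" "x2 \<in> sobolev (\<sigma> + 2)" "x3 \<in> sobolev (\<sigma> + 2)" "x4 \<in> sobolev (\<sigma> + 2)" "x5 \<in> sobolev (\<sigma> + 2)" "x6 \<in> sobolev (\<sigma> + 2)" "x7 \<in> sobolev (\<sigma> + 2)"
    using X(1) by (simp_all add: mem)
  have ys: "y1 \<in> sobolev (\<sigma> + 2)" "y2 \<in> sobolev (\<sigma> + 2)" "y3 \<in> sobolev (\<sigma> + 2)" "y4 \<in> sobolev (\<sigma> + 2)" "y5 \<in> sobolev (\<sigma> + 2)" "y6 \<in> sobolev (\<sigma> + 2)" "y7 \<in> sobolev (\<sigma> + 2)"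
    using X(2) by (simp_all add: mem)
  have us: "u1 \<in> sobolev (\<sigma> + 2)" "u2 \<in> sobolev (\<sigma> + 2)" "u3 \<in> sobolev (\<sigma> + 2)" "u4 \<in> sobolev (\<sigma> + 2)" "u5 \<in> sobolev (\<sigma> + 2)" "u6 \<in> sobolev (\<sigma> + 2)" "u7 \<in> sobolev (\<sigma> + 2)"
    using X(3) by (simp_all add: mem)
  have vs: "v1 \<in> sobolev (\<sigma> + 2)" "v2 \<in> sobolev (\<sigma> + 2)" "v3 \<in> sobolev (\<sigma> + 2)" "v4 \<in> sobolev (\<sigma> + 2)" "v5 \<in> sobolev (\<sigma> + 2)" "v6 \<in> sobolev (\<sigma> + 2)" "v7 \<in> sobolev (\<sigma> + 2)"
    using X(4) by (simp_all add: mem)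
  have lo: "\<And>u::'a \<Rightarrow> complex. u \<in> sobolev (\<sigma> + 2) \<Longrightarrow> u \<in> sobolev \<sigma>" "\<And>u::'a \<Rightarrow> complex. u \<in> sobolev (\<sigma> + 2) \<Longrightarrow> u \<in> sobolev 2"
    by (erule sobolev_mono(1), use order in simp)+
  have bX: "sobolev_bd \<sigma> x1 G" "sobolev_bd \<sigma> x3 G" "sobolev_bd \<sigma> x4 G" "sobolev_bd \<sigma> x5 G" "sobolev_bd \<sigma> x6 G" "sobolev_bd \<sigma> x7 G"
    by (intro sobolev_bdI lo xs G; simp add: mem)+
  have bY: "sobolev_bd \<sigma> y2 G" "sobolev_bd \<sigma> y4 G" "sobolev_bd \<sigma> y5 G" "sobolev_bd \<sigma> y7 G"
    by (intro sobolev_bdI lo ys G; simp add: mem)+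
  have bU: "sobolev_bd \<sigma> u1 G" "sobolev_bd \<sigma> u4 G" "sobolev_bd \<sigma> u5 G" "sobolev_bd \<sigma> u7 G"
    by (intro sobolev_bdI lo us G; simp add: mem)+
  have bV: "sobolev_bd \<sigma> v2 G"
    by (intro sobolev_bdI lo vs G; simp add: mem)
  note G0 = sobolev_bd_nonneg[OF bV]
  \<comment> \<open>Every component of either difference has norm at most S, so one number measures
    the errors of all arguments of the nonlinear terms.\<close>
  define S where "S = err \<sigma> dt (X - U) + err \<sigma> dt (Y - V)"
  have sZ: "X - U \<in> state_sobolev (\<sigma> + 2)" "Y - V \<in> state_sobolev (\<sigma> + 2)"
    unfolding DX DY state_sobolev_def components_def
    by (simp_all add: sobolev_diff(1) xs ys us vs)
  have eX: "sobolev_norm \<sigma> z \<le> S" if "z \<in> set (components (X - U))" for z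
    using err_component[OF sZ(1) order that, of dt] err_nonneg[of \<sigma> dt "Y - V"] by (simp add: S_def)
  have eY: "sobolev_norm \<sigma> z \<le> S" if "z \<in> set (components (Y - V))" for z
    using err_component[OF sZ(2) order that, of dt] err_nonneg[of \<sigma> dt "X - U"] by (simp add: S_def)
  have dX: "sobolev_bd \<sigma> (\<lambda>x. x1 x - u1 x) S" "sobolev_bd \<sigma> (\<lambda>x. x3 x - u3 x) S" "sobolev_bd \<sigma> (\<lambda>x. x4 x - u4 x) S"
    "sobolev_bd \<sigma> (\<lambda>x. x5 x - u5 x) S" "sobolev_bd \<sigma> (\<lambda>x. x6 x - u6 x) S" "sobolev_bd \<sigma> (\<lambda>x. x7 x - u7 x) S"
    by (intro sobolev_bdI sobolev_diff(1) lo xs us eX; simp add: DX components_def)+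
  have dY: "sobolev_bd \<sigma> (\<lambda>x. y2 x - v2 x) S" "sobolev_bd \<sigma> (\<lambda>x. y4 x - v4 x) S" "sobolev_bd \<sigma> (\<lambda>x. y5 x - v5 x) S" "sobolev_bd \<sigma> (\<lambda>x. y7 x - v7 x) S"
    by (intro sobolev_bdI sobolev_diff(1) lo ys vs eY; simp add: DY components_def)+
  note S0 = sobolev_bd_nonneg[OF dX(1)]
  have nn: "0 \<le> K * G * S" "0 \<le> \<bar>\<beta>\<bar> * (K * G * S)" "0 \<le> \<bar>\<beta>\<bar> * (K * K * G * G * S)"
    using K_pos G0 S0 by simp_all
  note dr = bd_density_rate_diff[OF bX(3,4) bU(4) dX(3,4,6)]
  define q2 where "q2 x = 2 * (density_rate x4 x5 x7 x - density_rate u4 u5 u7 x) - r2 x" for x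
  have "sobolev_bd \<sigma> q2 (cmod 2 * (4 * K * G * S) + \<delta>)"
    unfolding q2_def by (intro sobolev_bd_diff sobolev_bd_cmult dr r)
  then have q2: "sobolev_bd \<sigma> q2 (lip \<beta> G * S + \<delta>)"
    by (rule sobolev_bd_mono) (use nn in \<open>simp add: lip_def algebra_simps\<close>)
  have hd: "(\<lambda>x. (p x + q x) / 2 - (p' x + q' x) / 2) = (\<lambda>x. ((p x - p' x) + (q x - q' x)) / 2)" for p q p' q' :: "'a \<Rightarrow> complex"
    by (auto simp: field_simps)
  define q5 where "q5 x = of_real \<beta> * (y2 x * ((y5 x + y4 x) / 2) - v2 x * ((v5 x + v4 x) / 2)) - r5 x" for x
  have "sobolev_bd \<sigma> q5 (cmod (of_real \<beta>) * (K * S * G + K * G * S) + \<delta>)"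
    unfolding q5_def
    by (intro sobolev_bd_diff[OF sobolev_bd_cmult[OF bd_mult_diff[OF dY(1) bd_half_sum[OF bY(3,2)] bV(1)]] r(2)])
       (unfold hd, rule bd_half_sum[OF dY(3,2)])
  then have q5: "sobolev_bd \<sigma> q5 (lip \<beta> G * S + \<delta>)"
    by (rule sobolev_bd_mono) (use nn in \<open>simp add: lip_def algebra_simps\<close>)
  define q7 where "q7 x = (2 * of_real \<beta>) * (((y2 x + x1 x) / 2 * ((y7 x + 2 * x7 x + x6 x) / 4) - (v2 x + u1 x) / 2 * ((v7 x + 2 * u7 x + u6 x) / 4))
      + (density_rate x4 x5 x7 x * ((y5 x + x5 x + x4 x + x3 x) / 4) - density_rate u4 u5 u7 x * ((v5 x + u5 x + u4 x + u3 x) / 4))) - r7 x" for x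
  have w1: "sobolev_bd \<sigma> (\<lambda>x. (y2 x + x1 x) / 2 * ((y7 x + 2 * x7 x + x6 x) / 4) - (v2 x + u1 x) / 2 * ((v7 x + 2 * u7 x + u6 x) / 4)) (K * S * G + K * G * S)"
  proof (rule bd_mult_diff)
    show "sobolev_bd \<sigma> (\<lambda>x. (y2 x + x1 x) / 2 - (v2 x + u1 x) / 2) S" unfolding hd by (rule bd_half_sum[OF dY(1) dX(1)])
    show "sobolev_bd \<sigma> (\<lambda>x. (y7 x + 2 * x7 x + x6 x) / 4) G" by (rule bd_quarter_sum3[OF bY(4) bX(6,5)])
    show "sobolev_bd \<sigma> (\<lambda>x. (v2 x + u1 x) / 2) G" by (rule bd_half_sum[OF bV(1) bU(1)])
    have "(\<lambda>x. (y7 x + 2 * x7 x + x6 x) / 4 - (v7 x + 2 * u7 x + u6 x) / 4) = (\<lambda>x. ((y7 x - v7 x) + 2 * (x7 x - u7 x) + (x6 x - u6 x)) / 4)"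
      by (auto simp: field_simps)
    then show "sobolev_bd \<sigma> (\<lambda>x. (y7 x + 2 * x7 x + x6 x) / 4 - (v7 x + 2 * u7 x + u6 x) / 4) S"
      using bd_quarter_sum3[OF dY(4) dX(6,5)] by simp
  qed
  have w2: "sobolev_bd \<sigma> (\<lambda>x. density_rate x4 x5 x7 x * ((y5 x + x5 x + x4 x + x3 x) / 4) - density_rate u4 u5 u7 x * ((v5 x + u5 x + u4 x + u3 x) / 4)) (K * (4 * K * G * S) * G + K * (2 * K * G * G) * S)"
  proof (rule bd_mult_diff[OF dr _ bd_density_rate[OF bU(2,3,4)]])
    show "sobolev_bd \<sigma> (\<lambda>x. (y5 x + x5 x + x4 x + x3 x) / 4) G" by (rule bd_quarter_sum4[OF bY(3) bX(4,3,2)])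
    have "(\<lambda>x. (y5 x + x5 x + x4 x + x3 x) / 4 - (v5 x + u5 x + u4 x + u3 x) / 4) = (\<lambda>x. ((y5 x - v5 x) + (x5 x - u5 x) + (x4 x - u4 x) + (x3 x - u3 x)) / 4)"
      by (auto simp: field_simps)
    then show "sobolev_bd \<sigma> (\<lambda>x. (y5 x + x5 x + x4 x + x3 x) / 4 - (v5 x + u5 x + u4 x + u3 x) / 4) S"
      using bd_quarter_sum4[OF dY(3) dX(4,3,2)] by simp
  qed
  have "sobolev_bd \<sigma> q7 (cmod (2 * of_real \<beta>) * ((K * S * G + K * G * S) + (K * (4 * K * G * S) * G + K * (2 * K * G * G) * S)) + \<delta>)"
    unfolding q7_def by (intro sobolev_bd_diff sobolev_bd_cmult sobolev_bd_add w1 w2 r)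
  then have q7: "sobolev_bd \<sigma> q7 (lip \<beta> G * S + \<delta>)"
    by (rule sobolev_bd_mono) (use nn in \<open>simp add: lip_def norm_mult algebra_simps\<close>)
  note N = num[unfolded perturbed_step_def Xe Ye velocity_force_def, simplified prod.case]
  note E = ex[unfolded perturbed_step_def Ue Ve velocity_force_def, simplified prod.case]
  have cd: "ae_eq (crank c (\<lambda>x. p x - q x)) (\<lambda>x. crank c p x - crank c q x)" if "p \<in> sobolev (\<sigma> + 2)" "q \<in> sobolev (\<sigma> + 2)" for c and p q :: "'a \<Rightarrow> complex"
    by (rule crank_diff[OF lo(2)[OF that(1)] lo(2)[OF that(2)]])
  have "err \<sigma> dt (Y - V) \<le> err \<sigma> dt (X - U) + 4 * dt * (lip \<beta> G * S + \<delta>)"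
    unfolding DX DY
  proof (rule err_step[OF order dt sZ(1)[unfolded DX] sZ(2)[unfolded DY] q2 q5 q7])
    show "ae_eq (\<lambda>x. y1 x - v1 x) (\<lambda>x. x2 x - u2 x)" "ae_eq (\<lambda>x. y3 x - v3 x) (\<lambda>x. x4 x - u4 x)"
      "ae_eq (\<lambda>x. y4 x - v4 x) (\<lambda>x. x5 x - u5 x)" "ae_eq (\<lambda>x. y6 x - v6 x) (\<lambda>x. x7 x - u7 x)"
      using N E unfolding ae_eq_def by auto
    have "ae_eq y2 (\<lambda>x. x1 x + of_real dt * (2 * density_rate x4 x5 x7 x + 0))"
      "ae_eq v2 (\<lambda>x. u1 x + of_real dt * (2 * density_rate u4 u5 u7 x + r2 x))"
      using N E by simp_all
    then show "ae_eq (\<lambda>x. y2 x - v2 x) (\<lambda>x. x1 x - u1 x + of_real dt * q2 x)"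
      unfolding ae_eq_def by eventually_elim (simp add: q2_def algebra_simps)
    have "ae_eq (crank dt y5) (\<lambda>x. crank (- dt) x5 x + of_real dt * (of_real \<beta> * (y2 x * ((y5 x + y4 x) / 2)) + 0))"
      "ae_eq (crank dt v5) (\<lambda>x. crank (- dt) u5 x + of_real dt * (of_real \<beta> * (v2 x * ((v5 x + v4 x) / 2)) + r5 x))"
      using N E by simp_all
    then show "ae_eq (crank dt (\<lambda>x. y5 x - v5 x)) (\<lambda>x. crank (- dt) (\<lambda>x. x5 x - u5 x) x + of_real dt * q5 x)"
      using cd[OF ys(5) vs(5), of dt] cd[OF xs(5) us(5), of "- dt"]
      unfolding ae_eq_def
    proof eventually_elim
      case (elim x)
      show ?case unfolding elim q5_def by (simp add: algebra_simps)
    qed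
    let ?W = "\<lambda>x. (y2 x + x1 x) / 2 * ((y7 x + 2 * x7 x + x6 x) / 4) + density_rate x4 x5 x7 x * ((y5 x + x5 x + x4 x + x3 x) / 4)"
    let ?W' = "\<lambda>x. (v2 x + u1 x) / 2 * ((v7 x + 2 * u7 x + u6 x) / 4) + density_rate u4 u5 u7 x * ((v5 x + u5 x + u4 x + u3 x) / 4)"
    have "ae_eq (crank dt y7) (\<lambda>x. crank (- dt) x6 x + crank (- dt) x7 x - crank dt x7 x + of_real dt * (2 * of_real \<beta> * ?W x + 0))"
      "ae_eq (crank dt v7) (\<lambda>x. crank (- dt) u6 x + crank (- dt) u7 x - crank dt u7 x + of_real dt * (2 * of_real \<beta> * ?W' x + r7 x))"
      using N E by simp_all
    then show "ae_eq (crank dt (\<lambda>x. y7 x - v7 x)) (\<lambda>x. crank (- dt) (\<lambda>x. x6 x - u6 x) x + crank (- dt) (\<lambda>x. x7 x - u7 x) x - crank dt (\<lambda>x. x7 x - u7 x) x + of_real dt * q7 x)"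
      using cd[OF ys(7) vs(7), of dt] cd[OF xs(6) us(6), of "- dt"] cd[OF xs(7) us(7), of "- dt"] cd[OF xs(7) us(7), of dt]
      unfolding ae_eq_def
    proof eventually_elim
      case (elim x)
      define w where "w = ?W x"
      define w' where "w' = ?W' x"
      have q7: "q7 x = (2 * of_real \<beta>) * (w - w') - r7 x" by (simp add: q7_def w_def w'_def algebra_simps)
      show ?case unfolding elim q7 w_def[symmetric] w'_def[symmetric] by (simp add: algebra_simps)
    qed
  qed
  then show ?thesis by (simp add: S_def)
qed

end

subsection \<open>Initial error\<close>

context nls_curve
begin

text \<open>The entry with index -1 is a step of length -dt, hence both signs. For c < 0 the centred
  identity with half-width |c|/2 is read from right to left.\<close>

lemma midpoint_signed:
  assumes c: "c \<noteq> 0" "a \<le> - \<bar>c\<bar>" "\<bar>c\<bar> \<le> b"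
  shows "\<exists>e. sobolev_bd \<sigma> e (C5 * c\<^sup>2) \<and>
    ae_eq (crank c (D 0 c)) (\<lambda>x. crank (- c) (D 0 0) x + of_real c *
       (of_real \<beta> * (of_real ((cmod (D 0 (c / 2) x))\<^sup>2) * ((D 0 c x + D 0 0 x) / 2)) + e x))"
proof -
  have mem: "0 \<in> {a..b}" using c by auto
  have C5: "0 \<le> C5" unfolding C5_def using M_nonneg[OF mem] K_pos by simp
  have le: "C5 * (\<bar>c\<bar> / 2)\<^sup>2 \<le> C5 * c\<^sup>2"
    using C5 by (intro mult_left_mono) (simp_all add: power_divide)
  show ?thesis
  proof (cases "c > 0")
    case True
    have h: "c / 2 > 0" "a \<le> c / 2 - c / 2" "c / 2 + c / 2 \<le> b" using c True by auto
    obtain e where e: "sobolev_bd \<sigma> e (C5 * (c / 2)\<^sup>2)"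
      and ae: "ae_eq (crank (2 * (c / 2)) (D 0 (c / 2 + c / 2))) (\<lambda>x. crank (- (2 * (c / 2))) (D 0 (c / 2 - c / 2)) x + of_real (2 * (c / 2)) *
       (of_real \<beta> * (of_real ((cmod (D 0 (c / 2) x))\<^sup>2) * ((D 0 (c / 2 + c / 2) x + D 0 (c / 2 - c / 2) x) / 2)) + e x))"
      using midpoint_consistency[OF h] by blast
    have s: "2 * (c / 2) = c" "c / 2 + c / 2 = c" "c / 2 - c / 2 = 0" by simp_all
    show ?thesis using sobolev_bd_mono[OF e] le True ae unfolding s by auto
  next
    case False
    have h: "- c / 2 > 0" "a \<le> c / 2 - (- c / 2)" "c / 2 + (- c / 2) \<le> b" using c False by auto
    have h': "a \<le> c / 2 - (- c / 2)" using h by simp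
    obtain e where e: "sobolev_bd \<sigma> e (C5 * (- c / 2)\<^sup>2)"
      and ae: "ae_eq (crank (2 * (- c / 2)) (D 0 (c / 2 + - c / 2))) (\<lambda>x. crank (- (2 * (- c / 2))) (D 0 (c / 2 - - c / 2)) x + of_real (2 * (- c / 2)) *
       (of_real \<beta> * (of_real ((cmod (D 0 (c / 2) x))\<^sup>2) * ((D 0 (c / 2 + - c / 2) x + D 0 (c / 2 - - c / 2) x) / 2)) + e x))"
      using midpoint_consistency[OF h] by blast
    have s: "2 * (- c / 2) = - c" "c / 2 + - c / 2 = 0" "c / 2 - - c / 2 = c" "- (- c) = c" by simp_all
    have "ae_eq (crank c (D 0 c)) (\<lambda>x. crank (- c) (D 0 0) x + of_real c *
       (of_real \<beta> * (of_real ((cmod (D 0 (c / 2) x))\<^sup>2) * ((D 0 c x + D 0 0 x) / 2)) + e x))"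
      using ae unfolding s ae_eq_def
    proof eventually_elim
      case (elim x)
      show ?case unfolding elim by (simp add: add.commute)
    qed
    moreover have "sobolev_bd \<sigma> e (C5 * c\<^sup>2)"
      by (rule sobolev_bd_mono[OF e]) (use le in \<open>simp add: power_divide\<close>)
    ultimately show ?thesis by blast
  qed
qed

text \<open>For either sign of c the difference quotient is centred at c/2, where it approximates
  the derivative to second order.\<close>

lemma increment_signed:
  assumes c: "c \<noteq> 0" "a \<le> - \<bar>c\<bar>" "\<bar>c\<bar> \<le> b"
  shows "sobolev_bd \<rho> (\<lambda>x. (D 0 c x - D 0 0 x) / of_real c - D 1 (c / 2) x) (M * c\<^sup>2)"
proof -
  have mem: "0 \<in> {a..b}" using c by auto
  define h where "h = \<bar>c\<bar> / 2"
  have h: "h > 0" "a \<le> c / 2 - h" "c / 2 + h \<le> b" using c by (auto simp: h_def abs_if split: if_splits)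
  note t = taylor(3)[OF h]
  have e: "(\<lambda>x. (D 0 c x - D 0 0 x) / of_real c - D 1 (c / 2) x)
     = (\<lambda>x. of_real (1 / (2 * h)) * (D 0 (c / 2 + h) x - D 0 (c / 2 - h) x - of_real (2 * h) * D 1 (c / 2) x))"
  proof (cases "c > 0")
    case True
    have s: "c / 2 + h = c" "c / 2 - h = 0" "2 * h = c" using True by (simp_all add: h_def)
    show ?thesis unfolding s using c(1) by (auto simp: field_simps)
  next
    case False
    have s: "c / 2 + h = 0" "c / 2 - h = c" "2 * h = - c" using False by (simp_all add: h_def)
    show ?thesis unfolding s using c(1) by (auto simp: field_simps)
  qed
  show ?thesis unfolding e
  proof (rule sobolev_bd_mono[OF sobolev_bd_cmult[OF t]])
    have "cmod (of_real (1 / (2 * h))) * (M * h ^ 3) = M * (h\<^sup>2 / 2)"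
      using h(1) by (simp add: norm_divide field_simps power2_eq_square power3_eq_cube)
    also have "\<dots> \<le> M * c\<^sup>2"
      using M_nonneg[OF mem] by (intro mult_left_mono) (simp_all add: h_def power_divide)
    finally show "cmod (of_real (1 / (2 * h))) * (M * h ^ 3) \<le> M * c\<^sup>2" .
  qed
qed

text \<open>The difference of w and the exact value solves a Crank-Nicolson equation whose right
  side is c times the potential error, the residual and the potential acting on the difference
  itself; the last is absorbed by smallness of c. The surviving factor |c| is what permits division
  by c in the second estimate, the one for the initial increments.\<close>

lemma cayley_error:
  assumes c: "c \<noteq> 0" "a \<le> - \<bar>c\<bar>" "\<bar>c\<bar> \<le> b"
    and w: "w \<in> sobolev \<sigma>" "w \<in> sobolev 2" and \<phi>0: "ae_eq (D 0 0) \<phi>0" "\<phi>0 \<in> borel_measurable borel"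
    and eq: "ae_eq (\<lambda>x. 2 * w x + \<i> * of_real c * hamiltonian \<beta> V w x)
           (\<lambda>x. 2 * \<phi>0 x - \<i> * of_real c * hamiltonian \<beta> V \<phi>0 x)"
    and V: "sobolev_bd \<sigma> V Vb" and \<eta>: "sobolev_bd \<sigma> (\<lambda>x. V x - of_real ((cmod (D 0 (c / 2) x))\<^sup>2)) \<eta>"
    and small: "\<bar>c\<bar> * (\<bar>\<beta>\<bar> * K * Vb) \<le> 1"
  shows "sobolev_bd \<sigma> (\<lambda>x. w x - D 0 c x) (\<bar>c\<bar> * (2 * (\<bar>\<beta>\<bar> * K * M * \<eta>) + 2 * C5 * c\<^sup>2))"
    and "sobolev_bd \<sigma> (\<lambda>x. (w x - \<phi>0 x) / of_real c - D 1 (c / 2) x) (2 * (\<bar>\<beta>\<bar> * K * M * \<eta>) + (2 * C5 + M) * c\<^sup>2)"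
proof -
  have mem: "0 \<in> {a..b}" "c \<in> {a..b}" using c by auto
  obtain e where e: "sobolev_bd \<sigma> e (C5 * c\<^sup>2)"
    and ae: "ae_eq (crank c (D 0 c)) (\<lambda>x. crank (- c) (D 0 0) x + of_real c *
       (of_real \<beta> * (of_real ((cmod (D 0 (c / 2) x))\<^sup>2) * ((D 0 c x + D 0 0 x) / 2)) + e x))"
    using midpoint_signed[OF c] by blast
  let ?d = "\<lambda>x. w x - D 0 c x" and ?W = "\<lambda>x. complex_of_real ((cmod (D 0 (c / 2) x))\<^sup>2)"
  have D\<sigma>: "D 0 c \<in> sobolev \<sigma>" by (rule sobolev_bdD(1)[OF D_bd'[OF mem(2)]]) simp
  have d: "?d \<in> sobolev \<sigma>" "?d \<in> sobolev 2"
    by (intro sobolev_diff(1) w D\<sigma> D_2 mem)+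
  define X where "X = sobolev_norm \<sigma> ?d"
  \<comment> \<open>Right side of the equation for the difference: V acting on the error, the error
    of V acting on exact values, and the residual e.\<close>
  define q where "q x = of_real c * (of_real (\<beta> / 2) * (V x * ?d x + (V x - ?W x) * (D 0 c x + D 0 0 x)) - e x)" for x
  have "sobolev_bd \<sigma> q (cmod (of_real c) * (cmod (of_real (\<beta> / 2)) * (K * Vb * X + K * \<eta> * (M + M)) + C5 * c\<^sup>2))"
    unfolding q_def X_def
    by (intro sobolev_bd_cmult sobolev_bd_diff[OF _ e] sobolev_bd_add bd_mult V \<eta> D_bd' mem sobolev_bd_self d) simp_all
  then have q: "sobolev_bd \<sigma> q (\<bar>c\<bar> * (\<bar>\<beta>\<bar> / 2 * (K * Vb * X + K * \<eta> * (M + M)) + C5 * c\<^sup>2))" by simp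
  have cq: "ae_eq q (crank c ?d)"
    using eq ae crank_diff[OF w(2) D_2[OF mem(2), of 0], of c] crank_cong[OF D_2[OF mem(1), of 0] \<phi>0, of "- c"] \<phi>0(1)
    unfolding ae_eq_def
  proof eventually_elim
    case (elim x)
    have "2 * w x + \<i> * of_real c * hamiltonian \<beta> V w x = 2 * \<phi>0 x + \<i> * of_real (- c) * hamiltonian \<beta> V \<phi>0 x"
      using elim(1) by simp
    then have "- 2 * \<i> * crank c w x + \<i> * of_real (c * \<beta>) * (V x * w x) = - 2 * \<i> * crank (- c) \<phi>0 x + \<i> * of_real (- c * \<beta>) * (V x * \<phi>0 x)"
      unfolding hamiltonian_crank .
    then have "crank c w x = crank (- c) \<phi>0 x + of_real c * (of_real (\<beta> / 2) * (V x * (w x + \<phi>0 x)))"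
    proof -
      assume a1: "- 2 * \<i> * crank c w x + \<i> * of_real (c * \<beta>) * (V x * w x) = - 2 * \<i> * crank (- c) \<phi>0 x + \<i> * of_real (- c * \<beta>) * (V x * \<phi>0 x)"
      \<comment> \<open>Isolates A: multiplying by \<i> / 2 turns -2 \<i> A into A and \<i> B into
        -B/2, which the last term compensates.\<close>
      have r: "A = (\<i> / 2) * (- 2 * \<i> * A + \<i> * B) + B / 2" for A B :: complex by (simp add: algebra_simps)
      have "crank c w x = (\<i> / 2) * (- 2 * \<i> * crank (- c) \<phi>0 x + \<i> * (of_real (- c * \<beta>) * (V x * \<phi>0 x))) + of_real (c * \<beta>) * (V x * w x) / 2"
        by (subst r[of "crank c w x" "of_real (c * \<beta>) * (V x * w x)"]) (use a1 in \<open>simp add: mult.assoc\<close>)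
      then show ?thesis by (simp add: field_simps)
    qed
    then show ?case unfolding elim(3) elim(2) q_def using elim(4,5) by (simp add: field_simps)
  qed
  have cm: "crank c ?d \<in> borel_measurable borel"
    using crank_sobolev(1)[of ?d 0 c] d(2) sobolev_measurable by fastforce
  note cs = sobolev_bd_cong[OF q cq cm]
  have "X \<le> \<bar>c\<bar> * (\<bar>\<beta>\<bar> / 2 * (K * Vb * X + K * \<eta> * (M + M)) + C5 * c\<^sup>2)"
    unfolding X_def using norm_le_crank(2)[OF d(2) sobolev_bdD(1)[OF cs]] sobolev_bdD(2)[OF cs] unfolding X_def by simp
  \<comment> \<open>Half of X is split off with the coefficient that the smallness premise bounds by
    1, and is then absorbed on the left.\<close>
  also have "\<dots> = (\<bar>c\<bar> * (\<bar>\<beta>\<bar> * K * Vb)) * (X / 2) + \<bar>c\<bar> * (\<bar>\<beta>\<bar> * K * M * \<eta> + C5 * c\<^sup>2)"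
    by (simp add: field_simps)
  also have "\<dots> \<le> 1 * (X / 2) + \<bar>c\<bar> * (\<bar>\<beta>\<bar> * K * M * \<eta> + C5 * c\<^sup>2)"
    by (rule add_right_mono, rule mult_right_mono[OF small]) (simp add: X_def)
  finally have "X \<le> \<bar>c\<bar> * (2 * (\<bar>\<beta>\<bar> * K * M * \<eta>) + 2 * C5 * c\<^sup>2)" by (simp add: algebra_simps)
  then show bd: "sobolev_bd \<sigma> ?d (\<bar>c\<bar> * (2 * (\<bar>\<beta>\<bar> * K * M * \<eta>) + 2 * C5 * c\<^sup>2))"
    using d(1) by (simp add: sobolev_bd_def X_def)
  have \<rho>\<sigma>: "\<sigma> \<le> \<rho>" using \<rho> by simp
  have "sobolev_bd \<sigma> (\<lambda>x. (1 / of_real c) * ?d x + ((D 0 c x - D 0 0 x) / of_real c - D 1 (c / 2) x))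
     (cmod (1 / of_real c) * (\<bar>c\<bar> * (2 * (\<bar>\<beta>\<bar> * K * M * \<eta>) + 2 * C5 * c\<^sup>2)) + M * c\<^sup>2)"
    by (intro sobolev_bd_add sobolev_bd_cmult bd sobolev_bd_order[OF increment_signed[OF c] \<rho>\<sigma>])
  then have "sobolev_bd \<sigma> (\<lambda>x. (1 / of_real c) * ?d x + ((D 0 c x - D 0 0 x) / of_real c - D 1 (c / 2) x)) (2 * (\<bar>\<beta>\<bar> * K * M * \<eta>) + (2 * C5 + M) * c\<^sup>2)"
    by (rule sobolev_bd_mono) (use c(1) in \<open>simp add: norm_divide algebra_simps\<close>)
  moreover have "ae_eq (\<lambda>x. (1 / of_real c) * ?d x + ((D 0 c x - D 0 0 x) / of_real c - D 1 (c / 2) x)) (\<lambda>x. (w x - \<phi>0 x) / of_real c - D 1 (c / 2) x)"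
    using \<phi>0(1) unfolding ae_eq_def by eventually_elim (simp add: diff_divide_distrib)
  moreover have "(\<lambda>x. (w x - \<phi>0 x) / of_real c - D 1 (c / 2) x) \<in> borel_measurable borel"
  proof -
    have "c / 2 \<in> {a..b}" using c by (auto simp: abs_if split: if_splits)
    then have [measurable]: "D 1 (c / 2) \<in> borel_measurable borel" by (rule sobolev_measurable[OF D_sobolev])
    have [measurable]: "w \<in> borel_measurable borel" by (rule sobolev_measurable[OF w(1)])
    note [measurable] = \<phi>0(2)
    show ?thesis by measurable
  qed
  ultimately show "sobolev_bd \<sigma> (\<lambda>x. (w x - \<phi>0 x) / of_real c - D 1 (c / 2) x) (2 * (\<bar>\<beta>\<bar> * K * M * \<eta>) + (2 * C5 + M) * c\<^sup>2)"
    by (rule sobolev_bd_cong)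
qed

text \<open>The density at 1/2 is 2 |\<phi>_0|^2 minus that at -1/2, so its error is minus the given
  one up to this second difference. A polarisation identity reduces the latter to a second
  difference and the square of a first difference of the solution.\<close>

lemma density_second_difference:
  assumes h: "h > 0" "a \<le> - h" "h \<le> b"
  shows "sobolev_bd \<sigma> (\<lambda>x. of_real ((cmod (D 0 h x))\<^sup>2) + of_real ((cmod (D 0 (- h) x))\<^sup>2) - 2 * of_real ((cmod (D 0 0 x))\<^sup>2)) (4 * K * M * M * h\<^sup>2)"
proof -
  have h': "h > 0" "a \<le> 0 - h" "0 + h \<le> b" using h by auto
  have mem: "h \<in> {a..b}" "- h \<in> {a..b}" "0 \<in> {a..b}" using h by auto
  have \<rho>\<sigma>: "\<sigma> \<le> \<rho>" using \<rho> by simp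
  have T2: "sobolev_bd \<sigma> (\<lambda>x. D 0 h x + D 0 (- h) x - 2 * D 0 0 x) (M * h\<^sup>2)"
    using sobolev_bd_order[OF taylor(2)[OF h', of 0] \<rho>\<sigma>] by simp
  have T1: "sobolev_bd \<sigma> (\<lambda>x. D 0 h x - D 0 (- h) x) (2 * h * M)"
    using sobolev_bd_order[OF taylor(1)[OF h', of 0] \<rho>\<sigma>] by simp
  have "sobolev_bd \<sigma> (\<lambda>x. (1 / 2) * (of_real (Re ((D 0 h x + D 0 (- h) x - 2 * D 0 0 x) * cnj (D 0 h x + D 0 (- h) x + 2 * D 0 0 x))) + of_real ((cmod (D 0 h x - D 0 (- h) x))\<^sup>2)))
     (cmod (1 / 2) * (K * (M * h\<^sup>2) * (M + M + cmod 2 * M) + K * (2 * h * M) * (2 * h * M)))"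
    by (intro sobolev_bd_cmult sobolev_bd_add bd_Re bd_abs2 T1 T2 D_bd' mem) simp_all
  moreover have "(\<lambda>x. (1 / 2) * (of_real (Re ((D 0 h x + D 0 (- h) x - 2 * D 0 0 x) * cnj (D 0 h x + D 0 (- h) x + 2 * D 0 0 x))) + of_real ((cmod (D 0 h x - D 0 (- h) x))\<^sup>2)))
     = (\<lambda>x. complex_of_real ((cmod (D 0 h x))\<^sup>2) + of_real ((cmod (D 0 (- h) x))\<^sup>2) - 2 * of_real ((cmod (D 0 0 x))\<^sup>2))"
  proof
    fix x
    have r: "(1 / 2) * (Re ((p + m - 2 * f) * cnj (p + m + 2 * f)) + (cmod (p - m))\<^sup>2) = (cmod p)\<^sup>2 + (cmod m)\<^sup>2 - 2 * (cmod f)\<^sup>2" for p m f :: complex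
      unfolding cmod_power2 by (simp add: power2_eq_square algebra_simps)
    have "complex_of_real ((1 / 2) * (Re ((D 0 h x + D 0 (- h) x - 2 * D 0 0 x) * cnj (D 0 h x + D 0 (- h) x + 2 * D 0 0 x)) + (cmod (D 0 h x - D 0 (- h) x))\<^sup>2))
      = of_real ((cmod (D 0 h x))\<^sup>2 + (cmod (D 0 (- h) x))\<^sup>2 - 2 * (cmod (D 0 0 x))\<^sup>2)"
      unfolding r ..
    then show "(1 / 2) * (of_real (Re ((D 0 h x + D 0 (- h) x - 2 * D 0 0 x) * cnj (D 0 h x + D 0 (- h) x + 2 * D 0 0 x))) + of_real ((cmod (D 0 h x - D 0 (- h) x))\<^sup>2))
     = complex_of_real ((cmod (D 0 h x))\<^sup>2) + of_real ((cmod (D 0 (- h) x))\<^sup>2) - 2 * of_real ((cmod (D 0 0 x))\<^sup>2)"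
      by (simp only: of_real_mult of_real_add of_real_diff of_real_divide of_real_numeral of_real_1)
  qed
  moreover have "cmod (1 / 2) * (K * (M * h\<^sup>2) * (M + M + cmod 2 * M) + K * (2 * h * M) * (2 * h * M)) = 4 * K * M * M * h\<^sup>2"
    by (simp add: norm_divide power2_eq_square algebra_simps)
  ultimately show ?thesis by (simp only:)
qed

text \<open>\<open>exact_state\<close> with the smooth derivative \<open>D 1\<close> in place of the
  selected \<open>sobolev_deriv\<close>; the two agree almost everywhere.\<close>

definition curve_state :: "real \<Rightarrow> real \<Rightarrow> 'a state" where
  "curve_state dt t = ((\<lambda>x. of_real ((cmod (D 0 (t - dt / 2) x))\<^sup>2)), (\<lambda>x. of_real ((cmod (D 0 (t + dt / 2) x))\<^sup>2)),
     D 0 (t - dt), D 0 t, D 0 (t + dt), D 1 (t - dt / 2), D 1 (t + dt / 2))"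

lemma curve_state_bd:
  assumes "0 < dt" "a \<le> t - dt" "t + dt \<le> b" "u \<in> set (components (curve_state dt t))"
  shows "sobolev_bd \<sigma> u (M + K * M * M)"
proof -
  have mem: "t - dt / 2 \<in> {a..b}" "t + dt / 2 \<in> {a..b}" "t - dt \<in> {a..b}" "t \<in> {a..b}" "t + dt \<in> {a..b}"
    using assms by auto
  have M: "0 \<le> M" "0 \<le> K * M * M" using M_nonneg[OF mem(1)] K_pos by simp_all
  have b: "sobolev_bd \<sigma> (D k r) (M + K * M * M)" if "r \<in> {a..b}" "k \<le> 3" for k r
    by (rule sobolev_bd_mono[OF D_bd'[OF that]]) (use M in simp)
  have b2: "sobolev_bd \<sigma> (\<lambda>x. of_real ((cmod (D 0 r x))\<^sup>2)) (M + K * M * M)" if "r \<in> {a..b}" for r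
    by (rule sobolev_bd_mono[OF bd_abs2[OF D_bd'[OF that]]]) (use M in simp_all)
  show ?thesis
    using assms(4) b[OF mem(1), of 1] b[OF mem(2), of 1] b[OF mem(3), of 0] b[OF mem(4), of 0] b[OF mem(5), of 0] b2[OF mem(1)] b2[OF mem(2)]
    unfolding curve_state_def components_def by auto
qed

text \<open>Large enough for the bound of each of the seven initial components. The term with the
  extra factor K M^2 comes from the second difference of the density, which enters the forward
  Cayley step.\<close>

definition init_const where
  "init_const = 1 + K * M * M + 2 * \<bar>\<beta>\<bar> * K * M + 2 * \<bar>\<beta>\<bar> * K * M * (K * M * M) + 2 * C5 + M"

text \<open>Both neighbours of the initial value are governed by \<open>cayley_error\<close>,
  backward with the given density and forward with its reflection in |\<phi>_0|^2; R + 2 K M^2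
  bounds both potentials, so one smallness condition suffices.\<close>

lemma initial_error:
  assumes dt: "0 < dt" "dt \<le> 1" "a \<le> - dt" "dt \<le> b"
    and \<phi>0: "ae_eq (D 0 0) \<phi>0" "\<phi>0 \<in> sobolev \<rho>" and \<sigma>2: "2 \<le> \<sigma>"
    and Y: "sobolev_bd \<sigma> Y R" and small: "dt * (\<bar>\<beta>\<bar> * K * (R + 2 * K * M * M)) \<le> 1"
    and \<eta>: "sobolev_bd \<sigma> (\<lambda>x. Y x - of_real ((cmod (D 0 (- dt / 2) x))\<^sup>2)) \<eta>"
    and X: "X \<in> state_sobolev \<sigma>" "state_ae_eq X (initial_state \<beta> dt \<phi>0 Y)"
    and z: "z \<in> set (components (X - curve_state dt 0))"
  shows "sobolev_bd \<sigma> z (init_const * (\<eta> + dt\<^sup>2))"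
proof -
  have mem: "0 \<in> {a..b}" "dt \<in> {a..b}" "- dt \<in> {a..b}" using dt by auto
  have memh: "dt / 2 \<in> {a..b}" "- dt / 2 \<in> {a..b}" using dt by auto
  note M = M_nonneg[OF mem(1)]
  note \<eta>0 = sobolev_bd_nonneg[OF \<eta>] and R0 = sobolev_bd_nonneg[OF Y]
  have KM: "0 \<le> K * M * M" using M K_pos by simp
  have C5: "0 \<le> C5" unfolding C5_def using M K_pos by simp
  have \<phi>m: "\<phi>0 \<in> borel_measurable borel" by (rule sobolev_measurable[OF \<phi>0(2)])
  have \<phi>s: "\<phi>0 \<in> sobolev (\<sigma> + 2)" by (rule sobolev_mono(1)[OF \<phi>0(2) \<rho>])
  have \<phi>bd: "sobolev_bd \<sigma> \<phi>0 M" by (rule sobolev_bd_cong[OF D_bd'[OF mem(1), of 0] \<phi>0(1) \<phi>m]) simp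
  define Y' where "Y' = (\<lambda>x. 2 * of_real ((cmod (\<phi>0 x))\<^sup>2) - Y x)"
  define \<phi>n where "\<phi>n = cayley \<beta> Y (- dt) \<phi>0"
  define \<phi>p where "\<phi>p = cayley \<beta> Y' dt \<phi>0"
  have Y'b: "sobolev_bd \<sigma> Y' (R + 2 * K * M * M)"
    unfolding Y'_def by (rule sobolev_bd_mono[OF sobolev_bd_diff[OF sobolev_bd_cmult[OF bd_abs2[OF \<phi>bd]] Y]]) simp
  have Yb: "sobolev_bd \<sigma> Y (R + 2 * K * M * M)" by (rule sobolev_bd_mono[OF Y]) (use KM in simp)
  have sm: "\<bar>c * \<beta>\<bar> * K * sobolev_norm \<sigma> V \<le> 1" "\<bar>c\<bar> * (\<bar>\<beta>\<bar> * K * (R + 2 * K * M * M)) \<le> 1"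
    if "\<bar>c\<bar> = dt" "sobolev_bd \<sigma> V (R + 2 * K * M * M)" for c V
  proof -
    have "\<bar>c * \<beta>\<bar> * K * sobolev_norm \<sigma> V \<le> \<bar>c * \<beta>\<bar> * K * (R + 2 * K * M * M)"
      using K_pos sobolev_bdD(2)[OF that(2)] by (intro mult_left_mono) auto
    also have "\<dots> = dt * (\<bar>\<beta>\<bar> * K * (R + 2 * K * M * M))" using that(1) by (simp add: abs_mult)
    finally show "\<bar>c * \<beta>\<bar> * K * sobolev_norm \<sigma> V \<le> 1" using small by simp
    show "\<bar>c\<bar> * (\<bar>\<beta>\<bar> * K * (R + 2 * K * M * M)) \<le> 1" using small that(1) by simp
  qed
  have cay: "cayley \<beta> V c \<phi>0 \<in> sobolev 2 \<and>
     ae_eq (\<lambda>x. 2 * cayley \<beta> V c \<phi>0 x + \<i> * of_real c * hamiltonian \<beta> V (cayley \<beta> V c \<phi>0) x)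
           (\<lambda>x. 2 * \<phi>0 x - \<i> * of_real c * hamiltonian \<beta> V \<phi>0 x)"
    if "\<bar>c\<bar> = dt" "sobolev_bd \<sigma> V (R + 2 * K * M * M)" for c V
    unfolding cayley_def
    by (rule someI_ex[where P="\<lambda>w. w \<in> sobolev 2 \<and> ae_eq (\<lambda>x. 2 * w x + \<i> * of_real c * hamiltonian \<beta> V w x)
           (\<lambda>x. 2 * \<phi>0 x - \<i> * of_real c * hamiltonian \<beta> V \<phi>0 x)"],
        rule cayley_exists[OF alg order sobolev_bdD(1)[OF that(2)] \<phi>s _ sm(1)[OF that]])
       (use that(1) dt(1) in auto)
  note cn = cay[of "- dt" Y, folded \<phi>n_def, OF _ Yb] and cp = cay[of dt Y', folded \<phi>p_def, OF _ Y'b]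
  have an: "\<bar>- dt\<bar> = dt" and ap: "\<bar>dt\<bar> = dt" using dt(1) by auto
  obtain x1 x2 x3 x4 x5 x6 x7 where Xe: "X = (x1, x2, x3, x4, x5, x6, x7)" by (cases X) auto
  have xs: "x1 \<in> sobolev \<sigma>" "x2 \<in> sobolev \<sigma>" "x3 \<in> sobolev \<sigma>" "x4 \<in> sobolev \<sigma>" "x5 \<in> sobolev \<sigma>" "x6 \<in> sobolev \<sigma>" "x7 \<in> sobolev \<sigma>"
    using X(1) by (simp_all add: Xe state_sobolev_def components_def)
  have xe: "ae_eq x1 Y" "ae_eq x2 Y'" "ae_eq x3 \<phi>n" "ae_eq x4 \<phi>0" "ae_eq x5 \<phi>p"
    "ae_eq x6 (\<lambda>x. (\<phi>0 x - \<phi>n x) / of_real dt)" "ae_eq x7 (\<lambda>x. (\<phi>p x - \<phi>0 x) / of_real dt)"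
    using X(2) by (simp_all add: Xe state_ae_eq_def components_def initial_state_def Let_def Y'_def[symmetric] \<phi>n_def[symmetric] \<phi>p_def[symmetric] del: of_real_power)
  have n2: "\<phi>n \<in> sobolev 2" "\<phi>p \<in> sobolev 2" using cn cp an ap by simp_all
  \<comment> \<open>A Cayley transform is known a priori only in the space of order 2; order
    \<sigma> is inherited from the components of X, which agree with it almost everywhere.\<close>
  have ns: "\<phi>n \<in> sobolev \<sigma>" "\<phi>p \<in> sobolev \<sigma>"
    using sobolev_cong_ae(1)[OF xs(3) xe(3) sobolev_measurable[OF n2(1)]] sobolev_cong_ae(1)[OF xs(5) xe(5) sobolev_measurable[OF n2(2)]] .
  have \<eta>': "sobolev_bd \<sigma> (\<lambda>x. Y' x - of_real ((cmod (D 0 (dt / 2) x))\<^sup>2)) (\<eta> + K * M * M * dt\<^sup>2)"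
  proof -
    have h: "dt / 2 > 0" "a \<le> - (dt / 2)" "dt / 2 \<le> b" using dt by auto
    have "sobolev_bd \<sigma> (\<lambda>x. - 1 * (Y x - of_real ((cmod (D 0 (- dt / 2) x))\<^sup>2)) - (of_real ((cmod (D 0 (dt / 2) x))\<^sup>2) + of_real ((cmod (D 0 (- (dt / 2)) x))\<^sup>2) - 2 * of_real ((cmod (D 0 0 x))\<^sup>2)))
       (cmod (- 1) * \<eta> + 4 * K * M * M * (dt / 2)\<^sup>2)"
      by (intro sobolev_bd_diff sobolev_bd_cmult \<eta> density_second_difference h)
    then have b: "sobolev_bd \<sigma> (\<lambda>x. - 1 * (Y x - of_real ((cmod (D 0 (- dt / 2) x))\<^sup>2)) - (of_real ((cmod (D 0 (dt / 2) x))\<^sup>2) + of_real ((cmod (D 0 (- (dt / 2)) x))\<^sup>2) - 2 * of_real ((cmod (D 0 0 x))\<^sup>2)))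
       (\<eta> + K * M * M * dt\<^sup>2)" by (rule sobolev_bd_mono) (simp add: power_divide)
    show ?thesis
    proof (rule sobolev_bd_cong[OF b])
      show "ae_eq (\<lambda>x. - 1 * (Y x - of_real ((cmod (D 0 (- dt / 2) x))\<^sup>2)) - (of_real ((cmod (D 0 (dt / 2) x))\<^sup>2) + of_real ((cmod (D 0 (- (dt / 2)) x))\<^sup>2) - 2 * of_real ((cmod (D 0 0 x))\<^sup>2)))
        (\<lambda>x. Y' x - of_real ((cmod (D 0 (dt / 2) x))\<^sup>2))"
        using \<phi>0(1) unfolding ae_eq_def Y'_def by eventually_elim (simp del: of_real_power)
      show "(\<lambda>x. Y' x - of_real ((cmod (D 0 (dt / 2) x))\<^sup>2)) \<in> borel_measurable borel"
        by (rule sobolev_measurable[OF sobolev_diff(1)[OF sobolev_bdD(1)[OF Y'b] sobolev_bdD(1)[OF bd_abs2[OF D_bd'[OF memh(1), of 0]]]]]) simp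
    qed
  qed
  define B where "B = init_const * (\<eta> + dt\<^sup>2)"
  \<comment> \<open>Error of the density at 1/2: that at -1/2 plus the second difference.\<close>
  define e2 where "e2 = \<eta> + K * M * M * dt\<^sup>2"
  have e2: "\<eta> \<le> e2" using KM by (simp add: e2_def)
  have bM: "0 \<le> \<bar>\<beta>\<bar> * K * M" using M K_pos by simp
  have pos: "0 \<le> dt\<^sup>2" "0 \<le> \<eta>" "0 \<le> K * M * M * dt\<^sup>2" "0 \<le> \<bar>\<beta>\<bar> * K * M * \<eta>" "0 \<le> \<bar>\<beta>\<bar> * K * M * dt\<^sup>2"
    "0 \<le> \<bar>\<beta>\<bar> * K * M * (K * M * M) * \<eta>" "0 \<le> \<bar>\<beta>\<bar> * K * M * (K * M * M) * dt\<^sup>2" "0 \<le> C5 * \<eta>" "0 \<le> C5 * dt\<^sup>2" "0 \<le> M * \<eta>" "0 \<le> M * dt\<^sup>2" "0 \<le> K * M * M * \<eta>"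
    using \<eta>0 KM bM C5 M by simp_all
  have B: "\<eta> \<le> B" "e2 \<le> B" "2 * (\<bar>\<beta>\<bar> * K * M * e2) + (2 * C5 + M) * dt\<^sup>2 \<le> B"
    using pos unfolding B_def e2_def init_const_def by (simp_all add: algebra_simps)
  have B': "2 * (\<bar>\<beta>\<bar> * K * M * e2) + 2 * C5 * dt\<^sup>2 \<le> B" using B(3) pos by (simp add: algebra_simps)
  \<comment> \<open>Uniform in e \<le> e2, so that one statement serves the backward step with
    \<eta> and the forward step with e2.\<close>
  have Bc: "dt * (2 * (\<bar>\<beta>\<bar> * K * M * e) + 2 * C5 * dt\<^sup>2) \<le> B" "2 * (\<bar>\<beta>\<bar> * K * M * e) + (2 * C5 + M) * dt\<^sup>2 \<le> B" if "0 \<le> e" "e \<le> e2" for e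
  proof -
    have l: "\<bar>\<beta>\<bar> * K * M * e \<le> \<bar>\<beta>\<bar> * K * M * e2" using bM that by (intro mult_left_mono) auto
    have "dt * (2 * (\<bar>\<beta>\<bar> * K * M * e) + 2 * C5 * dt\<^sup>2) \<le> 1 * (2 * (\<bar>\<beta>\<bar> * K * M * e) + 2 * C5 * dt\<^sup>2)"
      using dt bM that C5 K_pos M by (intro mult_right_mono add_nonneg_nonneg mult_nonneg_nonneg) auto
    also have "\<dots> \<le> B" using l B' by simp
    finally show "dt * (2 * (\<bar>\<beta>\<bar> * K * M * e) + 2 * C5 * dt\<^sup>2) \<le> B" .
    show "2 * (\<bar>\<beta>\<bar> * K * M * e) + (2 * C5 + M) * dt\<^sup>2 \<le> B" using l B(3) by simp
  qed
  have E2: "0 \<le> e2" using e2 \<eta>0 by simp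
  have \<eta>'': "sobolev_bd \<sigma> (\<lambda>x. Y' x - of_real ((cmod (D 0 (dt / 2) x))\<^sup>2)) e2" using \<eta>' unfolding e2_def .
  have cn1: "- dt \<noteq> 0" "a \<le> - \<bar>- dt\<bar>" "\<bar>- dt\<bar> \<le> b" and cp1: "dt \<noteq> 0" "a \<le> - \<bar>dt\<bar>" "\<bar>dt\<bar> \<le> b" using dt by auto
  note ce_n = cayley_error[OF cn1 ns(1) n2(1) \<phi>0(1) \<phi>m conjunct2[OF cn[OF an]] Yb \<eta> sm(2)[OF an Yb]]
  note ce_p = cayley_error[OF cp1 ns(2) n2(2) \<phi>0(1) \<phi>m conjunct2[OF cp[OF ap]] Y'b \<eta>'' sm(2)[OF ap Y'b]]
  have k3: "sobolev_bd \<sigma> (\<lambda>x. \<phi>n x - D 0 (- dt) x) B"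
    by (rule sobolev_bd_mono[OF ce_n(1)]) (use Bc(1)[OF \<eta>0 e2] dt(1) in simp)
  have k5: "sobolev_bd \<sigma> (\<lambda>x. \<phi>p x - D 0 dt x) B"
    by (rule sobolev_bd_mono[OF ce_p(1)]) (use Bc(1)[OF E2 order_refl] dt(1) in simp)
  have k6: "sobolev_bd \<sigma> (\<lambda>x. (\<phi>0 x - \<phi>n x) / of_real dt - D 1 (- dt / 2) x) B"
  proof -
    have "(\<lambda>x. (\<phi>n x - \<phi>0 x) / of_real (- dt) - D 1 (- dt / 2) x) = (\<lambda>x. (\<phi>0 x - \<phi>n x) / of_real dt - D 1 (- dt / 2) x)"
      by (auto simp: diff_divide_distrib)
    then show ?thesis using sobolev_bd_mono[OF ce_n(2), of B] Bc(2)[OF \<eta>0 e2] by simp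
  qed
  have k7: "sobolev_bd \<sigma> (\<lambda>x. (\<phi>p x - \<phi>0 x) / of_real dt - D 1 (dt / 2) x) B"
    by (rule sobolev_bd_mono[OF ce_p(2)]) (rule Bc(2)[OF E2 order_refl])
  have k4: "sobolev_bd \<sigma> (\<lambda>x. \<phi>0 x - D 0 0 x) B"
  proof -
    have "ae_eq (\<lambda>x. 0) (\<lambda>x. \<phi>0 x - D 0 0 x)" using \<phi>0(1) by (auto simp: ae_eq_def)
    moreover have "(\<lambda>x. \<phi>0 x - D 0 0 x) \<in> borel_measurable borel"
      by (intro borel_measurable_diff \<phi>m sobolev_measurable[OF D_sobolev[OF mem(1)]])
    ultimately show ?thesis
      using sobolev_bd_cong[of \<sigma> "\<lambda>x. 0" B] B(1) \<eta>0 by (simp add: sobolev_bd_def)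
  qed
  have cong: "sobolev_bd \<sigma> (\<lambda>x. x' x - d x) B"
    if "sobolev_bd \<sigma> (\<lambda>x. u x - d x) B" "ae_eq x' u" "x' \<in> sobolev \<sigma>" "d \<in> borel_measurable borel" for u x' d
    by (rule sobolev_bd_cong[OF that(1)])
       (use that(2) in \<open>auto simp: ae_eq_def intro!: borel_measurable_diff sobolev_measurable[OF that(3)] that(4)\<close>)
  note Dm = sobolev_measurable[OF D_sobolev]
  have D2m: "(\<lambda>x. complex_of_real ((cmod (D 0 t x))\<^sup>2)) \<in> borel_measurable borel" if "t \<in> {a..b}" for t
    by (rule sobolev_measurable[OF sobolev_bdD(1)[OF bd_abs2[OF D_bd'[OF that, of 0]]]]) simp
  have "X - curve_state dt 0 = (\<lambda>x. x1 x - of_real ((cmod (D 0 (- dt / 2) x))\<^sup>2), \<lambda>x. x2 x - of_real ((cmod (D 0 (dt / 2) x))\<^sup>2),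
      \<lambda>x. x3 x - D 0 (- dt) x, \<lambda>x. x4 x - D 0 0 x, \<lambda>x. x5 x - D 0 dt x, \<lambda>x. x6 x - D 1 (- dt / 2) x, \<lambda>x. x7 x - D 1 (dt / 2) x)"
    by (simp add: Xe curve_state_def fun_diff_def)
  moreover have "sobolev_bd \<sigma> (\<lambda>x. x1 x - of_real ((cmod (D 0 (- dt / 2) x))\<^sup>2)) B"
    by (rule cong[OF sobolev_bd_mono[OF \<eta> B(1)] xe(1) xs(1) D2m[OF memh(2)]])
  moreover have "sobolev_bd \<sigma> (\<lambda>x. x2 x - of_real ((cmod (D 0 (dt / 2) x))\<^sup>2)) B"
    by (rule cong[OF sobolev_bd_mono[OF \<eta>'' B(2)] xe(2) xs(2) D2m[OF memh(1)]])
  moreover note cong[OF k3 xe(3) xs(3) Dm[OF mem(3)]] cong[OF k4 xe(4) xs(4) Dm[OF mem(1)]] cong[OF k5 xe(5) xs(5) Dm[OF mem(2)]]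
    cong[OF k6 xe(6) xs(6) Dm[OF memh(2)]] cong[OF k7 xe(7) xs(7) Dm[OF memh(1)]]
  ultimately show ?thesis using z unfolding B_def[symmetric] components_def by auto
qed

text \<open>The residuals are centred differently: density and velocity at t + dt/2, the
  Crank-Nicolson step at t + 3 dt/2. The velocity residual reaches from t - dt to t + 2 dt, which
  fixes the required interval.\<close>

lemma curve_step:
  assumes dt: "0 < dt" "a \<le> t - dt" "t + 2 * dt \<le> b"
  shows "\<exists>r2 r5 r7. sobolev_bd \<sigma> r2 ((C2 + C5 + C7) * dt\<^sup>2) \<and> sobolev_bd \<sigma> r5 ((C2 + C5 + C7) * dt\<^sup>2) \<and>
    sobolev_bd \<sigma> r7 ((C2 + C5 + C7) * dt\<^sup>2) \<and> perturbed_step \<beta> dt (curve_state dt t) (curve_state dt (t + dt)) r2 r5 r7"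
proof -
  have mem: "t \<in> {a..b}" using dt by auto
  note M = M_nonneg[OF mem]
  have C: "0 \<le> C2" "0 \<le> C5" unfolding C2_def C5_def using M K_pos by simp_all
  then have C7: "0 \<le> C7" unfolding C7_def using M K_pos by simp
  have le: "C2 * dt\<^sup>2 \<le> (C2 + C5 + C7) * dt\<^sup>2" "C5 * (dt / 2)\<^sup>2 \<le> (C2 + C5 + C7) * dt\<^sup>2" "C7 * dt\<^sup>2 \<le> (C2 + C5 + C7) * dt\<^sup>2"
  proof -
    have "(dt / 2)\<^sup>2 \<le> dt\<^sup>2" by (simp add: power_divide)
    then have "C5 * (dt / 2)\<^sup>2 \<le> C5 * dt\<^sup>2" using C by (intro mult_left_mono) auto
    also have "\<dots> \<le> (C2 + C5 + C7) * dt\<^sup>2" using C C7 by (intro mult_right_mono) auto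
    finally show "C5 * (dt / 2)\<^sup>2 \<le> (C2 + C5 + C7) * dt\<^sup>2" .
  qed (use C C7 in \<open>intro mult_right_mono; simp\<close>)+
  have h2: "dt > 0" "a \<le> (t + dt / 2) - dt" "(t + dt / 2) + dt \<le> b" using dt by auto
  have h5: "dt / 2 > 0" "a \<le> (t + dt + dt / 2) - dt / 2" "(t + dt + dt / 2) + dt / 2 \<le> b" using dt by auto
  have h7: "dt > 0" "a \<le> (t + dt / 2) - 3 * dt / 2" "(t + dt / 2) + 3 * dt / 2 \<le> b" using dt by auto
  \<comment> \<open>The time arguments are normalised so that the consistency statements match the
    entries of the two states literally.\<close>
  have a2: "(t + dt / 2) + dt = t + dt + dt / 2" "(t + dt / 2) - dt = t - dt / 2" "(t + dt / 2) + dt / 2 = t + dt" "(t + dt / 2) - dt / 2 = t"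
    by (simp_all add: field_simps)
  have a5: "(t + dt + dt / 2) + dt / 2 = t + dt + dt" "(t + dt + dt / 2) - dt / 2 = t + dt" "2 * (dt / 2) = dt"
    by (simp_all add: field_simps)
  have a7: "(t + dt / 2) + 3 * dt / 2 = t + dt + dt" "(t + dt / 2) - 3 * dt / 2 = t - dt"
    by (simp_all add: field_simps)
  have a1: "t + dt - dt / 2 = t + dt / 2" "t + dt - dt = t" by (simp_all add: field_simps)
  obtain r2 where r2: "sobolev_bd \<sigma> r2 (C2 * dt\<^sup>2)" and e2: "\<And>x. of_real ((cmod (D 0 (t + dt + dt / 2) x))\<^sup>2) = of_real ((cmod (D 0 (t - dt / 2) x))\<^sup>2) + of_real dt *
       (2 * of_real (2 * Re (D 1 (t + dt / 2) x * cnj ((D 0 (t + dt) x + D 0 t x) / 2))) + r2 x)"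
    using density_consistency[OF h2, unfolded a2] by blast
  obtain r5 where r5: "sobolev_bd \<sigma> r5 (C5 * (dt / 2)\<^sup>2)" and e5: "ae_eq (crank dt (D 0 (t + dt + dt))) (\<lambda>x. crank (- dt) (D 0 (t + dt)) x + of_real dt *
       (of_real \<beta> * (of_real ((cmod (D 0 (t + dt + dt / 2) x))\<^sup>2) * ((D 0 (t + dt + dt) x + D 0 (t + dt) x) / 2)) + r5 x))"
    using midpoint_consistency[OF h5, unfolded a5] by blast
  obtain r7 where r7: "sobolev_bd \<sigma> r7 (C7 * dt\<^sup>2)" and e7: "ae_eq (crank dt (D 1 (t + dt + dt / 2))) (\<lambda>x. crank (- dt) (D 1 (t - dt / 2)) x + crank (- dt) (D 1 (t + dt / 2)) x - crank dt (D 1 (t + dt / 2)) x + of_real dt *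
      (2 * of_real \<beta> * ((of_real ((cmod (D 0 (t + dt + dt / 2) x))\<^sup>2) + of_real ((cmod (D 0 (t - dt / 2) x))\<^sup>2)) / 2 * ((D 1 (t + dt + dt / 2) x + 2 * D 1 (t + dt / 2) x + D 1 (t - dt / 2) x) / 4)
        + of_real (2 * Re (D 1 (t + dt / 2) x * cnj ((D 0 (t + dt) x + D 0 t x) / 2)))
          * ((D 0 (t + dt + dt) x + D 0 (t + dt) x + D 0 t x + D 0 (t - dt) x) / 4)) + r7 x))"
    using velocity_consistency[OF h7, unfolded a2 a7] by blast
  have "perturbed_step \<beta> dt (curve_state dt t) (curve_state dt (t + dt)) r2 r5 r7"
    unfolding perturbed_step_def curve_state_def prod.case velocity_force_def density_rate_def a1
    using e5 e7 by (intro conjI ae_eq_refl) (simp_all only: e2 ae_eq_refl)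
  then show ?thesis
    using sobolev_bd_mono[OF r2 le(1)] sobolev_bd_mono[OF r5 le(2)] sobolev_bd_mono[OF r7 le(3)] by blast
qed

end

subsection \<open>The numerical solution\<close>

text \<open>\<open>calC\<close> also acts on the zero entries of \<open>calM\<close>, and a
  multiplier applied to 0 is merely a selected representative of 0.\<close>

lemma opB_zero: "ae_eq (opB c (\<lambda>x::'a::euclidean_space. 0)) (\<lambda>x. 0)"
proof (rule sobolev_norm_eq_0)
  show "opB c (\<lambda>x::'a. 0) \<in> sobolev 0" by (rule opB_sobolev(1)[OF sobolev_zero(1)]) simp
  have "sobolev_norm 0 (opB c (\<lambda>x::'a. 0)) \<le> sobolev_norm 0 (\<lambda>x::'a. 0)"
    by (rule opB_sobolev(2)[OF sobolev_zero(1)]) simp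
  then show "sobolev_norm 0 (opB c (\<lambda>x::'a. 0)) = 0"
    using sobolev_norm_nonneg[of 0 "opB c (\<lambda>x::'a. 0)"] by simp
qed

text \<open>Applying \<open>crank dt\<close> cancels \<open>opB dt\<close>; p stands for the terms
  built from \<open>opA dt\<close>, which \<open>crank_opA\<close> clears afterwards.\<close>

lemma crank_opA_opB:
  assumes y: "y \<in> sobolev 2" and p: "p \<in> sobolev 2" and q: "q \<in> sobolev \<sigma>" and "0 \<le> \<sigma>" and dt: "dt \<noteq> 0"
    and eq: "ae_eq y (\<lambda>x. p x + of_real dt * opB dt q x)"
  shows "ae_eq (crank dt y) (\<lambda>x. crank dt p x + of_real dt * q x)"
proof -
  have B: "opB dt q \<in> sobolev 2"
    using sobolev_mono(1)[OF opB_sobolev_gain[OF q \<open>0 \<le> \<sigma>\<close> dt], of 2] \<open>0 \<le> \<sigma>\<close> by simp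
  have q0: "q \<in> sobolev 0" by (rule sobolev_mono(1)[OF q \<open>0 \<le> \<sigma>\<close>])
  note dB = sobolev_cmult(1)[OF B, of "of_real dt"]
  show ?thesis
    using crank_cong[OF y eq sobolev_measurable[OF sobolev_add(1)[OF p dB]], of dt] crank_add[OF p dB, of dt]
      crank_cmult[OF B, of dt "of_real dt"] crank_opB[OF q0 dt]
    unfolding ae_eq_def by eventually_elim simp
qed

text \<open>The inverse operators are cleared row by row. In the last row the block A - I becomes
  \<open>crank (- dt)\<close> minus \<open>crank dt\<close>, acting on x7.\<close>

lemma (in sobolev_alg) numerical_step:
  fixes X Y :: "'a state"
  assumes X: "X \<in> state_sobolev (\<sigma> + 2)" and Y: "Y \<in> state_sobolev (\<sigma> + 2)" and dt: "dt \<noteq> 0"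
    and eq: "state_ae_eq Y (calB dt X + scale_state dt (calC dt (calM \<beta> X Y)))"
  shows "perturbed_step \<beta> dt X Y (\<lambda>x. 0) (\<lambda>x. 0) (\<lambda>x. 0)"
proof -
  obtain x1 x2 x3 x4 x5 x6 x7 where Xe: "X = (x1, x2, x3, x4, x5, x6, x7)" by (cases X) auto
  obtain y1 y2 y3 y4 y5 y6 y7 where Ye: "Y = (y1, y2, y3, y4, y5, y6, y7)" by (cases Y) auto
  have xs: "x1 \<in> sobolev (\<sigma> + 2)" "x2 \<in> sobolev (\<sigma> + 2)" "x3 \<in> sobolev (\<sigma> + 2)" "x4 \<in> sobolev (\<sigma> + 2)" "x5 \<in> sobolev (\<sigma> + 2)" "x6 \<in> sobolev (\<sigma> + 2)" "x7 \<in> sobolev (\<sigma> + 2)"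
    using X by (simp_all add: Xe state_sobolev_def components_def)
  have ys: "y1 \<in> sobolev (\<sigma> + 2)" "y2 \<in> sobolev (\<sigma> + 2)" "y3 \<in> sobolev (\<sigma> + 2)" "y4 \<in> sobolev (\<sigma> + 2)" "y5 \<in> sobolev (\<sigma> + 2)" "y6 \<in> sobolev (\<sigma> + 2)" "y7 \<in> sobolev (\<sigma> + 2)"
    using Y by (simp_all add: Ye state_sobolev_def components_def)
  have lo: "\<And>u::'a \<Rightarrow> complex. u \<in> sobolev (\<sigma> + 2) \<Longrightarrow> u \<in> sobolev \<sigma>" "\<And>u::'a \<Rightarrow> complex. u \<in> sobolev (\<sigma> + 2) \<Longrightarrow> u \<in> sobolev 2"
    by (erule sobolev_mono(1), use order in simp)+
  have bd: "sobolev_bd \<sigma> u (sobolev_norm \<sigma> u)" if "u \<in> sobolev (\<sigma> + 2)" for u :: "'a \<Rightarrow> complex"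
    by (rule sobolev_bd_self[OF lo(1)[OF that]])
  let ?W = "velocity_force X Y"
  let ?\<Phi> = "\<lambda>x. y2 x * ((y5 x + y4 x) / 2)"
  have half: "(\<lambda>x. (u x + v x) / 2) \<in> sobolev \<sigma>" if "u \<in> sobolev (\<sigma> + 2)" "v \<in> sobolev (\<sigma> + 2)" for u v :: "'a \<Rightarrow> complex"
    using sobolev_cmult(1)[OF sobolev_add(1)[OF lo(1)[OF that(1)] lo(1)[OF that(2)]], of "1/2"] by simp
  have \<Phi>: "(\<lambda>x. of_real \<beta> * ?\<Phi> x) \<in> sobolev \<sigma>"
    by (intro sobolev_cmult(1) conjunct1[OF alg] lo ys half)
  have dr: "density_rate x4 x5 x7 \<in> sobolev \<sigma>"
  proof -
    define G where "G = max (sobolev_norm \<sigma> x4) (max (sobolev_norm \<sigma> x5) (sobolev_norm \<sigma> x7))"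
    show ?thesis
      by (rule sobolev_bdD(1)[OF bd_density_rate[of _ G]]; rule sobolev_bd_mono[OF bd])
         (use xs in \<open>simp_all add: G_def\<close>)
  qed
  have q3: "(\<lambda>x. (y7 x + 2 * x7 x + x6 x) / 4) \<in> sobolev \<sigma>"
    using sobolev_cmult(1)[OF sobolev_add(1)[OF sobolev_add(1)[OF lo(1)[OF ys(7)] sobolev_cmult(1)[OF lo(1)[OF xs(7)], of 2]] lo(1)[OF xs(6)]], of "1/4"] by simp
  have q4: "(\<lambda>x. (y5 x + x5 x + x4 x + x3 x) / 4) \<in> sobolev \<sigma>"
    using sobolev_cmult(1)[OF sobolev_add(1)[OF sobolev_add(1)[OF sobolev_add(1)[OF lo(1)[OF ys(5)] lo(1)[OF xs(5)]] lo(1)[OF xs(4)]] lo(1)[OF xs(3)]], of "1/4"] by simp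
  have W: "(\<lambda>x. 2 * of_real \<beta> * ?W x) \<in> sobolev \<sigma>"
    unfolding velocity_force_def Xe Ye prod.case
    by (intro sobolev_cmult(1) sobolev_add(1) conjunct1[OF alg] half q3 q4 dr xs ys)
  have M: "calM \<beta> X Y = ((\<lambda>x. 0), (\<lambda>x. 2 * density_rate x4 x5 x7 x), (\<lambda>x. 0), (\<lambda>x. 0), (\<lambda>x. of_real \<beta> * ?\<Phi> x), (\<lambda>x. 0), (\<lambda>x. 2 * of_real \<beta> * ?W x))"
    by (simp add: calM_def Xe Ye Let_def density_rate_def velocity_force_def)
  have E: "ae_eq y1 x2" "ae_eq y2 (\<lambda>x. x1 x + of_real dt * (2 * density_rate x4 x5 x7 x))"
    "ae_eq y3 (\<lambda>x. x4 x + of_real dt * opB dt (\<lambda>x. 0) x)" "ae_eq y4 (\<lambda>x. x5 x + of_real dt * opB dt (\<lambda>x. 0) x)"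
    "ae_eq y5 (\<lambda>x. opA dt x5 x + of_real dt * opB dt (\<lambda>x. of_real \<beta> * ?\<Phi> x) x)"
    "ae_eq y6 (\<lambda>x. x7 x + of_real dt * opB dt (\<lambda>x. 0) x)"
    "ae_eq y7 (\<lambda>x. opA dt x6 x + (opA dt x7 x - x7 x) + of_real dt * opB dt (\<lambda>x. 2 * of_real \<beta> * ?W x) x)"
    using eq unfolding M
    by (simp_all add: state_ae_eq_def components_def calB_def calC_def scale_state_def Xe Ye plus_fun_def velocity_force_def)
  have z: "ae_eq u v" if "ae_eq u (\<lambda>x. v x + of_real dt * opB dt (\<lambda>x. 0) x)" for u v :: "'a \<Rightarrow> complex"
    using that opB_zero[of dt] unfolding ae_eq_def by eventually_elim simp
  have A: "opA dt x5 \<in> sobolev 2" "opA dt x6 \<in> sobolev 2" "opA dt x7 \<in> sobolev 2"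
    by (intro opA_sobolev(1) lo xs; simp)+
  have "ae_eq (crank dt y5) (\<lambda>x. crank (- dt) x5 x + of_real dt * (of_real \<beta> * ?\<Phi> x + 0))"
    using crank_opA_opB[OF lo(2)[OF ys(5)] A(1) \<Phi> order dt E(5)] crank_opA[OF lo(2)[OF xs(5)], of dt]
    unfolding ae_eq_def by eventually_elim simp
  moreover have "ae_eq (crank dt y7) (\<lambda>x. crank (- dt) x6 x + crank (- dt) x7 x - crank dt x7 x + of_real dt * (2 * of_real \<beta> * ?W x + 0))"
    using crank_opA_opB[OF lo(2)[OF ys(7)] sobolev_add(1)[OF A(2) sobolev_diff(1)[OF A(3) lo(2)[OF xs(7)]]] W order dt E(7)]
      crank_add[OF A(2) sobolev_diff(1)[OF A(3) lo(2)[OF xs(7)]], of dt] crank_diff[OF A(3) lo(2)[OF xs(7)], of dt]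
      crank_opA[OF lo(2)[OF xs(6)], of dt] crank_opA[OF lo(2)[OF xs(7)], of dt]
    unfolding ae_eq_def
  proof eventually_elim
    case (elim x)
    show ?case unfolding elim by simp
  qed
  ultimately show ?thesis
    using E(1,2) z[OF E(3)] z[OF E(4)] z[OF E(6)] by (simp add: perturbed_step_def Xe Ye)
qed

text \<open>Two derivatives are lost here, since \<open>crank dt\<close> is bounded by 1 + dt \<le>
  2 only from order \<sigma> + 2. The constant 10 is 1 + 1 + 4 + 4, one number for each summand of
  \<open>err\<close>.\<close>

lemma err_le_components:
  assumes Z: "Z \<in> state_sobolev (\<sigma> + 2)" and "0 \<le> \<sigma>" and dt: "0 \<le> dt" "dt \<le> 1"
    and B: "\<And>z. z \<in> set (components Z) \<Longrightarrow> sobolev_norm (\<sigma> + 2) z \<le> B"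
  shows "err \<sigma> dt Z \<le> 10 * B"
proof -
  obtain z1 z2 z3 z4 z5 z6 z7 where Ze: "Z = (z1, z2, z3, z4, z5, z6, z7)" by (cases Z) auto
  have zs: "z1 \<in> sobolev (\<sigma> + 2)" "z2 \<in> sobolev (\<sigma> + 2)" "z3 \<in> sobolev (\<sigma> + 2)" "z4 \<in> sobolev (\<sigma> + 2)" "z5 \<in> sobolev (\<sigma> + 2)" "z6 \<in> sobolev (\<sigma> + 2)" "z7 \<in> sobolev (\<sigma> + 2)"
    using Z by (simp_all add: Ze state_sobolev_def components_def)
  have n: "sobolev_norm (\<sigma> + 2) z1 \<le> B" "sobolev_norm (\<sigma> + 2) z2 \<le> B" "sobolev_norm (\<sigma> + 2) z3 \<le> B" "sobolev_norm (\<sigma> + 2) z4 \<le> B" "sobolev_norm (\<sigma> + 2) z5 \<le> B" "sobolev_norm (\<sigma> + 2) z6 \<le> B" "sobolev_norm (\<sigma> + 2) z7 \<le> B"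
    by (intro B; simp add: Ze components_def)+
  have B0: "0 \<le> B" using n(1) sobolev_norm_nonneg[of "\<sigma> + 2" z1] by linarith
  have lo: "sobolev_norm \<sigma> z \<le> B" if "z \<in> sobolev (\<sigma> + 2)" "sobolev_norm (\<sigma> + 2) z \<le> B" for z
    using sobolev_mono(2)[OF that(1), of \<sigma>] that(2) by simp
  have cr: "sobolev_norm \<sigma> (crank c z) \<le> 2 * b" if "z \<in> sobolev (\<sigma> + 2)" "sobolev_norm (\<sigma> + 2) z \<le> b" "\<bar>c\<bar> = dt" for z b c
  proof -
    have "sobolev_norm \<sigma> (crank c z) \<le> (1 + \<bar>c\<bar>) * sobolev_norm (\<sigma> + 2) z"
      by (rule crank_sobolev(2)[OF that(1) \<open>0 \<le> \<sigma>\<close>])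
    also have "\<dots> \<le> 2 * b" using dt that by (intro mult_mono) auto
    finally show ?thesis .
  qed
  have "sobolev_norm (\<sigma> + 2) (\<lambda>x. z6 x + z7 x) \<le> 2 * B"
    using sobolev_add(2)[OF zs(6,7)] n by simp
  then have p: "sobolev_norm \<sigma> (crank dt (\<lambda>x. z6 x + z7 x)) \<le> 4 * B"
    using cr[OF sobolev_add(1)[OF zs(6,7)], of "2 * B" dt] dt by simp
  have "sobolev_norm \<sigma> (\<lambda>x. crank dt z7 x - crank (- dt) z6 x) \<le> sobolev_norm \<sigma> (crank dt z7) + sobolev_norm \<sigma> (crank (- dt) z6)"
    by (rule sobolev_diff(2)[OF crank_sobolev(1)[OF zs(7) \<open>0 \<le> \<sigma>\<close>] crank_sobolev(1)[OF zs(6) \<open>0 \<le> \<sigma>\<close>]])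
  then have q: "sobolev_norm \<sigma> (\<lambda>x. crank dt z7 x - crank (- dt) z6 x) \<le> 4 * B"
    using cr[OF zs(7) n(7), of dt] cr[OF zs(6) n(6), of "- dt"] dt by simp
  have "max (sobolev_norm \<sigma> z1) (sobolev_norm \<sigma> z2) \<le> B" "max (sobolev_norm \<sigma> z3) (max (sobolev_norm \<sigma> z4) (sobolev_norm \<sigma> z5)) \<le> B"
    using lo[OF zs(1) n(1)] lo[OF zs(2) n(2)] lo[OF zs(3) n(3)] lo[OF zs(4) n(4)] lo[OF zs(5) n(5)] by simp_all
  with p q show ?thesis unfolding Ze err_def prod.case by linarith
qed

text \<open>Adding \<delta> to e makes the recursion homogeneous. The implicit term is moved to the
  left, and A dt \<le> 1/2 keeps the resulting quotient below 1 + 4 A dt.\<close>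

lemma discrete_gronwall:
  fixes e :: "nat \<Rightarrow> real"
  assumes step: "\<And>k. k < n \<Longrightarrow> e (Suc k) \<le> e k + A * dt * (e k + e (Suc k) + \<delta>)"
    and nn: "\<And>k. k \<le> n \<Longrightarrow> 0 \<le> e k" and pos: "0 \<le> A" "0 \<le> dt" "0 \<le> \<delta>" "A * dt \<le> 1 / 2"
  shows "e n \<le> exp (4 * A * (real n * dt)) * (e 0 + \<delta>)"
proof -
  let ?x = "A * dt"
  have x: "0 \<le> ?x" using pos by simp
  have "k \<le> n \<Longrightarrow> e k + \<delta> \<le> (1 + 4 * ?x) ^ k * (e 0 + \<delta>)" for k
  proof (induction k)
    case (Suc k)
    let ?Z = "e k + \<delta>" and ?Z' = "e (Suc k) + \<delta>"
    have Z: "0 \<le> ?Z" using nn[of k] Suc.prems pos(3) by simp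
    have "?x * (e k + e (Suc k) + \<delta>) \<le> ?x * (?Z + ?Z')"
      using pos x by (intro mult_left_mono) auto
    then have "?Z' * (1 - ?x) \<le> ?Z * (1 + ?x)"
      using step[of k] Suc.prems by (simp add: algebra_simps)
    also have "\<dots> \<le> ?Z * ((1 + 4 * ?x) * (1 - ?x))"
    proof (rule mult_left_mono[OF _ Z])
      \<comment> \<open>The difference of the two sides of the claim is x (2 - 4 x), nonnegative for
        x between 0 and 1/2.\<close>
      have "0 \<le> ?x * (2 - 4 * ?x)" using pos x by (intro mult_nonneg_nonneg) auto
      then show "1 + ?x \<le> (1 + 4 * ?x) * (1 - ?x)" by (simp add: algebra_simps)
    qed
    finally have "?Z' * (1 - ?x) \<le> ?Z * (1 + 4 * ?x) * (1 - ?x)" by (simp add: mult.assoc)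
    then have "?Z' \<le> ?Z * (1 + 4 * ?x)" using pos by (simp add: mult_le_cancel_right)
    also have "\<dots> \<le> (1 + 4 * ?x) ^ k * (e 0 + \<delta>) * (1 + 4 * ?x)"
      using Suc x by (intro mult_right_mono) auto
    finally show ?case by (simp add: ac_simps)
  qed simp
  from this[of n] have "e n + \<delta> \<le> (1 + 4 * ?x) ^ n * (e 0 + \<delta>)" by simp
  also have "\<dots> \<le> exp (4 * A * (real n * dt)) * (e 0 + \<delta>)"
  proof (rule mult_right_mono)
    have "(1 + 4 * ?x) ^ n \<le> exp (4 * ?x) ^ n" using x exp_ge_add_one_self[of "4 * ?x"] by (intro power_mono) auto
    then show "(1 + 4 * ?x) ^ n \<le> exp (4 * A * (real n * dt))" by (simp add: exp_of_nat_mult[symmetric] ac_simps)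
    show "0 \<le> e 0 + \<delta>" using nn[of 0] pos by simp
  qed
  finally show ?thesis using pos(3) by simp
qed

section \<open>Norms of vectors and the global estimate\<close>

lemma component_le_state_norm:
  assumes "u \<in> set (components X)"
  shows "sobolev_norm \<sigma> u \<le> state_norm \<sigma> X"
proof -
  have "(sobolev_norm \<sigma> u)\<^sup>2 \<le> (\<Sum>u\<leftarrow>components X. (sobolev_norm \<sigma> u)\<^sup>2)"
    using assms by (intro member_le_sum_list) (auto simp: image_iff)
  then show ?thesis unfolding state_norm_def by (rule real_le_rsqrt)
qed

text \<open>Seven squares give the factor sqrt 7, rounded up to 3.\<close>

lemma state_norm_le:
  assumes "\<And>u. u \<in> set (components X) \<Longrightarrow> sobolev_norm \<sigma> u \<le> B" "0 \<le> B"
  shows "state_norm \<sigma> X \<le> 3 * B"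
proof -
  obtain x1 x2 x3 x4 x5 x6 x7 where Xe: "X = (x1, x2, x3, x4, x5, x6, x7)" by (cases X) auto
  have sq: "(sobolev_norm \<sigma> u)\<^sup>2 \<le> B\<^sup>2" if "u \<in> set (components X)" for u
    using assms(1)[OF that] by (intro power_mono) auto
  have "(\<Sum>u\<leftarrow>components X. (sobolev_norm \<sigma> u)\<^sup>2) \<le> 7 * B\<^sup>2"
    using sq[of x1] sq[of x2] sq[of x3] sq[of x4] sq[of x5] sq[of x6] sq[of x7] by (simp add: Xe components_def)
  also have "\<dots> \<le> (3 * B)\<^sup>2" by (simp add: power_mult_distrib)
  finally show ?thesis
    unfolding state_norm_def using assms(2) by (intro real_le_lsqrt) auto
qed

theorem theorem8:
  fixes \<beta> s T R\<^sub>1 R\<^sub>2 dt\<^sub>0 :: real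
    and Tmax :: ereal
    and \<phi>\<^sub>0 :: "real ^ 'd \<Rightarrow> complex"
    and \<phi> :: "real \<Rightarrow> real ^ 'd \<Rightarrow> complex"
  assumes "CARD('d) \<in> {1, 2, 3}"
    and "s > real CARD('d) / 2"
    and "\<phi>\<^sub>0 \<in> sobolev (s + 4)"
    and "maximal_nls_solution \<beta> (s + 4) \<phi>\<^sub>0 Tmax \<phi>"
    and "0 < T" and "ereal T < Tmax"
    and "0 < dt\<^sub>0"
    and "nls_solution_on \<beta> (s + 4) {t. - dt\<^sub>0 < t \<and> ereal t < Tmax} \<phi>"
    and "sobolev_smooth_on (s + 4) {t. - dt\<^sub>0 < t \<and> ereal t < Tmax} \<phi>"
    and "0 < R\<^sub>1" and "0 < R\<^sub>2"
    and "\<And>Y dt n. \<lbrakk>Y \<in> sobolev (s + 4); real_valued Y; sobolev_norm (s + 4) Y \<le> R\<^sub>1;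
            0 < dt; dt < dt\<^sub>0; real n * dt \<le> T\<rbrakk> \<Longrightarrow>
          (\<exists>X. numerical_solution (s + 2) \<beta> dt \<phi>\<^sub>0 Y n X) \<and>
          (\<forall>X X'. numerical_solution (s + 2) \<beta> dt \<phi>\<^sub>0 Y n X \<and>
                  numerical_solution (s + 2) \<beta> dt \<phi>\<^sub>0 Y n X' \<longrightarrow>
                  (\<forall>k\<le>n. state_ae_eq (X k) (X' k))) \<and>
          (\<forall>X. numerical_solution (s + 2) \<beta> dt \<phi>\<^sub>0 Y n X \<longrightarrow> state_norm (s + 2) (X n) \<le> R\<^sub>2)"
  shows "\<exists>C>0. \<exists>dt\<^sub>1. 0 < dt\<^sub>1 \<and> dt\<^sub>1 \<le> dt\<^sub>0 \<and>
    (\<forall>Y dt n X.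
       Y \<in> sobolev (s + 4) \<and> real_valued Y \<and> sobolev_norm (s + 4) Y \<le> R\<^sub>1 \<and>
       0 < dt \<and> dt < dt\<^sub>1 \<and> real n * dt \<le> T \<and>
       numerical_solution (s + 2) \<beta> dt \<phi>\<^sub>0 Y n X \<longrightarrow>
       X n - exact_state (s + 4) dt \<phi> (real n * dt) \<in> state_sobolev s \<and>
       state_norm s (X n - exact_state (s + 4) dt \<phi> (real n * dt)) \<le>
         C * (sobolev_norm (s + 4) (\<lambda>x. Y x - of_real ((cmod (\<phi> (- dt / 2) x))\<^sup>2)) + dt\<^sup>2))"
proof -
  have sd: "s > real DIM(real ^ 'd) / 2" using assms(2) by simp
  have s0: "0 \<le> s" using assms(2) of_nat_0_le_iff[of "CARD('d)", where 'a=real] by linarith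
  \<comment> \<open>The product estimate is taken at three orders: s to propagate the error, s + 2
    for the initial error, and s + 4 so that the density in the final bound lies in the
    space.\<close>
  obtain K where K: "K > 0" "\<And>u v :: real ^ 'd \<Rightarrow> complex. u \<in> sobolev s \<Longrightarrow> v \<in> sobolev s \<Longrightarrow>
     (\<lambda>x. u x * v x) \<in> sobolev s \<and> sobolev_norm s (\<lambda>x. u x * v x) \<le> K * sobolev_norm s u * sobolev_norm s v"
    using sobolev_algebra[OF sd] by blast
  obtain K' where K': "K' > 0" "\<And>u v :: real ^ 'd \<Rightarrow> complex. u \<in> sobolev (s + 2) \<Longrightarrow> v \<in> sobolev (s + 2) \<Longrightarrow>
     (\<lambda>x. u x * v x) \<in> sobolev (s + 2) \<and> sobolev_norm (s + 2) (\<lambda>x. u x * v x) \<le> K' * sobolev_norm (s + 2) u * sobolev_norm (s + 2) v"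
    using sobolev_algebra[where 'a="real ^ 'd" and \<sigma>="s + 2"] sd by auto
  obtain K'' where K'': "K'' > 0" "\<And>u v :: real ^ 'd \<Rightarrow> complex. u \<in> sobolev (s + 4) \<Longrightarrow> v \<in> sobolev (s + 4) \<Longrightarrow>
     (\<lambda>x. u x * v x) \<in> sobolev (s + 4) \<and> sobolev_norm (s + 4) (\<lambda>x. u x * v x) \<le> K'' * sobolev_norm (s + 4) u * sobolev_norm (s + 4) v"
    using sobolev_algebra[where 'a="real ^ 'd" and \<sigma>="s + 4"] sd by auto
  define I where "I = {t. - dt\<^sub>0 < t \<and> ereal t < Tmax}"
  have openI: "open I"
    unfolding I_def by (intro open_Collect_conj open_Collect_less continuous_intros)
  obtain D :: "nat \<Rightarrow> real \<Rightarrow> real ^ 'd \<Rightarrow> complex" where D0: "D 0 = \<phi>"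
    and Dd: "\<And>k t. t \<in> I \<Longrightarrow> has_sobolev_derivative (s + 4) (D k) (D (Suc k) t) t I"
    using assms(9) unfolding sobolev_smooth_on_def I_def[symmetric] by blast
  \<comment> \<open>Tmax may be infinite, so a real time strictly between T and Tmax measures the
    room beyond T.\<close>
  obtain T' where T': "T < T'" "ereal T' < Tmax"
    using ereal_dense2[OF assms(6)] by auto
  \<comment> \<open>The exact vector at time t uses t - dt and t + dt, so the window reaches
    \<delta> beyond both ends of the interval from 0 to T. Half of \<open>dt\<^sub>0\<close> keeps
    it strictly inside the interval of existence, and \<delta> \<le> 1 is for
    \<open>err_le_components\<close>.\<close>
  define \<delta> where "\<delta> = min (min 1 (dt\<^sub>0 / 2)) (T' - T)"
  have \<delta>: "0 < \<delta>" "\<delta> \<le> 1" "\<delta> \<le> dt\<^sub>0 / 2" "T + \<delta> \<le> T'" using T'(1) assms(7) unfolding \<delta>_def by linarith+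
  have J: "{- \<delta>..T + \<delta>} \<subseteq> I"
  proof
    fix t assume t: "t \<in> {- \<delta>..T + \<delta>}"
    then have "ereal t \<le> ereal T'" using \<delta>(4) by simp
    then have "ereal t < Tmax" using T'(2) by (rule order.strict_trans1)
    then show "t \<in> I" using t \<delta>(3) assms(7) by (auto simp: I_def)
  qed
  have "\<exists>M. \<forall>k\<le>3. \<forall>t\<in>{- \<delta>..T + \<delta>}. sobolev_norm (s + 4) (D k t) \<le> M"
    by (rule sobolev_smooth_bounded[where D=D and I=I, OF _ compact_Icc J]) (rule Dd)
  then obtain M where M: "\<forall>k\<le>3. \<forall>t\<in>{- \<delta>..T + \<delta>}. sobolev_norm (s + 4) (D k t) \<le> M" ..
  \<comment> \<open>The equation provides a derivative of order s + 2, smoothness one of order s +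
    4; lowering the order of the latter, uniqueness identifies them.\<close>
  have nls: "ae_eq (\<lambda>x. \<i> * D 1 t x) (\<lambda>x. - laplacian (D 0 t) x / 2 + of_real \<beta> * of_real ((cmod (D 0 t x))\<^sup>2) * D 0 t x)"
    if "t \<in> I" for t
  proof -
    from assms(8) have "\<forall>t\<in>I. \<exists>\<psi>. has_sobolev_derivative (s + 4 - 2) \<phi> \<psi> t I \<and>
        ae_eq (\<lambda>x. \<i> * \<psi> x) (\<lambda>x. - laplacian (\<phi> t) x / 2 + of_real \<beta> * of_real ((cmod (\<phi> t x))\<^sup>2) * \<phi> t x)"
      unfolding nls_solution_on_def I_def[symmetric] by (rule conjunct2)
    from bspec[OF this that] obtain \<psi> where \<psi>: "has_sobolev_derivative (s + 4 - 2) \<phi> \<psi> t I"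
      and eq: "ae_eq (\<lambda>x. \<i> * \<psi> x) (\<lambda>x. - laplacian (\<phi> t) x / 2 + of_real \<beta> * of_real ((cmod (\<phi> t x))\<^sup>2) * \<phi> t x)"
      by (elim exE conjE)
    have d: "has_sobolev_derivative (s + 4 - 2) \<phi> (D 1 t) t I"
      using has_sobolev_derivative_mono[OF Dd[OF that, of 0], of "s + 4 - 2"] by (simp add: D0)
    have "at t within I \<noteq> bot"
      unfolding at_within_open[OF that openI] by simp
    from has_sobolev_derivative_unique[OF d \<psi> this] eq
    show ?thesis unfolding ae_eq_def D0 by eventually_elim simp
  qed
  have dwn: "\<phi> t \<in> sobolev (s + 4)" if "t \<in> I" for t
    using Dd[OF that, of 0] by (simp add: has_sobolev_derivative_def D0)
  \<comment> \<open>The same curve at two orders: L at s for consistency and stability along the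
    evolution, U at s + 2 for the initial error.\<close>
  interpret L: nls_curve s K "TYPE(real ^ 'd)" \<beta> "s + 4" M "- \<delta>" "T + \<delta>" I D
    by unfold_locales (use s0 K openI J Dd M nls in auto)
  interpret U: nls_curve "s + 2" K' "TYPE(real ^ 'd)" \<beta> "s + 4" M "- \<delta>" "T + \<delta>" I D
    by unfold_locales (use s0 K' openI J Dd M nls in auto)
  interpret H: sobolev_alg "s + 4" K'' "TYPE(real ^ 'd)"
    by unfold_locales (use s0 K'' in auto)
  have zero: "0 \<in> {- \<delta>..T + \<delta>}" using \<delta>(1) assms(5) by simp
  have M0: "0 \<le> M" by (rule L.M_nonneg[OF zero])
  \<comment> \<open>Common bound at order s for the numerical states, from the hypothesis, and for
    the exact ones.\<close>
  define G where "G = R\<^sub>2 + (M + K * M * M)"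
  define Cc where "Cc = L.C2 + L.C5 + L.C7"
  have Cc: "0 \<le> Cc"
    unfolding Cc_def L.C7_def L.C5_def L.C2_def using M0 K(1) by simp
  have lip: "0 \<le> L.lip \<beta> G"
    unfolding L.lip_def G_def using M0 K(1) assms(11) by simp
  \<comment> \<open>The 4 is that of \<open>stability\<close>; adding the residual constant allows
    the residual to be written as A dt times dt^2.\<close>
  define A where "A = 4 * (L.lip \<beta> G + Cc)"
  have A: "0 \<le> A" using lip Cc by (simp add: A_def)
  define Q where "Q = \<bar>\<beta>\<bar> * K' * (R\<^sub>1 + 2 * K' * M * M)"
  have Q: "0 \<le> Q" using K'(1) M0 assms(10) by (simp add: Q_def)
  \<comment> \<open>Three requirements: staying in the time window, A dt \<le> 1/2 for the Gronwall
    argument, and dt Q \<le> 1 for solving the two Cayley equations.\<close>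
  define dt\<^sub>1 where "dt\<^sub>1 = min \<delta> (min (1 / (2 * A + 1)) (1 / (Q + 1)))"
  have dt1: "0 < dt\<^sub>1" "dt\<^sub>1 \<le> \<delta>" "dt\<^sub>1 \<le> 1 / (2 * A + 1)" "dt\<^sub>1 \<le> 1 / (Q + 1)" using \<delta>(1) A Q by (simp_all add: dt\<^sub>1_def min.coboundedI1 min.coboundedI2)
  have ic: "0 \<le> U.init_const"
    unfolding U.init_const_def U.C5_def using K'(1) M0 by simp
  \<comment> \<open>The 3 comes from \<open>state_norm_le\<close>, the exponential from Gronwall, 10
    times \<open>init_const\<close> from the initial value of \<open>err\<close>, and 1 from the
    residual.\<close>
  define C where "C = 3 * (exp (4 * A * T) * (10 * U.init_const + 1))"
  have C: "C > 0" using ic by (simp add: C_def add_nonneg_pos)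
  have main: "X n - exact_state (s + 4) dt \<phi> (real n * dt) \<in> state_sobolev s \<and>
       state_norm s (X n - exact_state (s + 4) dt \<phi> (real n * dt)) \<le>
         C * (sobolev_norm (s + 4) (\<lambda>x. Y x - of_real ((cmod (\<phi> (- dt / 2) x))\<^sup>2)) + dt\<^sup>2)"
    if Y: "Y \<in> sobolev (s + 4)" "real_valued Y" "sobolev_norm (s + 4) Y \<le> R\<^sub>1"
      and dt: "0 < dt" "dt < dt\<^sub>1" and n: "real n * dt \<le> T"
      and X: "numerical_solution (s + 2) \<beta> dt \<phi>\<^sub>0 Y n X" for Y dt n X
  proof -
    have dts: "dt < \<delta>" "dt \<le> 1" "dt < dt\<^sub>0" using dt dt1 \<delta> assms(7) by auto
    define \<eta> where "\<eta> = sobolev_norm (s + 4) (\<lambda>x. Y x - of_real ((cmod (\<phi> (- dt / 2) x))\<^sup>2))"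
    have \<eta>0: "0 \<le> \<eta>" by (simp add: \<eta>_def)
    have kt: "real k * dt \<le> T" if "k \<le> n" for k
    proof -
      have "real k * dt \<le> real n * dt" using that dt(1) by (intro mult_right_mono) auto
      with n show ?thesis by linarith
    qed
    have Xs: "X k \<in> state_sobolev (s + 2)" if "k \<le> n" for k
      using X that by (simp add: numerical_solution_def)
    \<comment> \<open>The hypothesis bounds the last state of a numerical solution; restricting the
      solution to its first k steps bounds every state.\<close>
    have XR: "state_norm (s + 2) (X k) \<le> R\<^sub>2" if "k \<le> n" for k
    proof -
      have "numerical_solution (s + 2) \<beta> dt \<phi>\<^sub>0 Y k X"
        using X that by (auto simp: numerical_solution_def)
      then show ?thesis using assms(12)[OF Y dt(1) dts(3) kt[OF that]] by blast
    qed
    define E where "E k = L.curve_state dt (real k * dt)" for k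
    have E_U: "E k = U.curve_state dt (real k * dt)" for k
      by (simp add: E_def L.curve_state_def U.curve_state_def)
    have tb: "- \<delta> \<le> real k * dt - dt" "real k * dt + dt \<le> T + \<delta>" if "k \<le> n" for k
    proof -
      have "0 \<le> real k * dt" using dt(1) by simp
      then show "- \<delta> \<le> real k * dt - dt" "real k * dt + dt \<le> T + \<delta>" using kt[OF that] dts(1) by simp_all
    qed
    have Es: "E k \<in> state_sobolev (s + 2)" if "k \<le> n" for k
      using U.curve_state_bd[OF dt(1) tb[OF that]] unfolding E_U state_sobolev_def by (auto dest: sobolev_bdD(1))
    have En: "sobolev_norm s u \<le> G" if "k \<le> n" "u \<in> set (components (E k))" for k u
      using sobolev_bdD(2)[OF L.curve_state_bd[OF dt(1) tb[OF that(1)] that(2)[unfolded E_def]]] assms(11) by (simp add: G_def)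
    have Xn: "sobolev_norm s u \<le> G" if "k \<le> n" "u \<in> set (components (X k))" for k u
    proof -
      have "u \<in> sobolev (s + 2)" using Xs[OF that(1)] that(2) by (simp add: state_sobolev_def)
      then have "sobolev_norm s u \<le> sobolev_norm (s + 2) u" by (rule sobolev_mono(2)) simp
      also have "\<dots> \<le> R\<^sub>2" using component_le_state_norm[OF that(2), of "s + 2"] XR[OF that(1)] by simp
      also have "\<dots> \<le> G" using M0 K(1) by (simp add: G_def)
      finally show ?thesis .
    qed
    have step: "err s dt (X (Suc k) - E (Suc k)) \<le> err s dt (X k - E k)
        + A * dt * (err s dt (X k - E k) + err s dt (X (Suc k) - E (Suc k)) + dt\<^sup>2)" if k: "k < n" for k
    proof -
      have t: "real (Suc k) * dt = real k * dt + dt" by (simp add: algebra_simps)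
      have b: "- \<delta> \<le> real k * dt - dt" "real k * dt + 2 * dt \<le> T + \<delta>"
        using tb[of k] tb[of "Suc k"] k unfolding t by simp_all
      obtain r2 r5 r7 where r: "sobolev_bd s r2 (Cc * dt\<^sup>2)" "sobolev_bd s r5 (Cc * dt\<^sup>2)" "sobolev_bd s r7 (Cc * dt\<^sup>2)"
        and ps: "perturbed_step \<beta> dt (E k) (E (Suc k)) r2 r5 r7"
        using L.curve_step[OF dt(1) b] unfolding E_def t Cc_def by blast
      have ns: "perturbed_step \<beta> dt (X k) (X (Suc k)) (\<lambda>x. 0) (\<lambda>x. 0) (\<lambda>x. 0)"
        using X k dt(1) by (intro L.numerical_step Xs) (auto simp: numerical_solution_def)
      have Gb: "sobolev_norm s u \<le> G" if "u \<in> set (components (X k)) \<union> set (components (X (Suc k))) \<union> set (components (E k)) \<union> set (components (E (Suc k)))" for u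
        using that Xn[of k u] Xn[of "Suc k" u] En[of k u] En[of "Suc k" u] k by auto
      let ?S = "err s dt (X k - E k) + err s dt (X (Suc k) - E (Suc k))"
      have "err s dt (X (Suc k) - E (Suc k)) \<le> err s dt (X k - E k) + 4 * dt * (L.lip \<beta> G * ?S + Cc * dt\<^sup>2)"
        using k by (intro L.stability[OF _ _ _ _ _ Gb ns ps r] Xs Es) (use dt in auto)
      \<comment> \<open>The mixed products added on the right are nonnegative; this brings the
        estimate into the form of the Gronwall lemma.\<close>
      also have "4 * dt * (L.lip \<beta> G * ?S + Cc * dt\<^sup>2) \<le> 4 * dt * ((L.lip \<beta> G + Cc) * (?S + dt\<^sup>2))"
      proof (rule mult_left_mono)
        have "0 \<le> L.lip \<beta> G * dt\<^sup>2" "0 \<le> Cc * ?S"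
          using lip Cc by (auto intro!: mult_nonneg_nonneg add_nonneg_nonneg err_nonneg)
        then show "L.lip \<beta> G * ?S + Cc * dt\<^sup>2 \<le> (L.lip \<beta> G + Cc) * (?S + dt\<^sup>2)" by (simp add: distrib_left distrib_right)
      qed (use dt in simp)
      also have "4 * dt * ((L.lip \<beta> G + Cc) * (?S + dt\<^sup>2)) = A * dt * (?S + dt\<^sup>2)" by (simp add: A_def)
      finally show ?thesis by simp
    qed
    have mem0: "- dt / 2 \<in> {- \<delta>..T + \<delta>}" using dts(1) dt(1) assms(5) by simp
    have hb: "(\<lambda>x. of_real ((cmod (\<phi> (- dt / 2) x))\<^sup>2)) \<in> sobolev (s + 4)"
      by (rule sobolev_bdD(1)[OF H.bd_abs2[OF sobolev_bd_self[OF dwn]]]) (use mem0 J in blast)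
    have init: "sobolev_norm (s + 2) z \<le> U.init_const * (\<eta> + dt\<^sup>2)" if "z \<in> set (components (X 0 - E 0))" for z
    proof (rule sobolev_bdD(2), rule U.initial_error[of dt \<phi>\<^sub>0 Y R\<^sub>1 \<eta> "X 0"])
      show "ae_eq (D 0 0) \<phi>\<^sub>0" using assms(4) by (simp add: maximal_nls_solution_def D0)
      show "sobolev_bd (s + 2) Y R\<^sub>1" by (rule sobolev_bd_order[OF sobolev_bdI[OF Y(1,3)]]) simp
      show "sobolev_bd (s + 2) (\<lambda>x. Y x - of_real ((cmod (D 0 (- dt / 2) x))\<^sup>2)) \<eta>"
        unfolding D0 \<eta>_def by (rule sobolev_bd_order[OF sobolev_bd_self[OF sobolev_diff(1)[OF Y(1) hb]]]) simp
      have "dt * Q \<le> 1 / (Q + 1) * Q" using dt dt1(4) Q by (intro mult_right_mono) auto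
      also have "\<dots> \<le> 1" using Q by simp
      finally show "dt * (\<bar>\<beta>\<bar> * K' * (R\<^sub>1 + 2 * K' * M * M)) \<le> 1" by (simp add: Q_def)
      show "state_ae_eq (X 0) (initial_state \<beta> dt \<phi>\<^sub>0 Y)" using X by (simp add: numerical_solution_def)
      show "z \<in> set (components (X 0 - U.curve_state dt 0))" using that by (simp add: E_U)
    qed (use dt dts assms(3,5) s0 Xs[of 0] in auto)
    have XE: "X k - E k \<in> state_sobolev (s + 2)" if "k \<le> n" for k
    proof -
      obtain x1 x2 x3 x4 x5 x6 x7 where Xe: "X k = (x1, x2, x3, x4, x5, x6, x7)" by (cases "X k") auto
      obtain u1 u2 u3 u4 u5 u6 u7 where Ee: "E k = (u1, u2, u3, u4, u5, u6, u7)" by (cases "E k") auto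
      show ?thesis
        using Xs[OF that] Es[OF that] unfolding Xe Ee
        by (simp add: state_sobolev_def components_def fun_diff_def sobolev_diff(1))
    qed
    have e0: "err s dt (X 0 - E 0) \<le> 10 * (U.init_const * (\<eta> + dt\<^sup>2))"
      by (rule err_le_components[OF XE s0 _ dts(2) init]) (use dt in auto)
    have small: "A * dt \<le> 1 / 2"
    proof -
      have "A * dt \<le> A * (1 / (2 * A + 1))" using dt dt1(3) A by (intro mult_left_mono) auto
      also have "\<dots> \<le> 1 / 2" using A by (simp add: field_simps)
      finally show ?thesis .
    qed
    have "err s dt (X n - E n) \<le> exp (4 * A * (real n * dt)) * (err s dt (X 0 - E 0) + dt\<^sup>2)"
      by (rule discrete_gronwall[where e="\<lambda>k. err s dt (X k - E k)" and A=A and dt=dt and n=n, OF step err_nonneg A _ _ small]) (use dt in auto)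
    also have "\<dots> \<le> exp (4 * A * T) * (10 * (U.init_const * (\<eta> + dt\<^sup>2)) + dt\<^sup>2)"
      using e0 n A err_nonneg[of s dt "X 0 - E 0"] by (intro mult_mono) (auto intro!: mult_left_mono)
    also have "\<dots> \<le> exp (4 * A * T) * ((10 * U.init_const + 1) * (\<eta> + dt\<^sup>2))"
      using \<eta>0 by (intro mult_left_mono) (auto simp: algebra_simps)
    finally have en: "3 * err s dt (X n - E n) \<le> C * (\<eta> + dt\<^sup>2)" by (simp add: C_def)
    obtain x1 x2 x3 x4 x5 x6 x7 where Xe: "X n = (x1, x2, x3, x4, x5, x6, x7)" by (cases "X n") auto
    let ?t = "real n * dt"
    have mem: "?t - dt / 2 \<in> I" "?t + dt / 2 \<in> I"
      using J tb[of n] dt(1) by (auto intro!: subsetD[OF J])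
    \<comment> \<open>The last two entries of the exact vector are selected derivatives; they may be
      replaced by \<open>D 1\<close> up to null sets.\<close>
    have dv: "ae_eq (sobolev_deriv (s + 4) \<phi> r) (D 1 r)" "sobolev_deriv (s + 4) \<phi> r \<in> borel_measurable borel" if "r \<in> I" for r
      using sobolev_deriv_eq[OF Dd[OF that, of 0, unfolded D0] openI that] sobolev_measurable by auto
    have XEn: "X n - E n = (\<lambda>x. x1 x - of_real ((cmod (\<phi> (?t - dt / 2) x))\<^sup>2), \<lambda>x. x2 x - of_real ((cmod (\<phi> (?t + dt / 2) x))\<^sup>2),
       \<lambda>x. x3 x - \<phi> (?t - dt) x, \<lambda>x. x4 x - \<phi> ?t x, \<lambda>x. x5 x - \<phi> (?t + dt) x, \<lambda>x. x6 x - D 1 (?t - dt / 2) x, \<lambda>x. x7 x - D 1 (?t + dt / 2) x)"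
      by (simp add: Xe E_def L.curve_state_def D0 fun_diff_def)
    have XX: "X n - exact_state (s + 4) dt \<phi> ?t = (\<lambda>x. x1 x - of_real ((cmod (\<phi> (?t - dt / 2) x))\<^sup>2), \<lambda>x. x2 x - of_real ((cmod (\<phi> (?t + dt / 2) x))\<^sup>2),
       \<lambda>x. x3 x - \<phi> (?t - dt) x, \<lambda>x. x4 x - \<phi> ?t x, \<lambda>x. x5 x - \<phi> (?t + dt) x,
       \<lambda>x. x6 x - sobolev_deriv (s + 4) \<phi> (?t - dt / 2) x, \<lambda>x. x7 x - sobolev_deriv (s + 4) \<phi> (?t + dt / 2) x)"
      by (simp add: Xe exact_state_def fun_diff_def)
    have c: "sobolev_bd s z (err s dt (X n - E n))" if "z \<in> set (components (X n - E n))" for z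
      using err_component[OF XE[OF order_refl] s0 that, of dt] XE[OF order_refl] that sobolev_mono(1)[of z "s + 2" s]
      by (auto simp: sobolev_bd_def state_sobolev_def)
    have xm: "x6 \<in> borel_measurable borel" "x7 \<in> borel_measurable borel"
      using Xs[OF order_refl] by (auto simp: Xe state_sobolev_def components_def intro: sobolev_measurable)
    have c6: "sobolev_bd s (\<lambda>x. x6 x - sobolev_deriv (s + 4) \<phi> (?t - dt / 2) x) (err s dt (X n - E n))"
    proof (rule sobolev_bd_cong)
      show "sobolev_bd s (\<lambda>x. x6 x - D 1 (?t - dt / 2) x) (err s dt (X n - E n))"
        by (rule c) (simp add: XEn components_def)
      show "ae_eq (\<lambda>x. x6 x - D 1 (?t - dt / 2) x) (\<lambda>x. x6 x - sobolev_deriv (s + 4) \<phi> (?t - dt / 2) x)"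
        using dv(1)[OF mem(1)] unfolding ae_eq_def by eventually_elim simp
    qed (rule borel_measurable_diff[OF xm(1) dv(2)[OF mem(1)]])
    have c7: "sobolev_bd s (\<lambda>x. x7 x - sobolev_deriv (s + 4) \<phi> (?t + dt / 2) x) (err s dt (X n - E n))"
    proof (rule sobolev_bd_cong)
      show "sobolev_bd s (\<lambda>x. x7 x - D 1 (?t + dt / 2) x) (err s dt (X n - E n))"
        by (rule c) (simp add: XEn components_def)
      show "ae_eq (\<lambda>x. x7 x - D 1 (?t + dt / 2) x) (\<lambda>x. x7 x - sobolev_deriv (s + 4) \<phi> (?t + dt / 2) x)"
        using dv(1)[OF mem(2)] unfolding ae_eq_def by eventually_elim simp
    qed (rule borel_measurable_diff[OF xm(2) dv(2)[OF mem(2)]])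
    have c': "sobolev_bd s z (err s dt (X n - E n))" if "z \<in> set (components (X n - exact_state (s + 4) dt \<phi> ?t))" for z
      using that c c6 c7 unfolding XX XEn components_def by auto
    have "state_norm s (X n - exact_state (s + 4) dt \<phi> ?t) \<le> 3 * err s dt (X n - E n)"
      by (rule state_norm_le[OF sobolev_bdD(2)[OF c'] err_nonneg])
    moreover have "X n - exact_state (s + 4) dt \<phi> ?t \<in> state_sobolev s"
      using c' by (auto simp: state_sobolev_def dest: sobolev_bdD(1))
    ultimately show ?thesis using en unfolding \<eta>_def by linarith
  qed
  have "dt\<^sub>1 \<le> dt\<^sub>0" using dt1 \<delta> assms(7) by linarith
  with dt1(1) C main show ?thesis by blast
qed

end
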